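(* Let $d\ge 2$ be an integer. Let $\beta>1/2$ with $2\beta-1$ not an even integer $>0$; that is, $\beta-1/2=L+\varepsilon$ for some integer $L\ge 0$ and some real $0<\varepsilon<1$. (i) The kernel $\mathcal{K}_\beta$ has the representation $$\mathcal{K}_\beta(\mathbf{x},\mathbf{y})=\mathcal{Q}_{\beta-1}(\mathbf{x},\mathbf{y})+(-1)^{L+1}c_d(\beta)\,\|\mathbf{x}-\mathbf{y}\|^{2\beta-1},\qquad \mathbf{x},\mathbf{y}\in\mathbb{S}^d,$$ where, for $\mathbf{x},\mathbf{y}\in\mathbb{S}^d$, $$\mathcal{Q}_{\beta-1}(\mathbf{x},\mathbf{y})=\int_{\mathbb{S}^d}\frac{\frac1{2\beta-1}\,{}_2F_1\!\left(\tfrac12-\beta,1-\beta;\tfrac32-\beta;\left(\frac{\mathbf{x}\cdot\mathbf{z}-\mathbf{y}\cdot\mathbf{z}}{2-\mathbf{x}\cdot\mathbf{z}-\mathbf{y}\cdot\mathbf{z}}\right)^2\right)}{\left(1-\frac12\mathbf{x}\cdot\mathbf{z}-\frac12\mathbf{y}\cdot\mathbf{z}\right)^{1-2\beta}}\,\mathrm{d}\sigma_d(\mathbf{z})$$ $$=\frac{1}{2\beta-1}\,F^{2:0;1}_{1:0;1}\left[\left.\begin{matrix}1/2-\beta,\,1-\beta\\ (d+1)/2\end{matrix}\right|\left.\begin{matrix}-\\-\end{matrix}\right|\left.\begin{matrix}1/2\\ 3/2-\beta\end{matrix}\right|\frac{1+\mathbf{x}\cdot\mathbf{y}}2,\frac{1-\mathbf{x}\cdot\mathbf{y}}2\right],$$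 and $c_d(\beta)$ is the positive constant $$c_d(\beta)=\frac{2^{-2\beta}}{\sin(\pi(\beta-1/2-L))}\,\frac{\Gamma((d+1)/2)\,\Gamma(\beta)\,\Gamma(\beta)}{\Gamma(\beta+d/2)\,\Gamma(\beta+1/2)}.$$ For $\beta=1$ this reduces to $\mathcal{K}_1(\mathbf{x},\mathbf{y})=1-C_d\|\mathbf{x}-\mathbf{y}\|$ with $C_d=\frac1d\frac{\Gamma((d+1)/2)}{\sqrt\pi\,\Gamma(d/2)}$. (ii) Let $s$ be defined by $2\beta-1=2s-d$. The ultraspherical expansion $$\mathcal{Q}_{\beta-1}(\mathbf{x},\mathbf{y})=\sum_{k=0}^\infty A_k^{(2)}(s,d)\,Z(d,k)\,P_k^{(d)}(\mathbf{x}\cdot\mathbf{y})$$ reduces to a polynomial of degree $M-1$ (in $\mathbf{x}\cdot\mathbf{y}$) if $\beta=M$ with $M$ a positive integer, and otherwise the coefficients $A_k^{(2)}(s,d)$ have the asymptotic behavior $$A_k^{(2)}(s,d)\sim -\,2^{d-2}\left[\frac{\Gamma((d+1)/2)\,\Gamma(s+1/2)\,\Gamma(2s)}{\Gamma((d+1)/2-s)\,\Gamma(s+1)}\right]^2\frac{\Gamma(d/2)}{\Gamma(d/2+2s)}\,k^{-4s}\qquad\text{as }k\to\infty .$$ Thus the series expansion converges for all $\mathbf{x},\mathbf{y}\in\mathbb{S}^d$ if $s>d/2$.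
   Context: $\mathbb{S}^d$ is the unit sphere in $\mathbb{R}^{d+1}$, $\|\cdot\|$ is the Euclidean norm, and $\sigma_d$ is the normalized surface measure on $\mathbb{S}^d$ ($\sigma_d(\mathbb{S}^d)=1$). The truncated power is $u_+^{\alpha}=u^\alpha$ for $u>0$ and $u_+^\alpha=0$ for $u<0$ (with $u_+^0=1$ for $u\ge 0$). The kernel is $$\mathcal{K}_\beta(\mathbf{x},\mathbf{y}) = \int_{-1}^1\int_{\mathbb{S}^d} (\mathbf{x}\cdot\mathbf{z}-t)_+^{\beta-1}(\mathbf{y}\cdot\mathbf{z}-t)_+^{\beta-1}\,\mathrm{d}\sigma_d(\mathbf{z})\,\mathrm{d}t .$$ $P_k^{(d)}(t)=\mathrm{C}_k^{(d-1)/2}(t)/\mathrm{C}_k^{(d-1)/2}(1)$ is the normalized Gegenbauer polynomial and $Z(d,k)=(2k+d-1)\frac{\Gamma(k+d-1)}{\Gamma(d)\Gamma(k+1)}$. The coefficients $A_k^{(2)}(s,d)$ are the coefficients of $\mathcal{Q}_{\beta-1}$ in this expansion, i.e. (with $\omega_d$ the surface area of $\mathbb{S}^d$ and $\mathcal{Q}_{\beta-1}$ regarded as a function $q$ of $u=\mathbf{x}\cdot\mathbf{y}$) $A_k^{(2)}(s,d)=\frac{\omega_{d-1}}{\omega_d}\int_{-1}^1 q(u)P_k^{(d)}(u)(1-u^2)^{d/2-1}\,\mathrm{d}u$. $(a)_n=a(a+1)\cdots(a+n-1)$ is the Pochhammer symbol, ${}_2F_1(a,b;c;z)=\sum_{n\ge0}\frac{(a)_n(b)_n}{(c)_n\,n!}z^n$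 is the Gauss hypergeometric function, and the Kampé de Fériet function is $$F^{p:r;\mu}_{q:s;\nu}\left[\left.\begin{matrix}a_1,\dots,a_p\\ b_1,\dots,b_q\end{matrix}\right|\left.\begin{matrix}c_1,\dots,c_r\\ d_1,\dots,d_s\end{matrix}\right|\left.\begin{matrix}f_1,\dots,f_\mu\\ g_1,\dots,g_\nu\end{matrix}\right|x,y\right]=\sum_{m=0}^\infty\sum_{n=0}^\infty\frac{(a_1)_{m+n}\cdots(a_p)_{m+n}}{(b_1)_{m+n}\cdots(b_q)_{m+n}}\,\frac{(c_1)_m\cdots(c_r)_m}{(d_1)_m\cdots(d_s)_m}\,\frac{(f_1)_n\cdots(f_\mu)_n}{(g_1)_n\cdots(g_\nu)_n}\,\frac{x^my^n}{m!\,n!},$$ a dash denoting an empty list of parameters. $a_k\sim b_k$ means $a_k/b_k\to1$.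
   Formalization: The printed constant in the asymptotics of A_k^(2) is false (e.g. d=2, β=5/4); proved instead: A_k^(2)(s,d) ~ -2^(d-2) [Γ((d+1)/2)/Γ((d+1)/2-s)]^2 · Γ(s+1/2)Γ(2s)/(√π Γ(s+1)) · k^(-4s). *)

theory Defs
  imports
    "HOL-Probability.Probability"
    "HOL-Library.Landau_Symbols"
    "HOL-Computational_Algebra.Polynomial"
begin

text \<open>
  Normalized surface measure on the unit sphere as the cone measure: the measure of a Borel
  set \<open>A\<close> is the volume of the cone \<open>{r z. 0 < r \<le> 1, z \<in> A}\<close> relative to the unit ball.
  The lemmas \<open>emeasure_sphere_measure\<close>, \<open>prob_space_sphere_measure\<close> and
  \<open>sphere_measure_rotation_invariant\<close> confirm that this is a rotation-invariant probability
  measure on the sphere.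
\<close>

definition sphere_measure :: "(real ^ 'n::finite) measure" where
  "sphere_measure =
     restrict_space (distr (uniform_measure lborel (cball 0 1)) borel sgn) (sphere 0 1)"

lemma sgn_in_borel [measurable]: "(sgn :: real ^ 'n::finite \<Rightarrow> _) \<in> borel \<rightarrow>\<^sub>M borel"
  unfolding sgn_div_norm by measurable

lemma space_sphere_measure [simp]: "space sphere_measure = sphere (0 :: real ^ 'n::finite) 1"
  by (simp add: sphere_measure_def space_restrict_space)

lemma sets_sphere_measure:
  "sets sphere_measure = sets (restrict_space borel (sphere (0 :: real ^ 'n::finite) 1))"
  by (simp add: sphere_measure_def sets_restrict_space)

lemma emeasure_sphere_measure:
  fixes A :: "(real ^ 'n::finite) set"
  assumes "A \<in> sets borel" "A \<subseteq> sphere 0 1"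
  shows "emeasure sphere_measure A =
           emeasure lborel (cball 0 1 \<inter> sgn -` A) / emeasure lborel (cball (0 :: real ^ 'n) 1)"
proof -
  have [measurable]: "A \<in> sets borel" by fact
  have *: "sgn -` A \<in> sets (borel :: (real ^ 'n) measure)"
    using measurable_sets[OF sgn_in_borel assms(1)] by simp
  have "emeasure sphere_measure A =
          emeasure (distr (uniform_measure lborel (cball 0 1)) borel sgn) A"
    unfolding sphere_measure_def by (rule emeasure_restrict_space) (use assms in auto)
  also have "\<dots> = emeasure (uniform_measure lborel (cball 0 1)) (sgn -` A)"
    by (subst emeasure_distr) auto
  also have "\<dots> = emeasure lborel (cball 0 1 \<inter> sgn -` A) / emeasure lborel (cball (0 :: real ^ 'n) 1)"
    using * by (simp add: emeasure_uniform_measure)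
  finally show ?thesis .
qed

lemma prob_space_sphere_measure:
  "prob_space (sphere_measure :: (real ^ 'n::finite) measure)"
proof
  let ?B = "cball (0 :: real ^ 'n) 1"
  have v: "unit_ball_vol (real CARD('n)) \<noteq> 0"
    by (metis less_irrefl of_nat_0_le_iff unit_ball_vol_pos)
  have pos: "emeasure lborel ?B \<noteq> 0" "emeasure lborel ?B \<noteq> \<infinity>"
    by (simp_all add: emeasure_cball v)
  have eq: "?B \<inter> sgn -` sphere 0 1 = ?B - {0}"
    by (auto simp: sgn_zero_iff norm_sgn)
  have "emeasure sphere_measure (space (sphere_measure :: (real ^ 'n) measure)) =
          emeasure lborel (?B - {0}) / emeasure lborel ?B"
    by (simp add: emeasure_sphere_measure eq)
  also have "emeasure lborel (?B - {0}) = emeasure lborel ?B"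
    by (rule emeasure_Diff_null_set) auto
  finally show "emeasure sphere_measure (space (sphere_measure :: (real ^ 'n) measure)) = 1"
    using pos by (simp add: ennreal_divide_self top.not_eq_extremum)
qed

lemma sphere_measure_rotation_invariant:
  fixes T :: "real ^ 'n::{finite, wellorder} \<Rightarrow> real ^ 'n::_"
  assumes T: "orthogonal_transformation T" and A: "A \<in> sets sphere_measure"
  shows "emeasure sphere_measure (T ` A) = emeasure sphere_measure A"
proof -
  have lin: "linear T" and nrm: "\<And>v. norm (T v) = norm v"
    using T by (auto simp: orthogonal_transformation)
  obtain T' where T': "orthogonal_transformation T'" "\<And>v. T' (T v) = v" "\<And>v. T (T' v) = v"
    using T orthogonal_transformation_bij orthogonal_transformation_inv
    by (metis bij_inv_eq_iff)
  have lin': "linear T'" and nrm': "\<And>v. norm (T' v) = norm v"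
    using T' by (auto simp: orthogonal_transformation)
  have A': "A \<in> sets borel" "A \<subseteq> sphere 0 1"
    using A by (auto simp: sets_sphere_measure sets_restrict_space_iff)
  have TA: "T ` A = T' -` A"
  proof (intro equalityI subsetI)
    show "v \<in> T ` A" if "v \<in> T' -` A" for v
      using that T'(3)[of v] by (metis image_eqI vimageE)
  qed (auto simp: T')
  have "T' \<in> borel \<rightarrow>\<^sub>M borel"
    by (intro borel_measurable_continuous_onI linear_continuous_on linear_conv_bounded_linear[THEN iffD1] lin')
  from measurable_sets[OF this A'(1)] have "T ` A \<in> sets borel"
    using TA by simp
  moreover have "T ` A \<subseteq> sphere 0 1"
  proof
    fix v assume "v \<in> T ` A"
    then obtain w where "v = T w" "w \<in> A"
      by blast
    with A'(2) have "norm w = 1"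
      by auto
    thus "v \<in> sphere 0 1"
      by (simp add: \<open>v = T w\<close> nrm)
  qed
  ultimately have TA': "T ` A \<in> sets borel" "T ` A \<subseteq> sphere 0 1" .
  have cone: "cball 0 1 \<inter> sgn -` (T ` A) = T ` (cball 0 1 \<inter> sgn -` A)"
  proof -
    have "T' (sgn v) = sgn (T' v)" for v
      using lin' by (simp add: sgn_div_norm linear_scale nrm')
    hence 1: "sgn (T' v) \<in> A \<longleftrightarrow> T' (sgn v) \<in> A" for v
      by simp
    show ?thesis
    proof (intro equalityI subsetI)
      fix v assume "v \<in> cball 0 1 \<inter> sgn -` (T ` A)"
      hence "T' v \<in> cball 0 1 \<inter> sgn -` A"
        using 1[of v] by (simp add: TA nrm')
      thus "v \<in> T ` (cball 0 1 \<inter> sgn -` A)"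
        by (rule image_eqI[rotated]) (simp add: T')
    next
      fix v assume "v \<in> T ` (cball 0 1 \<inter> sgn -` A)"
      then obtain w where "v = T w" "w \<in> cball 0 1 \<inter> sgn -` A"
        by blast
      thus "v \<in> cball 0 1 \<inter> sgn -` (T ` A)"
        using 1[of v] by (simp add: TA nrm T')
    qed
  qed
  have borel: "cball 0 1 \<inter> sgn -` B \<in> sets borel" if "B \<in> sets borel" for B :: "(real ^ 'n::_) set"
    using measurable_sets[OF sgn_in_borel that] by auto
  have lm: "cball 0 1 \<inter> sgn -` B \<in> lmeasurable" if "B \<in> sets borel" for B :: "(real ^ 'n::_) set"
    by (rule bounded_set_imp_lmeasurable) (use borel[OF that] in \<open>auto intro: bounded_subset[OF bounded_cball]\<close>)
  have e: "emeasure lborel (cball 0 1 \<inter> sgn -` B) =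
             ennreal (measure lebesgue (cball 0 1 \<inter> sgn -` B))" if "B \<in> sets borel"
    for B :: "(real ^ 'n::_) set"
  proof -
    have "emeasure lborel (cball 0 1 \<inter> sgn -` B) = emeasure lebesgue (cball 0 1 \<inter> sgn -` B)"
      using borel[OF that] by simp
    also have "\<dots> = ennreal (measure lebesgue (cball 0 1 \<inter> sgn -` B))"
      by (rule emeasure_eq_measure2) (rule lm[OF that])
    finally show ?thesis .
  qed
  have "measure lebesgue (cball 0 1 \<inter> sgn -` (T ` A)) = measure lebesgue (cball 0 1 \<inter> sgn -` A)"
    unfolding cone by (rule measure_orthogonal_image[OF T lm[OF A'(1)]])
  thus ?thesis
    by (simp only: emeasure_sphere_measure[OF TA'] emeasure_sphere_measure[OF A'] e[OF TA'(1)] e[OF A'(1)])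
qed


text \<open>The convention \<open>0\<^sub>+\<^sup>0 = 1\<close> differs from \<open>0 powr 0 = 0\<close>.\<close>

definition trunc_pow :: "real \<Rightarrow> real \<Rightarrow> real" where
  "trunc_pow u \<alpha> = (if u > 0 then u powr \<alpha> else if u = 0 \<and> \<alpha> = 0 then 1 else 0)"

definition K_kernel :: "real \<Rightarrow> real ^ 'n::finite \<Rightarrow> real ^ 'n \<Rightarrow> real" where
  "K_kernel \<beta> x y =
     (LINT t:{-1..1}|lborel. (LINT z|sphere_measure.
        trunc_pow (x \<bullet> z - t) (\<beta> - 1) * trunc_pow (y \<bullet> z - t) (\<beta> - 1)))"


definition hyp2F1_term :: "real \<Rightarrow> real \<Rightarrow> real \<Rightarrow> real \<Rightarrow> nat \<Rightarrow> real" where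
  "hyp2F1_term a b c z n =
     pochhammer a n * pochhammer b n / (pochhammer c n * fact n) * z ^ n"

definition hyp2F1 :: "real \<Rightarrow> real \<Rightarrow> real \<Rightarrow> real \<Rightarrow> real" where
  "hyp2F1 a b c z = (\<Sum>n. hyp2F1_term a b c z n)"

definition poch_list :: "real list \<Rightarrow> nat \<Rightarrow> real" where
  "poch_list as n = (\<Prod>a\<leftarrow>as. pochhammer a n)"

definition kampe_de_feriet_term ::
  "real list \<Rightarrow> real list \<Rightarrow> real list \<Rightarrow> real list \<Rightarrow> real list \<Rightarrow> real list \<Rightarrow>
   real \<Rightarrow> real \<Rightarrow> nat \<Rightarrow> nat \<Rightarrow> real" where
  "kampe_de_feriet_term as bs cs ds fs gs x y m n =
     (poch_list as (m + n) / poch_list bs (m + n)) *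
     (poch_list cs m / poch_list ds m) *
     (poch_list fs n / poch_list gs n) * (x ^ m * y ^ n / (fact m * fact n))"

definition kampe_de_feriet ::
  "real list \<Rightarrow> real list \<Rightarrow> real list \<Rightarrow> real list \<Rightarrow> real list \<Rightarrow> real list \<Rightarrow>
   real \<Rightarrow> real \<Rightarrow> real" where
  "kampe_de_feriet as bs cs ds fs gs x y =
     (\<Sum>m. \<Sum>n. kampe_de_feriet_term as bs cs ds fs gs x y m n)"

definition kampe_de_feriet_converges ::
  "real list \<Rightarrow> real list \<Rightarrow> real list \<Rightarrow> real list \<Rightarrow> real list \<Rightarrow> real list \<Rightarrow>
   real \<Rightarrow> real \<Rightarrow> bool" where
  "kampe_de_feriet_converges as bs cs ds fs gs x y \<longleftrightarrow>
     (\<forall>m. summable (\<lambda>n. kampe_de_feriet_term as bs cs ds fs gs x y m n)) \<and>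
     summable (\<lambda>m. \<Sum>n. kampe_de_feriet_term as bs cs ds fs gs x y m n)"


definition Q_argument :: "real ^ 'n::finite \<Rightarrow> real ^ 'n \<Rightarrow> real ^ 'n \<Rightarrow> real" where
  "Q_argument x y z = ((x \<bullet> z - y \<bullet> z) / (2 - x \<bullet> z - y \<bullet> z))\<^sup>2"

definition Q_integrand ::
  "real \<Rightarrow> real ^ 'n::finite \<Rightarrow> real ^ 'n \<Rightarrow> real ^ 'n \<Rightarrow> real" where
  "Q_integrand \<beta> x y z =
     (1 / (2 * \<beta> - 1) * hyp2F1 (1 / 2 - \<beta>) (1 - \<beta>) (3 / 2 - \<beta>) (Q_argument x y z)) /
     (1 - x \<bullet> z / 2 - y \<bullet> z / 2) powr (1 - 2 * \<beta>)"

definition Q_kernel :: "real \<Rightarrow> real ^ 'n::finite \<Rightarrow> real ^ 'n \<Rightarrow> real" where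
  "Q_kernel \<beta> x y = (LINT z|sphere_measure. Q_integrand \<beta> x y z)"

text \<open>The integer \<open>L\<close> is the one with \<open>\<beta> - 1/2 - L\<close> strictly between 0 and 1.\<close>

definition c_const :: "nat \<Rightarrow> nat \<Rightarrow> real \<Rightarrow> real" where
  "c_const d L \<beta> =
     2 powr (- 2 * \<beta>) / sin (pi * (\<beta> - 1 / 2 - real L)) *
     (Gamma ((real d + 1) / 2) * Gamma \<beta> * Gamma \<beta> /
      (Gamma (\<beta> + real d / 2) * Gamma (\<beta> + 1 / 2)))"


definition gegenbauer :: "real \<Rightarrow> nat \<Rightarrow> real \<Rightarrow> real" where
  "gegenbauer a k t =
     (\<Sum>j\<le>k div 2. (-1) ^ j * pochhammer a (k - j) / (fact j * fact (k - 2 * j)) *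
                   (2 * t) ^ (k - 2 * j))"

definition gegenbauer_P :: "nat \<Rightarrow> nat \<Rightarrow> real \<Rightarrow> real" where
  "gegenbauer_P d k t =
     gegenbauer ((real d - 1) / 2) k t / gegenbauer ((real d - 1) / 2) k 1"

definition harmonic_dim :: "nat \<Rightarrow> nat \<Rightarrow> real" where
  "harmonic_dim d k =
     (2 * real k + real d - 1) * Gamma (real k + real d - 1) / (Gamma (real d) * Gamma (real k + 1))"

text \<open>The surface area of the unit \<open>d\<close>-sphere is \<open>d + 1\<close> times the volume of the unit ball it
  bounds.\<close>

definition sphere_area :: "nat \<Rightarrow> real" where
  "sphere_area d = real (d + 1) * unit_ball_vol (real (d + 1))"

definition ultraspherical_coeff :: "nat \<Rightarrow> (real \<Rightarrow> real) \<Rightarrow> nat \<Rightarrow> real" where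
  "ultraspherical_coeff d q k =
     sphere_area (d - 1) / sphere_area d *
     (LINT u:{-1..1}|lborel. q u * gegenbauer_P d k u * (1 - u\<^sup>2) powr (real d / 2 - 1))"

text \<open>
  A zonal kernel on the sphere, i.e. one that depends on \<open>x \<bullet> y\<close> only, regarded as a function
  of \<open>u = x \<bullet> y\<close>.
\<close>

definition zonal_profile :: "(real ^ 'n::finite \<Rightarrow> real ^ 'n \<Rightarrow> real) \<Rightarrow> real \<Rightarrow> real" where
  "zonal_profile F u = (THE v. \<forall>x\<in>sphere 0 1. \<forall>y\<in>sphere 0 1. x \<bullet> y = u \<longrightarrow> F x y = v)"

text \<open>The parameter \<open>\<beta>\<close> of the kernel is recovered from \<open>2 * \<beta> - 1 = 2 * s - d\<close>.\<close>

definition A2_coeff :: "'n::finite itself \<Rightarrow> real \<Rightarrow> nat \<Rightarrow> nat \<Rightarrow> real" where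
  "A2_coeff _ s d k =
     ultraspherical_coeff d
       (zonal_profile (Q_kernel (s - real d / 2 + 1 / 2) :: real ^ 'n \<Rightarrow> real ^ 'n \<Rightarrow> real)) k"

text \<open>
  The constant \<open>C\<close> in \<open>A2_coeff TYPE('n) s d k \<sim> - C * k powr (- 4 * s)\<close>.

  The source prints
  \<open>(Gamma ((d + 1) / 2) * Gamma (s + 1 / 2) * Gamma (2 * s) /
    (Gamma ((d + 1) / 2 - s) * Gamma (s + 1)))\<^sup>2 * Gamma (d / 2) / Gamma (d / 2 + 2 * s)\<close>
  in place of the product of the last two factors below; the ratio of the two expressions is
  \<open>sqrt pi * Gamma (s + 1 / 2) * Gamma (2 * s) * Gamma (d / 2) / (Gamma (s + 1) * Gamma (d / 2 + 2 * s))\<close>,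
  which is not 1 in general (for \<open>d = 2\<close>, \<open>s = 7 / 4\<close>, i.e. \<open>\<beta> = 5 / 4\<close>, it is about 0.357), so the
  printed relation is false and the corrected constant is used here. It comes from the singular part of the Kampe de Feriet series
  at \<open>x \<bullet> y = 1\<close>: with \<open>Y = (1 - x \<bullet> y) / 2\<close>, \<open>\<gamma> = 2 * s - d / 2\<close> and \<open>\<beta> = s - d / 2 + 1 / 2\<close>, the leading singular
  term of \<open>Q_kernel \<beta> x y\<close> is
  \<open>- Gamma ((d + 1) / 2) * Gamma (- \<gamma>) * Gamma (s + 1 / 2) / (2 * (Gamma (1 - \<beta>))\<^sup>2 * Gamma (s + 1)) * Y powr \<gamma>\<close>,
  and the coefficients of \<open>Y powr \<gamma>\<close> behave like
  \<open>Gamma d * Gamma (2 * s) / (Gamma (d / 2) * Gamma (- \<gamma>)) * k powr (- 4 * s)\<close>; the duplication formula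
  for \<open>Gamma d / Gamma (d / 2)\<close> gives the form below.
\<close>

definition A2_leading_const :: "nat \<Rightarrow> real \<Rightarrow> real" where
  "A2_leading_const d s =
     2 powr (real d - 2) *
     (Gamma ((real d + 1) / 2) / Gamma ((real d + 1) / 2 - s))\<^sup>2 *
     (Gamma (s + 1 / 2) * Gamma (2 * s) / (sqrt pi * Gamma (s + 1)))"

end

theory Submission
  imports Defs "HOL-Real_Asymp.Real_Asymp"
begin

text \<open>
  Let \<open>m\<close> and \<open>h\<close> be half the sum and half the difference of \<open>x \<bullet> z\<close> and \<open>y \<bullet> z\<close>. Integrating in \<open>t\<close>
  first, \<open>\<integral> (v\<^sup>2 - h\<^sup>2) powr (\<beta> - 1) dv\<close> over \<open>[\<bar>h\<bar>, 1 + m]\<close> has a hypergeometric antiderivative.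
  Its value at the upper end is the integrand of \<open>Q\<close> at \<open>-z\<close>; its value at the lower end is a constant times
  \<open>\<bar>h\<bar> powr (2 * \<beta> - 1)\<close>, whose average over the sphere is a power of \<open>norm (x - y)\<close>.

  The integrand of \<open>Q\<close> is an absolutely convergent double power series in \<open>m\<close> and \<open>h\<close>. Integrating it
  termwise gives the Kampe de Feriet series. Regrouped in powers of \<open>x \<bullet> z\<close> and \<open>y \<bullet> z\<close> its coefficients are
  \<open>(b)\<^sub>p (b)\<^sub>q / (p! q! (2 * \<beta> - 1 - p - q))\<close> with \<open>b = 1 - \<beta>\<close>. The sphere average of
  \<open>(x \<bullet> z) ^ p * (y \<bullet> z) ^ q\<close> has \<open>k\<close>-th ultraspherical coefficient \<open>m\<^sub>p\<^sub>k m\<^sub>q\<^sub>k\<close>, where \<open>m\<^sub>n\<^sub>k\<close> is that of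
  \<open>u ^ n\<close>; this gives the coefficients of \<open>Q\<close> as double series.

  For \<open>k > \<beta>\<close> write \<open>1 / (p + q + 1 - 2 * \<beta>)\<close> as an integral of a power of \<open>T\<close> over \<open>T > 1\<close>. The double
  series becomes the integral of the square of \<open>\<integral> (T - u) powr (\<beta> - 1 - k) * (1 - u\<^sup>2) powr (k + d/2 - 1) du\<close>, up to
  explicit factors. The scaling \<open>T = 1 + 2 y / k\<^sup>2\<close>, \<open>u = 1 - 2 \<tau> / k\<close> and dominated convergence lead to the
  integral of the square of \<open>\<integral> \<tau> powr (\<delta> - 1) * exp (- \<tau> - y / \<tau>) d\<tau>\<close> with \<open>\<delta> = d/2 + \<beta> - 1\<close>, which is evaluated by
  Tonelli's theorem.
\<close>

section \<open>Power series and termwise integration\<close>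

text \<open>Two borderline effects shape the estimates. The numbers \<open>(b)\<^sub>p / p!\<close>
  decay only like \<open>p powr (- \<beta>)\<close>, so for \<beta> < 1 they are not summable; the
  double series converges absolutely only with the help of its denominator, and \<beta> > 1/2 is
  exactly what this takes. And the expansion of the integrand must be dominated up to the boundary
  \<open>\<bar>m\<bar> + \<bar>h\<bar> = 1\<close>, which points of the sphere reach. Keeping
  \<open>2 * \<beta> - 1\<close> away from even integers keeps the denominators of even degree
  nonzero; odd degrees vanish in the sphere averages. The product
  \<open>m\<^sub>p\<^sub>k m\<^sub>q\<^sub>k\<close> is what the addition theorem for spherical
  harmonics would give. Here it is an identity between explicit moments, and orthogonality and
  boundedness of the Gegenbauer polynomials come from the same moments. For k > \<beta> all terms of
  the series of a coefficient have one sign, so the asymptotics can be done with nonnegative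
  extended integrals, exchanged without integrability conditions. The scaling balances
  \<open>1 - \<tau> / k\<close> to the power k against \<open>1 + y / (\<tau> * k)\<close> to the
  power -k; both have exponential limits.\<close>

definition pc :: "real \<Rightarrow> nat \<Rightarrow> real" where
  "pc b n = pochhammer b n / fact n"

lemma pc_0 [simp]: "pc b 0 = 1"
  by (simp add: pc_def)

lemma pc_Suc: "pc b (Suc n) = pc b n * (b + real n) / real (Suc n)"
  by (simp add: pc_def pochhammer_Suc field_simps)

lemma pc_eq_gbinomial: "pc b n = (-1) ^ n * ((-b) gchoose n)"
  by (simp add: pc_def gbinomial_pochhammer flip: power_mult_distrib)

lemma pc_1 [simp]: "pc 1 n = 1"
  by (simp add: pc_def pochhammer_fact[symmetric])

lemma pc_0_left: "pc 0 n = (if n = 0 then 1 else 0)"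
  by (simp add: pc_def pochhammer_0_left)

lemma pc_nonneg: "b \<ge> 0 \<Longrightarrow> pc b n \<ge> 0"
  by (simp add: pc_def pochhammer_prod prod_nonneg)

lemma pc_sums:
  assumes "\<bar>x\<bar> < 1"
  shows "(\<lambda>n. pc b n * x ^ n) sums (1 - x) powr (- b)"
proof -
  have "(\<lambda>n. ((- b) gchoose n) * (- x) ^ n) sums (1 + (- x)) powr (- b)"
    using assms by (intro gen_binomial_real) auto
  moreover have "((- b) gchoose n) * (- x) ^ n = pc b n * x ^ n" for n
    by (simp add: pc_eq_gbinomial power_minus[of x])
  ultimately show ?thesis by simp
qed

lemma pc_convolution: "(\<Sum>i\<le>n. pc b i * pc c (n - i)) = pc (b + c) n"
proof -
  have "pc b i * pc c (n - i) = real (n choose i) * pochhammer b i * pochhammer c (n - i) / fact n"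
    if "i \<le> n" for i
    using that by (simp add: pc_def binomial_fact field_simps)
  thus ?thesis
    by (simp add: pc_def pochhammer_binomial_sum sum_divide_distrib)
qed

text \<open>Gauss's limit for \<open>rGamma\<close>. \<open>rGamma_series b n\<close> contains the
  Pochhammer symbol of length \<open>n + 1\<close>, hence the passage through
  \<open>pc b (Suc n)\<close>. The base \<open>n + 1\<close> keeps the power nonzero at
  \<open>n = 0\<close>, so that a bound for all \<open>n\<close> follows from convergence.\<close>

lemma pc_asymp: "(\<lambda>n. pc b n * real (n + 1) powr (1 - b)) \<longlonglongrightarrow> rGamma b"
proof -
  have *: "pc b (Suc n) * real (Suc n + 1) powr (1 - b) =
      rGamma_series b n * (real n powr b / real (n + 1) * real (n + 2) powr (1 - b))" if "n > 0" for n
  proof -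
    have "exp (b * ln (real n)) = real n powr b"
      using that by (simp add: powr_def)
    moreover have "real n powr b \<noteq> 0" using that by simp
    ultimately show ?thesis
      by (simp add: rGamma_series_def pc_def field_simps)
  qed
  have "(\<lambda>n. real n powr b / real (n + 1) * real (n + 2) powr (1 - b)) \<longlonglongrightarrow> 1"
    by real_asymp
  from tendsto_mult[OF rGamma_series_LIMSEQ[of b] this]
  have "(\<lambda>n. rGamma_series b n * (real n powr b / real (n + 1) * real (n + 2) powr (1 - b)))
      \<longlonglongrightarrow> rGamma b" by simp
  hence "(\<lambda>n. pc b (Suc n) * real (Suc n + 1) powr (1 - b)) \<longlonglongrightarrow> rGamma b"
    by (rule Lim_transform_eventually)
       (use * in \<open>auto simp: eventually_at_top_linorder intro!: exI[of _ 1]\<close>)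
  thus ?thesis by (rule LIMSEQ_imp_Suc)
qed

lemma pc_bound: "\<exists>C>0. \<forall>n. \<bar>pc b n\<bar> \<le> C * real (n + 1) powr (b - 1)"
proof -
  have "Bseq (\<lambda>n. pc b n * real (n + 1) powr (1 - b))"
    using pc_asymp convergent_def convergent_imp_Bseq by blast
  then obtain C where C: "C > 0" "\<And>n. \<bar>pc b n * real (n + 1) powr (1 - b)\<bar> \<le> C"
    by (auto simp: Bseq_def)
  have "\<bar>pc b n\<bar> \<le> C * real (n + 1) powr (b - 1)" for n
  proof -
    have "\<bar>pc b n\<bar> = \<bar>pc b n * real (n + 1) powr (1 - b)\<bar> * real (n + 1) powr (b - 1)"
      by (simp add: abs_mult mult.assoc flip: powr_add)
    also have "\<dots> \<le> C * real (n + 1) powr (b - 1)"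
      by (intro mult_right_mono C) auto
    finally show ?thesis .
  qed
  with C(1) show ?thesis by blast
qed

text \<open>If \<open>a\<close> is a natural number, the term \<open>n = a\<close> is 0 by the
  convention for division, so the bound also covers a vanishing denominator.\<close>

lemma recip_linear_bound: "\<exists>C>0. \<forall>n. \<bar>1 / (a - real n)\<bar> \<le> C / real (n + 1)"
proof -
  have "(\<lambda>n. real (n + 1) / (a - real n)) \<longlonglongrightarrow> -1"
    by real_asymp
  then have "Bseq (\<lambda>n. real (n + 1) / (a - real n))"
    using convergent_def convergent_imp_Bseq by blast
  then obtain C where C: "C > 0" "\<And>n. \<bar>real (n + 1) / (a - real n)\<bar> \<le> C"
    by (auto simp: Bseq_def)
  have "\<bar>1 / (a - real n)\<bar> \<le> C / real (n + 1)" for n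
    using C(2)[of n] by (simp add: abs_mult abs_divide field_simps)
  with C(1) show ?thesis by blast
qed

lemma summable_Suc_powr: "a < -1 \<Longrightarrow> summable (\<lambda>n. real (n + 1) powr a)"
  using summable_Suc_iff[of "\<lambda>n. real n powr a"] by (simp add: summable_real_powr_iff add.commute)

lemma pc_summable:
  assumes "b < 0"
  shows "summable (\<lambda>n. \<bar>pc b n\<bar>)"
proof -
  obtain C where C: "C > 0" "\<And>n. \<bar>pc b n\<bar> \<le> C * real (n + 1) powr (b - 1)"
    using pc_bound by blast
  show ?thesis
    by (rule summable_comparison_test[OF _ summable_mult[OF summable_Suc_powr[of "b - 1"], of C]])
       (use C assms in auto)
qed

lemma pc_tendsto_0: "b < 1 \<Longrightarrow> pc b \<longlonglongrightarrow> 0"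
proof -
  assume b: "b < 1"
  have "(\<lambda>n. real (n + 1) powr (b - 1)) \<longlonglongrightarrow> 0"
    using b by real_asymp
  from tendsto_mult[OF pc_asymp[of b] this]
  have "(\<lambda>n. pc b n * real (n + 1) powr (1 - b) * real (n + 1) powr (b - 1)) \<longlonglongrightarrow> 0" by simp
  thus ?thesis by (simp add: mult.assoc flip: powr_add)
qed

lemma pc_div_summable:
  assumes "b < 1"
  shows "summable (\<lambda>n. \<bar>pc b n / (a - real n)\<bar>)"
proof -
  obtain C where C: "C > 0" "\<And>n. \<bar>pc b n\<bar> \<le> C * real (n + 1) powr (b - 1)"
    using pc_bound by blast
  obtain D where D: "D > 0" "\<And>n. \<bar>1 / (a - real n)\<bar> \<le> D / real (n + 1)"
    using recip_linear_bound by blast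
  have "\<bar>pc b n / (a - real n)\<bar> \<le> C * D * real (n + 1) powr (b - 2)" for n
  proof -
    have "\<bar>pc b n / (a - real n)\<bar> = \<bar>pc b n\<bar> * \<bar>1 / (a - real n)\<bar>"
      by (simp add: abs_mult)
    also have "\<dots> \<le> (C * real (n + 1) powr (b - 1)) * (D / real (n + 1))"
      using C D by (intro mult_mono) auto
    also have "real (n + 1) powr (b - 1) = real (n + 1) powr (b - 2) * real (n + 1)"
      using powr_add[of "real (n + 1)" "b - 2" 1] by simp
    finally show ?thesis using D by (simp add: mult_ac)
  qed
  thus ?thesis
    by (intro summable_comparison_test[OF _ summable_mult[OF summable_Suc_powr[of "b - 2"], of "C * D"]])
       (use assms in auto)
qed

section \<open>Beta integrals as series\<close>

lemma has_integral_nonneg_lborel: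
  fixes f :: "'a::euclidean_space \<Rightarrow> real"
  assumes [measurable]: "f \<in> borel_measurable borel" "S \<in> sets borel"
    and nonneg: "\<And>x. x \<in> S \<Longrightarrow> 0 \<le> f x" and I: "(f has_integral I) S"
  shows "set_integrable lborel S f" "(LINT x:S|lborel. f x) = I"
proof -
  have "has_bochner_integral lborel (\<lambda>x. indicator S x * f x) I"
  proof (rule has_bochner_integral_nn_integral)
    show "(\<integral>\<^sup>+x. ennreal (indicator S x * f x) \<partial>lborel) = ennreal I"
      by (rule nn_integral_has_integral_lebesgue[OF nonneg I])
    show "0 \<le> I" by (rule has_integral_nonneg[OF I nonneg])
  qed (use nonneg in \<open>auto simp: indicator_def\<close>)
  thus "set_integrable lborel S f" "(LINT x:S|lborel. f x) = I"
    by (auto simp: set_integrable_def set_lebesgue_integral_def has_bochner_integral_iff)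
qed

text \<open>Expand \<open>(1 - x) powr (y - 1)\<close> in the Beta integral and integrate termwise.
  The endpoints 0 and 1, where the expansion may fail, form a null set.\<close>

lemma pc_series_beta_pos:
  assumes a: "a > 0" and y: "y > 0"
  shows "(\<lambda>n. pc (1 - y) n / (a + real n)) sums Beta a y"
proof -
  define f where "f n x = indicator {0..1} x * (pc (1 - y) n * x powr (a + real n - 1))" for n x
  have I: "integrable lborel (\<lambda>x. indicator {0..1} x * (x powr (c - 1)))"
          "(\<integral>x. indicator {0..1} x * (x powr (c - 1)) \<partial>lborel) = 1 / c" if "c > 0" for c :: real
  proof -
    have *: "((\<lambda>x. x powr (c - 1)) has_integral 1 / c) {0..1}"
      using has_integral_powr_from_0[of "c - 1" 1] that by simp
    from has_integral_nonneg_lborel[OF _ _ _ this] show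
      "integrable lborel (\<lambda>x. indicator {0..1} x * (x powr (c - 1)))"
      "(\<integral>x. indicator {0..1} x * (x powr (c - 1)) \<partial>lborel) = 1 / c"
      by (auto simp: set_integrable_def set_lebesgue_integral_def)
  qed
  have int: "integrable lborel (f n)" "(\<integral>x. f n x \<partial>lborel) = pc (1 - y) n / (a + real n)"
     "(\<integral>x. norm (f n x) \<partial>lborel) = \<bar>pc (1 - y) n\<bar> / (a + real n)" for n
  proof -
    have 1: "f n = (\<lambda>x. pc (1 - y) n * (indicator {0..1} x * x powr (a + real n - 1)))"
      by (auto simp: f_def fun_eq_iff)
    have 2: "norm (f n x) = \<bar>pc (1 - y) n\<bar> * (indicator {0..1} x * x powr (a + real n - 1))" for x
      by (auto simp: f_def abs_mult indicator_def)
    show "integrable lborel (f n)" "(\<integral>x. f n x \<partial>lborel) = pc (1 - y) n / (a + real n)"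
      "(\<integral>x. norm (f n x) \<partial>lborel) = \<bar>pc (1 - y) n\<bar> / (a + real n)"
      unfolding 2 unfolding 1 using I[of "a + real n"] a by (auto simp: add_pos_nonneg)
  qed
  have sums: "(\<lambda>n. f n x) sums (indicator {0..1} x * (x powr (a - 1) * (1 - x) powr (y - 1)))"
    and abs: "summable (\<lambda>n. norm (f n x))" if "x \<noteq> 0" "x \<noteq> 1" for x
  proof -
    consider "x \<notin> {0..1}" | "0 < x" "x < 1"
      using \<open>x \<noteq> 0\<close> \<open>x \<noteq> 1\<close> by (cases "x \<in> {0..1}") (auto simp: less_le)
    hence "(\<lambda>n. f n x) sums (indicator {0..1} x * (x powr (a - 1) * (1 - x) powr (y - 1))) \<and>
           summable (\<lambda>n. norm (f n x))"
    proof cases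
      case 2
      have e: "f n x = pc (1 - y) n * x ^ n * x powr (a - 1)" for n
        using 2 by (simp add: f_def powr_add powr_diff powr_realpow)
      have "summable (\<lambda>n. norm (pc (1 - y) n * x ^ n))"
        using pc_sums[of "(1 + x) / 2" "1 - y"] 2
        by (intro powser_insidea[of _ "(1 + x) / 2"]) (auto simp: sums_iff)
      from summable_mult2[OF this, of "x powr (a - 1)"]
      have "summable (\<lambda>n. norm (f n x))" by (simp add: e abs_mult)
      moreover have "(\<lambda>n. f n x) sums ((1 - x) powr (-(1 - y)) * x powr (a - 1))"
        unfolding e using 2 by (intro sums_mult2 pc_sums) auto
      ultimately show ?thesis using 2 by (simp add: mult_ac)
    qed (auto simp: f_def)
    thus "(\<lambda>n. f n x) sums (indicator {0..1} x * (x powr (a - 1) * (1 - x) powr (y - 1)))"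
       "summable (\<lambda>n. norm (f n x))" by auto
  qed
  have ae: "AE x in lborel. x \<noteq> 0 \<and> x \<noteq> (1::real)"
    by (intro AE_conjI AE_lborel_singleton)
  have "(\<lambda>n. \<integral>x. f n x \<partial>lborel) sums (\<integral>x. (\<Sum>n. f n x) \<partial>lborel)"
  proof (rule sums_integral)
    show "AE x in lborel. summable (\<lambda>n. norm (f n x))"
      using ae by eventually_elim (use abs in auto)
    show "summable (\<lambda>n. \<integral>x. norm (f n x) \<partial>lborel)"
      unfolding int using pc_div_summable[of "1 - y" "-a"] a y
      by (simp add: abs_divide abs_minus_commute add_pos_nonneg add.commute)
  qed (use int in auto)
  also have "(\<integral>x. (\<Sum>n. f n x) \<partial>lborel) =
     (\<integral>x. indicator {0..1} x * (x powr (a - 1) * (1 - x) powr (y - 1)) \<partial>lborel)"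
  proof (intro integral_cong_AE)
    show "AE x in lborel. (\<Sum>n. f n x) = indicator {0..1} x * (x powr (a - 1) * (1 - x) powr (y - 1))"
      using ae by eventually_elim (use sums in \<open>auto simp: sums_iff\<close>)
  qed (unfold f_def, measurable)
  also have "\<dots> = Beta a y"
    using has_integral_nonneg_lborel(2)[OF _ _ _ has_integral_Beta_real[OF a y]]
    by (simp add: set_lebesgue_integral_def)
  finally show ?thesis by (simp add: int)
qed

text \<open>The Beta integral diverges for \<open>a \<le> 0\<close>. There the recurrence
  \<open>a * Beta a y = (a + y) * Beta (a + 1) y\<close> lowers \<open>a\<close> one unit at a time,
  and the series obeys the same recurrence up to a telescoping sum. The application has
  \<open>a = 1/2 - \<beta> < 0\<close>.\<close>

lemma pc_series_beta:
  assumes y: "y > 0" and a: "\<And>n. a + real n \<noteq> 0"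
  shows "(\<lambda>n. pc (1 - y) n / (a + real n)) sums Beta a y"
proof -
  have ge: "a + real k > 0 \<Longrightarrow> (\<And>n. a + real n \<noteq> 0) \<Longrightarrow>
    (\<lambda>n. pc (1 - y) n / (a + real n)) sums Beta a y" for k and a :: real
  proof (induction k arbitrary: a)
    case 0
    thus ?case using pc_series_beta_pos y by auto
  next
    case (Suc k)
    note nz = Suc.prems(2)
    have nz': "a + 1 + real n \<noteq> 0" for n using nz[of "Suc n"] by (simp add: add_ac)
    have IH: "(\<lambda>n. pc (1 - y) n / (a + 1 + real n)) sums Beta (a + 1) y"
      using Suc.IH[of "a + 1"] Suc.prems(1) nz' by (simp add: add_ac)
    \<comment> \<open>Chosen so that the two sides of the recurrence differ termwise by
      \<open>s n - s (Suc n)\<close>. The telescoped sum is 0, because \<open>s 0 = 0\<close> and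
      \<open>s\<close> tends to 0 together with \<open>pc (1 - y)\<close>, as
      \<open>y > 0\<close>.\<close>
    define s where "s n = real n * pc (1 - y) n / (a + real n)" for n
    have step: "a * (pc (1 - y) n / (a + real n)) =
        (a + y) * (pc (1 - y) n / (a + 1 + real n)) - (s n - s (Suc n))" for n
    proof -
      have 1: "s (Suc n) = pc (1 - y) n * (1 - y + real n) / (a + 1 + real n)"
        by (simp add: s_def pc_Suc add_ac)
      have 2: "s n = real n * pc (1 - y) n / (a + real n)" by (simp only: s_def)
      show ?thesis using nz[of n] nz'[of n]
        unfolding 1 2 by (simp add: divide_simps) (simp add: algebra_simps)
    qed
    have "s \<longlonglongrightarrow> 0"
    proof -
      have "(\<lambda>n. real n / (a + real n)) \<longlonglongrightarrow> 1" by real_asymp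
      from tendsto_mult[OF this pc_tendsto_0[of "1 - y"]] y show ?thesis
        by (simp add: s_def[abs_def] field_simps)
    qed
    hence "(\<lambda>n. s n - s (Suc n)) sums (s 0 - 0)" by (rule telescope_sums')
    hence "(\<lambda>n. s n - s (Suc n)) sums 0" by (simp add: s_def)
    from sums_diff[OF sums_mult[OF IH, of "a + y"] this]
    have "(\<lambda>n. a * (pc (1 - y) n / (a + real n))) sums ((a + y) * Beta (a + 1) y)"
      by (simp only: step) simp
    also have "(a + y) * Beta (a + 1) y = a * Beta a y"
      using Beta_plus1_left[of a y] nz by (metis add.right_neutral of_nat_0 nonpos_Ints_cases' add.left_inverse)
    finally have "(\<lambda>n. inverse a * (a * (pc (1 - y) n / (a + real n)))) sums (inverse a * (a * Beta a y))"
      by (rule sums_mult)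
    thus ?case using nz[of 0] by (simp add: field_simps)
  qed
  obtain k :: nat where "- a < real k" using reals_Archimedean2 by blast
  thus ?thesis using ge[of a k] a by simp
qed

text \<open>From \<open>p + q + 1 \<ge> sqrt ((p + 1) * (q + 1))\<close> the denominator splits
  evenly between the two factors, which leaves a product of two single series with exponent
  \<open>b - 3/2 < -1\<close>. For \<open>b = 1 - \<beta>\<close> the hypothesis reads
  \<open>\<beta> > 1/2\<close>.\<close>

lemma pc_weight_summable:
  assumes "b < 1 / 2"
  shows "(\<lambda>(p, q). \<bar>pc b p * pc b q / (a - real (p + q))\<bar>) summable_on UNIV"
proof -
  obtain C where C: "C > 0" "\<And>n. \<bar>pc b n\<bar> \<le> C * real (n + 1) powr (b - 1)"
    using pc_bound by blast
  obtain D where D: "D > 0" "\<And>n. \<bar>1 / (a - real n)\<bar> \<le> D / real (n + 1)"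
    using recip_linear_bound by blast
  define g where "g n = real (n + 1) powr (b - 3 / 2)" for n
  have g0: "g n \<ge> 0" for n by (simp add: g_def)
  have g: "g summable_on UNIV"
    unfolding g_def using summable_Suc_powr[of "b - 3 / 2"] assms
    by (intro summable_nonneg_imp_summable_on) auto
  have gg: "(\<lambda>(p, q). g p * g q) summable_on UNIV \<times> UNIV"
    by (rule summable_on_SigmaI[where g = "\<lambda>p. g p * infsum g UNIV"])
       (use g in \<open>auto intro!: has_sum_cmult_right has_sum_infsum summable_on_cmult_left simp: g0\<close>)
  show ?thesis
  proof (rule summable_on_comparison_test[OF summable_on_cmult_right[OF gg, of "C * C * D", simplified UNIV_Times_UNIV]])
    fix x :: "nat \<times> nat"
    obtain p q where x: "x = (p, q)" by (cases x)
    have "real (p + 1) powr (1/2) * real (q + 1) powr (1/2) \<le>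
          real (p + q + 1) powr (1/2) * real (p + q + 1) powr (1/2)"
      by (intro mult_mono powr_mono2) auto
    also have "\<dots> = real (p + q + 1)" by (simp flip: powr_add)
    finally have "D / real (p + q + 1) \<le> D / (real (p + 1) powr (1/2) * real (q + 1) powr (1/2))"
      using D(1) by (intro divide_left_mono) auto
    hence *: "\<bar>1 / (a - real (p + q))\<bar> \<le> D / (real (p + 1) powr (1/2) * real (q + 1) powr (1/2))"
      using D(2)[of "p + q"] by linarith
    have "\<bar>pc b p * pc b q / (a - real (p + q))\<bar> = \<bar>pc b p\<bar> * \<bar>pc b q\<bar> * \<bar>1 / (a - real (p + q))\<bar>"
      by (simp add: abs_mult)
    also have "\<dots> \<le> (C * real (p + 1) powr (b - 1)) * (C * real (q + 1) powr (b - 1)) *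
                      (D / (real (p + 1) powr (1/2) * real (q + 1) powr (1/2)))"
      using C(1) D(1) by (intro mult_mono C(2) *) auto
    also have "\<dots> = C * C * D * ((real (p + 1) powr (b - 1) / real (p + 1) powr (1/2)) *
                                 (real (q + 1) powr (b - 1) / real (q + 1) powr (1/2)))"
      by simp
    also have "\<dots> = C * C * D * (g p * g q)"
      unfolding g_def by (simp flip: powr_diff)
    finally show "(case x of (p, q) \<Rightarrow> \<bar>pc b p * pc b q / (a - real (p + q))\<bar>)
        \<le> C * C * D * (case x of (p, q) \<Rightarrow> g p * g q)" by (simp add: x)
  qed (auto simp: case_prod_beta)
qed

section \<open>Interchange of double sums and integrals\<close>

lemma abs_summable_on_boundedI:
  fixes f :: "'i \<Rightarrow> real"
  assumes "\<And>F. finite F \<Longrightarrow> (\<Sum>i\<in>F. \<bar>f i\<bar>) \<le> B"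
  shows "(\<lambda>i. \<bar>f i\<bar>) summable_on UNIV" "f summable_on UNIV"
proof -
  show *: "(\<lambda>i. \<bar>f i\<bar>) summable_on UNIV"
    by (rule nonneg_bdd_above_summable_on) (use assms in \<open>auto intro!: bdd_aboveI\<close>)
  show "f summable_on UNIV"
    using * by (subst summable_on_iff_abs_summable_on_real) simp
qed

text \<open>The majorant \<open>G\<close> bounds all finite sums of \<open>\<bar>f i x\<bar>\<close>
  at once. Enumerating the pairs by \<open>prod_decode\<close> turns the double sum into a single
  series, to which termwise integration applies; unconditional summability of the integrals then
  identifies the two sums.\<close>

lemma
  fixes f :: "nat \<times> nat \<Rightarrow> 'a \<Rightarrow> real"
  assumes G: "integrable M G" and meas: "\<And>i. f i \<in> borel_measurable M"
    and bd: "\<And>x F. x \<in> space M \<Longrightarrow> finite F \<Longrightarrow> (\<Sum>i\<in>F. \<bar>f i x\<bar>) \<le> G x"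
  shows has_sum_integral_double_sum:
      "((\<lambda>i. \<integral>x. f i x \<partial>M) has_sum (\<integral>x. infsum (\<lambda>i. f i x) UNIV \<partial>M)) UNIV"
    and integrable_double_sum: "integrable M (\<lambda>x. infsum (\<lambda>i. f i x) UNIV)"
proof -
  have int: "integrable M (f i)" for i
  proof (rule Bochner_Integration.integrable_bound[OF G meas])
    show "AE x in M. norm (f i x) \<le> norm (G x)"
      using bd[of _ "{i}"] by (intro AE_I2) (auto intro: order_trans[OF _ abs_ge_self])
  qed
  have int_sum: "(\<Sum>i\<in>F. \<integral>x. \<bar>f i x\<bar> \<partial>M) \<le> (\<integral>x. G x \<partial>M)" if "finite F" for F
  proof -
    have "(\<Sum>i\<in>F. \<integral>x. \<bar>f i x\<bar> \<partial>M) = (\<integral>x. (\<Sum>i\<in>F. \<bar>f i x\<bar>) \<partial>M)"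
      using int by (intro Bochner_Integration.integral_sum[symmetric]) auto
    also have "\<dots> \<le> (\<integral>x. G x \<partial>M)"
      using int bd that by (intro integral_mono G) auto
    finally show ?thesis .
  qed
  have abs: "(\<lambda>i. \<bar>\<integral>x. \<bar>f i x\<bar> \<partial>M\<bar>) summable_on UNIV"
    by (rule abs_summable_on_boundedI[where B = "\<integral>x. G x \<partial>M"]) (use int_sum in simp)
  hence abs': "(\<lambda>i. \<integral>x. \<bar>f i x\<bar> \<partial>M) summable_on UNIV" by simp
  define g where "g n = f (prod_decode n)" for n
  have bij: "bij_betw prod_decode UNIV UNIV" by (rule bij_prod_decode)
  have re: "infsum (\<lambda>n. g n x) UNIV = infsum (\<lambda>i. f i x) UNIV" for x
    unfolding g_def by (rule infsum_reindex_bij_betw[OF bij])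
  have abs1: "(\<lambda>n. norm (g n x)) summable_on UNIV" if "x \<in> space M" for x
    unfolding g_def summable_on_reindex_bij_betw[OF bij, of "\<lambda>i. norm (f i x)"]
    using abs_summable_on_boundedI(1)[of "\<lambda>i. f i x" "G x"] bd that by simp
  have sg: "summable (\<lambda>n. norm (g n x))" "infsum (\<lambda>n. g n x) UNIV = (\<Sum>n. g n x)"
    if "x \<in> space M" for x
  proof -
    show "summable (\<lambda>n. norm (g n x))"
      using abs1[OF that] by (rule summable_on_imp_summable)
    have "(\<lambda>n. g n x) summable_on UNIV"
      using abs1[OF that] by (subst summable_on_iff_abs_summable_on_real) simp
    hence "(\<lambda>n. g n x) sums infsum (\<lambda>n. g n x) UNIV"
      by (intro has_sum_imp_sums has_sum_infsum)
    thus "infsum (\<lambda>n. g n x) UNIV = (\<Sum>n. g n x)" by (simp add: sums_iff)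
  qed
  have s2: "summable (\<lambda>n. \<integral>x. norm (g n x) \<partial>M)"
    unfolding g_def using abs'
    by (intro summable_on_imp_summable) (simp add: summable_on_reindex_bij_betw[OF bij, of "\<lambda>i. \<integral>x. \<bar>f i x\<bar> \<partial>M"])
  have intg: "integrable M (g n)" for n unfolding g_def by (rule int)
  have "integrable M (\<lambda>x. \<Sum>n. g n x)"
    using sg s2 intg by (intro integrable_suminf) auto
  thus "integrable M (\<lambda>x. infsum (\<lambda>i. f i x) UNIV)"
    by (rule Bochner_Integration.integrable_cong[THEN iffD1, rotated 2]) (auto simp: sg(2) simp flip: re)
  have "(\<lambda>n. \<integral>x. g n x \<partial>M) sums (\<integral>x. (\<Sum>n. g n x) \<partial>M)"
    using sg s2 intg by (intro sums_integral) auto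
  also have "(\<integral>x. (\<Sum>n. g n x) \<partial>M) = (\<integral>x. infsum (\<lambda>i. f i x) UNIV \<partial>M)"
    by (intro Bochner_Integration.integral_cong) (auto simp: sg(2) simp flip: re)
  finally have sums: "(\<lambda>n. \<integral>x. g n x \<partial>M) sums (\<integral>x. infsum (\<lambda>i. f i x) UNIV \<partial>M)" .
  have "(\<lambda>i. \<integral>x. f i x \<partial>M) summable_on UNIV"
  proof (rule abs_summable_on_boundedI(2))
    fix F :: "(nat \<times> nat) set" assume "finite F"
    have "(\<Sum>i\<in>F. \<bar>\<integral>x. f i x \<partial>M\<bar>) \<le> (\<Sum>i\<in>F. \<integral>x. \<bar>f i x\<bar> \<partial>M)"
      by (intro sum_mono integral_abs_bound)
    with int_sum[OF \<open>finite F\<close>] show "(\<Sum>i\<in>F. \<bar>\<integral>x. f i x \<partial>M\<bar>) \<le> (\<integral>x. G x \<partial>M)" by linarith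
  qed
  hence hs: "((\<lambda>i. \<integral>x. f i x \<partial>M) has_sum infsum (\<lambda>i. \<integral>x. f i x \<partial>M) UNIV) UNIV"
    by (rule has_sum_infsum)
  hence "((\<lambda>n. \<integral>x. g n x \<partial>M) has_sum infsum (\<lambda>i. \<integral>x. f i x \<partial>M) UNIV) UNIV"
    unfolding g_def by (simp add: has_sum_reindex_bij_betw[OF bij, of "\<lambda>i. \<integral>x. f i x \<partial>M"])
  from sums_unique2[OF has_sum_imp_sums[OF this] sums] hs
  show "((\<lambda>i. \<integral>x. f i x \<partial>M) has_sum (\<integral>x. infsum (\<lambda>i. f i x) UNIV \<partial>M)) UNIV" by simp
qed

section \<open>Formal binomial series\<close>

lemma fps_linear_ode_unique:
  fixes f g R S :: "real fps"
  assumes R: "fps_nth R 0 = 1" and f: "R * fps_deriv f = S * f" and g: "R * fps_deriv g = S * g"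
    and eq: "fps_nth f 0 = fps_nth g 0"
  shows "f = g"
proof -
  define D where "D = f - g"
  define K where "K = inverse R * S"
  have "R * fps_deriv D = S * D"
    using f g by (simp add: D_def algebra_simps)
  hence "inverse R * (R * fps_deriv D) = inverse R * (S * D)" by simp
  hence D': "fps_deriv D = K * D"
    using R by (simp add: K_def mult.assoc[symmetric] inverse_mult_eq_1)
  have "fps_nth D n = 0" for n
  proof (induction n rule: less_induct)
    case (less n)
    show ?case
    proof (cases n)
      case (Suc m)
      have "real (Suc m) * fps_nth D (Suc m) = fps_nth (K * D) m"
        using arg_cong[OF D', of "\<lambda>h. fps_nth h m"] by simp
      also have "\<dots> = 0"
        unfolding fps_mult_nth by (intro sum.neutral) (use less Suc in auto)
      finally show ?thesis using Suc by simp
    qed (use eq D_def in simp)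
  qed
  thus ?thesis by (simp add: D_def fps_eq_iff)
qed

text \<open>Formally, \<open>1 - t X\<close> to the power \<open>-b\<close>.\<close>

definition fps_pc :: "real \<Rightarrow> real \<Rightarrow> real fps" where
  "fps_pc b t = Abs_fps (\<lambda>n. pc b n * t ^ n)"

lemma fps_pc_nth [simp]: "fps_nth (fps_pc b t) n = pc b n * t ^ n"
  by (simp add: fps_pc_def)

lemma fps_pc_mult: "fps_pc b t * fps_pc c t = fps_pc (b + c) t"
proof (rule fps_ext)
  fix n
  have "(\<Sum>i=0..n. pc b i * t ^ i * (pc c (n - i) * t ^ (n - i))) = (\<Sum>i\<le>n. pc b i * pc c (n - i)) * t ^ n"
    unfolding sum_distrib_right atLeast0AtMost
    by (intro sum.cong) (auto simp flip: power_add)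
  thus "fps_nth (fps_pc b t * fps_pc c t) n = fps_nth (fps_pc (b + c) t) n"
    by (simp add: fps_mult_nth pc_convolution)
qed

lemma fps_pc_deriv: "(1 - fps_const t * fps_X) * fps_deriv (fps_pc b t) = fps_const (b * t) * fps_pc b t"
proof (rule fps_ext)
  fix n
  show "fps_nth ((1 - fps_const t * fps_X) * fps_deriv (fps_pc b t)) n = fps_nth (fps_const (b * t) * fps_pc b t) n"
  proof (cases n)
    case (Suc k)
    have "real (Suc n) * pc b (Suc n) = pc b n * (b + real n)" by (simp add: pc_Suc)
    hence "real (Suc n) * (pc b (Suc n) * t ^ Suc n) = (b + real n) * (t * (pc b n * t ^ n))"
      by (simp add: algebra_simps)
    thus ?thesis using Suc by (simp add: left_diff_distrib mult.assoc algebra_simps)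
  qed (simp add: left_diff_distrib mult.assoc pc_Suc)
qed

lemma fps_pc_minus1: "fps_pc 1 t * (1 - fps_const t * fps_X) = 1"
proof (rule fps_ext)
  fix n
  show "fps_nth (fps_pc 1 t * (1 - fps_const t * fps_X)) n = fps_nth 1 n"
    by (cases n) (simp_all add: right_diff_distrib mult.assoc[symmetric])
qed

lemma fps_pc_power: "fps_pc b t ^ n = fps_pc (real n * b) t"
proof (induction n)
  case 0
  show ?case by (rule fps_ext) (simp add: pc_0_left)
next
  case (Suc n)
  thus ?case by (simp add: fps_pc_mult algebra_simps)
qed

text \<open>Both sides are the coefficient of \<open>X ^ i\<close> in
  \<open>(1 - (m + h) X) (1 - (m - h) X)\<close> to the power \<open>-b\<close>. The right-hand side
  results from writing this product as \<open>(1 - m X)\<^sup>2 - h\<^sup>2 X\<^sup>2\<close>,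
  factoring out \<open>(1 - m X)\<^sup>2\<close> and expanding in \<open>h\<close>. The two formal
  series are identified as solutions of one linear differential equation \<open>R f' = S f\<close>
  with the same constant term.\<close>

lemma pc_homogeneous_sum:
  "(\<Sum>p\<le>i. pc b p * pc b (i - p) * (m + h) ^ p * (m - h) ^ (i - p)) =
   (\<Sum>n\<le>i div 2. pc b n * pc (2 * b + 2 * real n) (i - 2 * n) * h ^ (2 * n) * m ^ (i - 2 * n))"
proof -
  define P where "P = 1 - fps_const m * fps_X"
  \<comment> \<open>\<open>Y\<close> is \<open>h\<^sup>2 X\<^sup>2 / (1 - m X)\<^sup>2\<close>,
    since \<open>fps_pc 2 m\<close> is the inverse of \<open>P\<^sup>2\<close>. The factorized form
    of \<open>f\<close> will be \<open>B * C\<close>.\<close>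
  define Y where "Y = fps_const (h\<^sup>2) * fps_X\<^sup>2 * fps_pc 2 m"
  define C where "C = fps_pc b 1 oo Y"
  define B where "B = fps_pc (2 * b) m"
  define R where "R = (1 - fps_const (m + h) * fps_X) * (1 - fps_const (m - h) * fps_X)"
  define S where "S = fps_const (b * (m + h)) * (1 - fps_const (m - h) * fps_X) +
                      fps_const (b * (m - h)) * (1 - fps_const (m + h) * fps_X)"
  define f where "f = fps_pc b (m + h) * fps_pc b (m - h)"
  have Y0: "fps_nth Y 0 = 0" by (simp add: Y_def)
  have R': "R = P\<^sup>2 - fps_const (h\<^sup>2) * fps_X\<^sup>2"
    by (simp add: R_def P_def power2_eq_square algebra_simps
        flip: fps_const_mult fps_const_add fps_const_sub)
  have S': "S = fps_const (2 * b) * (fps_const m * P + fps_const (h\<^sup>2) * fps_X)"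
    by (simp add: S_def P_def power2_eq_square flip: fps_const_mult fps_const_add fps_const_sub)
       (simp add: algebra_simps flip: fps_const_mult fps_const_add fps_const_sub numeral_fps_const)
  have f': "R * fps_deriv f = S * f"
  proof -
    define A1 A2 where "A1 = fps_pc b (m + h)" and "A2 = fps_pc b (m - h)"
    define p1 p2 where "p1 = 1 - fps_const (m + h) * fps_X" and "p2 = 1 - fps_const (m - h) * fps_X"
    have 1: "p1 * fps_deriv A1 = fps_const (b * (m + h)) * A1"
      unfolding A1_def p1_def by (rule fps_pc_deriv)
    have 2: "p2 * fps_deriv A2 = fps_const (b * (m - h)) * A2"
      unfolding A2_def p2_def by (rule fps_pc_deriv)
    have "p1 * p2 * (A1 * fps_deriv A2 + fps_deriv A1 * A2) =
        (p1 * A1) * (p2 * fps_deriv A2) + (p2 * A2) * (p1 * fps_deriv A1)"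
      by (simp add: algebra_simps)
    also have "\<dots> = (fps_const (b * (m + h)) * p2 + fps_const (b * (m - h)) * p1) * (A1 * A2)"
      unfolding 1 2 by (simp add: algebra_simps)
    finally show ?thesis
      by (simp add: R_def S_def f_def A1_def A2_def p1_def p2_def)
  qed
  have PP: "P\<^sup>2 * fps_pc 2 m = 1"
    using fps_pc_minus1[of m] fps_pc_mult[of 1 m 1]
    by (simp add: P_def power2_eq_square) (metis (no_types, lifting) mult.assoc mult.commute mult_1_right)
  have PY: "P\<^sup>2 * Y = fps_const (h\<^sup>2) * fps_X\<^sup>2"
    using PP by (simp add: Y_def algebra_simps)
  have dP: "fps_deriv P = - fps_const m" by (simp add: P_def)
  have "fps_deriv (P\<^sup>2 * Y) = fps_deriv (fps_const (h\<^sup>2) * fps_X\<^sup>2)" by (simp only: PY)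
  hence dPY: "P\<^sup>2 * fps_deriv Y - 2 * fps_const m * P * Y = 2 * fps_const (h\<^sup>2) * fps_X"
    by (simp add: power2_eq_square dP algebra_simps fps_deriv_mult flip: fps_const_neg)
  have P3: "P ^ 3 * fps_deriv Y = 2 * fps_const (h\<^sup>2) * fps_X"
  proof -
    have "P ^ 3 * fps_deriv Y = P * (P\<^sup>2 * fps_deriv Y - 2 * fps_const m * P * Y) + 2 * fps_const m * (P\<^sup>2 * Y)"
      by (simp add: power2_eq_square power3_eq_cube algebra_simps)
    also have "\<dots> = 2 * fps_const (h\<^sup>2) * fps_X * (P + fps_const m * fps_X)"
      unfolding dPY PY by (simp add: power2_eq_square algebra_simps)
    finally show ?thesis by (simp add: P_def)
  qed
  have dB: "P * fps_deriv B = 2 * fps_const b * fps_const m * B"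
    using fps_pc_deriv[of m "2 * b"] by (simp add: P_def B_def flip: fps_const_mult numeral_fps_const)
  define C1 where "C1 = fps_deriv (fps_pc b 1) oo Y"
  have dC: "fps_deriv C = C1 * fps_deriv Y"
    unfolding C_def C1_def using Y0 by (rule fps_compose_deriv)
  have "((1 - fps_X) * fps_deriv (fps_pc b 1)) oo Y = (fps_const b * fps_pc b 1) oo Y"
    using fps_pc_deriv[of 1 b] by simp
  hence C1: "(1 - Y) * C1 = fps_const b * C"
    using Y0 by (simp add: C1_def C_def fps_compose_mult_distrib fps_compose_sub_distrib)
  have g': "R * fps_deriv (B * C) = S * (B * C)"
  proof -
    have RP: "R = P\<^sup>2 * (1 - Y)" by (simp add: R' PY right_diff_distrib)
    \<comment> \<open>One extra factor \<open>P\<close> clears all denominators: \<open>P\<close>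
      the one in \<open>B'\<close>, and \<open>P ^ 3\<close>, available because
      \<open>R = P\<^sup>2 * (1 - Y)\<close>, the one in \<open>Y'\<close>.\<close>
    have "P * (R * fps_deriv (B * C)) =
       R * (P * fps_deriv B) * C + B * ((1 - Y) * C1) * (P ^ 3 * fps_deriv Y)"
      by (simp add: dC RP fps_deriv_mult power2_eq_square power3_eq_cube algebra_simps)
    also have "\<dots> = (R * fps_const m + fps_const (h\<^sup>2) * fps_X) * (2 * fps_const b) * (B * C)"
      unfolding dB C1 P3 by (simp add: algebra_simps)
    also have "R * fps_const m + fps_const (h\<^sup>2) * fps_X =
         fps_const m * P\<^sup>2 + fps_const (h\<^sup>2) * fps_X * (1 - fps_const m * fps_X)"
      by (simp add: R' power2_eq_square algebra_simps)
    also have "1 - fps_const m * fps_X = P" by (simp only: P_def)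
    also have "fps_const m * P\<^sup>2 + fps_const (h\<^sup>2) * fps_X * P = P * (fps_const m * P + fps_const (h\<^sup>2) * fps_X)"
      by (simp add: power2_eq_square algebra_simps)
    finally have "P * (R * fps_deriv (B * C)) = P * (S * (B * C))"
      by (simp add: S' algebra_simps flip: fps_const_mult numeral_fps_const)
    moreover have "P \<noteq> 0" using PP by auto
    ultimately show ?thesis by simp
  qed
  have "f = B * C"
    by (rule fps_linear_ode_unique[OF _ f' g']) (simp_all add: R_def f_def B_def C_def)
  have "(\<Sum>p\<le>i. pc b p * pc b (i - p) * (m + h) ^ p * (m - h) ^ (i - p)) = fps_nth f i"
    unfolding f_def fps_mult_nth atLeast0AtMost by (intro sum.cong) simp_all
  also have "\<dots> = fps_nth (B * C) i" by (simp only: \<open>f = B * C\<close>)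
  also have "\<dots> = (\<Sum>j\<le>i. fps_nth B (i - j) * (\<Sum>n\<le>j. pc b n * fps_nth (Y ^ n) j))"
    unfolding mult.commute[of B] fps_mult_nth[of C B] atLeast0AtMost
    by (intro sum.cong refl) (simp add: C_def fps_compose_nth atLeast0AtMost mult.commute)
  also have "\<dots> = (\<Sum>j\<le>i. fps_nth B (i - j) * (\<Sum>n\<le>i. pc b n * fps_nth (Y ^ n) j))"
  proof (rule sum.cong[OF refl])
    fix j assume j: "j \<in> {..i}"
    have "(\<Sum>n\<le>j. pc b n * fps_nth (Y ^ n) j) = (\<Sum>n\<le>i. pc b n * fps_nth (Y ^ n) j)"
      by (rule sum.mono_neutral_left) (use j Y0 in \<open>auto simp: startsby_zero_power_prefix\<close>)
    thus "fps_nth B (i - j) * (\<Sum>n\<le>j. pc b n * fps_nth (Y ^ n) j) =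
          fps_nth B (i - j) * (\<Sum>n\<le>i. pc b n * fps_nth (Y ^ n) j)" by simp
  qed
  also have "\<dots> = (\<Sum>n\<le>i. pc b n * (\<Sum>j\<le>i. fps_nth (Y ^ n) j * fps_nth B (i - j)))"
    by (subst sum_distrib_left, subst sum.swap) (simp add: sum_distrib_left mult_ac)
  also have "\<dots> = (\<Sum>n\<le>i. pc b n * fps_nth (Y ^ n * B) i)"
    by (simp add: fps_mult_nth atLeast0AtMost)
  also have "\<dots> = (\<Sum>n\<le>i. if 2 * n \<le> i then
      pc b n * pc (2 * b + 2 * real n) (i - 2 * n) * h ^ (2 * n) * m ^ (i - 2 * n) else 0)"
  proof (intro sum.cong refl)
    fix n
    have "Y ^ n * B = fps_const (h ^ (2 * n)) * (fps_X ^ (2 * n) * fps_pc (2 * b + 2 * real n) m)"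
      by (simp add: Y_def B_def power_mult_distrib fps_pc_power fps_pc_mult fps_const_power
          power_mult[symmetric] mult_ac add_ac) 
    thus "pc b n * fps_nth (Y ^ n * B) i = (if 2 * n \<le> i then
      pc b n * pc (2 * b + 2 * real n) (i - 2 * n) * h ^ (2 * n) * m ^ (i - 2 * n) else 0)"
      by (simp add: fps_X_power_mult_nth)
  qed
  also have "\<dots> = (\<Sum>n\<le>i div 2. pc b n * pc (2 * b + 2 * real n) (i - 2 * n) * h ^ (2 * n) * m ^ (i - 2 * n))"
    by (intro sum.mono_neutral_cong_right) auto
  finally show ?thesis .
qed

section \<open>Integration over the sphere\<close>

lemma pos_not_nonpos_Ints: "x > 0 \<Longrightarrow> x \<notin> \<int>\<^sub>\<le>\<^sub>0" for x :: real
  by (auto elim!: nonpos_Ints_cases)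

lemma borel_measurable_sphere_measure [measurable (raw)]:
  "f \<in> borel_measurable borel \<Longrightarrow> f \<in> borel_measurable (sphere_measure :: (real ^ 'n::finite) measure)"
  by (subst measurable_cong_sets[OF sets_sphere_measure refl]) (rule measurable_restrict_space1)

text \<open>The cone measure makes a sphere average an average over the ball of a function of
  \<open>sgn x\<close>. The only point of the ball that \<open>sgn\<close> does not send to the
  sphere is the null point \<open>x = 0\<close>.\<close>

lemma nn_integral_sphere_measure:
  fixes f :: "real ^ 'n::finite \<Rightarrow> ennreal"
  assumes [measurable]: "f \<in> borel_measurable borel"
  shows "(\<integral>\<^sup>+z. f z \<partial>sphere_measure) =
    (\<integral>\<^sup>+x. f (sgn x) * indicator (cball 0 1) x \<partial>lborel) / emeasure lborel (cball (0 :: real ^ 'n) 1)"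
proof -
  let ?S = "sphere (0 :: real ^ 'n) 1"
  have [measurable]: "?S \<in> sets borel" by simp
  have "(\<integral>\<^sup>+z. f z \<partial>sphere_measure) =
      (\<integral>\<^sup>+z. f z * indicator ?S z \<partial>distr (uniform_measure lborel (cball 0 1)) borel sgn)"
    unfolding sphere_measure_def by (subst nn_integral_restrict_space) simp_all
  also have "\<dots> = (\<integral>\<^sup>+x. f (sgn x) * indicator ?S (sgn x) \<partial>uniform_measure lborel (cball 0 1))"
    by (subst nn_integral_distr) simp_all
  also have "\<dots> = (\<integral>\<^sup>+x. f (sgn x) * indicator ?S (sgn x) * indicator (cball 0 1) x \<partial>lborel) /
                  emeasure lborel (cball (0 :: real ^ 'n) 1)"
    by (subst nn_integral_uniform_measure) simp_all
  also have "(\<integral>\<^sup>+x. f (sgn x) * indicator ?S (sgn x) * indicator (cball 0 1) x \<partial>lborel) =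
             (\<integral>\<^sup>+x. f (sgn x) * indicator (cball 0 1) x \<partial>lborel)"
  proof (rule nn_integral_cong_AE)
    have "AE x in lborel. x \<noteq> (0 :: real ^ 'n)" by (rule AE_lborel_singleton)
    thus "AE x in lborel. f (sgn x) * indicator ?S (sgn x) * indicator (cball 0 1) x =
                          f (sgn x) * indicator (cball 0 1) x"
      by eventually_elim (simp add: norm_sgn)
  qed
  finally show ?thesis .
qed

section \<open>Averages of powers of one linear form\<close>

lemma
  assumes p: "p > -1"
  shows nn_integral_powr_gaussian_half_line:
      "2 * (\<integral>\<^sup>+t. ennreal (\<bar>t\<bar> powr p * exp (- t\<^sup>2)) * indicator {0<..} t \<partial>lborel) = ennreal (Gamma ((p + 1) / 2))"
    and nn_integral_abs_powr_gaussian: "(\<integral>\<^sup>+t. ennreal (\<bar>t\<bar> powr p * exp (- t\<^sup>2)) \<partial>lborel) = ennreal (Gamma ((p + 1) / 2))"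
proof -
  let ?q = "(p + 1) / 2"
  have q: "?q > 0" using p by simp
  have img: "power2 ` {0<..} = {0::real<..}"
  proof (intro equalityI subsetI)
    fix x :: real assume "x \<in> {0<..}"
    thus "x \<in> power2 ` {0<..}" by (intro image_eqI[of _ _ "sqrt x"]) auto
  qed auto
  have 1: "((\<lambda>t. t powr (?q - 1) / exp t) has_integral Gamma ?q) {0<..}"
  proof -
    have eq: "(\<lambda>t. if t \<in> {0..} then t powr (?q - 1) / exp t else 0) =
              (\<lambda>t. if t \<in> {0<..} then t powr (?q - 1) / exp t else 0)"
      by (auto simp: fun_eq_iff)
    show ?thesis
      using Gamma_integral_real[OF q]
      unfolding has_integral_restrict_UNIV[of "{0..}", symmetric] has_integral_restrict_UNIV[of "{0<..}", symmetric] eq .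
  qed
  have "(\<lambda>t. t powr (?q - 1) / exp t) absolutely_integrable_on (power2 ` {0<..}) \<and>
        integral (power2 ` {0<..}) (\<lambda>t. t powr (?q - 1) / exp t) = Gamma ?q"
    unfolding img using 1 by (auto simp: has_integral_iff intro!: nonnegative_absolutely_integrable_1)
  hence "(\<lambda>x. \<bar>2 * x\<bar> * (x\<^sup>2 powr (?q - 1) / exp (x\<^sup>2))) absolutely_integrable_on {0<..} \<and>
         integral {0<..} (\<lambda>x. \<bar>2 * x\<bar> * (x\<^sup>2 powr (?q - 1) / exp (x\<^sup>2))) = Gamma ?q"
    by (subst has_absolute_integral_change_of_variables_1')
       (auto intro!: derivative_eq_intros simp: inj_on_def power2_eq_iff)
  hence 2: "((\<lambda>x. \<bar>2 * x\<bar> * (x\<^sup>2 powr (?q - 1) / exp (x\<^sup>2))) has_integral Gamma ?q) {0<..}"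
    by (auto simp: has_integral_iff set_lebesgue_integral_eq_integral)
  have "(\<integral>\<^sup>+x. ennreal (\<bar>2 * x\<bar> * (x\<^sup>2 powr (?q - 1) / exp (x\<^sup>2))) * indicator {0<..} x \<partial>lborel) =
        ennreal (Gamma ?q)"
    by (rule nn_integral_has_integral_lebesgue'[OF _ 2]) auto
  also have "(\<integral>\<^sup>+x. ennreal (\<bar>2 * x\<bar> * (x\<^sup>2 powr (?q - 1) / exp (x\<^sup>2))) * indicator {0<..} x \<partial>lborel) =
     (\<integral>\<^sup>+x. 2 * (ennreal (\<bar>x\<bar> powr p * exp (- x\<^sup>2)) * indicator {0<..} x) \<partial>lborel)"
  proof (intro nn_integral_cong)
    fix x :: real
    show "ennreal (\<bar>2 * x\<bar> * (x\<^sup>2 powr (?q - 1) / exp (x\<^sup>2))) * indicator {0<..} x =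
       2 * (ennreal (\<bar>x\<bar> powr p * exp (- x\<^sup>2)) * indicator {0<..} x)"
    proof (cases "x > 0")
      case True
      have "x\<^sup>2 powr (?q - 1) = x powr (p - 1)"
      proof -
        have "x\<^sup>2 powr (?q - 1) = (x powr 2) powr (?q - 1)" using True by simp
        also have "\<dots> = x powr (2 * (?q - 1))" by (rule powr_powr)
        also have "2 * (?q - 1) = p - 1" by (simp add: field_simps)
        finally show ?thesis .
      qed
      hence "\<bar>2 * x\<bar> * (x\<^sup>2 powr (?q - 1) / exp (x\<^sup>2)) = 2 * (\<bar>x\<bar> powr p * exp (- x\<^sup>2))"
        using True by (simp add: powr_diff exp_minus field_simps)
      thus ?thesis using True by (simp add: ennreal_mult)
    qed auto
  qed
  also have "\<dots> = 2 * (\<integral>\<^sup>+x. ennreal (\<bar>x\<bar> powr p * exp (- x\<^sup>2)) * indicator {0<..} x \<partial>lborel)"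
    by (subst nn_integral_cmult) auto
  finally show 3: "2 * (\<integral>\<^sup>+x. ennreal (\<bar>x\<bar> powr p * exp (- x\<^sup>2)) * indicator {0<..} x \<partial>lborel) =
     ennreal (Gamma ?q)" .
  have "(\<integral>\<^sup>+x. ennreal (\<bar>x\<bar> powr p * exp (- x\<^sup>2)) * indicator {..<0} x \<partial>lborel) =
        (\<integral>\<^sup>+x. ennreal (\<bar>x\<bar> powr p * exp (- x\<^sup>2)) * indicator {0<..} x \<partial>lborel)"
    by (subst nn_integral_real_affine[where t = 0 and c = "-1"])
       (auto intro!: nn_integral_cong simp: indicator_def)
  hence "(\<integral>\<^sup>+x. ennreal (\<bar>x\<bar> powr p * exp (- x\<^sup>2)) * indicator {0<..} x +
             ennreal (\<bar>x\<bar> powr p * exp (- x\<^sup>2)) * indicator {..<0} x \<partial>lborel) = ennreal (Gamma ?q)"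
    by (subst nn_integral_add) (auto simp: mult_2 simp flip: 3)
  also have "(\<integral>\<^sup>+x. ennreal (\<bar>x\<bar> powr p * exp (- x\<^sup>2)) * indicator {0<..} x +
             ennreal (\<bar>x\<bar> powr p * exp (- x\<^sup>2)) * indicator {..<0} x \<partial>lborel) =
     (\<integral>\<^sup>+x. ennreal (\<bar>x\<bar> powr p * exp (- x\<^sup>2)) \<partial>lborel)"
    by (intro nn_integral_cong) (auto simp: indicator_def)
  finally show "(\<integral>\<^sup>+x. ennreal (\<bar>x\<bar> powr p * exp (- x\<^sup>2)) \<partial>lborel) = ennreal (Gamma ?q)" .
qed

lemma nn_integral_cball_homogeneous:
  fixes g :: "'a::euclidean_space \<Rightarrow> real"
  assumes [measurable]: "g \<in> borel_measurable borel"
    and hom: "\<And>c x. c > 0 \<Longrightarrow> g (c *\<^sub>R x) = c powr p * g x" and nonneg: "\<And>x. g x \<ge> 0" and r: "r > 0"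
  shows "(\<integral>\<^sup>+x. ennreal (g x) * indicator (cball 0 r) x \<partial>lborel) =
    ennreal (r powr (p + DIM('a))) * (\<integral>\<^sup>+x. ennreal (g x) * indicator (cball 0 1) x \<partial>lborel)"
proof -
  have [measurable]: "cball (0 :: 'a) r \<in> sets borel" for r by simp
  have "(\<integral>\<^sup>+x. ennreal (g x) * indicator (cball 0 r) x \<partial>lborel) =
     (\<integral>\<^sup>+x. ennreal (r ^ DIM('a)) * (ennreal (g (r *\<^sub>R x)) * indicator (cball 0 r) (r *\<^sub>R x)) \<partial>lborel)"
    using r by (subst lborel_affine[of r 0], simp, subst nn_integral_density)
      (auto simp: nn_integral_distr)
  also have "\<dots> = (\<integral>\<^sup>+x. ennreal (r powr (p + DIM('a))) * (ennreal (g x) * indicator (cball 0 1) x) \<partial>lborel)"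
  proof (intro nn_integral_cong)
    fix x :: 'a
    have "indicator (cball 0 r) (r *\<^sub>R x) = (indicator (cball 0 1) x :: ennreal)"
      using r by (auto simp: indicator_def)
    moreover have "ennreal (r ^ DIM('a)) * ennreal (g (r *\<^sub>R x)) = ennreal (r powr (p + DIM('a))) * ennreal (g x)"
      using r nonneg by (simp add: hom powr_add powr_realpow mult_ac flip: ennreal_mult)
    ultimately show "ennreal (r ^ DIM('a)) * (ennreal (g (r *\<^sub>R x)) * indicator (cball 0 r) (r *\<^sub>R x)) =
      ennreal (r powr (p + DIM('a))) * (ennreal (g x) * indicator (cball 0 1) x)"
      by (metis mult.assoc)
  qed
  also have "\<dots> = ennreal (r powr (p + DIM('a))) * (\<integral>\<^sup>+x. ennreal (g x) * indicator (cball 0 1) x \<partial>lborel)"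
    by (rule nn_integral_cmult) auto
  finally show ?thesis .
qed

text \<open>Write \<open>exp (- (norm x)\<^sup>2)\<close> as an integral over \<open>r\<close> of indicators of \<open>cball 0 r\<close> and rescale each ball.\<close>

lemma nn_integral_homogeneous_gaussian:
  fixes g :: "'a::euclidean_space \<Rightarrow> real"
  assumes [measurable]: "g \<in> borel_measurable borel" and p: "p \<ge> 0"
    and hom: "\<And>c x. c > 0 \<Longrightarrow> g (c *\<^sub>R x) = c powr p * g x" and nonneg: "\<And>x. g x \<ge> 0"
  shows "(\<integral>\<^sup>+x. ennreal (g x * exp (- (norm x)\<^sup>2)) \<partial>lborel) =
    ennreal (Gamma ((p + DIM('a)) / 2 + 1)) * (\<integral>\<^sup>+x. ennreal (g x) * indicator (cball 0 1) x \<partial>lborel)"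
proof -
  have [measurable]: "cball (0 :: 'a) r \<in> sets borel" for r by simp
  let ?C = "\<integral>\<^sup>+x. ennreal (g x) * indicator (cball 0 1) x \<partial>lborel"
  have cake: "ennreal (exp (- (norm x)\<^sup>2)) =
     (\<integral>\<^sup>+r. ennreal (2 * r * exp (- r\<^sup>2)) * indicator {norm x..} r \<partial>lborel)" for x :: 'a
  proof -
    have "(\<integral>\<^sup>+r. ennreal (2 * r * exp (- r\<^sup>2)) * indicator {norm x..} r \<partial>lborel) = ennreal (0 - (- exp (- (norm x)\<^sup>2)))"
    proof (rule nn_integral_FTC_atLeast)
      fix r assume "norm x \<le> r"
      show "((\<lambda>r. - exp (- r\<^sup>2)) has_real_derivative 2 * r * exp (- r\<^sup>2)) (at r)"
        by (auto intro!: derivative_eq_intros)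
      show "0 \<le> 2 * r * exp (- r\<^sup>2)" using \<open>norm x \<le> r\<close> norm_ge_zero[of x] by (simp del: norm_ge_zero)
    next
      have "((\<lambda>r::real. - exp (- r\<^sup>2)) \<longlongrightarrow> -0) at_top" by real_asymp
      thus "((\<lambda>r::real. - exp (- r\<^sup>2)) \<longlongrightarrow> 0) at_top" by simp
    qed auto
    thus ?thesis by simp
  qed
  have "(\<integral>\<^sup>+x. ennreal (g x * exp (- (norm x)\<^sup>2)) \<partial>lborel) =
     (\<integral>\<^sup>+x. (\<integral>\<^sup>+r. ennreal (g x) * (ennreal (2 * r * exp (- r\<^sup>2)) * indicator {norm x..} r) \<partial>lborel) \<partial>lborel)"
    using nonneg by (subst nn_integral_cmult) (auto simp: ennreal_mult cake)
  also have "\<dots> = (\<integral>\<^sup>+x. (\<integral>\<^sup>+r. ennreal (g x) * (ennreal (2 * r * exp (- r\<^sup>2)) * (if norm x \<le> r then 1 else 0)) \<partial>lborel) \<partial>lborel)"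
    by (intro nn_integral_cong) (auto simp: indicator_def)
  also have "\<dots> = (\<integral>\<^sup>+r. (\<integral>\<^sup>+x. ennreal (g x) * (ennreal (2 * r * exp (- r\<^sup>2)) * (if norm x \<le> r then 1 else 0)) \<partial>lborel) \<partial>lborel)"
    by (rule lborel_pair.Fubini') measurable
  also have "\<dots> = (\<integral>\<^sup>+r. ?C * (2 * (ennreal (\<bar>r\<bar> powr (p + DIM('a) + 1) * exp (- r\<^sup>2)) * indicator {0<..} r)) \<partial>lborel)"
  proof (intro nn_integral_cong_AE)
    have "AE r in lborel. r \<noteq> (0::real)" by (rule AE_lborel_singleton)
    thus "AE r in lborel. (\<integral>\<^sup>+x. ennreal (g x) * (ennreal (2 * r * exp (- r\<^sup>2)) * (if norm x \<le> r then 1 else 0)) \<partial>lborel) =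
       ?C * (2 * (ennreal (\<bar>r\<bar> powr (p + DIM('a) + 1) * exp (- r\<^sup>2)) * indicator {0<..} r))"
    proof eventually_elim
      case (elim r)
      show ?case
      proof (cases "r > 0")
        case True
        have "(\<integral>\<^sup>+x. ennreal (g x) * (ennreal (2 * r * exp (- r\<^sup>2)) * (if norm x \<le> r then 1 else 0)) \<partial>lborel) =
          (\<integral>\<^sup>+x. ennreal (2 * r * exp (- r\<^sup>2)) * (ennreal (g x) * indicator (cball 0 r) x) \<partial>lborel)"
          by (intro nn_integral_cong) (auto simp: indicator_def mult_ac)
        also have "\<dots> = ennreal (2 * r * exp (- r\<^sup>2)) * (\<integral>\<^sup>+x. ennreal (g x) * indicator (cball 0 r) x \<partial>lborel)"
          by (rule nn_integral_cmult) measurable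
        also have "\<dots> = ennreal (2 * r * exp (- r\<^sup>2)) * (ennreal (r powr (p + DIM('a))) * ?C)"
          by (subst nn_integral_cball_homogeneous[OF _ hom nonneg True]) auto
        also have "\<dots> = ?C * ennreal (2 * (\<bar>r\<bar> powr (p + DIM('a) + 1) * exp (- r\<^sup>2)))"
          using True by (simp add: powr_add mult_ac flip: ennreal_mult)
             (simp add: ennreal_mult mult_ac)
        finally show ?thesis using True by (simp add: ennreal_mult)
      next
        case False
        hence "r < 0" using elim by simp
        thus ?thesis by (auto simp: not_le[symmetric] intro!: nn_integral_0_iff_AE[THEN iffD2] AE_I2
             dest: order_trans[OF norm_ge_zero])
      qed
    qed
  qed
  also have "\<dots> = ?C * (2 * (\<integral>\<^sup>+r. ennreal (\<bar>r\<bar> powr (p + DIM('a) + 1) * exp (- r\<^sup>2)) * indicator {0<..} r \<partial>lborel))"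
    by (subst nn_integral_cmult, simp)+ simp
  also have "2 * (\<integral>\<^sup>+r. ennreal (\<bar>r\<bar> powr (p + DIM('a) + 1) * exp (- r\<^sup>2)) * indicator {0<..} r \<partial>lborel) =
     ennreal (Gamma ((p + DIM('a)) / 2 + 1))"
    using nn_integral_powr_gaussian_half_line[of "p + DIM('a) + 1"] p
    by (simp add: add_divide_distrib add_ac) 
  finally show ?thesis by (simp add: mult.commute)
qed

text \<open>A substitute for polar coordinates. One has
  \<open>g (sgn x) = norm x powr (- p) * g x\<close>, and on the unit ball
  \<open>norm x powr (- p) - 1\<close> is the integral of \<open>p * r powr (- p - 1)\<close> over
  \<open>[norm x, 1]\<close>. After exchanging the integrals, the homogeneity of \<open>g\<close>
  turns the integral over each ball of radius \<open>r\<close> into a multiple of the one over the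
  unit ball.\<close>

lemma nn_integral_cball_homogeneous_sgn:
  fixes g :: "'a::euclidean_space \<Rightarrow> real"
  assumes [measurable]: "g \<in> borel_measurable borel" and p: "p > 0"
    and hom: "\<And>c x. c > 0 \<Longrightarrow> g (c *\<^sub>R x) = c powr p * g x" and nonneg: "\<And>x. g x \<ge> 0"
  shows "(\<integral>\<^sup>+x. ennreal (g (sgn x)) * indicator (cball 0 1) x \<partial>lborel) =
    ennreal (1 + p / DIM('a)) * (\<integral>\<^sup>+x. ennreal (g x) * indicator (cball 0 1) x \<partial>lborel)"
proof -
  have [measurable]: "cball (0 :: 'a) r \<in> sets borel" for r by simp
  let ?C = "\<integral>\<^sup>+x. ennreal (g x) * indicator (cball 0 1) x \<partial>lborel"
  let ?h = "\<lambda>x r. ennreal (g x) * (ennreal (p * r powr (- p - 1)) * (if norm x \<le> r \<and> 0 < r \<and> r \<le> 1 then 1 else 0))"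
  have sgn: "ennreal (g (sgn x)) * indicator (cball 0 1) x =
      ennreal (g x) * indicator (cball 0 1) x + (\<integral>\<^sup>+r. ?h x r \<partial>lborel)" if "x \<noteq> 0" for x
  proof (cases "norm x \<le> 1")
    case True
    have "(\<integral>\<^sup>+r. ennreal (p * r powr (- p - 1)) * (if norm x \<le> r \<and> 0 < r \<and> r \<le> 1 then 1 else 0) \<partial>lborel) =
        (\<integral>\<^sup>+r. ennreal (p * r powr (- p - 1)) * indicator {norm x..1} r \<partial>lborel)"
      using that by (intro nn_integral_cong) (auto simp: indicator_def intro: less_le_trans[of _ "norm x"])
    also have "\<dots> = ennreal (- (1 powr (- p)) - (- (norm x powr (- p))))"
    proof (rule nn_integral_FTC_Icc)
      fix r assume "r \<in> {norm x..1}"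
      hence "r > 0" using that by (auto intro: less_le_trans[of _ "norm x"])
      thus "((\<lambda>r. - (r powr (- p))) has_real_derivative p * r powr (- p - 1)) (at r)"
        by (auto intro!: derivative_eq_intros simp: powr_diff)
    qed (use True p in auto)
    finally have *: "(\<integral>\<^sup>+r. ?h x r \<partial>lborel) = ennreal (g x) * ennreal (norm x powr (- p) - 1)"
      by (subst nn_integral_cmult) auto
    have "norm x powr p \<le> 1" using True p by (intro powr_le1) auto
    hence "norm x powr (- p) \<ge> 1" using that by (simp add: powr_minus one_le_inverse)
    hence "ennreal (g x) + ennreal (g x) * ennreal (norm x powr (- p) - 1) = ennreal (norm x powr (- p) * g x)"
    proof -
      assume *: "1 \<le> norm x powr (- p)"
      have "ennreal (g x) + ennreal (g x) * ennreal (norm x powr (- p) - 1) =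
            ennreal (g x + g x * (norm x powr (- p) - 1))"
        using nonneg[of x] * by (simp add: ennreal_mult ennreal_plus)
      thus ?thesis by (simp add: algebra_simps)
    qed
    also have "norm x powr (- p) * g x = g (sgn x)"
      using hom[of "inverse (norm x)" x] that by (simp add: sgn_div_norm inverse_powr powr_minus)
    finally show ?thesis using True by (simp add: *)
  next
    case False
    have "?h x = (\<lambda>_. 0)" using False by (auto simp: fun_eq_iff)
    thus ?thesis using False by (simp only: nn_integral_const) simp
  qed
  have "(\<integral>\<^sup>+x. ennreal (g (sgn x)) * indicator (cball 0 1) x \<partial>lborel) =
    (\<integral>\<^sup>+x. ennreal (g x) * indicator (cball 0 1) x + (\<integral>\<^sup>+r. ?h x r \<partial>lborel) \<partial>lborel)"
  proof (rule nn_integral_cong_AE)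
    have "AE x in lborel. x \<noteq> (0 :: 'a)" by (rule AE_lborel_singleton)
    thus "AE x in lborel. ennreal (g (sgn x)) * indicator (cball 0 1) x =
      ennreal (g x) * indicator (cball 0 1) x + (\<integral>\<^sup>+r. ?h x r \<partial>lborel)"
      by eventually_elim (rule sgn)
  qed
  also have "\<dots> = ?C + (\<integral>\<^sup>+x. (\<integral>\<^sup>+r. ?h x r \<partial>lborel) \<partial>lborel)"
    by (rule nn_integral_add) measurable
  also have "(\<integral>\<^sup>+x. (\<integral>\<^sup>+r. ?h x r \<partial>lborel) \<partial>lborel) = (\<integral>\<^sup>+r. (\<integral>\<^sup>+x. ?h x r \<partial>lborel) \<partial>lborel)"
    by (rule lborel_pair.Fubini') measurable
  also have "\<dots> = (\<integral>\<^sup>+r. ?C * (ennreal (p * r ^ (DIM('a) - 1)) * indicator {0..1} r) \<partial>lborel)"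
  proof (intro nn_integral_cong_AE)
    have "AE r in lborel. r \<noteq> (0::real)" by (rule AE_lborel_singleton)
    thus "AE r in lborel. (\<integral>\<^sup>+x. ?h x r \<partial>lborel) = ?C * (ennreal (p * r ^ (DIM('a) - 1)) * indicator {0..1} r)"
    proof eventually_elim
      case (elim r)
      show ?case
      proof (cases "r > 0 \<and> r \<le> 1")
        case True
        have "(\<integral>\<^sup>+x. ?h x r \<partial>lborel) =
          (\<integral>\<^sup>+x. ennreal (p * r powr (- p - 1)) * (ennreal (g x) * indicator (cball 0 r) x) \<partial>lborel)"
          using True by (intro nn_integral_cong) (auto simp: indicator_def mult_ac)
        also have "\<dots> = ennreal (p * r powr (- p - 1)) * (\<integral>\<^sup>+x. ennreal (g x) * indicator (cball 0 r) x \<partial>lborel)"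
          by (rule nn_integral_cmult) measurable
        also have "\<dots> = ennreal (p * r powr (- p - 1)) * (ennreal (r powr (p + DIM('a))) * ?C)"
          using True by (subst nn_integral_cball_homogeneous[OF _ hom nonneg]) auto
        also have "\<dots> = ?C * ennreal (p * (r powr (- p - 1) * r powr (p + DIM('a))))"
          using p by (simp add: mult_ac ennreal_mult)
        also have "r powr (- p - 1) * r powr (p + DIM('a)) = r powr real (DIM('a) - 1)"
          by (simp add: of_nat_diff flip: powr_add)
        also have "\<dots> = r ^ (DIM('a) - 1)" using True by (intro powr_realpow) auto
        finally show ?thesis using True by simp
      next
        case False
        hence "?h x r = 0" for x by auto
        thus ?thesis using False elim by (auto simp: indicator_def)
      qed
    qed
  qed
  also have "\<dots> = ?C * (\<integral>\<^sup>+r. ennreal (p * r ^ (DIM('a) - 1)) * indicator {0..1} r \<partial>lborel)"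
    by (rule nn_integral_cmult) measurable
  also have "(\<integral>\<^sup>+r. ennreal (p * r ^ (DIM('a) - 1)) * indicator {0..1} r \<partial>lborel) =
     ennreal (p / DIM('a) * 1 ^ DIM('a) - p / DIM('a) * 0 ^ DIM('a))"
  proof (rule nn_integral_FTC_Icc)
    fix r :: real
    show "((\<lambda>r. p / DIM('a) * r ^ DIM('a)) has_real_derivative p * r ^ (DIM('a) - 1)) (at r)"
      by (auto intro!: derivative_eq_intros)
  qed (use p in auto)
  also have "?C + ?C * \<dots> = ennreal (1 + p / DIM('a)) * ?C"
    using p by (simp add: distrib_right mult.commute ennreal_plus zero_power)
  finally show ?thesis .
qed

lemma nn_integral_axis_powr_gaussian:
  fixes i :: "'a::euclidean_space"
  assumes p: "p \<ge> 0" and i: "i \<in> Basis"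
  shows "(\<integral>\<^sup>+x. ennreal (\<bar>x \<bullet> i\<bar> powr p * exp (- (norm x)\<^sup>2)) \<partial>lborel) =
    ennreal (Gamma ((p + 1) / 2) * sqrt pi ^ (DIM('a) - 1))"
proof -
  define f where "f b t = (if b = i then \<bar>t\<bar> powr p * exp (- t\<^sup>2) else exp (- t\<^sup>2))" for b :: 'a and t :: real
  have f0: "f b t \<ge> 0" for b t by (simp add: f_def)
  have [measurable]: "f b \<in> borel_measurable borel" for b by (cases "b = i") (simp_all add: f_def[abs_def])
  have "\<bar>x \<bullet> i\<bar> powr p * exp (- (norm x)\<^sup>2) = (\<Prod>b\<in>Basis. f b (x \<bullet> b))" for x :: 'a
  proof -
    have "(norm x)\<^sup>2 = (\<Sum>b\<in>Basis. (x \<bullet> b)\<^sup>2)"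
      unfolding power2_norm_eq_inner using euclidean_inner[of x x] by (simp add: power2_eq_square)
    hence "exp (- (norm x)\<^sup>2) = (\<Prod>b\<in>Basis. exp (- (x \<bullet> b)\<^sup>2))"
      by (simp only: sum_negf[symmetric] exp_sum finite_Basis)
    thus ?thesis using i by (simp add: f_def prod.remove mult_ac)
  qed
  hence "(\<integral>\<^sup>+x. ennreal (\<bar>x \<bullet> i\<bar> powr p * exp (- (norm x)\<^sup>2)) \<partial>lborel) =
         (\<integral>\<^sup>+x. (\<Prod>b\<in>Basis. ennreal (f b ((x::'a) \<bullet> b))) \<partial>lborel)"
    using f0 by (simp add: prod_ennreal)
  also have "\<dots> = (\<Prod>b\<in>(Basis :: 'a set). \<integral>\<^sup>+t. ennreal (f b t) \<partial>lborel)"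
    by (rule nn_integral_lborel_prod) auto
  also have "\<dots> = (\<integral>\<^sup>+t. ennreal (f i t) \<partial>lborel) * (\<Prod>b\<in>Basis - {i}. \<integral>\<^sup>+t. ennreal (f b t) \<partial>lborel)"
    using i by (intro prod.remove) auto
  also have "(\<integral>\<^sup>+t. ennreal (f i t) \<partial>lborel) = ennreal (Gamma ((p + 1) / 2))"
    using nn_integral_abs_powr_gaussian[of p] p by (simp add: f_def)
  also have "(\<Prod>b\<in>Basis - {i}. \<integral>\<^sup>+t. ennreal (f b t) \<partial>lborel) = (\<Prod>b\<in>Basis - {i}. ennreal (sqrt pi))"
  proof (rule prod.cong)
    fix b assume b: "b \<in> Basis - {i}"
    have "(\<integral>\<^sup>+t. ennreal (f b t) \<partial>lborel) = (\<integral>\<^sup>+t. ennreal (\<bar>t\<bar> powr 0 * exp (- t\<^sup>2)) \<partial>lborel)"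
    \<comment> \<open>Only almost everywhere: \<open>0 powr 0 = 0\<close>, so the two integrands
      differ at \<open>t = 0\<close>.\<close>
    proof (intro nn_integral_cong_AE)
      have "AE t in lborel. t \<noteq> (0::real)" by (rule AE_lborel_singleton)
      thus "AE t in lborel. ennreal (f b t) = ennreal (\<bar>t\<bar> powr 0 * exp (- t\<^sup>2))"
        by eventually_elim (use b in \<open>simp add: f_def\<close>)
    qed
    also have "\<dots> = ennreal (sqrt pi)"
      using nn_integral_abs_powr_gaussian[of 0] by (simp add: Gamma_one_half_real)
    finally show "(\<integral>\<^sup>+t. ennreal (f b t) \<partial>lborel) = ennreal (sqrt pi)" .
  qed simp
  also have "\<dots> = ennreal (sqrt pi ^ (DIM('a) - 1))"
    using i by (simp add: ennreal_power card_Diff_singleton)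
  finally show ?thesis using p by (simp add: ennreal_mult Gamma_real_nonneg)
qed

text \<open>The Gaussian integral of \<open>\<bar>x \<bullet> i\<bar> powr p\<close> factors over
  the coordinates. Homogeneity converts it into the integral \<open>?C\<close> over the unit ball,
  and that into the average over the sphere; the Gamma factors come from these two conversions and
  from the volume of the ball.\<close>

lemma nn_integral_sphere_axis_powr:
  fixes i :: "real ^ 'n::finite" and p :: real
  assumes p: "p > 0" and i: "i \<in> Basis"
  shows "(\<integral>\<^sup>+z. ennreal (\<bar>z \<bullet> i\<bar> powr p) \<partial>sphere_measure) =
    ennreal (Gamma ((p + 1) / 2) * Gamma (CARD('n) / 2) / (sqrt pi * Gamma ((p + CARD('n)) / 2)))"
proof -
  let ?N = "real CARD('n)"
  let ?C = "\<integral>\<^sup>+x. ennreal (\<bar>x \<bullet> i\<bar> powr p) * indicator (cball 0 1) x \<partial>lborel"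
  have N: "?N \<ge> 1" using one_le_card_finite[where 'a='n] by simp
  have hom: "\<bar>(c *\<^sub>R x) \<bullet> i\<bar> powr p = c powr p * \<bar>x \<bullet> i\<bar> powr p" if "c > 0" for c x
    using that by (simp add: abs_mult powr_mult)
  have G: "ennreal (Gamma ((p + 1) / 2) * sqrt pi ^ (CARD('n) - 1)) = ennreal (Gamma ((p + ?N) / 2 + 1)) * ?C"
    using nn_integral_axis_powr_gaussian[OF less_imp_le[OF p] i]
      nn_integral_homogeneous_gaussian[of "\<lambda>x. \<bar>x \<bullet> i\<bar> powr p" p, OF _ _ hom] p by simp
  have G0: "Gamma ((p + ?N) / 2 + 1) > 0" using p N by (intro Gamma_real_pos) (auto intro: add_pos_pos)
  have C: "?C = ennreal (Gamma ((p + 1) / 2) * sqrt pi ^ (CARD('n) - 1) / Gamma ((p + ?N) / 2 + 1))"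
  proof -
    let ?G = "Gamma ((p + ?N) / 2 + 1)"
    have inv: "ennreal (inverse ?G) * ennreal ?G = 1"
      using G0 by (simp flip: ennreal_mult)
    have "?C = ennreal (inverse ?G) * ennreal ?G * ?C" by (simp only: inv mult_1)
    also have "\<dots> = ennreal (inverse ?G) * ennreal (Gamma ((p + 1) / 2) * sqrt pi ^ (CARD('n) - 1))"
      by (simp only: mult.assoc G)
    also have "\<dots> = ennreal (inverse ?G * (Gamma ((p + 1) / 2) * sqrt pi ^ (CARD('n) - 1)))"
      using G0 p by (intro ennreal_mult[symmetric]) (auto simp: Gamma_real_nonneg)
    also have "inverse ?G * (Gamma ((p + 1) / 2) * sqrt pi ^ (CARD('n) - 1)) =
       Gamma ((p + 1) / 2) * sqrt pi ^ (CARD('n) - 1) / ?G"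
      by (simp only: divide_inverse mult.commute)
    finally show ?thesis .
  qed
  have vol: "emeasure lborel (cball (0 :: real ^ 'n) 1) = ennreal (sqrt pi ^ CARD('n) / Gamma (?N / 2 + 1))"
    by (simp add: emeasure_cball unit_ball_vol_def powr_half_sqrt[symmetric] powr_powr flip: powr_realpow)
  have "(\<integral>\<^sup>+z. ennreal (\<bar>z \<bullet> i\<bar> powr p) \<partial>sphere_measure) = ennreal (1 + p / ?N) * ?C /
      emeasure lborel (cball (0 :: real ^ 'n) 1)"
    using nn_integral_cball_homogeneous_sgn[of "\<lambda>x. \<bar>x \<bullet> i\<bar> powr p" p, OF _ p hom]
    by (simp add: nn_integral_sphere_measure)
  also have "\<dots> = ennreal ((1 + p / ?N) * (Gamma ((p + 1) / 2) * sqrt pi ^ (CARD('n) - 1) / Gamma ((p + ?N) / 2 + 1)) /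
       (sqrt pi ^ CARD('n) / Gamma (?N / 2 + 1)))"
  proof -
    have *: "ennreal a * ennreal b / ennreal c = ennreal (a * b / c)" if "a \<ge> 0" "b \<ge> 0" "c > 0" for a b c
      using that by (simp add: divide_ennreal flip: ennreal_mult)
    have "sqrt pi ^ CARD('n) / Gamma (?N / 2 + 1) > 0" using N by (auto intro!: divide_pos_pos Gamma_real_pos)
    moreover have "Gamma ((p + 1) / 2) * sqrt pi ^ (CARD('n) - 1) / Gamma ((p + ?N) / 2 + 1) \<ge> 0"
      using G0 p by (auto intro!: divide_nonneg_pos mult_nonneg_nonneg simp: Gamma_real_nonneg)
    ultimately show ?thesis
      unfolding C vol using p by (intro *) auto
  qed
  also have "(1 + p / ?N) * (Gamma ((p + 1) / 2) * sqrt pi ^ (CARD('n) - 1) / Gamma ((p + ?N) / 2 + 1)) /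
       (sqrt pi ^ CARD('n) / Gamma (?N / 2 + 1)) =
     Gamma ((p + 1) / 2) * Gamma (?N / 2) / (sqrt pi * Gamma ((p + ?N) / 2))"
  proof -
    have 1: "Gamma ((p + ?N) / 2 + 1) = (p + ?N) / 2 * Gamma ((p + ?N) / 2)" "Gamma (?N / 2 + 1) = ?N / 2 * Gamma (?N / 2)"
      by (rule Gamma_plus1[OF pos_not_nonpos_Ints], use p N in simp)+
    have 2: "sqrt pi ^ CARD('n) = sqrt pi * sqrt pi ^ (CARD('n) - 1)"
      by (metis power_minus_mult zero_less_card_finite mult.commute)
    have 3: "Gamma ((p + ?N) / 2) > 0" "Gamma (?N / 2) > 0" using p N by (auto intro!: Gamma_real_pos)
    have 4: "1 + p / ?N = (p + ?N) / ?N" "p + ?N > 0" "sqrt pi ^ (CARD('n) - 1) > 0" using p N by (auto simp: field_simps)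
    have 5: "(t / n) * (g1 * w / (t / 2 * g3)) / (q * w / (n / 2 * g4)) = g1 * g4 / (q * g3)"
      if "t > 0" "n > 0" "w > 0" "g3 > 0" "q > 0" for t n w g1 g3 g4 q :: real
      using that by (simp add: field_simps)
    show ?thesis unfolding 1 2 4(1) by (rule 5) (use 3 4 N in auto)
  qed
  finally show ?thesis .
qed

section \<open>Rotation invariance of sphere averages\<close>

lemma distr_sphere_measure:
  fixes T :: "real ^ 'n::{finite, wellorder} \<Rightarrow> real ^ 'n::_"
  assumes T: "orthogonal_transformation T"
  shows "distr sphere_measure sphere_measure T = sphere_measure"
proof -
  obtain T' where T': "orthogonal_transformation T'" "\<And>v. T' (T v) = v" "\<And>v. T (T' v) = v"
    using T orthogonal_transformation_bij orthogonal_transformation_inv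
    by (metis bij_inv_eq_iff)
  have nrm: "norm (T v) = norm v" "norm (T' v) = norm v" for v
    using T T' by (auto simp: orthogonal_transformation)
  have "T \<in> borel \<rightarrow>\<^sub>M borel"
    using T by (intro borel_measurable_continuous_onI linear_continuous_on linear_conv_bounded_linear[THEN iffD1])
               (simp add: orthogonal_transformation)
  hence "T \<in> sphere_measure \<rightarrow>\<^sub>M restrict_space borel (sphere 0 1)"
    by (intro measurable_restrict_space2 borel_measurable_sphere_measure) (auto simp: nrm)
  hence m: "T \<in> sphere_measure \<rightarrow>\<^sub>M sphere_measure"
    by (subst measurable_cong_sets[OF refl sets_sphere_measure])
  show ?thesis
  proof (rule measure_eqI)
    fix A :: "(real ^ 'n::_) set" assume "A \<in> sets (distr sphere_measure sphere_measure T)"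
    hence A: "A \<in> sets sphere_measure" by simp
    have "A \<subseteq> sphere 0 1" using sets.sets_into_space[OF A] by simp
    hence "T -` A \<inter> space sphere_measure = T' ` A"
      using T' nrm by (auto simp: image_iff) metis
    with m A show "emeasure (distr sphere_measure sphere_measure T) A = emeasure sphere_measure A"
      by (simp add: emeasure_distr sphere_measure_rotation_invariant[OF T'(1)])
  qed simp
qed

lemma
  fixes T :: "real ^ 'n::{finite, wellorder} \<Rightarrow> real ^ 'n::_" and f :: "real ^ 'n::_ \<Rightarrow> real"
  assumes T: "orthogonal_transformation T" and f: "f \<in> borel_measurable borel"
  shows integral_sphere_rotate: "(LINT z|sphere_measure. f (T z)) = (LINT z|sphere_measure. f z)"
    and integrable_sphere_rotate:
      "integrable sphere_measure (\<lambda>z. f (T z)) \<longleftrightarrow> integrable sphere_measure f"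
proof -
  have nrm: "norm (T v) = norm v" for v
    using T by (auto simp: orthogonal_transformation)
  have "T \<in> borel \<rightarrow>\<^sub>M borel"
    using T by (intro borel_measurable_continuous_onI linear_continuous_on linear_conv_bounded_linear[THEN iffD1])
               (simp add: orthogonal_transformation)
  hence "T \<in> sphere_measure \<rightarrow>\<^sub>M restrict_space borel (sphere 0 1)"
    by (intro measurable_restrict_space2 borel_measurable_sphere_measure) (auto simp: nrm)
  hence m: "T \<in> sphere_measure \<rightarrow>\<^sub>M sphere_measure"
    by (subst measurable_cong_sets[OF refl sets_sphere_measure])
  have "(LINT z|sphere_measure. f z) = (LINT z|distr sphere_measure sphere_measure T. f z)"
    by (simp only: distr_sphere_measure[OF T])
  also have "\<dots> = (LINT z|sphere_measure. f (T z))"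
    by (rule integral_distr[OF m borel_measurable_sphere_measure[OF f]])
  finally show "(LINT z|sphere_measure. f (T z)) = (LINT z|sphere_measure. f z)" by simp
  have "integrable sphere_measure f \<longleftrightarrow> integrable (distr sphere_measure sphere_measure T) f"
    by (simp only: distr_sphere_measure[OF T])
  also have "\<dots> \<longleftrightarrow> integrable sphere_measure (\<lambda>z. f (T z))"
    by (rule integrable_distr_eq[OF m borel_measurable_sphere_measure[OF f]])
  finally show "integrable sphere_measure (\<lambda>z. f (T z)) \<longleftrightarrow> integrable sphere_measure f" by simp
qed

lemma integral_sphere_uminus:
  fixes f :: "real ^ 'n::{finite, wellorder} \<Rightarrow> real"
  assumes "f \<in> borel_measurable borel"
  shows "(LINT z|sphere_measure. f (- z)) = (LINT z|sphere_measure. f z)"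
  by (rule integral_sphere_rotate[OF _ assms]) (simp add: orthogonal_transformation_def linear_iff)

text \<open>For \<open>p > 0\<close> this is the average of
  \<open>\<bar>v \<bullet> z\<bar> powr p\<close> over the unit sphere in dimension
  \<open>N\<close>, for a unit vector \<open>v\<close>.\<close>

definition sphere_abs_moment :: "nat \<Rightarrow> real \<Rightarrow> real" where
  "sphere_abs_moment N p =
     Gamma ((p + 1) / 2) * Gamma (N / 2) / (sqrt pi * Gamma ((p + N) / 2))"

lemma integral_sphere_abs_powr:
  fixes v :: "real ^ 'n::{finite, wellorder}"
  assumes p: "p > 0"
  shows "(LINT z|sphere_measure. \<bar>v \<bullet> z\<bar> powr p) = norm v powr p * sphere_abs_moment CARD('n) p"
proof -
  obtain i :: "real ^ 'n::_" where i: "i \<in> Basis" using nonempty_Basis by blast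
  have axis: "(LINT z|sphere_measure. \<bar>z \<bullet> i\<bar> powr p) = sphere_abs_moment CARD('n) p"
    using nn_integral_sphere_axis_powr[OF p i] p
    by (intro integral_eq_nn_integral[THEN trans])
       (auto simp: sphere_abs_moment_def intro!: enn2real_ennreal divide_nonneg_nonneg mult_nonneg_nonneg Gamma_real_nonneg)
  show ?thesis
  proof (cases "v = 0")
    case False
    have "norm (v /\<^sub>R norm v) = 1" "norm i = 1" using False i by auto
    then obtain T where T: "orthogonal_transformation T" "T (v /\<^sub>R norm v) = i"
      using orthogonal_transformation_exists_1 by metis
    have "\<bar>v \<bullet> z\<bar> powr p = norm v powr p * \<bar>T z \<bullet> i\<bar> powr p" for z
    proof -
      have "v \<bullet> z = norm v * ((v /\<^sub>R norm v) \<bullet> z)" using False by simp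
      also have "(v /\<^sub>R norm v) \<bullet> z = T z \<bullet> i"
        using T by (metis inner_commute orthogonal_transformation_def)
      finally show ?thesis by (simp add: abs_mult powr_mult)
    qed
    hence "(LINT z|sphere_measure. \<bar>v \<bullet> z\<bar> powr p) = norm v powr p * (LINT z|sphere_measure. \<bar>T z \<bullet> i\<bar> powr p)"
      by simp
    also have "(LINT z|sphere_measure. \<bar>T z \<bullet> i\<bar> powr p) = (LINT z|sphere_measure. \<bar>z \<bullet> i\<bar> powr p)"
      by (rule integral_sphere_rotate[OF T(1)]) simp
    finally show ?thesis by (simp add: axis)
  qed simp
qed

lemma integrable_sphere_continuous:
  fixes f :: "real ^ 'n::finite \<Rightarrow> real"
  assumes "f \<in> borel_measurable borel" "\<And>z. norm z = 1 \<Longrightarrow> \<bar>f z\<bar> \<le> B"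
  shows "integrable sphere_measure f"
proof -
  interpret prob_space "sphere_measure :: (real ^ 'n) measure" by (rule prob_space_sphere_measure)
  show ?thesis
    by (rule integrable_const_bound[where B = B]) (use assms in \<open>auto intro!: AE_I2\<close>)
qed

lemma integral_sphere_const [simp]: "(LINT z|(sphere_measure :: (real ^ 'n::finite) measure). c) = (c :: real)"
proof -
  interpret prob_space "sphere_measure :: (real ^ 'n) measure" by (rule prob_space_sphere_measure)
  show ?thesis using prob_space by simp
qed

lemma integral_sphere_even_power:
  fixes v :: "real ^ 'n::{finite, wellorder}"
  shows "(LINT z|sphere_measure. (v \<bullet> z) ^ (2 * l)) =
    (norm v) ^ (2 * l) * (pochhammer (1 / 2) l / pochhammer (CARD('n) / 2) l)"
\<comment> \<open>The formula for real exponents requires \<open>p > 0\<close>, and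
  \<open>0 powr 0 = 0\<close> differs from \<open>0 ^ 0\<close>; so the zeroth power is treated
  apart.\<close>
proof (cases "l = 0")
  case False
  let ?N = "real CARD('n)"
  have N: "?N \<ge> 1" using one_le_card_finite[where 'a='n] by simp
  have nz: "\<bar>t\<bar> powr real (2 * l) = t ^ (2 * l)" for t :: real
  proof (cases "t = 0")
    case False
    hence "\<bar>t\<bar> powr real (2 * l) = \<bar>t\<bar> ^ (2 * l)" by (intro powr_realpow) auto
    thus ?thesis using power_even_abs[of "2 * l" t] by simp
  qed (use \<open>l \<noteq> 0\<close> in simp)
  have nz': "norm v powr real (2 * l) = norm v ^ (2 * l)" using nz[of "norm v"] by simp
  have "(LINT z|sphere_measure. (v \<bullet> z) ^ (2 * l)) = norm v ^ (2 * l) * sphere_abs_moment CARD('n) (2 * l)"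
    using integral_sphere_abs_powr[of "real (2 * l)" v] False by (simp only: nz nz')
  also have "sphere_abs_moment CARD('n) (2 * l) = pochhammer (1 / 2) l / pochhammer (?N / 2) l"
  proof -
    have "pochhammer (1 / 2) l = Gamma (1 / 2 + real l) / Gamma (1 / 2)"
      by (rule pochhammer_Gamma) (rule pos_not_nonpos_Ints, simp)
    moreover have "pochhammer (?N / 2) l = Gamma (?N / 2 + real l) / Gamma (?N / 2)"
      by (rule pochhammer_Gamma) (rule pos_not_nonpos_Ints, use N in simp)
    moreover have e: "(real (2 * l) + 1) / 2 = 1 / 2 + real l" "(real (2 * l) + ?N) / 2 = ?N / 2 + real l"
      by (simp_all add: field_simps)
    ultimately show ?thesis unfolding sphere_abs_moment_def e by (simp add: Gamma_one_half_real)
  qed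
  finally show ?thesis .
qed (use integral_sphere_const[of 1] in simp)

section \<open>Mixed moments of two linear forms\<close>

lemma fact_double_pochhammer: "fact (2 * n) = (4 ^ n * pochhammer (1 / 2) n * fact n :: real)"
proof -
  have "(2::real) ^ (2 * n) = 4 ^ n" by (simp add: power_mult)
  thus ?thesis unfolding fact_double by simp
qed

text \<open>Here \<open>n\<close> is the number of factors that contribute the linear term
  \<open>B\<close>; the parity and range conditions say that the rest of the degree is made up of
  whole factors of degree 2 and 0. It will be applied to the square of \<open>norm (r x + y)\<close>
  as a polynomial in \<open>r\<close>.\<close>

lemma coeff_trinomial_power:
  fixes A B C :: real
  shows "coeff ([:C, B, A:] ^ l) p =
    (\<Sum>n\<le>l. if n \<le> p \<and> n \<le> 2 * l - p \<and> even (p - n) \<and> p \<le> 2 * l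
      then fact l / (fact n * fact ((p - n) div 2) * fact ((2 * l - p - n) div 2)) *
           B ^ n * A ^ ((p - n) div 2) * C ^ ((2 * l - p - n) div 2) else 0)"
proof -
  have "[:C, B, A:] = monom B 1 + (monom A 2 + monom C 0)"
    by (simp add: monom_altdef numeral_2_eq_2)
  hence "[:C, B, A:] ^ l = (\<Sum>n\<le>l. of_nat (l choose n) * monom B 1 ^ n * (monom A 2 + monom C 0) ^ (l - n))"
    by (simp only: binomial_ring)
  also have "\<dots> = (\<Sum>n\<le>l. \<Sum>i\<le>l - n. monom (real (l choose n) * real ((l - n) choose i) * B ^ n * A ^ i * C ^ (l - (n + i))) (n + 2 * i))"
    by (simp add: binomial_ring sum_distrib_left monom_power mult_monom of_nat_poly
        smult_monom mult_ac flip: monom_0)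
  finally have "coeff ([:C, B, A:] ^ l) p = (\<Sum>n\<le>l. \<Sum>i\<le>l - n.
     if n + 2 * i = p then real (l choose n) * real ((l - n) choose i) * B ^ n * A ^ i * C ^ (l - (n + i)) else 0)"
    by (simp add: coeff_sum)
  also have "\<dots> = (\<Sum>n\<le>l. if n \<le> p \<and> n \<le> 2 * l - p \<and> even (p - n) \<and> p \<le> 2 * l
      then fact l / (fact n * fact ((p - n) div 2) * fact ((2 * l - p - n) div 2)) *
           B ^ n * A ^ ((p - n) div 2) * C ^ ((2 * l - p - n) div 2) else 0)"
  proof (intro sum.cong refl)
    fix n assume n: "n \<in> {..l}"
    show "(\<Sum>i\<le>l - n. if n + 2 * i = p then real (l choose n) * real ((l - n) choose i) * B ^ n * A ^ i * C ^ (l - (n + i)) else 0) =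
      (if n \<le> p \<and> n \<le> 2 * l - p \<and> even (p - n) \<and> p \<le> 2 * l
      then fact l / (fact n * fact ((p - n) div 2) * fact ((2 * l - p - n) div 2)) *
           B ^ n * A ^ ((p - n) div 2) * C ^ ((2 * l - p - n) div 2) else 0)"
    proof (cases "n \<le> p \<and> n \<le> 2 * l - p \<and> even (p - n) \<and> p \<le> 2 * l")
      case True
      then obtain i0 where i0: "p = n + 2 * i0" by (metis evenE le_add_diff_inverse)
      have le: "i0 \<le> l - n" using True n unfolding i0 by auto
      have d: "(2 * l - p - n) div 2 = l - (n + i0)" "(p - n) div 2 = i0" using True n unfolding i0 by auto
      have "(\<Sum>i\<le>l - n. if n + 2 * i = p then real (l choose n) * real ((l - n) choose i) * B ^ n * A ^ i * C ^ (l - (n + i)) else 0) =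
        (\<Sum>i\<le>l - n. if i = i0 then real (l choose n) * real ((l - n) choose i) * B ^ n * A ^ i * C ^ (l - (n + i)) else 0)"
        by (intro sum.cong) (auto simp: i0)
      also have "\<dots> = real (l choose n) * real ((l - n) choose i0) * B ^ n * A ^ i0 * C ^ (l - (n + i0))"
        using le by simp
      also have "real (l choose n) * real ((l - n) choose i0) = fact l / (fact n * fact i0 * fact (l - (n + i0)))"
        using le n by (simp add: binomial_fact)
      finally show ?thesis by (simp only: if_P[OF True] d)
    next
      case False
      have "n + 2 * i \<noteq> p" if "i \<le> l - n" for i using False that n by auto
      thus ?thesis using False by (auto intro!: sum.neutral)
    qed
  qed
  finally show ?thesis .
qed

lemma integrable_sphere_inner_powers:
  fixes x y :: "real ^ 'n::finite"
  shows "integrable sphere_measure (\<lambda>z. (x \<bullet> z) ^ p * (y \<bullet> z) ^ q)"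
proof (rule integrable_sphere_continuous)
  fix z :: "real ^ 'n" assume z: "norm z = 1"
  have "\<bar>x \<bullet> z\<bar> \<le> norm x" "\<bar>y \<bullet> z\<bar> \<le> norm y"
    using Cauchy_Schwarz_ineq2[of x z] Cauchy_Schwarz_ineq2[of y z] z by auto
  thus "\<bar>(x \<bullet> z) ^ p * (y \<bullet> z) ^ q\<bar> \<le> norm x ^ p * norm y ^ q"
    by (auto simp: abs_mult power_abs intro!: mult_mono power_mono)
qed simp

lemma integral_sphere_inner_powers_odd:
  fixes x y :: "real ^ 'n::{finite, wellorder}"
  assumes "odd (p + q)"
  shows "(LINT z|sphere_measure. (x \<bullet> z) ^ p * (y \<bullet> z) ^ q) = 0"
proof -
  have "(LINT z|sphere_measure. (x \<bullet> (- z)) ^ p * (y \<bullet> (- z)) ^ q) =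
        (LINT z|sphere_measure. (x \<bullet> z) ^ p * (y \<bullet> z) ^ q)"
    by (rule integral_sphere_uminus) simp
  moreover have "(x \<bullet> (- z)) ^ p * (y \<bullet> (- z)) ^ q = - ((x \<bullet> z) ^ p * (y \<bullet> z) ^ q)" for z
  proof -
    have "(x \<bullet> (- z)) ^ p * (y \<bullet> (- z)) ^ q = (- 1) ^ (p + q) * ((x \<bullet> z) ^ p * (y \<bullet> z) ^ q)"
      by (simp add: power_minus[of "x \<bullet> z"] power_minus[of "y \<bullet> z"] power_add)
    thus ?thesis using assms by simp
  qed
  ultimately show ?thesis by simp
qed

text \<open>Polarization: for every real \<open>r\<close> the average of
  \<open>((r x + y) \<bullet> z) ^ (2 * l)\<close> is a fixed multiple of
  \<open>norm (r x + y) ^ (2 * l)\<close>. Both are polynomials in \<open>r\<close>, so their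
  coefficients of \<open>r ^ p\<close> agree.\<close>

lemma integral_sphere_inner_powers:
  fixes x y :: "real ^ 'n::{finite, wellorder}"
  assumes pq: "p + q = 2 * l"
  shows "(LINT z|sphere_measure. (x \<bullet> z) ^ p * (y \<bullet> z) ^ q) =
    fact p * fact q / (4 ^ l * pochhammer (CARD('n) / 2) l) *
    (\<Sum>n\<le>l. if n \<le> p \<and> n \<le> q \<and> even (p - n) then
       (2 * (x \<bullet> y)) ^ n / (fact n * fact ((p - n) div 2) * fact ((q - n) div 2)) *
       norm x ^ (p - n) * norm y ^ (q - n) else 0)"
proof -
  define E where "E p = (LINT z|sphere_measure. (x \<bullet> z) ^ p * (y \<bullet> z) ^ (2 * l - p))" for p
  define \<kappa> where "\<kappa> = pochhammer (1 / 2) l / pochhammer (CARD('n) / 2) l"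
  define P where "P = (\<Sum>p\<le>2 * l. monom (real (2 * l choose p) * E p) p)"
  define Q where "Q = smult \<kappa> ([:(norm y)\<^sup>2, 2 * (x \<bullet> y), (norm x)\<^sup>2:] ^ l)"
  have "P = Q"
  proof (rule poly_ext)
    fix r
    have "norm (r *\<^sub>R x + y) ^ (2 * l) = ((norm y)\<^sup>2 + r * (2 * (x \<bullet> y) + r * (norm x)\<^sup>2)) ^ l"
    proof -
      have "(norm (r *\<^sub>R x + y))\<^sup>2 = (norm y)\<^sup>2 + r * (2 * (x \<bullet> y) + r * (norm x)\<^sup>2)"
        unfolding power2_norm_eq_inner by (simp add: inner_add inner_commute algebra_simps)
      thus ?thesis by (simp add: power_mult)
    qed
    hence "poly Q r = norm (r *\<^sub>R x + y) ^ (2 * l) * \<kappa>" by (simp add: Q_def)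
    also have "\<dots> = (LINT z|sphere_measure. ((r *\<^sub>R x + y) \<bullet> z) ^ (2 * l))"
      unfolding \<kappa>_def by (rule integral_sphere_even_power[symmetric])
    also have "\<dots> = (LINT z|sphere_measure. (\<Sum>p\<le>2 * l. real (2 * l choose p) * r ^ p * ((x \<bullet> z) ^ p * (y \<bullet> z) ^ (2 * l - p))))"
      by (simp add: inner_add_left binomial_ring power_mult_distrib mult_ac)
    also have "\<dots> = (\<Sum>p\<le>2 * l. LINT z|sphere_measure. real (2 * l choose p) * r ^ p * ((x \<bullet> z) ^ p * (y \<bullet> z) ^ (2 * l - p)))"
      by (rule Bochner_Integration.integral_sum)
         (intro integrable_mult_right integrable_sphere_inner_powers)
    also have "\<dots> = (\<Sum>p\<le>2 * l. real (2 * l choose p) * r ^ p * E p)"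
      unfolding E_def by (intro sum.cong refl) (rule Bochner_Integration.integral_mult_right_zero)
    also have "\<dots> = poly P r"
      by (simp add: P_def poly_sum poly_monom mult_ac)
    finally show "poly P r = poly Q r" by simp
  qed
  have p: "p \<le> 2 * l" "2 * l - p = q" using pq by auto
  have "coeff P p = (\<Sum>i\<le>2 * l. if i = p then real (2 * l choose p) * E p else 0)"
    unfolding P_def by (simp add: coeff_sum) 
  also have "\<dots> = real (2 * l choose p) * E p" using p by simp
  finally have "real (2 * l choose p) * E p = coeff Q p" by (simp only: \<open>P = Q\<close>)
  also have "\<dots> = \<kappa> * fact l * (\<Sum>n\<le>l. if n \<le> p \<and> n \<le> q \<and> even (p - n) then
       (2 * (x \<bullet> y)) ^ n / (fact n * fact ((p - n) div 2) * fact ((q - n) div 2)) *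
       norm x ^ (p - n) * norm y ^ (q - n) else 0)"
    unfolding Q_def coeff_smult coeff_trinomial_power p(2) mult.assoc[of \<kappa>] sum_distrib_left
  proof (intro sum.cong refl arg_cong2[where f = "(*)"])
    fix n assume "n \<in> {..l}"
    have "even (q - n)" if "n \<le> p" "n \<le> q" "even (p - n)"
      using that pq by (metis even_diff_nat even_add even_mult_iff even_numeral linorder_not_less)
    thus "(if n \<le> p \<and> n \<le> q \<and> even (p - n) \<and> p \<le> 2 * l
        then fact l / (fact n * fact ((p - n) div 2) * fact ((q - n) div 2)) * (2 * (x \<bullet> y)) ^ n *
             ((norm x)\<^sup>2) ^ ((p - n) div 2) * ((norm y)\<^sup>2) ^ ((q - n) div 2) else 0) =
       fact l * (if n \<le> p \<and> n \<le> q \<and> even (p - n) then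
       (2 * (x \<bullet> y)) ^ n / (fact n * fact ((p - n) div 2) * fact ((q - n) div 2)) *
       norm x ^ (p - n) * norm y ^ (q - n) else 0)"
      using p by (auto simp: power_mult[symmetric])
  qed
  also have "\<kappa> * fact l = real (2 * l choose p) * (fact p * fact q / (4 ^ l * pochhammer (CARD('n) / 2) l))"
  proof -
    have b: "real (2 * l choose p) = fact (2 * l) / (fact p * fact q)"
      using p by (simp add: binomial_fact)
    show ?thesis unfolding b \<kappa>_def fact_double_pochhammer by (simp add: field_simps)
  qed
  finally have "real (2 * l choose p) * E p = real (2 * l choose p) * (fact p * fact q / (4 ^ l * pochhammer (CARD('n) / 2) l) *
    (\<Sum>n\<le>l. if n \<le> p \<and> n \<le> q \<and> even (p - n) then
       (2 * (x \<bullet> y)) ^ n / (fact n * fact ((p - n) div 2) * fact ((q - n) div 2)) *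
       norm x ^ (p - n) * norm y ^ (q - n) else 0))"
    by (simp only: mult.assoc)
  hence "E p = fact p * fact q / (4 ^ l * pochhammer (CARD('n) / 2) l) *
    (\<Sum>n\<le>l. if n \<le> p \<and> n \<le> q \<and> even (p - n) then
       (2 * (x \<bullet> y)) ^ n / (fact n * fact ((p - n) div 2) * fact ((q - n) div 2)) *
       norm x ^ (p - n) * norm y ^ (q - n) else 0)"
    by (rule iffD1[OF mult_left_cancel, rotated]) (use p in simp)
  thus ?thesis by (simp add: E_def p)
qed

lemma integral_sphere_inner_powers_orthogonal:
  fixes x y :: "real ^ 'n::{finite, wellorder}"
  assumes "x \<bullet> y = 0"
  shows "(LINT z|sphere_measure. (x \<bullet> z) ^ (2 * k) * (y \<bullet> z) ^ (2 * n)) =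
    pochhammer (1 / 2) k * pochhammer (1 / 2) n / pochhammer (CARD('n) / 2) (k + n) *
    norm x ^ (2 * k) * norm y ^ (2 * n)"
proof -
  have "(\<Sum>i\<le>k + n. if i \<le> 2 * k \<and> i \<le> 2 * n \<and> even (2 * k - i) then
       (2 * (x \<bullet> y)) ^ i / (fact i * fact ((2 * k - i) div 2) * fact ((2 * n - i) div 2)) *
       norm x ^ (2 * k - i) * norm y ^ (2 * n - i) else 0) =
    (\<Sum>i\<le>k + n. if i = 0 then norm x ^ (2 * k) * norm y ^ (2 * n) / (fact k * fact n) else 0)"
    using assms by (intro sum.cong) auto
  hence "(LINT z|sphere_measure. (x \<bullet> z) ^ (2 * k) * (y \<bullet> z) ^ (2 * n)) =
    fact (2 * k) * fact (2 * n) / (4 ^ (k + n) * pochhammer (CARD('n) / 2) (k + n)) *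
    (\<Sum>i\<le>k + n. if i = 0 then norm x ^ (2 * k) * norm y ^ (2 * n) / (fact k * fact n) else 0)"
    by (subst integral_sphere_inner_powers[where l = "k + n"]) simp_all
  also have "(\<Sum>i\<le>k + n. if i = 0 then norm x ^ (2 * k) * norm y ^ (2 * n) / (fact k * fact n) else 0) =
     norm x ^ (2 * k) * norm y ^ (2 * n) / (fact k * fact n)" by simp
  finally show ?thesis
    unfolding fact_double_pochhammer power_add by (simp add: divide_simps)
qed

section \<open>Gegenbauer polynomials\<close>

text \<open>The generating function \<open>1 - 2 t X + X\<^sup>2\<close> to the power
  \<open>-a\<close>, written as a composition with \<open>2 t X - X\<^sup>2\<close>. In degree
  \<open>k\<close> the power \<open>n = k - j\<close> of this polynomial contributes the
  \<open>j\<close>-th term of the defining sum.\<close>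

lemma gegenbauer_fps: "fps_nth (fps_pc a 1 oo (fps_const (2 * t) * fps_X - fps_X\<^sup>2)) k = gegenbauer a k t"
proof -
  define Y where "Y = fps_const (2 * t) * fps_X - (fps_X :: real fps)\<^sup>2"
  have Y: "Y = fps_X * (fps_const (2 * t) - fps_X)"
    by (simp add: Y_def power2_eq_square algebra_simps)
  have Yn: "fps_nth (Y ^ n) k = (if n \<le> k \<and> k - n \<le> n then (-1) ^ (k - n) * real (n choose (k - n)) * (2 * t) ^ (n - (k - n)) else 0)" for n k
  proof -
    have "(fps_const (2 * t) - fps_X) ^ n = (- fps_X + fps_const (2 * t)) ^ n" by simp
    also have "\<dots> = (\<Sum>j\<le>n. fps_const (real (n choose j) * (-1) ^ j * (2 * t) ^ (n - j)) * fps_X ^ j)"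
      unfolding binomial_ring
    proof (intro sum.cong refl)
      fix j
      have 1: "(- fps_X :: real fps) ^ j = fps_const ((-1) ^ j) * fps_X ^ j"
        unfolding power_minus[of fps_X] by (metis fps_const_1_eq_1 fps_const_neg fps_const_power)
      have 2: "(of_nat (n choose j) :: real fps) = fps_const (real (n choose j))"
        by (simp add: fps_of_nat)
      have "of_nat (n choose j) * (- fps_X) ^ j * fps_const (2 * t) ^ (n - j) =
        (fps_const (real (n choose j)) * fps_const ((-1) ^ j) * fps_const ((2 * t) ^ (n - j))) * fps_X ^ j"
        unfolding 1 2 fps_const_power by (simp only: mult_ac)
      thus "of_nat (n choose j) * (- fps_X) ^ j * fps_const (2 * t) ^ (n - j) =
        fps_const (real (n choose j) * (-1) ^ j * (2 * t) ^ (n - j)) * fps_X ^ j"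
        by (simp only: fps_const_mult)
    qed
    finally have "fps_nth ((fps_const (2 * t) - fps_X) ^ n) i =
       (\<Sum>j\<le>n. if j = i then real (n choose j) * (-1) ^ j * (2 * t) ^ (n - j) else 0)" for i
      by (simp add: fps_sum_nth if_distrib cong: if_cong) (intro sum.cong; auto)?
    thus ?thesis
      by (simp add: Y power_mult_distrib fps_X_power_mult_nth)
  qed
  have "fps_nth (fps_pc a 1 oo Y) k = (\<Sum>n\<le>k. pc a n * fps_nth (Y ^ n) k)"
    by (simp add: fps_compose_nth atLeast0AtMost)
  also have "\<dots> = (\<Sum>j\<le>k. pc a (k - j) * fps_nth (Y ^ (k - j)) k)"
    by (rule sum.reindex_bij_witness[of _ "\<lambda>j. k - j" "\<lambda>j. k - j"]) auto
  also have "\<dots> = (\<Sum>j\<le>k div 2. pc a (k - j) * fps_nth (Y ^ (k - j)) k)"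
    by (rule sum.mono_neutral_right) (auto simp: Yn)
  also have "\<dots> = gegenbauer a k t"
    unfolding gegenbauer_def
  proof (intro sum.cong refl)
    fix j assume "j \<in> {..k div 2}"
    hence j: "2 * j \<le> k" by auto
    have e: "k - (k - j) = j" "k - j - j = k - 2 * j" "k - (j + j) = k - 2 * j" using j by auto
    have "pc a (k - j) * real ((k - j) choose j) = pochhammer a (k - j) / (fact j * fact (k - 2 * j))"
      using j by (simp add: pc_def binomial_fact e)
    moreover have "pc a (k - j) * fps_nth (Y ^ (k - j)) k =
        pc a (k - j) * real ((k - j) choose j) * ((-1) ^ j * (2 * t) ^ (k - 2 * j))"
      unfolding Yn e using j by simp
    ultimately show "pc a (k - j) * fps_nth (Y ^ (k - j)) k =
       (- 1) ^ j * pochhammer a (k - j) / (fact j * fact (k - 2 * j)) * (2 * t) ^ (k - 2 * j)"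
      by simp
  qed
  finally show ?thesis by (simp add: Y_def)
qed

lemma gegenbauer_0 [simp]: "gegenbauer a 0 t = 1"
  by (simp add: gegenbauer_def)

lemma gegenbauer_1: "gegenbauer a (Suc 0) t = 2 * a * t"
  by (simp add: gegenbauer_def)

text \<open>The coefficient of degree \<open>k + 1\<close> in the differential equation
  \<open>(1 - Y) F' = a Y' F\<close> of the generating function.\<close>

lemma gegenbauer_rec:
  "real (k + 2) * gegenbauer a (k + 2) t =
   2 * (real k + 1 + a) * t * gegenbauer a (k + 1) t - (real k + 2 * a) * gegenbauer a k t"
proof -
  define Y where "Y = fps_const (2 * t) * fps_X - (fps_X :: real fps)\<^sup>2"
  define F where "F = fps_pc a 1 oo Y"
  have Y0: "fps_nth Y 0 = 0" by (simp add: Y_def)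
  have F: "fps_nth F k = gegenbauer a k t" for k
    unfolding F_def Y_def by (rule gegenbauer_fps)
  have "((1 - fps_X) * fps_deriv (fps_pc a 1)) oo Y = (fps_const a * fps_pc a 1) oo Y"
    using fps_pc_deriv[of 1 a] by simp
  hence C1: "(1 - Y) * (fps_deriv (fps_pc a 1) oo Y) = fps_const a * F"
    using Y0 by (simp add: F_def fps_compose_mult_distrib fps_compose_sub_distrib)
  have "fps_deriv F = (fps_deriv (fps_pc a 1) oo Y) * fps_deriv Y"
    unfolding F_def using Y0 by (rule fps_compose_deriv)
  hence "(1 - Y) * fps_deriv F = fps_const a * F * fps_deriv Y"
    using C1 by (simp flip: C1 add: mult_ac)
  hence "fps_deriv F - fps_const (2 * t) * (fps_X * fps_deriv F) + fps_X * (fps_X * fps_deriv F) =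
         fps_const (2 * a * t) * F - fps_const (2 * a) * (fps_X * F)"
    by (simp add: Y_def power2_eq_square algebra_simps flip: fps_const_mult numeral_fps_const)
  from arg_cong[OF this, of "\<lambda>f. fps_nth f (Suc k)"]
  show ?thesis by (cases k; simp add: F; simp add: algebra_simps)
qed

lemma gegenbauer_at_1: "gegenbauer a k 1 = pc (2 * a) k"
proof (induction k rule: induct_nat_012)
  case (ge2 k)
  have "real (k + 2) * gegenbauer a (k + 2) 1 = real (k + 2) * pc (2 * a) (k + 2)"
    unfolding gegenbauer_rec using ge2 by (simp add: pc_Suc divide_simps) (simp add: algebra_simps)
  thus ?case by simp
qed (simp_all add: gegenbauer_1 pc_Suc)

text \<open>\<open>gegen_moment \<nu> n k\<close> is the \<open>k\<close>-th ultraspherical coefficient of \<open>u ^ n\<close>, for \<open>\<nu> = (d + 1) / 2\<close>.\<close>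

definition gegen_moment :: "real \<Rightarrow> nat \<Rightarrow> nat \<Rightarrow> real" where
  "gegen_moment \<nu> n k = (if k \<le> n \<and> even (n - k)
     then fact n / (2 ^ n * fact ((n - k) div 2) * pochhammer \<nu> ((n + k) div 2)) else 0)"

lemma gegen_moment_eq_0: "n < k \<or> odd (n + k) \<Longrightarrow> gegen_moment \<nu> n k = 0"
  by (auto simp: gegen_moment_def)

lemma gegen_moment_add:
  "gegen_moment \<nu> (k + 2 * j) k = fact (k + 2 * j) / (2 ^ (k + 2 * j) * fact j * pochhammer \<nu> (k + j))"
proof -
  have "(k + 2 * j + k) div 2 = k + j" by simp
  thus ?thesis by (simp add: gegen_moment_def)
qed

lemma gegen_moment_nonneg: "\<nu> > 0 \<Longrightarrow> gegen_moment \<nu> n k \<ge> 0"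
  by (auto simp: gegen_moment_def intro!: divide_nonneg_pos mult_pos_pos pochhammer_pos)

text \<open>The three-term recurrence of the Gegenbauer polynomials, integrated against
  \<open>u ^ n\<close>. It is checked on the explicit numbers, since it serves to show that these
  are the ultraspherical coefficients. For \<open>k = 0\<close> the truncated index
  \<open>k - 1\<close> is multiplied by 0.\<close>

lemma gegen_moment_rec:
  assumes \<nu>: "\<nu> > 0"
  shows "(2 * \<nu> - 2 + real k) * gegen_moment \<nu> n (k + 1) + real k * gegen_moment \<nu> n (k - 1) =
     2 * (real k + \<nu> - 1) * gegen_moment \<nu> (n + 1) k"
proof (cases "k \<le> n + 1 \<and> even (n + 1 - k)")
  case False
  have "gegen_moment \<nu> n (k + 1) = 0" by (rule gegen_moment_eq_0) (use False in presburger)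
  moreover have "gegen_moment \<nu> (n + 1) k = 0" by (rule gegen_moment_eq_0) (use False in presburger)
  moreover have "gegen_moment \<nu> n (k - 1) = 0" if "k \<noteq> 0"
    by (rule gegen_moment_eq_0) (use False that in presburger)
  ultimately show ?thesis by (cases "k = 0") auto
next
  case True
  then obtain j where j: "n + 1 = k + 2 * j" by (metis evenE le_add_diff_inverse)
  have pos: "pochhammer \<nu> i > 0" for i using \<nu> by (intro pochhammer_pos)
  \<comment> \<open>The common factor of the three moments; once it is taken out, the identity
    reduces to \<open>n + 1 = k + 2 * j\<close>.\<close>
  define w where "w = fact n / (2 ^ (n + 1) * fact j * pochhammer \<nu> (k + j))"
  have m1: "gegen_moment \<nu> (n + 1) k = real (n + 1) * w"
    unfolding w_def j gegen_moment_add using arg_cong[OF j, of "fact :: _ \<Rightarrow> real"] by (simp flip: j)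
  have m2: "gegen_moment \<nu> n (k + 1) = 2 * real j * w"
  proof (cases j)
    case 0
    thus ?thesis using j by (simp add: gegen_moment_eq_0)
  next
    case (Suc i)
    have n: "n = (k + 1) + 2 * i" using j Suc by simp
    have "gegen_moment \<nu> n (k + 1) = fact n / (2 ^ n * fact i * pochhammer \<nu> (k + j))"
      using gegen_moment_add[of \<nu> "k + 1" i] unfolding n[symmetric] by (simp add: Suc)
    moreover have "fact j = real j * (fact i :: real)" "real j > 0" using Suc by simp_all
    ultimately show ?thesis
      using pos[of "k + j"] unfolding w_def by (simp add: field_simps)
  qed
  have m3: "real k * gegen_moment \<nu> n (k - 1) = real k * (2 * (\<nu> + real (k + j) - 1) * w)"
  proof (cases k)
    case (Suc i)
    have n: "n = i + 2 * j" using j Suc by simp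
    define e where "e = \<nu> + real (k + j) - 1"
    have "gegen_moment \<nu> n (k - 1) = fact n / (2 ^ n * fact j * pochhammer \<nu> (i + j))"
      using gegen_moment_add[of \<nu> i j] unfolding n[symmetric] by (simp add: Suc)
    moreover have "w = fact n / (2 ^ (n + 1) * fact j * (pochhammer \<nu> (i + j) * e))"
      by (simp add: w_def e_def Suc pochhammer_Suc)
    moreover have "e > 0" using \<nu> Suc by (simp add: e_def)
    ultimately have "gegen_moment \<nu> n (k - 1) = 2 * e * w" by simp
    hence "gegen_moment \<nu> n (k - 1) = 2 * (\<nu> + real (k + j) - 1) * w" by (simp only: e_def)
    thus ?thesis by simp
  qed simp
  have "real (n + 1) = real k + 2 * real j" using j by (metis of_nat_add of_nat_mult of_nat_numeral)
  thus ?thesis unfolding m1 m2 m3 by (simp add: algebra_simps)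
qed

context
  fixes d :: nat and \<nu> :: real
  assumes d: "d \<ge> 2"
  defines "\<nu> \<equiv> (real d + 1) / 2"
begin

lemma nu_pos: "\<nu> > 0" using d by (simp add: \<nu>_def)

lemma gegenbauer_P_altdef: "gegenbauer_P d k t = gegenbauer (\<nu> - 1) k t / pc (real d - 1) k"
proof -
  have e: "(real d - 1) / 2 = \<nu> - 1" "2 * (\<nu> - 1) = real d - 1" by (simp_all add: \<nu>_def field_simps)
  show ?thesis unfolding gegenbauer_P_def gegenbauer_at_1 e ..
qed

lemma pc_dim_pos: "pc (real d - 1) k > 0"
  using d by (simp add: pc_def pochhammer_pos)

lemma gegenbauer_P_0 [simp]: "gegenbauer_P d 0 t = 1"
  by (simp add: gegenbauer_P_altdef)

lemma gegenbauer_P_at_1 [simp]: "gegenbauer_P d k 1 = 1"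
proof -
  have "2 * (\<nu> - 1) = real d - 1" by (simp add: \<nu>_def field_simps)
  thus ?thesis
    using pc_dim_pos[of k] unfolding gegenbauer_P_altdef gegenbauer_at_1 by simp
qed

lemma gegenbauer_P_rec:
  "2 * (real k + \<nu> - 1) * t * gegenbauer_P d k t =
   (2 * \<nu> - 2 + real k) * gegenbauer_P d (k + 1) t + real k * gegenbauer_P d (k - 1) t"
proof (cases k)
  case 0
  thus ?thesis using d by (simp add: gegenbauer_P_altdef gegenbauer_1 pc_Suc \<nu>_def field_simps)
next
  case (Suc i)
  define C where "C k = gegenbauer (\<nu> - 1) k t" for k
  define q where "q = pc (real d - 1) i"
  have q: "q > 0" unfolding q_def by (rule pc_dim_pos)
  have P: "gegenbauer_P d i t = C i / q" by (simp add: gegenbauer_P_altdef C_def q_def)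
  have P1: "gegenbauer_P d (i + 1) t = C (i + 1) * real (i + 1) / (q * (real d - 1 + real i))"
    by (simp add: gegenbauer_P_altdef C_def q_def pc_Suc)
  have P2: "gegenbauer_P d (i + 2) t = (real (i + 2) * C (i + 2)) * real (i + 1) / (q * (real d - 1 + real i) * (real d + real i))"
    by (simp add: gegenbauer_P_altdef C_def q_def pc_Suc field_simps)
  have r: "real (i + 2) * C (i + 2) = 2 * (real i + \<nu>) * t * C (i + 1) - (real i + real d - 1) * C i"
  proof -
    have "real i + 1 + (\<nu> - 1) = real i + \<nu>" "real i + 2 * (\<nu> - 1) = real i + real d - 1"
      by (simp_all add: \<nu>_def field_simps)
    with gegenbauer_rec[of i "\<nu> - 1" t] show ?thesis unfolding C_def by simp
  qed
  have nz: "real d - 1 + real i > 0" "real d + real i > 0" using d by auto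
  have "2 * \<nu> - 2 + real k = real d + real i" by (simp add: Suc \<nu>_def field_simps)
  hence "(2 * \<nu> - 2 + real k) * gegenbauer_P d (k + 1) t + real k * gegenbauer_P d (k - 1) t =
    (real d + real i) * gegenbauer_P d (i + 2) t + real (i + 1) * gegenbauer_P d i t"
    by (simp add: Suc)
  also have "\<dots> = 2 * (real i + \<nu>) * t * gegenbauer_P d (i + 1) t"
    unfolding P P1 P2 r using nz q by (simp add: divide_simps) (simp add: algebra_simps)
  finally show ?thesis by (simp add: Suc add_ac)
qed

lemma harmonic_dim_altdef: "harmonic_dim d k = (real k + \<nu> - 1) / (\<nu> - 1) * pc (real d - 1) k"
proof -
  have "pochhammer (real d - 1) k = Gamma (real d - 1 + real k) / Gamma (real d - 1)"
    using d by (intro pochhammer_Gamma pos_not_nonpos_Ints) auto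
  moreover have "Gamma (real d) = (real d - 1) * Gamma (real d - 1)"
    using Gamma_plus1[OF pos_not_nonpos_Ints, of "real d - 1"] d by simp
  moreover have "Gamma (real d - 1) > 0" using d by (intro Gamma_real_pos) auto
  ultimately have "harmonic_dim d k = (2 * real k + real d - 1) * (g * pochhammer (real d - 1) k) /
      ((real d - 1) * g * fact k)" and "g > 0" if "g = Gamma (real d - 1)" for g
    using that d by (simp_all add: harmonic_dim_def Gamma_fact[symmetric] add_ac add_diff_eq)
  note * = this
  have "(2 * real k + real d - 1) * (g * pochhammer (real d - 1) k) / ((real d - 1) * g * fact k) =
      (2 * real k + real d - 1) / (real d - 1) * (pochhammer (real d - 1) k / fact k)"
    if "g > 0" for g :: real using that by simp
  moreover have "(2 * real k + real d - 1) / (real d - 1) = (real k + \<nu> - 1) / (\<nu> - 1)"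
    using d by (simp add: \<nu>_def field_simps)
  ultimately show ?thesis
    using * by (simp add: pc_def)
qed

lemma harmonic_dim_pos: "harmonic_dim d k > 0"
proof -
  have "\<nu> > 1" using d by (simp add: \<nu>_def)
  thus ?thesis unfolding harmonic_dim_altdef using pc_dim_pos[of k]
    by (intro mult_pos_pos divide_pos_pos) auto
qed

text \<open>Multiplication by \<open>u\<close> shifts the index of \<open>gegenbauer_P\<close> by
  one in either direction. The bound \<open>K\<close> is kept free because the induction step from
  \<open>n\<close> uses the expansion of \<open>u ^ n\<close> up to \<open>Suc K\<close>; the extra
  terms have vanishing moments.\<close>

lemma power_gegenbauer_expansion:
  assumes "n \<le> K"
  shows "u ^ n = (\<Sum>k\<le>K. gegen_moment \<nu> n k * harmonic_dim d k * gegenbauer_P d k u)"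
  using assms
proof (induction n arbitrary: K)
  case 0
  have "(\<Sum>k\<le>K. gegen_moment \<nu> 0 k * harmonic_dim d k * gegenbauer_P d k u) =
        (\<Sum>k\<le>K. if k = 0 then 1 else 0)"
    using d by (intro sum.cong) (auto simp: gegen_moment_def harmonic_dim_altdef \<nu>_def)
  thus ?case by simp
next
  case (Suc n)
  \<comment> \<open>This normalization gives both shifted sums the same weight:
    \<open>y k * (2 * \<nu> - 2 + k) = (k + 1) * y (k + 1)\<close>. The remaining factor of
    \<open>harmonic_dim\<close> is the one on the left of the three-term recurrence.\<close>
  define y where "y k = pc (real d - 1) k / (2 * (\<nu> - 1))" for k
  have nu1: "\<nu> - 1 > 0" using d by (simp add: \<nu>_def)
  have y: "y k * (2 * \<nu> - 2 + real k) = real (k + 1) * y (k + 1)" for k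
    by (simp add: y_def pc_Suc \<nu>_def)
  have Z: "harmonic_dim d k = 2 * (real k + \<nu> - 1) * y k" for k
    using nu1 by (simp add: harmonic_dim_altdef y_def field_simps)
  let ?P = "\<lambda>k. gegenbauer_P d k u"
  have "u ^ Suc n = u * (\<Sum>k\<le>Suc K. gegen_moment \<nu> n k * harmonic_dim d k * ?P k)"
    using Suc.IH[of "Suc K"] Suc.prems by simp
  also have "\<dots> = (\<Sum>k\<le>Suc K. gegen_moment \<nu> n k * y k * (2 * (real k + \<nu> - 1) * u * ?P k))"
    unfolding sum_distrib_left by (intro sum.cong refl) (simp add: Z)
  also have "\<dots> = (\<Sum>k\<le>Suc K. gegen_moment \<nu> n k * (real (k + 1) * y (k + 1)) * ?P (k + 1)) +
      (\<Sum>k\<le>Suc K. gegen_moment \<nu> n k * y k * real k * ?P (k - 1))"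
    unfolding sum.distrib[symmetric] gegenbauer_P_rec y[symmetric]
    by (intro sum.cong refl) (simp add: algebra_simps)
  also have "(\<Sum>k\<le>Suc K. gegen_moment \<nu> n k * (real (k + 1) * y (k + 1)) * ?P (k + 1)) =
      (\<Sum>k\<le>K. real k * gegen_moment \<nu> n (k - 1) * y k * ?P k)"
  proof -
    have "(\<Sum>k\<le>Suc K. gegen_moment \<nu> n k * (real (k + 1) * y (k + 1)) * ?P (k + 1)) =
       (\<Sum>k<K. gegen_moment \<nu> n k * (real (k + 1) * y (k + 1)) * ?P (k + 1))"
      using Suc.prems by (intro sum.mono_neutral_right) (auto simp: gegen_moment_eq_0)
    also have "\<dots> = (\<Sum>k\<le>K. real k * gegen_moment \<nu> n (k - 1) * y k * ?P k)"
      by (simp add: sum.atMost_shift mult_ac)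
    finally show ?thesis .
  qed
  also have "(\<Sum>k\<le>Suc K. gegen_moment \<nu> n k * y k * real k * ?P (k - 1)) =
      (\<Sum>k\<le>K. (2 * \<nu> - 2 + real k) * gegen_moment \<nu> n (k + 1) * y k * ?P k)"
  proof -
    have "(\<Sum>k\<le>Suc K. gegen_moment \<nu> n k * y k * real k * ?P (k - 1)) =
      (\<Sum>k\<le>K. gegen_moment \<nu> n (Suc k) * (real (k + 1) * y (k + 1)) * ?P k)"
      by (subst sum.atMost_Suc_shift) (simp add: mult_ac)
    thus ?thesis unfolding y[symmetric] by (simp add: mult_ac)
  qed
  also have "(\<Sum>k\<le>K. real k * gegen_moment \<nu> n (k - 1) * y k * ?P k) +
      (\<Sum>k\<le>K. (2 * \<nu> - 2 + real k) * gegen_moment \<nu> n (k + 1) * y k * ?P k) =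
      (\<Sum>k\<le>K. ((2 * \<nu> - 2 + real k) * gegen_moment \<nu> n (k + 1) + real k * gegen_moment \<nu> n (k - 1)) * y k * ?P k)"
    unfolding sum.distrib[symmetric] by (intro sum.cong refl) (simp add: algebra_simps)
  also have "\<dots> = (\<Sum>k\<le>K. gegen_moment \<nu> (Suc n) k * harmonic_dim d k * ?P k)"
    unfolding gegen_moment_rec[OF nu_pos] by (simp add: Z mult_ac)
  finally show ?case .
qed

end

section \<open>The Gegenbauer weight as a probability measure\<close>

definition gegen_measure :: "nat \<Rightarrow> real measure" where
  "gegen_measure d = density lborel (\<lambda>u. ennreal (indicator {-1..1} u *
     (sphere_area (d - 1) / sphere_area d * (1 - u\<^sup>2) powr (real d / 2 - 1))))"

lemma sets_gegen_measure [simp, measurable_cong]: "sets (gegen_measure d) = sets borel"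
  by (simp add: gegen_measure_def)

lemma space_gegen_measure [simp]: "space (gegen_measure d) = UNIV"
  by (simp add: gegen_measure_def)

lemma sphere_area_pos: "sphere_area d > 0"
  by (simp add: sphere_area_def)

lemma sphere_area_ratio:
  assumes "d \<ge> 1"
  shows "sphere_area (d - 1) / sphere_area d = 1 / Beta (1 / 2) (real d / 2)"
proof -
  have 1: "real d / 2 > 0" "(real d + 1) / 2 > 0" using assms by auto
  have "sphere_area (d - 1) = 2 * pi powr (real d / 2) / Gamma (real d / 2)"
  proof -
    have a: "sphere_area (d - 1) = real d * unit_ball_vol (real d)" using assms by (simp add: sphere_area_def)
    show ?thesis unfolding a unit_ball_vol_def Gamma_plus1[OF pos_not_nonpos_Ints[OF 1(1)]] using assms by simp
  qed
  moreover have "sphere_area d = 2 * pi powr ((real d + 1) / 2) / Gamma ((real d + 1) / 2)"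
  proof -
    have a: "sphere_area d = (real d + 1) * unit_ball_vol (real d + 1)" by (simp add: sphere_area_def add.commute)
    have "e * (x / (e / 2 * g)) = 2 * x / g" if "e > 0" for e x g :: real using that by simp
    thus ?thesis unfolding a unit_ball_vol_def Gamma_plus1[OF pos_not_nonpos_Ints[OF 1(2)]] by simp
  qed
  moreover have "pi powr ((real d + 1) / 2) = pi powr (real d / 2) * sqrt pi"
    by (simp add: add_divide_distrib powr_add powr_half_sqrt)
  moreover have "Beta (1 / 2) (real d / 2) = sqrt pi * Gamma (real d / 2) / Gamma ((real d + 1) / 2)"
    by (simp add: Beta_def Gamma_one_half_real add_divide_distrib add.commute)
  moreover have "(2 * x / g) / (2 * (x * q) / h) = 1 / (q * g / h)" if "x > 0" "g > 0" "h > 0" for x g h q :: real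
    using that by simp
  ultimately show ?thesis using 1 by (simp only:) (simp add: Gamma_real_pos)
qed

lemma integral_gegen_measure:
  assumes [measurable]: "f \<in> borel_measurable borel"
  shows "(\<integral>u. f u \<partial>gegen_measure d) = sphere_area (d - 1) / sphere_area d *
     (LINT u:{-1..1}|lborel. f u * (1 - u\<^sup>2) powr (real d / 2 - 1))"
proof -
  have "(\<integral>u. f u \<partial>gegen_measure d) = (\<integral>u. (indicator {-1..1} u *
     (sphere_area (d - 1) / sphere_area d * (1 - u\<^sup>2) powr (real d / 2 - 1))) *\<^sub>R f u \<partial>lborel)"
    unfolding gegen_measure_def
  proof (rule integral_density)
    show "AE u in lborel. 0 \<le> indicator {-1..1} u * (sphere_area (d - 1) / sphere_area d * (1 - u\<^sup>2) powr (real d / 2 - 1))"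
      by (intro AE_I2 mult_nonneg_nonneg divide_nonneg_nonneg less_imp_le[OF sphere_area_pos]) simp_all
  qed measurable
  also have "\<dots> = (\<integral>u. sphere_area (d - 1) / sphere_area d *
     (indicator {-1..1} u *\<^sub>R (f u * (1 - u\<^sup>2) powr (real d / 2 - 1))) \<partial>lborel)"
    by (intro Bochner_Integration.integral_cong) auto
  also have "\<dots> = sphere_area (d - 1) / sphere_area d *
     (LINT u:{-1..1}|lborel. f u * (1 - u\<^sup>2) powr (real d / 2 - 1))"
    unfolding set_lebesgue_integral_def by (rule Bochner_Integration.integral_mult_right_zero)
  finally show ?thesis .
qed

lemma AE_gegen_measure: "AE u in gegen_measure d. u \<in> {-1..1}"
proof -
  have *: "u \<in> {-1..1}" if "0 < ennreal (indicator {-1..1} u * c)" for u c :: real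
    by (rule ccontr) (use that in simp)
  have "AE u in lborel. 0 < ennreal (indicator {-1..1} u *
     (sphere_area (d - 1) / sphere_area d * (1 - u\<^sup>2) powr (real d / 2 - 1))) \<longrightarrow> u \<in> {-1..1}"
    by (intro AE_I2 impI) (erule *)
  thus ?thesis
    unfolding gegen_measure_def by (subst AE_density) measurable
qed

lemma prob_space_gegen_measure:
  assumes d: "d \<ge> 2"
  shows "prob_space (gegen_measure d)"
proof
  let ?r = "sphere_area (d - 1) / sphere_area d"
  have r: "?r > 0" using sphere_area_pos by simp
  have "emeasure (gegen_measure d) (space (gegen_measure d)) =
    (\<integral>\<^sup>+u. ennreal (indicator {-1..1} u * (?r * (1 - u\<^sup>2) powr (real d / 2 - 1))) \<partial>lborel)"
    unfolding gegen_measure_def by (simp add: emeasure_density)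
  also have "\<dots> = (\<integral>\<^sup>+u. ennreal ?r * ennreal (indicator {-1..1} u * sqrt (1 - u\<^sup>2) ^ (d - 2)) \<partial>lborel)"
  proof (rule nn_integral_cong_AE)
    \<comment> \<open>For \<open>d = 2\<close> the exponents are 0, and at the endpoints
      \<open>0 powr 0 = 0\<close> while \<open>0 ^ 0 = 1\<close>; so they have to be
      discarded.\<close>
    have "AE u in lborel. u \<noteq> (1::real) \<and> u \<noteq> -1"
      by (intro AE_conjI AE_lborel_singleton)
    thus "AE u in lborel. ennreal (indicator {-1..1} u * (?r * (1 - u\<^sup>2) powr (real d / 2 - 1))) =
      ennreal ?r * ennreal (indicator {-1..1} u * sqrt (1 - u\<^sup>2) ^ (d - 2))"
    proof eventually_elim
      case (elim u)
      show ?case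
      proof (cases "u \<in> {-1..1}")
        case True
        hence "\<bar>u\<bar> < 1" using elim by auto
        hence u: "1 - u\<^sup>2 > 0" by (simp add: abs_square_less_1)
        have "sqrt (1 - u\<^sup>2) ^ (d - 2) = ((1 - u\<^sup>2) powr (1 / 2)) powr real (d - 2)"
          using u by (simp add: powr_half_sqrt powr_realpow)
        also have "\<dots> = (1 - u\<^sup>2) powr (real d / 2 - 1)"
          unfolding powr_powr using d by (simp add: of_nat_diff diff_divide_distrib)
        finally have q: "sqrt (1 - u\<^sup>2) ^ (d - 2) = (1 - u\<^sup>2) powr (real d / 2 - 1)" .
        have "ennreal (?r * (1 - u\<^sup>2) powr (real d / 2 - 1)) = ennreal ?r * ennreal ((1 - u\<^sup>2) powr (real d / 2 - 1))"
          using r by (intro ennreal_mult) auto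
        thus ?thesis using True unfolding q by simp
      qed auto
    qed
  qed
  also have "\<dots> = ennreal ?r * ennreal (Beta (1 / 2) (real (d - 2) / 2 + 1))"
    by (subst nn_integral_cmult) (auto simp: emeasure_cball_aux_integral)
  also have "real (d - 2) / 2 + 1 = real d / 2" using d by (simp add: of_nat_diff diff_divide_distrib)
  also have "ennreal ?r * ennreal (Beta (1 / 2) (real d / 2)) = 1"
  proof -
    have "Beta (1 / 2) (real d / 2) > 0" using d by (simp add: Beta_def Gamma_real_pos)
    moreover have "?r = 1 / Beta (1 / 2) (real d / 2)" using d by (intro sphere_area_ratio) simp
    moreover have "ennreal (1 / b) * ennreal b = 1" if "b > 0" for b :: real
      using that by (simp flip: ennreal_mult)
    ultimately show ?thesis by (simp only:)
  qed
  finally show "emeasure (gegen_measure d) (space (gegen_measure d)) = 1" .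
qed

lemma integrable_gegen_measure:
  assumes d: "d \<ge> 2" and "f \<in> borel_measurable borel" "\<And>u. u \<in> {-1..1} \<Longrightarrow> \<bar>f u\<bar> \<le> B"
  shows "integrable (gegen_measure d) (f :: real \<Rightarrow> real)"
proof -
  interpret prob_space "gegen_measure d" by (rule prob_space_gegen_measure[OF d])
  show ?thesis
  proof (rule integrable_const_bound[where B = B])
    show "AE u in gegen_measure d. norm (f u) \<le> B"
      using AE_gegen_measure by eventually_elim (use assms(3) in simp)
    show "f \<in> borel_measurable (gegen_measure d)"
      using assms(2) by (subst measurable_cong_sets[OF sets_gegen_measure refl])
  qed
qed

lemma continuous_bounded_Icc:
  fixes f :: "real \<Rightarrow> real"
  assumes "continuous_on UNIV f"
  shows "\<exists>B. \<forall>u\<in>{a..b}. \<bar>f u\<bar> \<le> B"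
proof -
  have "compact (f ` {a..b})"
    by (intro compact_continuous_image continuous_on_subset[OF assms]) auto
  hence "bounded (f ` {a..b})" by (rule compact_imp_bounded)
  thus ?thesis by (auto simp: bounded_iff)
qed

lemma integrable_gegen_continuous:
  assumes d: "d \<ge> 2" and f: "continuous_on UNIV f"
  shows "integrable (gegen_measure d) (f :: real \<Rightarrow> real)"
proof -
  obtain B where B: "\<And>u. u \<in> {-1..1} \<Longrightarrow> \<bar>f u\<bar> \<le> B"
    using continuous_bounded_Icc[OF f, of "-1" 1] by blast
  thus ?thesis
    using f B by (intro integrable_gegen_measure[OF d]) (auto intro: borel_measurable_continuous_onI)
qed

text \<open>Integrate the derivative of \<open>u ^ (n + 1) * (1 - u\<^sup>2) powr s\<close> with
  \<open>s = d / 2\<close>: the boundary terms vanish, and what remains links the moments of order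
  \<open>n\<close> and \<open>n + 2\<close>. The first moment comes from
  \<open>(1 - u\<^sup>2) powr s\<close> itself in the same way.\<close>

lemma integral_gegen_power_rec:
  assumes d: "d \<ge> 2"
  shows "(real n + 1 + real d) * (\<integral>u. u ^ (n + 2) \<partial>gegen_measure d) = (real n + 1) * (\<integral>u. u ^ n \<partial>gegen_measure d)"
    and "(\<integral>u. u \<partial>gegen_measure d) = 0"
proof -
  define s where "s = real d / 2"
  have s: "s \<ge> 1" using d by (simp add: s_def)
  let ?r = "sphere_area (d - 1) / sphere_area d"
  have int: "set_integrable lborel {-1..1} (\<lambda>u. f u * (1 - u\<^sup>2) powr (s - 1))"
    if f: "continuous_on UNIV f" for f :: "real \<Rightarrow> real"
  proof -
    have [measurable]: "f \<in> borel_measurable borel" using f by (rule borel_measurable_continuous_onI)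
    obtain B where B: "\<And>u. u \<in> {-1..1} \<Longrightarrow> \<bar>f u\<bar> \<le> B"
      using continuous_bounded_Icc[OF f, of "-1" 1] by blast
    show ?thesis
      unfolding set_integrable_def
    proof (rule integrableI_bounded_set_indicator[where B = B])
      show "AE u in lborel. u \<in> {-1..1} \<longrightarrow> norm (f u * (1 - u\<^sup>2) powr (s - 1)) \<le> B"
      proof (intro AE_I2 impI)
        fix u :: real assume u: "u \<in> {-1..1}"
        have "u\<^sup>2 \<le> 1" using u by (auto simp: abs_square_le_1)
        hence "(1 - u\<^sup>2) powr (s - 1) \<le> 1" using s by (intro powr_le1) auto
        hence "\<bar>f u\<bar> * (1 - u\<^sup>2) powr (s - 1) \<le> B * 1" using B[OF u] by (intro mult_mono) auto
        thus "norm (f u * (1 - u\<^sup>2) powr (s - 1)) \<le> B" by (simp add: abs_mult)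
      qed
    qed auto
  qed
  have zero: "(LINT u:{-1..1}|lborel. f u * (1 - u\<^sup>2) powr (s - 1)) = 0"
    if f: "continuous_on UNIV f" and F: "continuous_on UNIV G"
     and D: "\<And>u. -1 < u \<Longrightarrow> u < 1 \<Longrightarrow> ((\<lambda>u. G u * (1 - u\<^sup>2) powr s) has_real_derivative f u * (1 - u\<^sup>2) powr (s - 1)) (at u)"
   for f G :: "real \<Rightarrow> real"
  proof -
    have "((\<lambda>u. f u * (1 - u\<^sup>2) powr (s - 1)) has_integral
        (G 1 * (1 - 1\<^sup>2) powr s - G (-1) * (1 - (-1)\<^sup>2) powr s)) {-1..1}"
    proof (rule fundamental_theorem_of_calculus_interior)
      show "continuous_on {-1..1} (\<lambda>u. G u * (1 - u\<^sup>2) powr s)"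
        using s F by (intro continuous_intros continuous_on_powr' continuous_on_subset[OF F])
            (auto simp: abs_square_le_1 simp flip: abs_le_iff)
    qed (use D in \<open>auto simp: has_real_derivative_iff_has_vector_derivative\<close>)
    thus ?thesis using set_borel_integral_eq_integral(2)[OF int[OF f]] by (simp add: integral_unique)
  qed
  have "(LINT u:{-1..1}|lborel. (real (n + 1) * u ^ n * (1 - u\<^sup>2) - 2 * s * u ^ (n + 2)) * (1 - u\<^sup>2) powr (s - 1)) = 0"
  proof (rule zero[of _ "\<lambda>u. u ^ (n + 1)"])
    fix u :: real assume u: "-1 < u" "u < 1"
    hence u2: "1 - u\<^sup>2 > 0" by (simp add: abs_square_less_1 abs_less_iff)
    have P: "(1 - u\<^sup>2) powr s = (1 - u\<^sup>2) powr (s - 1) * (1 - u\<^sup>2)"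
      using u2 powr_add[of "1 - u\<^sup>2" "s - 1" 1] by simp
    have D1: "((\<lambda>u. u ^ (n + 1)) has_real_derivative real (n + 1) * u ^ n) (at u)"
      using DERIV_pow[of "n + 1" u] by simp
    have D2: "((\<lambda>u. (1 - u\<^sup>2) powr s) has_real_derivative s * (1 - u\<^sup>2) powr (s - 1) * (- 2 * u)) (at u)"
      using u2 by (auto intro!: derivative_eq_intros simp: powr_diff field_simps)
    show "((\<lambda>u. u ^ (n + 1) * (1 - u\<^sup>2) powr s) has_real_derivative
        (real (n + 1) * u ^ n * (1 - u\<^sup>2) - 2 * s * u ^ (n + 2)) * (1 - u\<^sup>2) powr (s - 1)) (at u)"
      by (rule DERIV_cong[OF DERIV_mult[OF D1 D2]], unfold P) (simp add: algebra_simps power2_eq_square)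
  qed (auto intro!: continuous_intros)
  also have "(\<lambda>u. (real (n + 1) * u ^ n * (1 - u\<^sup>2) - 2 * s * u ^ (n + 2)) * (1 - u\<^sup>2) powr (s - 1)) =
    (\<lambda>u. real (n + 1) * (u ^ n * (1 - u\<^sup>2) powr (s - 1)) - (real n + 1 + real d) * (u ^ (n + 2) * (1 - u\<^sup>2) powr (s - 1)))"
    by (auto simp: fun_eq_iff s_def algebra_simps power2_eq_square)
  also have "(LINT u:{-1..1}|lborel. real (n + 1) * (u ^ n * (1 - u\<^sup>2) powr (s - 1)) - (real n + 1 + real d) * (u ^ (n + 2) * (1 - u\<^sup>2) powr (s - 1))) =
    real (n + 1) * (LINT u:{-1..1}|lborel. u ^ n * (1 - u\<^sup>2) powr (s - 1)) -
    (real n + 1 + real d) * (LINT u:{-1..1}|lborel. u ^ (n + 2) * (1 - u\<^sup>2) powr (s - 1))"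
    by (subst set_integral_diff) (auto intro!: int continuous_intros set_integrable_mult_right)
  finally have e: "(real n + 1 + real d) * (LINT u:{-1..1}|lborel. u ^ (n + 2) * (1 - u\<^sup>2) powr (s - 1)) =
     (real n + 1) * (LINT u:{-1..1}|lborel. u ^ n * (1 - u\<^sup>2) powr (s - 1))"
    by (simp add: add.commute)
  have I: "(\<integral>u. u ^ m \<partial>gegen_measure d) = ?r * (LINT u:{-1..1}|lborel. u ^ m * (1 - u\<^sup>2) powr (s - 1))" for m
    unfolding s_def by (rule integral_gegen_measure) simp
  show "(real n + 1 + real d) * (\<integral>u. u ^ (n + 2) \<partial>gegen_measure d) = (real n + 1) * (\<integral>u. u ^ n \<partial>gegen_measure d)"
    unfolding I mult.left_commute[of _ ?r] e ..
  have "(LINT u:{-1..1}|lborel. u * (1 - u\<^sup>2) powr (s - 1)) = 0"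
  proof (rule zero[of _ "\<lambda>u. - 1 / (2 * s)"])
    fix u :: real assume u: "-1 < u" "u < 1"
    hence u2: "1 - u\<^sup>2 > 0" by (simp add: abs_square_less_1 abs_less_iff)
    have D2: "((\<lambda>u. (1 - u\<^sup>2) powr s) has_real_derivative s * (1 - u\<^sup>2) powr (s - 1) * (- 2 * u)) (at u)"
      using u2 by (auto intro!: derivative_eq_intros simp: powr_diff field_simps)
    show "((\<lambda>u. - 1 / (2 * s) * (1 - u\<^sup>2) powr s) has_real_derivative u * (1 - u\<^sup>2) powr (s - 1)) (at u)"
      by (rule DERIV_cong[OF DERIV_cmult[OF D2]]) (use s in simp)
  qed (auto intro!: continuous_intros)
  thus "(\<integral>u. u \<partial>gegen_measure d) = 0"
    using I[of 1] by simp
qed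

lemma integral_gegen_power:
  assumes d: "d \<ge> 2"
  shows "(\<integral>u. u ^ n \<partial>gegen_measure d) = gegen_moment ((real d + 1) / 2) n 0"
proof (induction n rule: nat_induct2)
  case 0
  interpret prob_space "gegen_measure d" by (rule prob_space_gegen_measure[OF d])
  show ?case using prob_space by (simp add: gegen_moment_def)
next
  case 1
  show ?case using integral_gegen_power_rec(2)[OF d] by (simp add: gegen_moment_def)
next
  case (step n)
  let ?\<nu> = "(real d + 1) / 2"
  show ?case
  proof (cases "even n")
    case True
    then obtain j where n: "n = 0 + 2 * j" by auto
    have n2: "n + 2 = 0 + 2 * Suc j" using n by simp
    have p: "pochhammer ?\<nu> j > 0" by (intro pochhammer_pos) auto
    have m: "gegen_moment ?\<nu> n 0 = fact (2 * j) / (2 ^ (2 * j) * fact j * pochhammer ?\<nu> j)"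
      using gegen_moment_add[of ?\<nu> 0 j] by (simp add: n)
    have m2: "gegen_moment ?\<nu> (n + 2) 0 = (real n + 1) * (2 * real j + 2) * fact (2 * j) /
         (4 * 2 ^ (2 * j) * ((real j + 1) * fact j) * (pochhammer ?\<nu> j * (?\<nu> + real j)))"
      using gegen_moment_add[of ?\<nu> 0 "Suc j"] unfolding n2[symmetric]
      by (simp add: n pochhammer_Suc algebra_simps)
    have "(real n + 1 + real d) * gegen_moment ?\<nu> (n + 2) 0 = (real n + 1) * gegen_moment ?\<nu> n 0"
    proof -
      have g: "(2 * e) * (a * (2 * b) * f / (4 * q * (b * h) * (p * e))) = a * (f / (q * h * p))"
        if "b > 0" "e > 0" for a b e f q h p :: real using that by (simp add: field_simps)
      have e: "real n + 1 + real d = 2 * (?\<nu> + real j)" "2 * real j + 2 = 2 * (real j + 1)"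
        by (simp_all add: n field_simps)
      show ?thesis unfolding m m2 unfolding e by (rule g) (auto intro: add_pos_nonneg)
    qed
    also have "\<dots> = (real n + 1 + real d) * (\<integral>u. u ^ (n + 2) \<partial>gegen_measure d)"
      using integral_gegen_power_rec(1)[OF d, of n] step by simp
    finally show ?thesis by simp
  next
    case False
    hence "gegen_moment ?\<nu> n 0 = 0" "gegen_moment ?\<nu> (n + 2) 0 = 0"
      by (simp_all add: gegen_moment_eq_0)
    hence "(real n + 1 + real d) * (\<integral>u. u ^ (n + 2) \<partial>gegen_measure d) = 0"
      using integral_gegen_power_rec(1)[OF d, of n] step by simp
    thus ?thesis using \<open>gegen_moment ?\<nu> (n + 2) 0 = 0\<close> by (simp add: add_nonneg_eq_0_iff)
  qed
qed

lemma continuous_on_gegenbauer_P: "continuous_on A (gegenbauer_P d k)"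
  unfolding gegenbauer_P_def gegenbauer_def divide_inverse by (intro continuous_intros)

lemma continuous_on_gegenbauer_P' [continuous_intros]:
  "continuous_on A f \<Longrightarrow> continuous_on A (\<lambda>x. gegenbauer_P d k (f x))"
  by (rule continuous_on_compose2[OF continuous_on_gegenbauer_P[of UNIV]]) auto

text \<open>The three-term recurrence gives the integrals the same recurrence in \<open>k\<close>
  that \<open>gegen_moment_rec\<close> gives the explicit numbers; for \<open>k = 0\<close> both are
  the plain moments.\<close>

lemma integral_gegen_power_gegenbauer_P:
  assumes d: "d \<ge> 2"
  shows "(\<integral>u. u ^ n * gegenbauer_P d k u \<partial>gegen_measure d) = gegen_moment ((real d + 1) / 2) n k"
proof (induction k arbitrary: n rule: less_induct)
  case (less k)
  let ?\<nu> = "(real d + 1) / 2"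
  have \<nu>: "?\<nu> > 1" using d by simp
  show ?case
  proof (cases k)
    case 0
    thus ?thesis using integral_gegen_power[OF d] d by simp
  next
    case (Suc i)
    have int: "integrable (gegen_measure d) (\<lambda>u. c * u ^ m * gegenbauer_P d j u)" for c m j
      by (intro integrable_gegen_continuous[OF d] continuous_intros)
    have "(2 * ?\<nu> - 2 + real i) * (\<integral>u. u ^ n * gegenbauer_P d k u \<partial>gegen_measure d) =
      (\<integral>u. 2 * (real i + ?\<nu> - 1) * u ^ (n + 1) * gegenbauer_P d i u - real i * u ^ n * gegenbauer_P d (i - 1) u \<partial>gegen_measure d)"
      unfolding Bochner_Integration.integral_mult_right_zero[symmetric]
    proof (intro Bochner_Integration.integral_cong refl)
      fix u
      have "(2 * ?\<nu> - 2 + real i) * (u ^ n * gegenbauer_P d k u) =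
        u ^ n * ((2 * ?\<nu> - 2 + real i) * gegenbauer_P d (i + 1) u)" by (simp add: Suc)
      also have "(2 * ?\<nu> - 2 + real i) * gegenbauer_P d (i + 1) u =
         2 * (real i + ?\<nu> - 1) * u * gegenbauer_P d i u - real i * gegenbauer_P d (i - 1) u"
        using gegenbauer_P_rec[OF d, of i u] by simp
      finally show "(2 * ?\<nu> - 2 + real i) * (u ^ n * gegenbauer_P d k u) =
        2 * (real i + ?\<nu> - 1) * u ^ (n + 1) * gegenbauer_P d i u - real i * u ^ n * gegenbauer_P d (i - 1) u"
        by (simp add: right_diff_distrib mult_ac)
    qed
    also have "\<dots> = (\<integral>u. 2 * (real i + ?\<nu> - 1) * u ^ (n + 1) * gegenbauer_P d i u \<partial>gegen_measure d) -
       (\<integral>u. real i * u ^ n * gegenbauer_P d (i - 1) u \<partial>gegen_measure d)"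
      by (rule Bochner_Integration.integral_diff) (rule int)+
    also have "\<dots> = 2 * (real i + ?\<nu> - 1) * (\<integral>u. u ^ (n + 1) * gegenbauer_P d i u \<partial>gegen_measure d) -
       real i * (\<integral>u. u ^ n * gegenbauer_P d (i - 1) u \<partial>gegen_measure d)"
      by (simp only: mult.assoc Bochner_Integration.integral_mult_right_zero)
    also have "\<dots> = 2 * (real i + ?\<nu> - 1) * gegen_moment ?\<nu> (n + 1) i - real i * gegen_moment ?\<nu> n (i - 1)"
    proof -
      have 1: "(\<integral>u. u ^ (n + 1) * gegenbauer_P d i u \<partial>gegen_measure d) = gegen_moment ?\<nu> (n + 1) i"
        by (rule less.IH) (simp add: Suc)
      have 2: "(\<integral>u. u ^ n * gegenbauer_P d (i - 1) u \<partial>gegen_measure d) = gegen_moment ?\<nu> n (i - 1)"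
        by (rule less.IH) (simp add: Suc)
      show ?thesis unfolding 1 2 ..
    qed
    also have "\<dots> = (2 * ?\<nu> - 2 + real i) * gegen_moment ?\<nu> n k"
      using gegen_moment_rec[of ?\<nu> i n] \<nu> Suc by simp
    finally have *: "(2 * ?\<nu> - 2 + real i) * (\<integral>u. u ^ n * gegenbauer_P d k u \<partial>gegen_measure d) =
       (2 * ?\<nu> - 2 + real i) * gegen_moment ?\<nu> n k" .
    have "2 * ?\<nu> - 2 + real i \<noteq> 0" using \<nu> by linarith
    thus ?thesis using * by (rule mult_left_cancel[THEN iffD1])
  qed
qed

text \<open>Chu--Vandermonde, in the form needed for the product structure of the mixed moments.\<close>

lemma sum_recip_fact_pochhammer:
  assumes \<nu>: "\<nu> > (0::real)"
  shows "(\<Sum>j\<le>min p q. 1 / (fact (p - j) * fact (q - j) * fact j * pochhammer \<nu> j)) =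
     pochhammer \<nu> (p + q) / (fact p * fact q * pochhammer \<nu> p * pochhammer \<nu> q)"
proof -
  have pos: "pochhammer \<nu> i > 0" for i using \<nu> by (intro pochhammer_pos)
  have "(\<Sum>j\<le>min p q. 1 / (fact (p - j) * fact (q - j) * fact j * pochhammer \<nu> j)) =
    (\<Sum>j\<le>min p q. real (q choose j) * ((\<nu> + real p - 1) gchoose (p - j)) / (fact q * pochhammer \<nu> p))"
  proof (intro sum.cong refl)
    fix j assume "j \<in> {..min p q}"
    hence j: "j \<le> p" "j \<le> q" by auto
    have "pochhammer \<nu> p = pochhammer \<nu> j * pochhammer (\<nu> + real j) (p - j)"
      using j by (metis pochhammer_product)
    moreover have "(\<nu> + real p - 1) gchoose (p - j) = pochhammer (\<nu> + real j) (p - j) / fact (p - j)"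
      unfolding gbinomial_pochhammer' using j by (simp add: of_nat_diff)
    ultimately show "1 / (fact (p - j) * fact (q - j) * fact j * pochhammer \<nu> j) =
      real (q choose j) * ((\<nu> + real p - 1) gchoose (p - j)) / (fact q * pochhammer \<nu> p)"
      using j pos[of j] pochhammer_pos[of "\<nu> + real j" "p - j"] \<nu> by (simp add: binomial_fact divide_simps)
  qed
  also have "\<dots> = (\<Sum>j\<le>p. real (q choose j) * ((\<nu> + real p - 1) gchoose (p - j)) / (fact q * pochhammer \<nu> p))"
    by (rule sum.mono_neutral_left) (auto simp: binomial_eq_0)
  also have "\<dots> = (\<Sum>j=0..p. (real q gchoose j) * ((\<nu> + real p - 1) gchoose (p - j))) / (fact q * pochhammer \<nu> p)"
    by (simp add: sum_divide_distrib atLeast0AtMost binomial_gbinomial)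
  also have "\<dots> = ((real q + (\<nu> + real p - 1)) gchoose p) / (fact q * pochhammer \<nu> p)"
    by (simp only: gbinomial_Vandermonde)
  also have "(real q + (\<nu> + real p - 1)) gchoose p = pochhammer (\<nu> + real q) p / fact p"
    unfolding gbinomial_pochhammer' by (simp add: algebra_simps)
  also have "pochhammer (\<nu> + real q) p = pochhammer \<nu> (p + q) / pochhammer \<nu> q"
    using pochhammer_product'[of \<nu> q p] pos[of q] by (simp add: add.commute field_simps)
  finally show ?thesis by (simp add: mult_ac)
qed

text \<open>The left-hand side adds up the \<open>k\<close>-th ultraspherical coefficients of the
  powers \<open>(x \<bullet> y) ^ n\<close> that occur in a mixed moment of unit vectors. Parity
  leaves only \<open>n = k + 2 * j\<close>, and the sum over \<open>j\<close> is
  \<open>sum_recip_fact_pochhammer\<close> at \<open>\<nu> + k\<close>.\<close>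

lemma gegen_moment_product_sum:
  assumes \<nu>: "\<nu> > 0" and pq: "p + q = 2 * l"
  shows "(\<Sum>n\<le>l. if n \<le> p \<and> n \<le> q \<and> even (p - n) then
      fact p * fact q / (4 ^ l * pochhammer \<nu> l) *
      (2 ^ n / (fact n * fact ((p - n) div 2) * fact ((q - n) div 2)) * gegen_moment \<nu> n k) else 0) =
    gegen_moment \<nu> p k * gegen_moment \<nu> q k" (is "(\<Sum>n\<le>l. ?f n) = _")
proof (cases "k \<le> p \<and> k \<le> q \<and> even (p - k)")
  case False
  have "?f n = 0" for n
  proof (cases "n \<le> p \<and> n \<le> q \<and> even (p - n)")
    case True
    hence "n < k \<or> odd (n + k)" using False by presburger
    thus ?thesis by (simp add: gegen_moment_eq_0)
  next
    case False
    thus ?thesis by (rule if_not_P)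
  qed
  moreover have "p < k \<or> q < k \<or> odd (p + k)" using False by presburger
  ultimately show ?thesis by (auto simp: gegen_moment_eq_0)
next
  case True
  then obtain P where P: "p = k + 2 * P" by (metis evenE le_add_diff_inverse)
  have "even (q - k)" using True pq by presburger
  then obtain Q where Q: "q = k + 2 * Q" using True by (metis evenE le_add_diff_inverse)
  have l: "l = k + (P + Q)" using pq P Q by simp
  define C where "C = fact p * fact q / (4 ^ l * pochhammer \<nu> l * pochhammer \<nu> k)"
  have pos: "pochhammer \<nu> i > 0" "pochhammer (\<nu> + real k) i > 0" for i
    using \<nu> by (auto intro!: pochhammer_pos)
  have "(\<Sum>n\<le>l. ?f n) = (\<Sum>n\<in>(\<lambda>j. k + 2 * j) ` {..min P Q}. ?f n)"
  proof (rule sum.mono_neutral_right)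
    show "\<forall>n\<in>{..l} - (\<lambda>j. k + 2 * j) ` {..min P Q}. ?f n = 0"
    proof
      fix n assume n: "n \<in> {..l} - (\<lambda>j. k + 2 * j) ` {..min P Q}"
      show "?f n = 0"
      proof (cases "n \<le> p \<and> n \<le> q \<and> even (p - n) \<and> k \<le> n \<and> even (n - k)")
        case True
        then obtain j where j: "n = k + 2 * j" by (metis evenE le_add_diff_inverse)
        have "j \<le> min P Q" using True unfolding j P Q by auto
        thus ?thesis using n j by auto
      next
        case False
        show ?thesis
        proof (cases "n \<le> p \<and> n \<le> q \<and> even (p - n)")
          case True
          hence "n < k \<or> odd (n + k)" using False by presburger
          thus ?thesis by (simp add: gegen_moment_eq_0)
        next
          case False
          thus ?thesis by (rule if_not_P)
        qed
      qed
    qed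
  qed (use l in auto)
  also have "\<dots> = (\<Sum>j\<le>min P Q. ?f (k + 2 * j))"
    by (subst sum.reindex) (auto simp: inj_on_def)
  also have "\<dots> = (\<Sum>j\<le>min P Q. C * (1 / (fact (P - j) * fact (Q - j) * fact j * pochhammer (\<nu> + real k) j)))"
  proof (intro sum.cong refl)
    fix j assume "j \<in> {..min P Q}"
    hence j: "j \<le> P" "j \<le> Q" by auto
    have d: "(p - (k + 2 * j)) div 2 = P - j" "(q - (k + 2 * j)) div 2 = Q - j" using P Q j by auto
    have c: "k + 2 * j \<le> p \<and> k + 2 * j \<le> q \<and> even (p - (k + 2 * j))" using P Q j by auto
    have m: "gegen_moment \<nu> (k + 2 * j) k = fact (k + 2 * j) / (2 ^ (k + 2 * j) * fact j * (pochhammer \<nu> k * pochhammer (\<nu> + real k) j))"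
      by (simp only: gegen_moment_add pochhammer_product')
    show "?f (k + 2 * j) = C * (1 / (fact (P - j) * fact (Q - j) * fact j * pochhammer (\<nu> + real k) j))"
      unfolding if_P[OF c] d m C_def by simp
  qed
  also have "\<dots> = C * (pochhammer (\<nu> + real k) (P + Q) /
      (fact P * fact Q * pochhammer (\<nu> + real k) P * pochhammer (\<nu> + real k) Q))"
    using \<nu> by (simp only: sum_distrib_left[symmetric] sum_recip_fact_pochhammer add_pos_nonneg of_nat_0_le_iff)
  also have "\<dots> = gegen_moment \<nu> p k * gegen_moment \<nu> q k"
  proof -
    have 2: "(2::real) ^ (k + 2 * P) * 2 ^ (k + 2 * Q) = 4 ^ l"
    proof -
      have "(4::real) ^ l = 2 ^ (2 * l)" by (simp add: power_mult)
      thus ?thesis by (simp add: l power_add mult_2 power_mult_distrib)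
    qed
    have "gegen_moment \<nu> p k * gegen_moment \<nu> q k = fact p * fact q / ((2 ^ (k + 2 * P) * 2 ^ (k + 2 * Q)) *
      (fact P * fact Q * (pochhammer \<nu> k * pochhammer (\<nu> + real k) P) * (pochhammer \<nu> k * pochhammer (\<nu> + real k) Q)))"
      by (simp add: P Q gegen_moment_add pochhammer_product')
    also have "\<dots> = C * (pochhammer (\<nu> + real k) (P + Q) /
      (fact P * fact Q * pochhammer (\<nu> + real k) P * pochhammer (\<nu> + real k) Q))"
    proof -
      have l': "pochhammer \<nu> l = pochhammer \<nu> k * pochhammer (\<nu> + real k) (P + Q)"
        unfolding l by (rule pochhammer_product')
      have "a / (w * (f * g * (h * r) * (h * s))) = a / (w * (h * t) * h) * (t / (f * g * r * s))"
        if "t > 0" for a w f g h r s t :: real using that by simp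
      thus ?thesis unfolding C_def 2 l' using pos(2)[of "P + Q"] by simp
    qed
    finally show ?thesis ..
  qed
  finally show ?thesis .
qed

text \<open>The average of \<open>(x \<bullet> z) ^ p * (y \<bullet> z) ^ q\<close> over the sphere
  as a polynomial in \<open>u = x \<bullet> y\<close>, so that it can be integrated in
  \<open>u\<close> without choosing vectors. The sum stops at \<open>p\<close> because the moments
  vanish beyond.\<close>

definition gegen_product :: "nat \<Rightarrow> nat \<Rightarrow> nat \<Rightarrow> real \<Rightarrow> real" where
  "gegen_product d p q u = (\<Sum>k\<le>p. gegen_moment ((real d + 1) / 2) p k * gegen_moment ((real d + 1) / 2) q k *
      harmonic_dim d k * gegenbauer_P d k u)"

lemma integral_sphere_inner_powers_gegenbauer:
  fixes x y :: "real ^ 'n::{finite, wellorder}"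
  assumes d: "d \<ge> 2" and dim: "CARD('n) = d + 1" and xy: "norm x = 1" "norm y = 1"
  shows "(LINT z|sphere_measure. (x \<bullet> z) ^ p * (y \<bullet> z) ^ q) = gegen_product d p q (x \<bullet> y)"
proof (cases "even (p + q)")
  case False
  have "gegen_moment \<nu> p k * gegen_moment \<nu> q k = 0" for k \<nu>
    using False by (cases "even (p + k)") (auto simp: gegen_moment_eq_0)
  hence "gegen_product d p q (x \<bullet> y) = 0"
    unfolding gegen_product_def by (intro sum.neutral ballI) simp
  thus ?thesis using False by (simp add: integral_sphere_inner_powers_odd)
next
  case True
  then obtain l where l: "p + q = 2 * l" by blast
  define \<nu> where "\<nu> = (real d + 1) / 2"
  have \<nu>: "\<nu> > 0" by (simp add: \<nu>_def add_nonneg_pos)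
  have N: "CARD('n) / 2 = \<nu>" by (simp add: dim \<nu>_def)
  define c where "c n = (if n \<le> p \<and> n \<le> q \<and> even (p - n) then
      fact p * fact q / (4 ^ l * pochhammer \<nu> l) *
      (2 ^ n / (fact n * fact ((p - n) div 2) * fact ((q - n) div 2))) else 0)" for n
  have "(LINT z|sphere_measure. (x \<bullet> z) ^ p * (y \<bullet> z) ^ q) = (\<Sum>n\<le>l. c n * (x \<bullet> y) ^ n)"
    unfolding integral_sphere_inner_powers[OF l] N sum_distrib_left
  proof (intro sum.cong refl)
    fix n
    let ?X = "(2 * (x \<bullet> y)) ^ n / (fact n * fact ((p - n) div 2) * fact ((q - n) div 2)) * norm x ^ (p - n) * norm y ^ (q - n)"
    show "fact p * fact q / (4 ^ l * pochhammer \<nu> l) * (if n \<le> p \<and> n \<le> q \<and> even (p - n) then ?X else 0) = c n * (x \<bullet> y) ^ n"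
    proof (cases "n \<le> p \<and> n \<le> q \<and> even (p - n)")
      case True
      show ?thesis unfolding c_def if_P[OF True] xy by (simp add: power_mult_distrib)
    next
      case False
      show ?thesis unfolding c_def if_not_P[OF False] by simp
    qed
  qed
  also have "\<dots> = (\<Sum>n\<le>l. c n * (\<Sum>k\<le>p. gegen_moment \<nu> n k * harmonic_dim d k * gegenbauer_P d k (x \<bullet> y)))"
  proof (intro sum.cong refl)
    fix n
    show "c n * (x \<bullet> y) ^ n = c n * (\<Sum>k\<le>p. gegen_moment \<nu> n k * harmonic_dim d k * gegenbauer_P d k (x \<bullet> y))"
    proof (cases "n \<le> p")
      case True
      show ?thesis unfolding \<nu>_def by (simp only: power_gegenbauer_expansion[OF d True])
    qed (simp add: c_def)
  qed
  also have "\<dots> = (\<Sum>k\<le>p. (\<Sum>n\<le>l. c n * gegen_moment \<nu> n k) * harmonic_dim d k * gegenbauer_P d k (x \<bullet> y))"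
    unfolding sum_distrib_left sum_distrib_right by (subst sum.swap) (simp add: mult.assoc)
  also have "\<dots> = (\<Sum>k\<le>p. (gegen_moment \<nu> p k * gegen_moment \<nu> q k) * harmonic_dim d k * gegenbauer_P d k (x \<bullet> y))"
  proof (intro sum.cong refl arg_cong2[where f = "(*)"])
    fix k
    have "(\<Sum>n\<le>l. c n * gegen_moment \<nu> n k) = (\<Sum>n\<le>l. if n \<le> p \<and> n \<le> q \<and> even (p - n) then
      fact p * fact q / (4 ^ l * pochhammer \<nu> l) *
      (2 ^ n / (fact n * fact ((p - n) div 2) * fact ((q - n) div 2)) * gegen_moment \<nu> n k) else 0)"
      unfolding c_def by (intro sum.cong refl) (simp only: if_distrib[of "\<lambda>t. t * _"] mult_zero_left mult.assoc)
    thus "(\<Sum>n\<le>l. c n * gegen_moment \<nu> n k) = gegen_moment \<nu> p k * gegen_moment \<nu> q k"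
      by (simp only: gegen_moment_product_sum[OF \<nu> l])
  qed
  finally show ?thesis by (simp add: gegen_product_def \<nu>_def)
qed

text \<open>Expand \<open>u ^ j\<close> in the \<open>P\<^sub>i\<close> with
  \<open>i \<le> j\<close> and integrate against \<open>P\<^sub>k\<close>. For \<open>j < k\<close>
  the total is 0 and the terms \<open>i < j\<close> vanish by induction, hence so does the term
  \<open>i = j\<close>. For \<open>j = k\<close> the same comparison yields the norm.\<close>

lemma
  assumes d: "d \<ge> 2"
  shows gegenbauer_P_orthogonal: "j < k \<Longrightarrow> (\<integral>u. gegenbauer_P d j u * gegenbauer_P d k u \<partial>gegen_measure d) = 0"
    and gegenbauer_P_norm: "(\<integral>u. gegenbauer_P d k u * gegenbauer_P d k u \<partial>gegen_measure d) = 1 / harmonic_dim d k"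
proof -
  let ?\<nu> = "(real d + 1) / 2"
  have int: "integrable (gegen_measure d) (\<lambda>u. c * (gegenbauer_P d i u * gegenbauer_P d k u))" for c i k
    by (intro integrable_gegen_continuous[OF d] continuous_intros)
  have exp: "gegen_moment ?\<nu> j k = (\<Sum>i\<le>j. gegen_moment ?\<nu> j i * harmonic_dim d i *
      (\<integral>u. gegenbauer_P d i u * gegenbauer_P d k u \<partial>gegen_measure d))" for j k
  proof -
    have "gegen_moment ?\<nu> j k = (\<integral>u. u ^ j * gegenbauer_P d k u \<partial>gegen_measure d)"
      by (rule integral_gegen_power_gegenbauer_P[OF d, symmetric])
    also have "\<dots> = (\<integral>u. (\<Sum>i\<le>j. (gegen_moment ?\<nu> j i * harmonic_dim d i) * (gegenbauer_P d i u * gegenbauer_P d k u)) \<partial>gegen_measure d)"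
      by (intro Bochner_Integration.integral_cong refl, subst power_gegenbauer_expansion[OF d order.refl])
         (simp add: sum_distrib_left sum_distrib_right mult_ac)
    also have "\<dots> = (\<Sum>i\<le>j. gegen_moment ?\<nu> j i * harmonic_dim d i *
      (\<integral>u. gegenbauer_P d i u * gegenbauer_P d k u \<partial>gegen_measure d))"
      by (subst Bochner_Integration.integral_sum) (use int in auto)
    finally show ?thesis .
  qed
  have nz: "gegen_moment ?\<nu> k k * harmonic_dim d k \<noteq> 0" for k
  proof -
    have "pochhammer ?\<nu> ((k + k) div 2) > 0" by (intro pochhammer_pos) (simp add: add_nonneg_pos)
    thus ?thesis using harmonic_dim_pos[OF d, of k] by (simp add: gegen_moment_def)
  qed
  show orth: "(\<integral>u. gegenbauer_P d j u * gegenbauer_P d k u \<partial>gegen_measure d) = 0" if "j < k" for j k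
    using that
  proof (induction j rule: less_induct)
    case (less j)
    have "0 = gegen_moment ?\<nu> j k" using less.prems by (simp add: gegen_moment_eq_0)
    also note exp
    also have "(\<Sum>i\<le>j. gegen_moment ?\<nu> j i * harmonic_dim d i *
      (\<integral>u. gegenbauer_P d i u * gegenbauer_P d k u \<partial>gegen_measure d)) =
      (\<Sum>i\<le>j. if i = j then gegen_moment ?\<nu> j i * harmonic_dim d i *
      (\<integral>u. gegenbauer_P d i u * gegenbauer_P d k u \<partial>gegen_measure d) else 0)"
      by (intro sum.cong refl) (use less in auto)
    finally show ?case using nz[of j] by simp
  qed
  have "gegen_moment ?\<nu> k k = (\<Sum>i\<le>k. if i = k then gegen_moment ?\<nu> k i * harmonic_dim d i *
      (\<integral>u. gegenbauer_P d i u * gegenbauer_P d k u \<partial>gegen_measure d) else 0)"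
    by (rule trans[OF exp], intro sum.cong refl) (use orth in auto)
  thus "(\<integral>u. gegenbauer_P d k u * gegenbauer_P d k u \<partial>gegen_measure d) = 1 / harmonic_dim d k"
    using nz[of k] by (simp add: field_simps)
qed

lemma gegenbauer_P_orthonormal:
  assumes "d \<ge> 2"
  shows "(\<integral>u. gegenbauer_P d j u * gegenbauer_P d k u \<partial>gegen_measure d) = (if j = k then 1 / harmonic_dim d k else 0)"
  using gegenbauer_P_orthogonal[OF assms, of j k] gegenbauer_P_orthogonal[OF assms, of k j]
    gegenbauer_P_norm[OF assms, of k]
  by (cases j k rule: linorder_cases) (auto simp: mult.commute)

definition gegenbauer_poly :: "nat \<Rightarrow> nat \<Rightarrow> real poly" where
  "gegenbauer_poly d k = smult (1 / gegenbauer ((real d - 1) / 2) k 1)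
     (\<Sum>j\<le>k div 2. monom ((-1) ^ j * pochhammer ((real d - 1) / 2) (k - j) / (fact j * fact (k - 2 * j)) * 2 ^ (k - 2 * j)) (k - 2 * j))"

lemma poly_gegenbauer_poly: "poly (gegenbauer_poly d k) t = gegenbauer_P d k t"
  by (simp add: gegenbauer_poly_def gegenbauer_P_def poly_sum poly_monom power_mult_distrib
      gegenbauer_def[of "(real d - 1) / 2" k t] mult_ac)

lemma degree_gegenbauer_poly_le: "degree (gegenbauer_poly d k) \<le> k"
  unfolding gegenbauer_poly_def
  by (intro order.trans[OF degree_smult_le] degree_sum_le) (auto intro: order.trans[OF degree_monom_le])

lemma lead_gegenbauer_poly:
  assumes "d \<ge> 2"
  shows "coeff (gegenbauer_poly d k) k \<noteq> 0"
proof -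
  let ?a = "(real d - 1) / 2"
  have "coeff (\<Sum>j\<le>k div 2. monom ((-1) ^ j * pochhammer ?a (k - j) / (fact j * fact (k - 2 * j)) * 2 ^ (k - 2 * j)) (k - 2 * j)) k =
    (\<Sum>j\<le>k div 2. if j = 0 then pochhammer ?a k / fact k * 2 ^ k else 0)"
    unfolding coeff_sum coeff_monom by (intro sum.cong refl) auto
  also have "\<dots> = pochhammer ?a k / fact k * 2 ^ k" by simp
  finally have "coeff (gegenbauer_poly d k) k = pochhammer ?a k / fact k * 2 ^ k / gegenbauer ?a k 1"
    by (simp add: gegenbauer_poly_def)
  moreover have "pochhammer ?a k > 0" using assms by (intro pochhammer_pos) simp
  moreover have "gegenbauer ?a k 1 > 0"
  proof -
    have "2 * ?a = real d - 1" by simp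
    thus ?thesis unfolding gegenbauer_at_1 by (simp only: pc_dim_pos[OF assms])
  qed
  ultimately show ?thesis by simp
qed

text \<open>Because mixed moments are sums of products, \<open>P\<^sub>k (x \<bullet> y) / Z\<close>
  is the average of \<open>P\<^sub>k (x \<bullet> z) * P\<^sub>k (y \<bullet> z)\<close>. The
  inequality of arithmetic and geometric means bounds it by the same averages with equal vectors,
  which are \<open>1 / Z\<close> since \<open>P\<^sub>k 1 = 1\<close>.\<close>

lemma gegenbauer_P_abs_le_1:
  fixes x y :: "real ^ 'n::{finite, wellorder}"
  assumes d: "d \<ge> 2" and dim: "CARD('n) = d + 1" and xy: "norm x = 1" "norm y = 1"
  shows "\<bar>gegenbauer_P d k (x \<bullet> y)\<bar> \<le> 1"
proof -
  let ?\<nu> = "(real d + 1) / 2"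
  define c where "c n = coeff (gegenbauer_poly d k) n" for n
  have P: "gegenbauer_P d k t = (\<Sum>n\<le>k. c n * t ^ n)" for t
    unfolding poly_gegenbauer_poly[symmetric] c_def poly_altdef
    by (rule sum.mono_neutral_left) (use degree_gegenbauer_poly_le in \<open>auto simp: coeff_eq_0\<close>)
  \<comment> \<open>Orthogonality of \<open>P\<^sub>k\<close> and \<open>P\<^sub>i\<close> read
    through the monomials of \<open>P\<^sub>k\<close>. Used once for each of the two factors below,
    it leaves only the term \<open>i = k\<close>.\<close>
  have cm: "(\<Sum>n\<le>k. c n * gegen_moment ?\<nu> n i) = (if i = k then 1 / harmonic_dim d k else 0)" for i
  proof -
    have int: "integrable (gegen_measure d) (\<lambda>u. c n * (u ^ n * gegenbauer_P d i u))" for n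
      by (intro integrable_gegen_continuous[OF d] continuous_intros)
    have "(\<Sum>n\<le>k. c n * gegen_moment ?\<nu> n i) = (\<integral>u. (\<Sum>n\<le>k. c n * (u ^ n * gegenbauer_P d i u)) \<partial>gegen_measure d)"
      by (subst Bochner_Integration.integral_sum) (use int in \<open>simp_all add: integral_gegen_power_gegenbauer_P[OF d]\<close>)
    also have "\<dots> = (\<integral>u. gegenbauer_P d k u * gegenbauer_P d i u \<partial>gegen_measure d)"
      by (intro Bochner_Integration.integral_cong refl) (simp add: P sum_distrib_right mult.assoc)
    also have "\<dots> = (if i = k then 1 / harmonic_dim d k else 0)"
      using gegenbauer_P_orthonormal[OF d, of k i] by auto
    finally show ?thesis .
  qed
  have intz: "integrable sphere_measure (\<lambda>z. gegenbauer_P d k (v \<bullet> z) * gegenbauer_P d k (w \<bullet> z))"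
    for v w :: "real ^ 'n::_"
  proof -
    have "integrable sphere_measure (\<lambda>z. \<Sum>n\<le>k. \<Sum>m\<le>k. c n * c m * ((v \<bullet> z) ^ n * (w \<bullet> z) ^ m))"
      by (intro Bochner_Integration.integrable_sum integrable_mult_right integrable_sphere_inner_powers)
    thus ?thesis by (simp add: P sum_product mult_ac)
  qed
  have E: "(LINT z|sphere_measure. gegenbauer_P d k (v \<bullet> z) * gegenbauer_P d k (w \<bullet> z)) =
      gegenbauer_P d k (v \<bullet> w) / harmonic_dim d k"
    if vw: "norm v = 1" "norm w = 1" for v w :: "real ^ 'n::_"
  proof -
    have "(LINT z|sphere_measure. gegenbauer_P d k (v \<bullet> z) * gegenbauer_P d k (w \<bullet> z)) =
      (LINT z|sphere_measure. (\<Sum>n\<le>k. \<Sum>m\<le>k. c n * c m * ((v \<bullet> z) ^ n * (w \<bullet> z) ^ m)))"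
      by (simp add: P sum_product mult_ac)
    also have "\<dots> = (\<Sum>n\<le>k. \<Sum>m\<le>k. c n * c m * gegen_product d n m (v \<bullet> w))"
      by (simp add: Bochner_Integration.integral_sum integrable_sphere_inner_powers
          integral_sphere_inner_powers_gegenbauer[OF d dim vw])
    also have "\<dots> = (\<Sum>n\<le>k. \<Sum>m\<le>k. c n * c m * (\<Sum>i\<le>k. gegen_moment ?\<nu> n i * gegen_moment ?\<nu> m i *
      harmonic_dim d i * gegenbauer_P d i (v \<bullet> w)))"
    proof (intro sum.cong refl arg_cong2[where f = "(*)"])
      fix n m assume "n \<in> {..k}"
      thus "gegen_product d n m (v \<bullet> w) = (\<Sum>i\<le>k. gegen_moment ?\<nu> n i * gegen_moment ?\<nu> m i *
        harmonic_dim d i * gegenbauer_P d i (v \<bullet> w))"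
        unfolding gegen_product_def by (intro sum.mono_neutral_left) (auto simp: gegen_moment_eq_0)
    qed
    also have "\<dots> = (\<Sum>i\<le>k. (\<Sum>n\<le>k. c n * gegen_moment ?\<nu> n i) * (\<Sum>m\<le>k. c m * gegen_moment ?\<nu> m i) *
        (harmonic_dim d i * gegenbauer_P d i (v \<bullet> w)))"
    proof -
      have "(\<Sum>n\<le>k. \<Sum>m\<le>k. c n * c m * (\<Sum>i\<le>k. gegen_moment ?\<nu> n i * gegen_moment ?\<nu> m i *
        harmonic_dim d i * gegenbauer_P d i (v \<bullet> w))) =
       (\<Sum>n\<le>k. \<Sum>m\<le>k. \<Sum>i\<le>k. c n * c m * (gegen_moment ?\<nu> n i * gegen_moment ?\<nu> m i *
        harmonic_dim d i * gegenbauer_P d i (v \<bullet> w)))"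
        by (simp only: sum_distrib_left)
      also have "\<dots> = (\<Sum>n\<le>k. \<Sum>i\<le>k. \<Sum>m\<le>k. c n * c m * (gegen_moment ?\<nu> n i * gegen_moment ?\<nu> m i *
        harmonic_dim d i * gegenbauer_P d i (v \<bullet> w)))"
        by (intro sum.cong refl sum.swap)
      also have "\<dots> = (\<Sum>i\<le>k. \<Sum>n\<le>k. \<Sum>m\<le>k. c n * c m * (gegen_moment ?\<nu> n i * gegen_moment ?\<nu> m i *
        harmonic_dim d i * gegenbauer_P d i (v \<bullet> w)))"
        by (rule sum.swap)
      also have "\<dots> = (\<Sum>i\<le>k. (\<Sum>n\<le>k. c n * gegen_moment ?\<nu> n i) * (\<Sum>m\<le>k. c m * gegen_moment ?\<nu> m i) *
        (harmonic_dim d i * gegenbauer_P d i (v \<bullet> w)))"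
        by (intro sum.cong refl) (simp add: sum_product sum_distrib_left sum_distrib_right mult_ac)
      finally show ?thesis .
    qed
    also have "\<dots> = (\<Sum>i\<le>k. if i = k then gegenbauer_P d k (v \<bullet> w) / harmonic_dim d k else 0)"
      unfolding cm using harmonic_dim_pos[OF d, of k] by (intro sum.cong refl) auto
    finally show ?thesis by simp
  qed
  let ?h = "harmonic_dim d k"
  have h: "?h > 0" by (rule harmonic_dim_pos[OF d])
  have "\<bar>gegenbauer_P d k (x \<bullet> y)\<bar> / ?h = \<bar>LINT z|sphere_measure. gegenbauer_P d k (x \<bullet> z) * gegenbauer_P d k (y \<bullet> z)\<bar>"
    using h by (simp add: E[OF xy])
  also have "\<dots> \<le> (LINT z|sphere_measure. \<bar>gegenbauer_P d k (x \<bullet> z) * gegenbauer_P d k (y \<bullet> z)\<bar>)"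
    by (rule integral_abs_bound)
  also have "\<dots> \<le> (LINT z|sphere_measure. (gegenbauer_P d k (x \<bullet> z) * gegenbauer_P d k (x \<bullet> z) +
       gegenbauer_P d k (y \<bullet> z) * gegenbauer_P d k (y \<bullet> z)) / 2)"
  proof (rule integral_mono)
    fix z :: "real ^ 'n::_"
    have "\<bar>a * b\<bar> \<le> (a * a + b * b) / 2" for a b :: real
      using sum_squares_bound[of "\<bar>a\<bar>" "\<bar>b\<bar>"] by (simp add: abs_mult power2_eq_square)
    thus "\<bar>gegenbauer_P d k (x \<bullet> z) * gegenbauer_P d k (y \<bullet> z)\<bar> \<le> (gegenbauer_P d k (x \<bullet> z) * gegenbauer_P d k (x \<bullet> z) +
       gegenbauer_P d k (y \<bullet> z) * gegenbauer_P d k (y \<bullet> z)) / 2" .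
  qed (use intz in \<open>auto intro!: integrable_abs\<close>)
  also have "\<dots> = 1 / ?h"
    using E[OF xy(1) xy(1)] E[OF xy(2) xy(2)] xy d
    by (simp add: intz norm_eq_1)
  finally show ?thesis using h by (simp add: divide_le_cancel)
qed

section \<open>The kernel of hypergeometric integrals\<close>

lemma has_sum_diagonals:
  fixes f :: "nat \<times> nat \<Rightarrow> real"
  assumes "(f has_sum S) UNIV"
  shows "(\<lambda>i. \<Sum>p\<le>i. f (p, i - p)) sums S"
proof -
  have "((\<lambda>(i, p). f (p, i - p)) has_sum S) (SIGMA i:UNIV. {..i})"
    using assms
    by (subst has_sum_reindex_bij_witness[where j = "\<lambda>(i, p). (p, i - p)" and i = "\<lambda>(p, q). (p + q, p)" and T = UNIV and h = f])
       auto
  hence "((\<lambda>i. \<Sum>p\<le>i. f (p, i - p)) has_sum S) UNIV"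
    by (rule has_sum_SigmaD) (auto intro: has_sum_finiteI)
  thus ?thesis by (rule has_sum_imp_sums)
qed

text \<open>For \<open>s < 0\<close> the coefficients are absolutely summable, so the series is
  continuous on the closed interval, as is the power. The values at the endpoints follow by letting
  interior points tend to them.\<close>

lemma pc_sums_closed:
  assumes s: "s < 0" and x: "\<bar>x\<bar> \<le> 1"
  shows "(\<lambda>j. pc s j * x ^ j) sums (1 - x) powr (- s)"
proof -
  define f where "f x = (\<Sum>j. pc s j * x ^ j)" for x :: real
  have bd: "norm (pc s j * x ^ j) \<le> \<bar>pc s j\<bar>" if "x \<in> {-1..1}" for j and x :: real
  proof -
    have "\<bar>x\<bar> ^ j \<le> 1" using that by (intro power_le_one) auto
    thus ?thesis by (simp add: abs_mult power_abs mult_left_le)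
  qed
  have "uniform_limit {-1..1} (\<lambda>n x. \<Sum>j<n. pc s j * x ^ j) f sequentially"
    unfolding f_def by (rule Weierstrass_m_test[OF bd pc_summable[OF s]])
  hence cf: "continuous_on {-1..1} f"
    by (rule uniform_limit_theorem[rotated]) (auto intro!: always_eventually continuous_intros)
  have cg: "continuous_on {-1..1} (\<lambda>x::real. (1 - x) powr (- s))"
    using s by (intro continuous_on_powr' continuous_intros) auto
  define X where "X k = x * (real k / (real k + 1))" for k :: nat
  have Xk: "\<bar>X k\<bar> < 1" for k
  proof -
    have "\<bar>X k\<bar> \<le> real k / (real k + 1)"
      using x mult_right_mono[of "\<bar>x\<bar>" 1 "real k / (real k + 1)"] by (simp add: X_def abs_mult)
    also have "\<dots> < 1" by simp
    finally show ?thesis .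
  qed
  have "(\<lambda>k. real k / (real k + 1)) \<longlonglongrightarrow> 1" by real_asymp
  hence "X \<longlonglongrightarrow> x * 1" unfolding X_def by (intro tendsto_mult tendsto_const)
  hence X: "X \<longlonglongrightarrow> x" by simp
  have ev: "\<forall>\<^sub>F k in sequentially. X k \<in> {-1..1}"
    using Xk by (intro always_eventually allI) (auto simp: abs_less_iff less_imp_le)
  have "(\<lambda>k. f (X k)) \<longlonglongrightarrow> f x"
    by (rule continuous_on_tendsto_compose[OF cf X _ ev]) (use x in auto)
  moreover have "(\<lambda>k. (1 - X k) powr (- s)) \<longlonglongrightarrow> (1 - x) powr (- s)"
    by (rule continuous_on_tendsto_compose[OF cg X _ ev]) (use x in auto)
  moreover have "f (X k) = (1 - X k) powr (- s)" for k
    unfolding f_def using pc_sums[OF Xk, of s k] by (simp add: sums_iff)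
  ultimately have "f x = (1 - x) powr (- s)" by (simp add: LIMSEQ_unique)
  moreover have "summable (\<lambda>j. pc s j * x ^ j)"
    by (rule summable_comparison_test[OF _ pc_summable[OF s]]) (use bd[of x] x in \<open>auto simp: abs_le_iff\<close>)
  ultimately show ?thesis by (simp add: f_def sums_iff)
qed

text \<open>\<open>(2 * \<beta> - 1) * hcoef \<beta> n\<close> is the \<open>n\<close>-th
  coefficient of the hypergeometric function in \<open>Q\<close>: its parameters
  \<open>a = 1/2 - \<beta>\<close> above and \<open>a + 1\<close> below leave only
  \<open>a / (a + n)\<close>.\<close>

definition hcoef :: "real \<Rightarrow> nat \<Rightarrow> real" where
  "hcoef \<beta> n = pc (1 - \<beta>) n / (2 * \<beta> - 1 - 2 * real n)"

text \<open>The form in which the representation of \<beta> by L and \<epsilon> is used: the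
  denominators of \<open>hcoef\<close> do not vanish.\<close>

locale half_integer_free =
  fixes \<beta> :: real
  assumes beta_gt: "\<beta> > 1 / 2" and nonhalf: "\<And>n::nat. 2 * \<beta> - 1 \<noteq> 2 * real n"
begin

lemma hyp2F1_term_hcoef:
  "hyp2F1_term (1 / 2 - \<beta>) (1 - \<beta>) (3 / 2 - \<beta>) z n = (2 * \<beta> - 1) * (hcoef \<beta> n * z ^ n)"
proof -
  define a where "a = 1 / 2 - \<beta>"
  have nz: "a + real m \<noteq> 0" for m using nonhalf[of m] by (auto simp: a_def)
  have c: "3 / 2 - \<beta> = a + 1" by (simp add: a_def)
  have "pochhammer (a + 1) n \<noteq> 0"
  proof
    assume "pochhammer (a + 1) n = 0"
    then obtain k where "a + 1 = - real k" by (auto simp: pochhammer_eq_0_iff)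
    with nz[of "Suc k"] show False by simp
  qed
  moreover have "a * pochhammer (a + 1) n = pochhammer a n * (a + real n)"
    using pochhammer_rec[of a n] pochhammer_Suc[of a n] by simp
  ultimately have r: "pochhammer a n / pochhammer (a + 1) n = a / (a + real n)"
    using nz[of n] by (simp add: field_simps)
  have "hyp2F1_term a (1 - \<beta>) (a + 1) z n = (pochhammer a n / pochhammer (a + 1) n) * pc (1 - \<beta>) n * z ^ n"
    by (simp add: hyp2F1_term_def pc_def)
  also have "\<dots> = (2 * \<beta> - 1) * (hcoef \<beta> n * z ^ n)"
  proof -
    have "a / (a + real n) = (2 * \<beta> - 1) / (2 * \<beta> - 1 - 2 * real n)"
      using nz[of n] nonhalf[of n] by (simp add: a_def field_simps)
    thus ?thesis unfolding r hcoef_def by simp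
  qed
  finally show ?thesis by (simp only: c a_def)
qed

lemma hcoef_summable: "summable (\<lambda>n. \<bar>hcoef \<beta> n\<bar>)"
proof -
  have "\<bar>hcoef \<beta> n\<bar> = (1 / 2) * \<bar>pc (1 - \<beta>) n / ((\<beta> - 1 / 2) - real n)\<bar>" for n
  proof -
    have "2 * \<beta> - 1 - 2 * real n = 2 * ((\<beta> - 1 / 2) - real n)" by (simp add: field_simps)
    moreover have "\<bar>a / (2 * c)\<bar> = (1 / 2) * \<bar>a / c\<bar>" for a c :: real
      by (simp add: abs_mult)
    ultimately show ?thesis unfolding hcoef_def by (simp only:)
  qed
  thus ?thesis using summable_mult[OF pc_div_summable[of "1 - \<beta>" "\<beta> - 1 / 2"], of "1 / 2"] beta_gt by simp
qed

lemma hcoef_power_summable: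
  assumes "\<bar>z\<bar> \<le> 1"
  shows "summable (\<lambda>n. hcoef \<beta> n * z ^ n)"
proof (rule summable_comparison_test[OF _ hcoef_summable], intro exI allI impI)
  fix n
  have "\<bar>z\<bar> ^ n \<le> 1" using assms by (intro power_le_one) auto
  thus "norm (hcoef \<beta> n * z ^ n) \<le> \<bar>hcoef \<beta> n\<bar>" by (simp add: abs_mult power_abs mult_left_le)
qed

text \<open>At \<open>W = 1 - m\<close> this is the integrand of \<open>Q\<close>; as a function of
  \<open>W > h \<ge> 0\<close> it is an antiderivative of
  \<open>(W\<^sup>2 - h\<^sup>2) powr (\<beta> - 1)\<close>. Both readings are needed, one for the
  expansion and one for the integral over \<open>t\<close>.\<close>

definition qfun :: "real \<Rightarrow> real \<Rightarrow> real" where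
  "qfun W h = W powr (2 * \<beta> - 1) * (\<Sum>n. hcoef \<beta> n * (h / W) ^ (2 * n))"

definition qterm :: "real \<Rightarrow> real \<Rightarrow> nat \<times> nat \<Rightarrow> real" where
  "qterm m h = (\<lambda>(n, j). hcoef \<beta> n * h ^ (2 * n) * (pc (2 * real n + 1 - 2 * \<beta>) j * m ^ j))"

text \<open>Row \<open>n\<close> is a binomial series with parameter \<open>s n\<close>. If
  \<open>s n > 0\<close>, its terms at \<open>\<bar>m\<bar>\<close> are nonnegative with sum
  \<open>(1 - \<bar>m\<bar>) powr (- s n)\<close>, and
  \<open>\<bar>h\<bar> \<le> 1 - \<bar>m\<bar>\<close> lowers the product with
  \<open>\<bar>h\<bar> ^ (2 * n)\<close> to at most
  \<open>(1 - \<bar>m\<bar>) powr (2 * \<beta> - 1) \<le> 1\<close>. The finitely many rows with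
  \<open>s n < 0\<close> have absolutely summable coefficients. Summability over the rows is then
  that of \<open>hcoef\<close>.\<close>

lemma qterm_bounded: "\<exists>B. \<forall>m h F. \<bar>m\<bar> + \<bar>h\<bar> \<le> 1 \<longrightarrow> finite F \<longrightarrow> (\<Sum>i\<in>F. \<bar>qterm m h i\<bar>) \<le> B"
proof -
  define s where "s n = 2 * real n + 1 - 2 * \<beta>" for n :: nat
  define U where "U n = (if s n > 0 then 1 else \<Sum>j. \<bar>pc (s n) j\<bar>)" for n
  have s0: "s n \<noteq> 0" for n using nonhalf[of n] by (auto simp: s_def)
  have "eventually (\<lambda>n. \<bar>hcoef \<beta> n\<bar> * U n = \<bar>hcoef \<beta> n\<bar>) sequentially"
  proof -
    have "eventually (\<lambda>n. real n > \<beta>) sequentially" by real_asymp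
    thus ?thesis by eventually_elim (auto simp: U_def s_def)
  qed
  hence sm: "summable (\<lambda>n. \<bar>hcoef \<beta> n\<bar> * U n)"
    using hcoef_summable by (subst summable_cong)
  have U0: "U n \<ge> 0" for n
    using s0[of n] by (auto simp: U_def intro!: suminf_nonneg pc_summable)
  have inner: "(\<Sum>j<J. \<bar>qterm m h (n, j)\<bar>) \<le> \<bar>hcoef \<beta> n\<bar> * U n" if mh: "\<bar>m\<bar> + \<bar>h\<bar> \<le> 1" for m h n J
  proof -
    have eq: "(\<Sum>j<J. \<bar>qterm m h (n, j)\<bar>) = \<bar>hcoef \<beta> n\<bar> * (\<bar>h\<bar> ^ (2 * n) * (\<Sum>j<J. \<bar>pc (s n) j\<bar> * \<bar>m\<bar> ^ j))"
      by (simp add: qterm_def s_def abs_mult power_abs sum_distrib_left mult_ac)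
    have "\<bar>h\<bar> ^ (2 * n) * (\<Sum>j<J. \<bar>pc (s n) j\<bar> * \<bar>m\<bar> ^ j) \<le> U n"
    proof (cases "s n > 0")
      case True
      show ?thesis
      proof (cases "\<bar>m\<bar> < 1")
        case m: True
        have sums: "(\<lambda>j. pc (s n) j * \<bar>m\<bar> ^ j) sums (1 - \<bar>m\<bar>) powr (- s n)"
          by (rule pc_sums) (use m in auto)
        have "(\<Sum>j<J. \<bar>pc (s n) j\<bar> * \<bar>m\<bar> ^ j) = (\<Sum>j<J. pc (s n) j * \<bar>m\<bar> ^ j)"
          using True by (simp add: pc_nonneg)
        also have "\<dots> \<le> (1 - \<bar>m\<bar>) powr (- s n)"
          using sums True by (intro sum_le_suminf[THEN order.trans]) (auto simp: sums_iff pc_nonneg)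
        finally have 1: "(\<Sum>j<J. \<bar>pc (s n) j\<bar> * \<bar>m\<bar> ^ j) \<le> (1 - \<bar>m\<bar>) powr (- s n)" .
        have "\<bar>h\<bar> ^ (2 * n) * (\<Sum>j<J. \<bar>pc (s n) j\<bar> * \<bar>m\<bar> ^ j) \<le> (1 - \<bar>m\<bar>) ^ (2 * n) * (1 - \<bar>m\<bar>) powr (- s n)"
          using mh m by (intro mult_mono 1 power_mono) (auto intro!: sum_nonneg)
        also have "\<dots> = (1 - \<bar>m\<bar>) powr (real (2 * n) + (- s n))"
        proof -
          have "(1 - \<bar>m\<bar>) ^ (2 * n) = (1 - \<bar>m\<bar>) powr real (2 * n)"
            by (rule powr_realpow[symmetric]) (use m in simp)
          thus ?thesis by (simp only: powr_add)
        qed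
        also have "real (2 * n) + (- s n) = 2 * \<beta> - 1" by (simp add: s_def)
        also have "(1 - \<bar>m\<bar>) powr (2 * \<beta> - 1) \<le> 1" using m beta_gt by (intro powr_le1) auto
        finally show ?thesis using True by (simp add: U_def)
      next
        case False
        \<comment> \<open>At \<open>\<bar>m\<bar> = 1\<close> the row itself may diverge, but
          \<open>h = 0\<close>, and \<open>s n > 0\<close> excludes \<open>n = 0\<close>; so the
          factor \<open>h ^ (2 * n)\<close> is 0.\<close>
        hence "h = 0" using mh by auto
        moreover have "n > 0" using True beta_gt by (cases n) (auto simp: s_def)
        ultimately show ?thesis using U0[of n] by (simp add: power_0_left)
      qed
    next
      case False
      hence sn: "s n < 0" using s0[of n] by simp
      have "(\<Sum>j<J. \<bar>pc (s n) j\<bar> * \<bar>m\<bar> ^ j) \<le> (\<Sum>j<J. \<bar>pc (s n) j\<bar>)"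
        using mh by (intro sum_mono mult_left_le power_le_one) auto
      also have "\<dots> \<le> (\<Sum>j. \<bar>pc (s n) j\<bar>)"
        using pc_summable[OF sn] by (intro sum_le_suminf) auto
      finally have 1: "(\<Sum>j<J. \<bar>pc (s n) j\<bar> * \<bar>m\<bar> ^ j) \<le> U n" using False by (simp add: U_def)
      have "\<bar>h\<bar> ^ (2 * n) * (\<Sum>j<J. \<bar>pc (s n) j\<bar> * \<bar>m\<bar> ^ j) \<le> 1 * U n"
        using mh by (intro mult_mono 1 power_le_one) (auto intro!: sum_nonneg)
      thus ?thesis by simp
    qed
    thus ?thesis unfolding eq by (intro mult_left_mono) auto
  qed
  have "(\<Sum>i\<in>F. \<bar>qterm m h i\<bar>) \<le> (\<Sum>n. \<bar>hcoef \<beta> n\<bar> * U n)"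
    if mh: "\<bar>m\<bar> + \<bar>h\<bar> \<le> 1" and F: "finite F" for m h and F :: "(nat \<times> nat) set"
  proof -
    obtain K where K: "F \<subseteq> {..<K} \<times> {..<K}"
    proof -
      have "finite (fst ` F \<union> snd ` F)" using F by simp
      then obtain K where "fst ` F \<union> snd ` F \<subseteq> {..<K}" using finite_nat_iff_bounded by blast
      hence "F \<subseteq> {..<K} \<times> {..<K}" by force
      thus ?thesis using that by blast
    qed
    have "(\<Sum>i\<in>F. \<bar>qterm m h i\<bar>) \<le> (\<Sum>i\<in>{..<K} \<times> {..<K}. \<bar>qterm m h i\<bar>)"
      by (rule sum_mono2) (use K in auto)
    also have "\<dots> = (\<Sum>n<K. \<Sum>j<K. \<bar>qterm m h (n, j)\<bar>)"
      by (simp add: sum.cartesian_product)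
    also have "\<dots> \<le> (\<Sum>n<K. \<bar>hcoef \<beta> n\<bar> * U n)" by (intro sum_mono inner mh)
    also have "\<dots> \<le> (\<Sum>n. \<bar>hcoef \<beta> n\<bar> * U n)" using sm U0 by (intro sum_le_suminf) auto
    finally show ?thesis .
  qed
  thus ?thesis by blast
qed

text \<open>The uniform bound permits summation by rows, and row \<open>n\<close> expands the power
  \<open>2 * \<beta> - 1 - 2 * n\<close> of \<open>1 - m\<close>.\<close>

lemma qterm_has_sum:
  assumes mh: "\<bar>m\<bar> + \<bar>h\<bar> \<le> 1"
  shows "(qterm m h has_sum qfun (1 - m) h) UNIV"
proof -
  obtain B where B: "\<And>F. finite F \<Longrightarrow> (\<Sum>i\<in>F. \<bar>qterm m h i\<bar>) \<le> B"
    using qterm_bounded mh by blast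
  have hs: "(qterm m h has_sum infsum (qterm m h) UNIV) UNIV"
    using abs_summable_on_boundedI(2)[of "qterm m h" B] B by (intro has_sum_infsum) auto
  have inner: "((\<lambda>j. qterm m h (n, j)) has_sum (1 - m) powr (2 * \<beta> - 1) * (hcoef \<beta> n * (h / (1 - m)) ^ (2 * n))) UNIV" for n
  proof -
    have m1: "\<bar>m\<bar> \<le> 1" using mh by simp
    have abs: "(\<lambda>j. \<bar>qterm m h (n, j)\<bar>) summable_on UNIV"
    proof (rule abs_summable_on_boundedI(1)[of _ B])
      fix F :: "nat set" assume "finite F"
      thus "(\<Sum>j\<in>F. \<bar>qterm m h (n, j)\<bar>) \<le> B"
        using B[of "Pair n ` F"] by (simp add: sum.reindex inj_on_def)
    qed
    have "(\<lambda>j. qterm m h (n, j)) sums ((1 - m) powr (2 * \<beta> - 1) * (hcoef \<beta> n * (h / (1 - m)) ^ (2 * n)))"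
    proof (cases "\<bar>m\<bar> < 1")
      case True
      have "(\<lambda>j. qterm m h (n, j)) sums (hcoef \<beta> n * h ^ (2 * n) * (1 - m) powr (- (2 * real n + 1 - 2 * \<beta>)))"
        unfolding qterm_def split by (intro sums_mult pc_sums True)
      also have "(1 - m) powr (- (2 * real n + 1 - 2 * \<beta>)) = (1 - m) powr (2 * \<beta> - 1 - real (2 * n))"
        by (simp add: algebra_simps)
      also have "\<dots> = (1 - m) powr (2 * \<beta> - 1) / (1 - m) ^ (2 * n)"
        unfolding powr_diff using True by (subst powr_realpow) auto
      finally show ?thesis by (simp add: power_divide mult_ac)
    next
      case False
      \<comment> \<open>On this part of the boundary only the row \<open>n = 0\<close> survives. Its
        parameter \<open>1 - 2 * \<beta>\<close> is negative, so the binomial series still converges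
        there.\<close>
      hence h: "h = 0" and m: "\<bar>m\<bar> = 1" using mh by auto
      show ?thesis
      proof (cases n)
        case 0
        have "(\<lambda>j. hcoef \<beta> 0 * (pc (1 - 2 * \<beta>) j * m ^ j)) sums (hcoef \<beta> 0 * (1 - m) powr (- (1 - 2 * \<beta>)))"
          by (intro sums_mult pc_sums_closed) (use m beta_gt in auto)
        thus ?thesis using 0 by (simp add: qterm_def mult_ac)
      qed (simp add: qterm_def h)
    qed
    hence "((\<lambda>j. qterm m h (n, j)) has_sum infsum (\<lambda>j. qterm m h (n, j)) UNIV) UNIV"
      "(\<lambda>j. qterm m h (n, j)) sums ((1 - m) powr (2 * \<beta> - 1) * (hcoef \<beta> n * (h / (1 - m)) ^ (2 * n)))"
      using abs by (auto intro!: has_sum_infsum simp: summable_on_iff_abs_summable_on_real[of "\<lambda>j. qterm m h (n, j)"])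
    thus ?thesis using has_sum_imp_sums sums_unique2 by metis
  qed
  have "((\<lambda>n. (1 - m) powr (2 * \<beta> - 1) * (hcoef \<beta> n * (h / (1 - m)) ^ (2 * n))) has_sum infsum (qterm m h) UNIV) UNIV"
  proof (rule has_sum_SigmaD)
    show "(qterm m h has_sum infsum (qterm m h) UNIV) (SIGMA n:UNIV. UNIV)" using hs by simp
  qed (rule inner)
  hence "(\<lambda>n. (1 - m) powr (2 * \<beta> - 1) * (hcoef \<beta> n * (h / (1 - m)) ^ (2 * n))) sums infsum (qterm m h) UNIV"
    by (rule has_sum_imp_sums)
  moreover have "summable (\<lambda>n. hcoef \<beta> n * (h / (1 - m)) ^ (2 * n))"
  proof -
    have "\<bar>(h / (1 - m))\<^sup>2\<bar> \<le> 1"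
      using mh by (auto simp: abs_square_le_1 divide_le_eq)
    from hcoef_power_summable[OF this] show ?thesis by (simp add: power_mult)
  qed
  ultimately have "infsum (qterm m h) UNIV = qfun (1 - m) h"
    by (simp add: qfun_def sums_iff suminf_mult)
  thus ?thesis using hs by simp
qed

end

section \<open>Expansion of the averaged integrand\<close>

lemma gegen_product_abs_le_1:
  fixes x y :: "real ^ 'n::{finite, wellorder}"
  assumes d: "d \<ge> 2" and dim: "CARD('n) = d + 1" and xy: "norm x = 1" "norm y = 1"
  shows "\<bar>gegen_product d p q (x \<bullet> y)\<bar> \<le> 1"
proof -
  interpret prob_space "sphere_measure :: (real ^ 'n::_) measure" by (rule prob_space_sphere_measure)
  have "\<bar>gegen_product d p q (x \<bullet> y)\<bar> = \<bar>LINT z|sphere_measure. (x \<bullet> z) ^ p * (y \<bullet> z) ^ q\<bar>"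
    by (simp only: integral_sphere_inner_powers_gegenbauer[OF d dim xy])
  also have "\<dots> \<le> (LINT z|sphere_measure. \<bar>(x \<bullet> z) ^ p * (y \<bullet> z) ^ q\<bar>)" by (rule integral_abs_bound)
  also have "\<dots> \<le> (LINT z|(sphere_measure :: (real ^ 'n::_) measure). 1)"
  proof (rule integral_mono)
    fix z :: "real ^ 'n::_" assume "z \<in> space sphere_measure"
    hence z: "norm z = 1" by simp
    have "\<bar>x \<bullet> z\<bar> \<le> 1" "\<bar>y \<bullet> z\<bar> \<le> 1"
      using Cauchy_Schwarz_ineq2[of x z] Cauchy_Schwarz_ineq2[of y z] z xy by auto
    hence "\<bar>x \<bullet> z\<bar> ^ p * \<bar>y \<bullet> z\<bar> ^ q \<le> 1 * 1"
      by (intro mult_mono power_le_one) auto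
    thus "\<bar>(x \<bullet> z) ^ p * (y \<bullet> z) ^ q\<bar> \<le> 1" by (simp add: abs_mult power_abs)
  qed (auto intro!: integrable_abs integrable_sphere_inner_powers)
  finally show ?thesis using prob_space by simp
qed

context half_integer_free
begin

definition mid :: "real ^ 'n::finite \<Rightarrow> real ^ 'n \<Rightarrow> real ^ 'n" where
  "mid x y = (1 / 2) *\<^sub>R (x + y)"

definition hdiff :: "real ^ 'n::finite \<Rightarrow> real ^ 'n \<Rightarrow> real ^ 'n" where
  "hdiff x y = (1 / 2) *\<^sub>R (x - y)"

lemma mid_hdiff_bound:
  fixes x y z :: "real ^ 'n::finite"
  assumes "norm x = 1" "norm y = 1" "norm z = 1"
  shows "\<bar>mid x y \<bullet> z\<bar> + \<bar>hdiff x y \<bullet> z\<bar> \<le> 1"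
proof -
  have "\<bar>x \<bullet> z\<bar> \<le> 1" "\<bar>y \<bullet> z\<bar> \<le> 1"
    using Cauchy_Schwarz_ineq2[of x z] Cauchy_Schwarz_ineq2[of y z] assms by auto
  moreover have "\<bar>(a + b) / 2\<bar> + \<bar>(a - b) / 2\<bar> \<le> 1" if "\<bar>a\<bar> \<le> 1" "\<bar>b\<bar> \<le> 1" for a b :: real
  proof -
    have *: "\<bar>a + b\<bar> + \<bar>a - b\<bar> \<le> 2" using that by arith
    have "\<bar>(a + b) / 2\<bar> + \<bar>(a - b) / 2\<bar> = (\<bar>a + b\<bar> + \<bar>a - b\<bar>) / 2"
      by simp
    also have "\<dots> \<le> 1" using * by simp
    finally show ?thesis .
  qed
  ultimately show ?thesis
    by (simp add: mid_def hdiff_def inner_add_left inner_diff_left)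
qed

lemma Q_argument_le_1:
  fixes x y z :: "real ^ 'n::finite"
  assumes "norm x = 1" "norm y = 1" "norm z = 1"
  shows "\<bar>hdiff x y \<bullet> z / (1 - mid x y \<bullet> z)\<bar> \<le> 1"
  using mid_hdiff_bound[OF assms] by (auto simp: abs_divide divide_le_eq)

lemma Q_argument_altdef: "Q_argument x y z = (hdiff x y \<bullet> z / (1 - mid x y \<bullet> z))\<^sup>2"
proof -
  have e: "2 - x \<bullet> z - y \<bullet> z = 2 * (1 - mid x y \<bullet> z)" "x \<bullet> z - y \<bullet> z = 2 * (hdiff x y \<bullet> z)"
    by (simp_all add: mid_def hdiff_def inner_add_left inner_diff_left field_simps)
  show ?thesis unfolding Q_argument_def e by (simp only: mult_divide_mult_cancel_left_if) simp
qed

lemma Q_hyp_summable: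
  fixes x y z :: "real ^ 'n::finite"
  assumes "norm x = 1" "norm y = 1" "norm z = 1"
  shows "summable (hyp2F1_term (1 / 2 - \<beta>) (1 - \<beta>) (3 / 2 - \<beta>) (Q_argument x y z))"
proof -
  have "\<bar>Q_argument x y z\<bar> \<le> 1"
    using Q_argument_le_1[OF assms] by (simp add: Q_argument_altdef abs_square_le_1)
  thus ?thesis unfolding hyp2F1_term_hcoef by (intro summable_mult hcoef_power_summable)
qed

lemma Q_integrand_qfun:
  fixes x y z :: "real ^ 'n::finite"
  assumes "norm x = 1" "norm y = 1" "norm z = 1"
  shows "Q_integrand \<beta> x y z = qfun (1 - mid x y \<bullet> z) (hdiff x y \<bullet> z)"
proof -
  define W where "W = 1 - mid x y \<bullet> z"
  define h where "h = hdiff x y \<bullet> z"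
  have W: "1 - x \<bullet> z / 2 - y \<bullet> z / 2 = W"
    by (simp add: W_def mid_def inner_add_left field_simps)
  have arg: "Q_argument x y z = (h / W)\<^sup>2" by (simp add: Q_argument_altdef h_def W_def)
  have "\<bar>(h / W)\<^sup>2\<bar> \<le> 1"
    using Q_argument_le_1[OF assms] by (simp add: h_def W_def abs_square_le_1)
  from hcoef_power_summable[OF this]
  have "hyp2F1 (1 / 2 - \<beta>) (1 - \<beta>) (3 / 2 - \<beta>) ((h / W)\<^sup>2) = (2 * \<beta> - 1) * (\<Sum>n. hcoef \<beta> n * (h / W) ^ (2 * n))"
    unfolding hyp2F1_def hyp2F1_term_hcoef by (simp add: suminf_mult power_mult)
  hence *: "1 / (2 * \<beta> - 1) * hyp2F1 (1 / 2 - \<beta>) (1 - \<beta>) (3 / 2 - \<beta>) ((h / W)\<^sup>2) = (\<Sum>n. hcoef \<beta> n * (h / W) ^ (2 * n))"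
    using beta_gt by simp
  have "W powr (1 - 2 * \<beta>) = inverse (W powr (2 * \<beta> - 1))"
    using powr_minus[of W "2 * \<beta> - 1"] by simp
  thus ?thesis
    unfolding Q_integrand_def arg W qfun_def * W_def[symmetric] h_def[symmetric]
    by (simp add: divide_inverse mult.commute)
qed

text \<open>The bound of \<open>qterm_bounded\<close> is uniform over the sphere, so a constant
  serves as the integrable majorant.\<close>

lemma
  fixes x y :: "real ^ 'n::finite"
  assumes xy: "norm x = 1" "norm y = 1"
  shows integrable_Q_integrand: "integrable sphere_measure (Q_integrand \<beta> x y)"
    and Q_kernel_has_sum: "((\<lambda>i. LINT z|sphere_measure. qterm (mid x y \<bullet> z) (hdiff x y \<bullet> z) i) has_sum Q_kernel \<beta> x y) UNIV"
proof -
  interpret prob_space "sphere_measure :: (real ^ 'n) measure" by (rule prob_space_sphere_measure)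
  obtain B where B: "\<And>m h F. \<bar>m\<bar> + \<bar>h\<bar> \<le> 1 \<Longrightarrow> finite F \<Longrightarrow> (\<Sum>i\<in>F. \<bar>qterm m h i\<bar>) \<le> B"
    using qterm_bounded by blast
  let ?f = "\<lambda>i z. qterm (mid x y \<bullet> z) (hdiff x y \<bullet> z) i"
  have bd: "(\<Sum>i\<in>F. \<bar>?f i z\<bar>) \<le> B" if "z \<in> space sphere_measure" "finite F" for z F
    by (rule B) (use that mid_hdiff_bound[OF xy, of z] in auto)
  have meas: "?f i \<in> borel_measurable sphere_measure" for i
    by (cases i) (auto simp: qterm_def intro!: borel_measurable_sphere_measure)
  have G: "integrable (sphere_measure :: (real ^ 'n) measure) (\<lambda>_. B)" by simp
  have eq: "infsum (\<lambda>i. ?f i z) UNIV = Q_integrand \<beta> x y z" if "z \<in> space sphere_measure" for z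
    using that Q_integrand_qfun[OF xy, of z]
      infsumI[OF qterm_has_sum[OF mid_hdiff_bound[OF xy, of z]]] by (simp add: cong: infsum_cong)
  have "integrable sphere_measure (\<lambda>z. infsum (\<lambda>i. ?f i z) UNIV)"
    by (rule integrable_double_sum[OF G meas bd])
  thus "integrable sphere_measure (Q_integrand \<beta> x y)"
    by (rule Bochner_Integration.integrable_cong[THEN iffD1, rotated 2]) (auto simp: eq)
  have "((\<lambda>i. LINT z|sphere_measure. ?f i z) has_sum (LINT z|sphere_measure. infsum (\<lambda>i. ?f i z) UNIV)) UNIV"
    by (rule has_sum_integral_double_sum[OF G meas bd])
  also have "(LINT z|sphere_measure. infsum (\<lambda>i. ?f i z) UNIV) = Q_kernel \<beta> x y"
    unfolding Q_kernel_def by (intro Bochner_Integration.integral_cong) (auto simp: eq)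
  finally show "((\<lambda>i. LINT z|sphere_measure. ?f i z) has_sum Q_kernel \<beta> x y) UNIV" .
qed

text \<open>Half sum and half difference of unit vectors are orthogonal, so the average of an even
  power of one times an even power of the other is a single product. This is where the two arguments
  of the Kampe de Feriet series come from.\<close>

lemma
  fixes x y :: "real ^ 'n::finite"
  assumes xy: "norm x = 1" "norm y = 1"
  shows mid_inner_hdiff: "mid x y \<bullet> hdiff x y = 0"
    and norm_mid: "norm (mid x y) ^ (2 * k) = ((1 + x \<bullet> y) / 2) ^ k"
    and norm_hdiff: "norm (hdiff x y) ^ (2 * k) = ((1 - x \<bullet> y) / 2) ^ k"
proof -
  have 1: "x \<bullet> x = 1" "y \<bullet> y = 1" using xy by (auto simp: norm_eq_1)
  show "mid x y \<bullet> hdiff x y = 0"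
    using 1 by (simp add: mid_def hdiff_def inner_diff_left inner_add_right inner_add_left inner_diff_right inner_commute)
  have "(norm (mid x y))\<^sup>2 = (1 + x \<bullet> y) / 2"
    unfolding power2_norm_eq_inner using 1 by (simp add: mid_def inner_add inner_commute field_simps)
  thus "norm (mid x y) ^ (2 * k) = ((1 + x \<bullet> y) / 2) ^ k" by (simp only: power_mult)
  have "(norm (hdiff x y))\<^sup>2 = (1 - x \<bullet> y) / 2"
    unfolding power2_norm_eq_inner using 1 by (simp add: hdiff_def inner_diff inner_commute field_simps)
  thus "norm (hdiff x y) ^ (2 * k) = ((1 - x \<bullet> y) / 2) ^ k" by (simp only: power_mult)
qed

lemma integral_qterm_even:
  fixes x y :: "real ^ 'n::{finite, wellorder}"
  assumes xy: "norm x = 1" "norm y = 1"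
  shows "(LINT z|sphere_measure. qterm (mid x y \<bullet> z) (hdiff x y \<bullet> z) (n, 2 * k)) =
    hcoef \<beta> n * pc (2 * real n + 1 - 2 * \<beta>) (2 * k) *
    (pochhammer (1 / 2) k * pochhammer (1 / 2) n / pochhammer (CARD('n) / 2) (k + n) *
     ((1 + x \<bullet> y) / 2) ^ k * ((1 - x \<bullet> y) / 2) ^ n)"
proof -
  have "(LINT z|sphere_measure. qterm (mid x y \<bullet> z) (hdiff x y \<bullet> z) (n, 2 * k)) =
    (LINT z|sphere_measure. hcoef \<beta> n * pc (2 * real n + 1 - 2 * \<beta>) (2 * k) *
       ((mid x y \<bullet> z) ^ (2 * k) * (hdiff x y \<bullet> z) ^ (2 * n)))"
    by (intro Bochner_Integration.integral_cong) (auto simp: qterm_def)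
  also have "\<dots> = hcoef \<beta> n * pc (2 * real n + 1 - 2 * \<beta>) (2 * k) *
       (LINT z|sphere_measure. (mid x y \<bullet> z) ^ (2 * k) * (hdiff x y \<bullet> z) ^ (2 * n))"
    by (rule Bochner_Integration.integral_mult_right_zero)
  also have "(LINT z|sphere_measure. (mid x y \<bullet> z) ^ (2 * k) * (hdiff x y \<bullet> z) ^ (2 * n)) =
     pochhammer (1 / 2) k * pochhammer (1 / 2) n / pochhammer (CARD('n) / 2) (k + n) *
     ((1 + x \<bullet> y) / 2) ^ k * ((1 - x \<bullet> y) / 2) ^ n"
    by (simp only: integral_sphere_inner_powers_orthogonal[OF mid_inner_hdiff[OF xy]] norm_mid[OF xy] norm_hdiff[OF xy])
  finally show ?thesis .
qed

lemma integral_qterm_odd: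
  fixes x y :: "real ^ 'n::{finite, wellorder}"
  assumes "odd j"
  shows "(LINT z|sphere_measure. qterm (mid x y \<bullet> z) (hdiff x y \<bullet> z) (n, j)) = 0"
proof -
  have "(LINT z|sphere_measure. qterm (mid x y \<bullet> z) (hdiff x y \<bullet> z) (n, j)) =
    (LINT z|sphere_measure. hcoef \<beta> n * pc (2 * real n + 1 - 2 * \<beta>) j *
       ((mid x y \<bullet> z) ^ j * (hdiff x y \<bullet> z) ^ (2 * n)))"
    by (intro Bochner_Integration.integral_cong) (auto simp: qterm_def)
  also have "\<dots> = 0"
    by (subst Bochner_Integration.integral_mult_right_zero, subst integral_sphere_inner_powers_odd) (use assms in auto)
  finally show ?thesis .
qed

lemma Q_kernel_has_sum_even:
  fixes x y :: "real ^ 'n::{finite, wellorder}"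
  assumes xy: "norm x = 1" "norm y = 1"
  shows "((\<lambda>(n, k). LINT z|sphere_measure. qterm (mid x y \<bullet> z) (hdiff x y \<bullet> z) (n, 2 * k)) has_sum Q_kernel \<beta> x y) UNIV"
proof -
  let ?f = "\<lambda>i. LINT z|sphere_measure. qterm (mid x y \<bullet> z) (hdiff x y \<bullet> z) i"
  let ?g = "\<lambda>(n, k). (n :: nat, 2 * k :: nat)"
  have "(?f has_sum Q_kernel \<beta> x y) (range ?g)"
  proof (rule has_sum_cong_neutral[THEN iffD1, OF _ _ _ Q_kernel_has_sum[OF xy]])
    fix i :: "nat \<times> nat" assume "i \<in> UNIV - range ?g"
    moreover obtain n j where i: "i = (n, j)" by (cases i)
    moreover have "(n, j) \<in> range ?g" if "even j"
      using that by (auto elim!: evenE intro!: image_eqI[where x = "(n, j div 2)"])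
    ultimately have "odd j" by auto
    thus "?f i = 0" unfolding i by (rule integral_qterm_odd)
  qed auto
  moreover have "inj ?g" by (auto simp: inj_def)
  ultimately have "((?f \<circ> ?g) has_sum Q_kernel \<beta> x y) UNIV"
    by (subst (asm) has_sum_reindex) auto
  moreover have "?f \<circ> ?g = (\<lambda>(n, k). ?f (n, 2 * k))" by auto
  ultimately show ?thesis by simp
qed

text \<open>Two factorizations of \<open>pochhammer s (j + 1)\<close>. It trades the denominator of
  \<open>weight\<close>, which depends on the total degree, for that of \<open>hcoef\<close>, which
  depends on the row.\<close>

lemma pc_shift_div:
  assumes "s + real j \<noteq> 0" "s \<noteq> 0"
  shows "pc (s + 1) j / (- s - real j) = pc s j / (- s)"
proof -
  have "s * pochhammer (s + 1) j = pochhammer s j * (s + real j)"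
    using pochhammer_rec[of s j] pochhammer_Suc[of s j] by simp
  hence "s * pc (s + 1) j = pc s j * (s + real j)" by (simp add: pc_def)
  thus ?thesis using assms by (simp add: field_simps)
qed

text \<open>For even \<open>p + q\<close>, the coefficient of
  \<open>(x \<bullet> z) ^ p * (y \<bullet> z) ^ q\<close> in the integrand of \<open>Q\<close>. For
  odd \<open>p + q\<close> the denominator vanishes if \<beta> is an integer with
  \<open>2 * \<beta> - 1 = p + q\<close>; the resulting value 0 is harmless, as the average of the
  monomial over the sphere is 0.\<close>

definition weight :: "nat \<Rightarrow> nat \<Rightarrow> real" where
  "weight p q = pc (1 - \<beta>) p * pc (1 - \<beta>) q / (2 * \<beta> - 1 - real (p + q))"

lemma weight_abs_summable: "(\<lambda>(p, q). \<bar>weight p q\<bar>) summable_on UNIV"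
  using pc_weight_summable[of "1 - \<beta>" "2 * \<beta> - 1"] beta_gt by (simp add: weight_def)

text \<open>The parts of degree \<open>2 * l\<close> of the two expansions agree already at every
  \<open>z\<close>. \<open>pc_homogeneous_sum\<close> regroups the numerators, whose common
  denominator depends only on \<open>l\<close>, and \<open>pc_shift_div\<close> moves that
  denominator to the rows.\<close>

lemma weight_homogeneous:
  fixes x y :: "real ^ 'n::{finite, wellorder}"
  assumes d: "d \<ge> 2" and dim: "CARD('n) = d + 1" and xy: "norm x = 1" "norm y = 1"
  shows "(\<Sum>p\<le>2 * l. weight p (2 * l - p) * gegen_product d p (2 * l - p) (x \<bullet> y)) =
    (\<Sum>n\<le>l. LINT z|sphere_measure. qterm (mid x y \<bullet> z) (hdiff x y \<bullet> z) (n, 2 * (l - n)))"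
proof -
  let ?b = "1 - \<beta>"
  let ?m = "\<lambda>z. mid x y \<bullet> z" and ?h = "\<lambda>z. hdiff x y \<bullet> z"
  have xz: "?m z + ?h z = x \<bullet> z" "?m z - ?h z = y \<bullet> z" for z
    by (simp_all add: mid_def hdiff_def inner_simps field_simps)
  define D where "D = 2 * \<beta> - 1 - real (2 * l)"
  have D: "D \<noteq> 0" using nonhalf[of l] by (simp add: D_def)
  have "(\<Sum>p\<le>2 * l. weight p (2 * l - p) * gegen_product d p (2 * l - p) (x \<bullet> y)) =
     (\<Sum>p\<le>2 * l. LINT z|sphere_measure. (pc ?b p * pc ?b (2 * l - p) / D) * ((x \<bullet> z) ^ p * (y \<bullet> z) ^ (2 * l - p)))"
  proof (intro sum.cong refl)
    fix p assume "p \<in> {..2 * l}"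
    hence "real (p + (2 * l - p)) = real (2 * l)" by simp
    thus "weight p (2 * l - p) * gegen_product d p (2 * l - p) (x \<bullet> y) =
      (LINT z|sphere_measure. (pc ?b p * pc ?b (2 * l - p) / D) * ((x \<bullet> z) ^ p * (y \<bullet> z) ^ (2 * l - p)))"
      by (simp only: weight_def D_def integral_sphere_inner_powers_gegenbauer[OF d dim xy, symmetric]
          Bochner_Integration.integral_mult_right_zero)
  qed
  also have "\<dots> = (LINT z|sphere_measure. (\<Sum>p\<le>2 * l. (pc ?b p * pc ?b (2 * l - p) / D) * ((x \<bullet> z) ^ p * (y \<bullet> z) ^ (2 * l - p))))"
    by (rule Bochner_Integration.integral_sum[symmetric]) (intro integrable_mult_right integrable_sphere_inner_powers)
  also have "\<dots> = (LINT z|sphere_measure. (\<Sum>n\<le>l. qterm (?m z) (?h z) (n, 2 * (l - n))))"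
  proof (intro Bochner_Integration.integral_cong refl)
    fix z
    have "(\<Sum>p\<le>2 * l. (pc ?b p * pc ?b (2 * l - p) / D) * ((x \<bullet> z) ^ p * (y \<bullet> z) ^ (2 * l - p))) =
      (\<Sum>p\<le>2 * l. pc ?b p * pc ?b (2 * l - p) * (x \<bullet> z) ^ p * (y \<bullet> z) ^ (2 * l - p)) / D"
      unfolding sum_divide_distrib by (intro sum.cong refl) simp
    also have "(\<Sum>p\<le>2 * l. pc ?b p * pc ?b (2 * l - p) * (x \<bullet> z) ^ p * (y \<bullet> z) ^ (2 * l - p)) =
      (\<Sum>n\<le>l. pc ?b n * pc (2 * ?b + 2 * real n) (2 * l - 2 * n) * ?h z ^ (2 * n) * ?m z ^ (2 * l - 2 * n))"
      using pc_homogeneous_sum[of ?b "2 * l" "?m z" "?h z"] unfolding xz by simp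
    also have "\<dots> / D = (\<Sum>n\<le>l. qterm (?m z) (?h z) (n, 2 * (l - n)))"
      unfolding sum_divide_distrib
    proof (intro sum.cong refl)
      fix n assume n: "n \<in> {..l}"
      define s where "s = 2 * real n + 1 - 2 * \<beta>"
      have s: "s \<noteq> 0" using nonhalf[of n] by (simp add: s_def)
      have sD: "- s - real (2 * (l - n)) = D" using n by (simp add: s_def D_def of_nat_diff algebra_simps)
      have "pc (2 * ?b + 2 * real n) (2 * l - 2 * n) / D = pc (s + 1) (2 * (l - n)) / (- s - real (2 * (l - n)))"
        unfolding sD by (simp add: s_def algebra_simps)
      also have "\<dots> = pc s (2 * (l - n)) / (- s)"
        by (rule pc_shift_div) (use s sD D in linarith)+
      finally have e: "pc (2 * ?b + 2 * real n) (2 * l - 2 * n) / D = pc s (2 * (l - n)) / (- s)" .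
      have "pc ?b n * pc (2 * ?b + 2 * real n) (2 * l - 2 * n) * ?h z ^ (2 * n) * ?m z ^ (2 * l - 2 * n) / D =
        pc ?b n * (pc (2 * ?b + 2 * real n) (2 * l - 2 * n) / D) * ?h z ^ (2 * n) * ?m z ^ (2 * l - 2 * n)"
        by simp
      also have "\<dots> = qterm (?m z) (?h z) (n, 2 * (l - n))"
      proof -
        have "hcoef \<beta> n = pc ?b n / (- s)" by (simp add: hcoef_def s_def algebra_simps)
        thus ?thesis unfolding e by (simp add: qterm_def s_def diff_mult_distrib2)
      qed
      finally show "pc ?b n * pc (2 * ?b + 2 * real n) (2 * l - 2 * n) * ?h z ^ (2 * n) * ?m z ^ (2 * l - 2 * n) / D =
        qterm (?m z) (?h z) (n, 2 * (l - n))" .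
    qed
    finally show "(\<Sum>p\<le>2 * l. (pc ?b p * pc ?b (2 * l - p) / D) * ((x \<bullet> z) ^ p * (y \<bullet> z) ^ (2 * l - p))) =
      (\<Sum>n\<le>l. qterm (?m z) (?h z) (n, 2 * (l - n)))" .
  qed
  also have "\<dots> = (\<Sum>n\<le>l. LINT z|sphere_measure. qterm (?m z) (?h z) (n, 2 * (l - n)))"
  proof (rule Bochner_Integration.integral_sum)
    fix n
    have "integrable sphere_measure (\<lambda>z. hcoef \<beta> n * pc (2 * real n + 1 - 2 * \<beta>) (2 * (l - n)) * (?h z ^ (2 * n) * ?m z ^ (2 * (l - n))))"
      by (intro integrable_mult_right integrable_sphere_inner_powers)
    thus "integrable sphere_measure (\<lambda>z. qterm (?m z) (?h z) (n, 2 * (l - n)))"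
      by (simp add: qterm_def mult_ac)
  qed
  finally show ?thesis .
qed

text \<open>Both double series are summable in any order, hence also by total degree, where
  \<open>weight_homogeneous\<close> makes them agree. The odd degrees drop out with their
  averages.\<close>

lemma Q_kernel_gegen_product:
  fixes x y :: "real ^ 'n::{finite, wellorder}"
  assumes d: "d \<ge> 2" and dim: "CARD('n) = d + 1" and xy: "norm x = 1" "norm y = 1"
  shows "((\<lambda>(p, q). weight p q * gegen_product d p q (x \<bullet> y)) has_sum Q_kernel \<beta> x y) UNIV"
proof -
  let ?f = "\<lambda>(p, q). weight p q * gegen_product d p q (x \<bullet> y)"
  have "(\<lambda>i. norm (?f i)) summable_on UNIV"
  proof (rule summable_on_comparison_test[OF weight_abs_summable])
    fix i :: "nat \<times> nat"
    obtain p q where i: "i = (p, q)" by (cases i)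
    have "\<bar>weight p q\<bar> * \<bar>gegen_product d p q (x \<bullet> y)\<bar> \<le> \<bar>weight p q\<bar>"
      by (intro mult_left_le gegen_product_abs_le_1[OF d dim xy]) simp
    thus "norm (?f i) \<le> (case i of (p, q) \<Rightarrow> \<bar>weight p q\<bar>)" by (simp add: i abs_mult)
  qed auto
  hence "?f summable_on UNIV" by (subst summable_on_iff_abs_summable_on_real) simp
  hence hs: "(?f has_sum infsum ?f UNIV) UNIV" by (rule has_sum_infsum)
  have "(\<lambda>i. \<Sum>p\<le>i. ?f (p, i - p)) sums infsum ?f UNIV" by (rule has_sum_diagonals[OF hs])
  also have "?this \<longleftrightarrow> (\<lambda>l. \<Sum>p\<le>2 * l. ?f (p, 2 * l - p)) sums infsum ?f UNIV"
  proof (rule sums_mono_reindex[symmetric])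
    show "strict_mono (\<lambda>l::nat. 2 * l)" by (auto simp: strict_mono_def)
    fix i :: nat assume "i \<notin> range (\<lambda>l. 2 * l)"
    hence "odd i" by (auto elim!: evenE)
    show "(\<Sum>p\<le>i. ?f (p, i - p)) = 0"
    proof (intro sum.neutral ballI)
      fix p assume "p \<in> {..i}"
      hence "odd (p + (i - p))" using \<open>odd i\<close> by simp
      hence "gegen_product d p (i - p) (x \<bullet> y) = 0"
        using integral_sphere_inner_powers_gegenbauer[OF d dim xy, of p "i - p"]
        by (simp add: integral_sphere_inner_powers_odd)
      thus "?f (p, i - p) = 0" by simp
    qed
  qed
  finally have 1: "(\<lambda>l. \<Sum>p\<le>2 * l. weight p (2 * l - p) * gegen_product d p (2 * l - p) (x \<bullet> y)) sums infsum ?f UNIV"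
    by simp
  have "(\<lambda>l. \<Sum>n\<le>l. LINT z|sphere_measure. qterm (mid x y \<bullet> z) (hdiff x y \<bullet> z) (n, 2 * (l - n))) sums Q_kernel \<beta> x y"
    using has_sum_diagonals[OF Q_kernel_has_sum_even[OF xy]] by simp
  with 1 have "infsum ?f UNIV = Q_kernel \<beta> x y"
    unfolding weight_homogeneous[OF d dim xy] by (rule sums_unique2)
  with hs show ?thesis by simp
qed

end

lemma obtain_unit_vectors_inner:
  assumes "CARD('n::finite) \<ge> 2" "u \<in> {-1..1}"
  obtains x y :: "real ^ 'n" where "norm x = 1" "norm y = 1" "x \<bullet> y = u"
proof -
  obtain i j :: 'n where ij: "i \<noteq> j"
    using assms(1) card_le_Suc0_iff_eq[of "UNIV :: 'n set"] by auto
  define x y :: "real ^ 'n" where "x = axis i 1" and "y = u *\<^sub>R axis i 1 + sqrt (1 - u\<^sup>2) *\<^sub>R axis j 1"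
  have u: "u\<^sup>2 \<le> 1" using assms(2) by (simp add: abs_square_le_1 abs_le_iff)
  have "y \<bullet> y = 1"
    using ij u by (simp add: y_def inner_add_left inner_add_right inner_axis_axis power2_eq_square[symmetric])
  hence "norm y = 1" by (simp add: norm_eq_1)
  moreover have "norm x = 1" by (simp add: x_def)
  moreover have "x \<bullet> y = u" using ij by (simp add: x_def y_def inner_add_right inner_axis_axis)
  ultimately show ?thesis using that by blast
qed

section \<open>Ultraspherical coefficients and the Kampe de Feriet series\<close>

lemma integral_gegen_product:
  assumes d: "d \<ge> 2"
  shows "(\<integral>u. gegen_product d p q u * gegenbauer_P d k u \<partial>gegen_measure d) =
    gegen_moment ((real d + 1) / 2) p k * gegen_moment ((real d + 1) / 2) q k"
proof -
  let ?m = "gegen_moment ((real d + 1) / 2)"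
  have int: "integrable (gegen_measure d) (\<lambda>u. c * (gegenbauer_P d i u * gegenbauer_P d k u))" for c i
    by (intro integrable_gegen_continuous[OF d] continuous_intros)
  have "(\<integral>u. gegen_product d p q u * gegenbauer_P d k u \<partial>gegen_measure d) =
    (\<integral>u. (\<Sum>i\<le>p. (?m p i * ?m q i * harmonic_dim d i) * (gegenbauer_P d i u * gegenbauer_P d k u)) \<partial>gegen_measure d)"
    unfolding gegen_product_def sum_distrib_right
    by (intro Bochner_Integration.integral_cong sum.cong refl) (simp add: mult_ac)
  also have "\<dots> = (\<Sum>i\<le>p. ?m p i * ?m q i * harmonic_dim d i * (if i = k then 1 / harmonic_dim d k else 0))"
    by (subst Bochner_Integration.integral_sum) (use int in \<open>simp_all add: gegenbauer_P_orthonormal[OF d]\<close>)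
  also have "\<dots> = (\<Sum>i\<le>p. if i = k then ?m p k * ?m q k else 0)"
    using harmonic_dim_pos[OF d, of k] by (intro sum.cong refl) auto
  also have "\<dots> = ?m p k * ?m q k" by (auto simp: gegen_moment_eq_0)
  finally show ?thesis .
qed

lemma continuous_on_gegen_product [continuous_intros]:
  "continuous_on A f \<Longrightarrow> continuous_on A (\<lambda>x. gegen_product d p q (f x))"
  unfolding gegen_product_def by (intro continuous_intros)

context half_integer_free
begin

text \<open>The \<open>k\<close>-th ultraspherical coefficient of \<open>Q\<close>, obtained by
  replacing each \<open>gegen_product\<close> in the expansion by its own coefficient.\<close>

definition qcoef :: "nat \<Rightarrow> nat \<Rightarrow> real" where
  "qcoef d k = infsum (\<lambda>(p, q). weight p q *
     (gegen_moment ((real d + 1) / 2) p k * gegen_moment ((real d + 1) / 2) q k)) UNIV"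

text \<open>With \<open>a = 1/2 - \<beta>\<close>, duplication splits
  \<open>pochhammer (2 * (a + n)) (2 * k)\<close> into symbols at \<open>a + n\<close> and
  \<open>a + 1/2 + n\<close>, and each of them prolongs one numerator symbol of \<open>hcoef\<close>
  from length \<open>n\<close> to length \<open>k + n\<close>. The exponents of \<open>m\<close> and
  \<open>h\<close> are \<open>2 * k\<close> and \<open>2 * n\<close>.\<close>

lemma kampe_de_feriet_term_qterm:
  fixes x y :: "real ^ 'n::{finite, wellorder}"
  assumes dim: "CARD('n) = d + 1" and xy: "norm x = 1" "norm y = 1"
  shows "kampe_de_feriet_term [1 / 2 - \<beta>, 1 - \<beta>] [(real d + 1) / 2] [] [] [1 / 2] [3 / 2 - \<beta>]
      ((1 + x \<bullet> y) / 2) ((1 - x \<bullet> y) / 2) k n =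
    (2 * \<beta> - 1) * (LINT z|sphere_measure. qterm (mid x y \<bullet> z) (hdiff x y \<bullet> z) (n, 2 * k))"
proof -
  define a where "a = 1 / 2 - \<beta>"
  define X Y where "X = (1 + x \<bullet> y) / 2" and "Y = (1 - x \<bullet> y) / 2"
  define \<nu> where "\<nu> = (real d + 1) / 2"
  have N: "real CARD('n) / 2 = \<nu>" by (simp add: dim \<nu>_def)
  have b: "1 - \<beta> = a + 1 / 2" "3 / 2 - \<beta> = a + 1" by (simp_all add: a_def)
  have h: "(2 * \<beta> - 1) * hcoef \<beta> n = pochhammer a n * pochhammer (a + 1 / 2) n / (pochhammer (a + 1) n * fact n)"
    using hyp2F1_term_hcoef[of 1 n] unfolding b a_def[symmetric] by (simp add: hyp2F1_term_def)
  have e: "2 * real n + 1 - 2 * \<beta> = 2 * (a + real n)" by (simp add: a_def algebra_simps)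
  have "pc (2 * real n + 1 - 2 * \<beta>) (2 * k) =
      4 ^ k * pochhammer (a + real n) k * pochhammer (a + real n + 1 / 2) k / (4 ^ k * pochhammer (1 / 2) k * fact k)"
    unfolding pc_def e pochhammer_double fact_double_pochhammer by (simp add: power_mult)
  hence p: "pc (2 * real n + 1 - 2 * \<beta>) (2 * k) * pochhammer (1 / 2) k =
     pochhammer (a + real n) k * pochhammer (a + 1 / 2 + real n) k / fact k"
    using pochhammer_pos[of "1 / 2 :: real" k] by (simp add: add_ac)
  have "(2 * \<beta> - 1) * (LINT z|sphere_measure. qterm (mid x y \<bullet> z) (hdiff x y \<bullet> z) (n, 2 * k)) =
    ((2 * \<beta> - 1) * hcoef \<beta> n) * (pc (2 * real n + 1 - 2 * \<beta>) (2 * k) * pochhammer (1 / 2) k) *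
     pochhammer (1 / 2) n / pochhammer \<nu> (k + n) * X ^ k * Y ^ n"
    unfolding integral_qterm_even[OF xy] N X_def[symmetric] Y_def[symmetric] by simp
  also have "\<dots> = (pochhammer a n * pochhammer (a + real n) k) * (pochhammer (a + 1 / 2) n * pochhammer (a + 1 / 2 + real n) k) /
     pochhammer \<nu> (k + n) * (pochhammer (1 / 2) n / pochhammer (a + 1) n) * (X ^ k * Y ^ n / (fact k * fact n))"
    unfolding h p by (simp add: mult_ac)
  also have "\<dots> = kampe_de_feriet_term [a, a + 1 / 2] [\<nu>] [] [] [1 / 2] [a + 1] X Y k n"
    by (simp add: kampe_de_feriet_term_def poch_list_def pochhammer_product'[symmetric] add.commute[of k n])
  finally show ?thesis unfolding b \<nu>_def X_def Y_def a_def[symmetric] by (rule sym)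
qed

lemma
  fixes x y :: "real ^ 'n::{finite, wellorder}"
  assumes dim: "CARD('n) = d + 1" and xy: "norm x = 1" "norm y = 1"
  shows kampe_de_feriet_converges_Q:
      "kampe_de_feriet_converges [1 / 2 - \<beta>, 1 - \<beta>] [(real d + 1) / 2] [] [] [1 / 2] [3 / 2 - \<beta>]
        ((1 + x \<bullet> y) / 2) ((1 - x \<bullet> y) / 2)"
    and Q_kernel_kampe_de_feriet:
      "Q_kernel \<beta> x y = 1 / (2 * \<beta> - 1) *
        kampe_de_feriet [1 / 2 - \<beta>, 1 - \<beta>] [(real d + 1) / 2] [] [] [1 / 2] [3 / 2 - \<beta>]
        ((1 + x \<bullet> y) / 2) ((1 - x \<bullet> y) / 2)"
proof -
  let ?t = "kampe_de_feriet_term [1 / 2 - \<beta>, 1 - \<beta>] [(real d + 1) / 2] [] [] [1 / 2] [3 / 2 - \<beta>]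
      ((1 + x \<bullet> y) / 2) ((1 - x \<bullet> y) / 2)"
  have "((\<lambda>(n, k). LINT z|sphere_measure. qterm (mid x y \<bullet> z) (hdiff x y \<bullet> z) (n, 2 * k)) has_sum Q_kernel \<beta> x y) (UNIV \<times> UNIV)"
    using Q_kernel_has_sum_even[OF xy] by simp
  hence "((\<lambda>(k, n). LINT z|sphere_measure. qterm (mid x y \<bullet> z) (hdiff x y \<bullet> z) (n, 2 * k)) has_sum Q_kernel \<beta> x y) (UNIV \<times> UNIV)"
    by (subst (asm) has_sum_swap) simp
  from has_sum_cmult_right[OF this, of "2 * \<beta> - 1"]
  have hs: "((\<lambda>(k, n). ?t k n) has_sum (2 * \<beta> - 1) * Q_kernel \<beta> x y) (UNIV \<times> UNIV)"
    by (simp only: kampe_de_feriet_term_qterm[OF dim xy] case_prod_unfold)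
  have inner: "((\<lambda>n. ?t k n) has_sum infsum (\<lambda>n. ?t k n) UNIV) UNIV" for k
    using summable_on_SigmaD1[OF has_sum_imp_summable[OF hs], of k] by (intro has_sum_infsum) simp
  hence inner': "?t k sums infsum (?t k) UNIV" for k by (intro has_sum_imp_sums) simp
  hence eq: "infsum (?t k) UNIV = (\<Sum>n. ?t k n)" for k by (simp add: sums_iff)
  have "((\<lambda>k. infsum (\<lambda>n. ?t k n) UNIV) has_sum (2 * \<beta> - 1) * Q_kernel \<beta> x y) UNIV"
    by (rule has_sum_SigmaD[OF hs]) (use inner in simp)
  hence outer: "(\<lambda>k. \<Sum>n. ?t k n) sums ((2 * \<beta> - 1) * Q_kernel \<beta> x y)"
    unfolding eq by (rule has_sum_imp_sums)
  show "kampe_de_feriet_converges [1 / 2 - \<beta>, 1 - \<beta>] [(real d + 1) / 2] [] [] [1 / 2] [3 / 2 - \<beta>]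
        ((1 + x \<bullet> y) / 2) ((1 - x \<bullet> y) / 2)"
    unfolding kampe_de_feriet_converges_def using inner' outer by (auto simp: sums_iff)
  have "kampe_de_feriet [1 / 2 - \<beta>, 1 - \<beta>] [(real d + 1) / 2] [] [] [1 / 2] [3 / 2 - \<beta>]
        ((1 + x \<bullet> y) / 2) ((1 - x \<bullet> y) / 2) = (2 * \<beta> - 1) * Q_kernel \<beta> x y"
    unfolding kampe_de_feriet_def using outer by (simp add: sums_iff)
  thus "Q_kernel \<beta> x y = 1 / (2 * \<beta> - 1) *
        kampe_de_feriet [1 / 2 - \<beta>, 1 - \<beta>] [(real d + 1) / 2] [] [] [1 / 2] [3 / 2 - \<beta>]
        ((1 + x \<bullet> y) / 2) ((1 - x \<bullet> y) / 2)"
    using beta_gt by simp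
qed

text \<open>The sums over \<open>(p, q)\<close> and over \<open>k\<close> may be exchanged: since
  \<open>\<bar>P\<^sub>k\<bar> \<le> 1\<close> and the moments are nonnegative, the absolute terms
  with fixed \<open>(p, q)\<close> add up to at most \<open>\<bar>weight p q\<bar>\<close> times
  \<open>gegen_product\<close> at \<open>x \<bullet> x = 1\<close>, which is at most 1.\<close>

lemma Q_kernel_gegenbauer_sums:
  fixes x y :: "real ^ 'n::{finite, wellorder}"
  assumes d: "d \<ge> 2" and dim: "CARD('n) = d + 1" and xy: "norm x = 1" "norm y = 1"
  shows "(\<lambda>k. qcoef d k * harmonic_dim d k * gegenbauer_P d k (x \<bullet> y)) sums Q_kernel \<beta> x y"
proof -
  let ?\<nu> = "(real d + 1) / 2"
  let ?m = "gegen_moment ?\<nu>"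
  have \<nu>: "?\<nu> > 0" by (simp add: add_nonneg_pos)
  define c where "c p q k = ?m p k * ?m q k * harmonic_dim d k" for p q k
  have c0: "c p q k \<ge> 0" for p q k
    using gegen_moment_nonneg[OF \<nu>] harmonic_dim_pos[OF d] by (simp add: c_def less_imp_le)
  have c_zero: "c p q k = 0" if "k > p" for p q k using that by (simp add: c_def gegen_moment_eq_0)
  define f where "f = (\<lambda>((p, q), k). weight p q * (c p q k * gegenbauer_P d k (x \<bullet> y)))"
  have "(\<lambda>i. norm (f i)) summable_on (UNIV \<times> UNIV)"
  proof (rule summable_on_SigmaI[where g = "\<lambda>(p, q). \<Sum>k\<le>p. \<bar>f ((p, q), k)\<bar>"])
    fix i :: "nat \<times> nat"
    obtain p q where i: "i = (p, q)" by (cases i)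
    have "((\<lambda>k. norm (f ((p, q), k))) has_sum (\<Sum>k\<le>p. \<bar>f ((p, q), k)\<bar>)) {..p}"
      by (rule has_sum_finiteI) auto
    also have "?this \<longleftrightarrow> ((\<lambda>k. norm (f ((p, q), k))) has_sum (\<Sum>k\<le>p. \<bar>f ((p, q), k)\<bar>)) UNIV"
      by (rule has_sum_cong_neutral) (auto simp: f_def c_zero)
    finally show "((\<lambda>k. norm (f (i, k))) has_sum (case i of (p, q) \<Rightarrow> \<Sum>k\<le>p. \<bar>f ((p, q), k)\<bar>)) UNIV"
      by (simp add: i)
  next
    show "(\<lambda>(p, q). \<Sum>k\<le>p. \<bar>f ((p, q), k)\<bar>) summable_on UNIV"
    proof (rule summable_on_comparison_test[OF weight_abs_summable])
      fix i :: "nat \<times> nat"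
      obtain p q where i: "i = (p, q)" by (cases i)
      have "(\<Sum>k\<le>p. \<bar>f ((p, q), k)\<bar>) \<le> (\<Sum>k\<le>p. \<bar>weight p q\<bar> * (c p q k * 1))"
      proof (intro sum_mono)
        fix k
        have "\<bar>f ((p, q), k)\<bar> = \<bar>weight p q\<bar> * (c p q k * \<bar>gegenbauer_P d k (x \<bullet> y)\<bar>)"
          using c0[of p q k] by (simp add: f_def abs_mult)
        also have "\<dots> \<le> \<bar>weight p q\<bar> * (c p q k * 1)"
          using c0 by (intro mult_left_mono gegenbauer_P_abs_le_1[OF d dim xy]) auto
        finally show "\<bar>f ((p, q), k)\<bar> \<le> \<bar>weight p q\<bar> * (c p q k * 1)" .
      qed
      also have "\<dots> = \<bar>weight p q\<bar> * gegen_product d p q (x \<bullet> x)"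
        using xy d by (simp add: gegen_product_def c_def sum_distrib_left norm_eq_1)
      also have "\<dots> \<le> \<bar>weight p q\<bar> * 1"
        using gegen_product_abs_le_1[OF d dim xy(1) xy(1), of p q] by (intro mult_left_mono) auto
      finally show "(case i of (p, q) \<Rightarrow> \<Sum>k\<le>p. \<bar>f ((p, q), k)\<bar>) \<le> (case i of (p, q) \<Rightarrow> \<bar>weight p q\<bar>)"
        by (simp add: i)
    qed auto
  qed auto
  hence "f summable_on (UNIV \<times> UNIV)" by (subst summable_on_iff_abs_summable_on_real) simp
  hence hs: "(f has_sum infsum f (UNIV \<times> UNIV)) (UNIV \<times> UNIV)" by (rule has_sum_infsum)
  have "((\<lambda>(p, q). weight p q * gegen_product d p q (x \<bullet> y)) has_sum infsum f (UNIV \<times> UNIV)) UNIV"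
  proof (rule has_sum_SigmaD[OF hs])
    fix i :: "nat \<times> nat"
    obtain p q where i: "i = (p, q)" by (cases i)
    have "((\<lambda>k. f ((p, q), k)) has_sum (weight p q * gegen_product d p q (x \<bullet> y))) {..p}"
      by (rule has_sum_finiteI) (auto simp: gegen_product_def f_def c_def sum_distrib_left mult_ac)
    also have "?this \<longleftrightarrow> ((\<lambda>k. f ((p, q), k)) has_sum (weight p q * gegen_product d p q (x \<bullet> y))) UNIV"
      by (rule has_sum_cong_neutral) (auto simp: f_def c_zero)
    finally show "((\<lambda>k. f (i, k)) has_sum (case i of (p, q) \<Rightarrow> weight p q * gegen_product d p q (x \<bullet> y))) UNIV"
      by (simp add: i)
  qed
  hence S: "infsum f (UNIV \<times> UNIV) = Q_kernel \<beta> x y"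
    using Q_kernel_gegen_product[OF d dim xy] has_sum_unique by blast
  have hs': "((\<lambda>(k, i). f (i, k)) has_sum Q_kernel \<beta> x y) (UNIV \<times> UNIV)"
    using hs unfolding S by (subst has_sum_swap) simp
  have "((\<lambda>k. qcoef d k * harmonic_dim d k * gegenbauer_P d k (x \<bullet> y)) has_sum Q_kernel \<beta> x y) UNIV"
  proof (rule has_sum_SigmaD[OF hs'])
    fix k :: nat
    have "(\<lambda>i. f (i, k)) summable_on UNIV"
      using summable_on_SigmaD1[OF has_sum_imp_summable[OF hs'], of k] by simp
    hence "((\<lambda>i. f (i, k)) has_sum infsum (\<lambda>i. f (i, k)) UNIV) UNIV" by (rule has_sum_infsum)
    also have "(\<lambda>i. f (i, k)) = (\<lambda>i. (case i of (p, q) \<Rightarrow> weight p q * (?m p k * ?m q k)) * (harmonic_dim d k * gegenbauer_P d k (x \<bullet> y)))"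
      by (auto simp: f_def c_def fun_eq_iff)
    also have "infsum \<dots> UNIV = qcoef d k * harmonic_dim d k * gegenbauer_P d k (x \<bullet> y)"
      unfolding infsum_cmult_left' qcoef_def by simp
    finally show "((\<lambda>y. case (k, y) of (k, i) \<Rightarrow> f (i, k)) has_sum
      qcoef d k * harmonic_dim d k * gegenbauer_P d k (x \<bullet> y)) UNIV"
      by (auto simp: f_def c_def fun_eq_iff case_prod_unfold mult_ac)
  qed
  thus ?thesis by (rule has_sum_imp_sums)
qed

text \<open>The expansion in \<open>gegen_product\<close> contains the vectors only through their
  inner product, which provides the uniqueness required by the definite description.\<close>

lemma zonal_profile_Q_kernel:
  fixes x y :: "real ^ 'n::{finite, wellorder}"
  assumes d: "d \<ge> 2" and dim: "CARD('n) = d + 1" and xy: "norm x = 1" "norm y = 1"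
  shows "zonal_profile (Q_kernel \<beta> :: real ^ 'n::_ \<Rightarrow> real ^ 'n::_ \<Rightarrow> real) (x \<bullet> y) = Q_kernel \<beta> x y"
  unfolding zonal_profile_def
proof (rule the_equality)
  have *: "Q_kernel \<beta> x' y' = Q_kernel \<beta> x y" if "norm x' = 1" "norm y' = 1" "x' \<bullet> y' = x \<bullet> y"
    for x' y' :: "real ^ 'n::_"
    using Q_kernel_gegen_product[OF d dim xy] Q_kernel_gegen_product[OF d dim that(1,2)] that(3)
    by (simp add: has_sum_unique)
  show "\<forall>x'\<in>sphere (0 :: real ^ 'n::_) 1. \<forall>y'\<in>sphere 0 1. x' \<bullet> y' = x \<bullet> y \<longrightarrow> Q_kernel \<beta> x' y' = Q_kernel \<beta> x y"
    by (intro ballI impI; rule *; simp)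
qed (use xy in auto)

lemma ultraspherical_coeff_Q_kernel:
  assumes d: "d \<ge> 2" and dim: "CARD('n::{finite, wellorder}) = d + 1"
  shows "ultraspherical_coeff d (zonal_profile (Q_kernel \<beta> :: real ^ 'n::_ \<Rightarrow> real ^ 'n::_ \<Rightarrow> real)) k = qcoef d k"
proof -
  let ?m = "gegen_moment ((real d + 1) / 2)"
  let ?q = "zonal_profile (Q_kernel \<beta> :: real ^ 'n::_ \<Rightarrow> real ^ 'n::_ \<Rightarrow> real)"
  interpret prob_space "gegen_measure d" by (rule prob_space_gegen_measure[OF d])
  \<comment> \<open>The indicator restricts to \<open>[-1, 1]\<close>, where every \<open>u\<close>
    is an inner product of unit vectors; the bounds by 1 on \<open>gegen_product\<close> and
    \<open>gegenbauer_P\<close> are known only for such \<open>u\<close>.\<close>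
  define f where "f i u = indicator {-1..1} u * ((case i of (p, q) \<Rightarrow> weight p q * gegen_product d p q u) * gegenbauer_P d k u)"
    for i and u :: real
  have card2: "CARD('n) \<ge> 2" using dim d by simp
  define B where "B = infsum (\<lambda>(p, q). \<bar>weight p q\<bar>) UNIV"
  have G: "integrable (gegen_measure d) (\<lambda>_. B)" by simp
  have meas: "f i \<in> borel_measurable (gegen_measure d)" for i
  proof -
    obtain p q where i: "i = (p, q)" by (cases i)
    have [measurable]: "gegen_product d p q \<in> borel_measurable borel" "gegenbauer_P d k \<in> borel_measurable borel"
      by (intro borel_measurable_continuous_onI continuous_intros)+
    show ?thesis unfolding f_def[abs_def] i split
      by (subst measurable_cong_sets[OF sets_gegen_measure refl]) measurable
  qed
  have bd: "(\<Sum>i\<in>F. \<bar>f i u\<bar>) \<le> B" if F: "finite F" for u and F :: "(nat \<times> nat) set"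
  proof -
    have "\<bar>f (p, q) u\<bar> \<le> \<bar>weight p q\<bar>" for p q
    proof (cases "u \<in> {-1..1}")
      case True
      then obtain x y :: "real ^ 'n::_" where xy: "norm x = 1" "norm y = 1" "x \<bullet> y = u"
        using obtain_unit_vectors_inner[OF card2] by blast
      have "\<bar>gegen_product d p q u\<bar> * \<bar>gegenbauer_P d k u\<bar> \<le> 1 * 1"
        using gegen_product_abs_le_1[OF d dim xy(1,2), of p q] gegenbauer_P_abs_le_1[OF d dim xy(1,2), of k]
        unfolding xy(3) by (intro mult_mono) auto
      hence "\<bar>weight p q\<bar> * (\<bar>gegen_product d p q u\<bar> * \<bar>gegenbauer_P d k u\<bar>) \<le> \<bar>weight p q\<bar>"
        by (intro mult_left_le) auto
      thus ?thesis using True by (simp add: f_def abs_mult mult.assoc)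
    qed (simp add: f_def)
    hence "(\<Sum>i\<in>F. \<bar>f i u\<bar>) \<le> (\<Sum>i\<in>F. case i of (p, q) \<Rightarrow> \<bar>weight p q\<bar>)"
      by (intro sum_mono) auto
    also have "\<dots> \<le> B" unfolding B_def
      by (rule finite_sum_le_infsum[OF weight_abs_summable F]) auto
    finally show ?thesis .
  qed
  have inf: "infsum (\<lambda>i. f i u) UNIV = ?q u * gegenbauer_P d k u" if u: "u \<in> {-1..1}" for u
  proof -
    obtain x y :: "real ^ 'n::_" where xy: "norm x = 1" "norm y = 1" "x \<bullet> y = u"
      using obtain_unit_vectors_inner[OF card2 u] by blast
    have "infsum (\<lambda>i. f i u) UNIV = infsum (\<lambda>(p, q). weight p q * gegen_product d p q u) UNIV * gegenbauer_P d k u"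
      using u by (simp add: f_def infsum_cmult_left')
    also have "infsum (\<lambda>(p, q). weight p q * gegen_product d p q u) UNIV = Q_kernel \<beta> x y"
      using Q_kernel_gegen_product[OF d dim xy(1,2)] xy(3) by (intro infsumI) simp
    also have "\<dots> = ?q u"
      using zonal_profile_Q_kernel[OF d dim xy(1,2)] xy(3) by simp
    finally show ?thesis .
  qed
  have intf: "(\<integral>u. f (p, q) u \<partial>gegen_measure d) = weight p q * (?m p k * ?m q k)" for p q
  proof -
    have "(\<integral>u. f (p, q) u \<partial>gegen_measure d) = (\<integral>u. weight p q * (gegen_product d p q u * gegenbauer_P d k u) \<partial>gegen_measure d)"
    proof (rule integral_cong_AE)
      show "AE u in gegen_measure d. f (p, q) u = weight p q * (gegen_product d p q u * gegenbauer_P d k u)"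
        using AE_gegen_measure by eventually_elim (simp add: f_def)
      show "f (p, q) \<in> borel_measurable (gegen_measure d)" by (rule meas)
      show "(\<lambda>u. weight p q * (gegen_product d p q u * gegenbauer_P d k u)) \<in> borel_measurable (gegen_measure d)"
        by (subst measurable_cong_sets[OF sets_gegen_measure refl])
           (intro borel_measurable_continuous_onI continuous_intros)
    qed
    also have "\<dots> = weight p q * (?m p k * ?m q k)"
      by (simp add: integral_gegen_product[OF d])
    finally show ?thesis .
  qed
  have "ultraspherical_coeff d ?q k = sphere_area (d - 1) / sphere_area d *
     (LINT u:{-1..1}|lborel. infsum (\<lambda>i. f i u) UNIV * (1 - u\<^sup>2) powr (real d / 2 - 1))"
    unfolding ultraspherical_coeff_def
    by (intro arg_cong2[where f = "(*)"] refl set_lebesgue_integral_cong) (auto simp: inf)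
  also have "\<dots> = (\<integral>u. infsum (\<lambda>i. f i u) UNIV \<partial>gegen_measure d)"
  proof (rule integral_gegen_measure[symmetric])
    have "(\<lambda>u. infsum (\<lambda>i. f i u) UNIV) \<in> borel_measurable (gegen_measure d)"
      using integrable_double_sum[OF G meas bd] by (rule borel_measurable_integrable)
    thus "(\<lambda>u. infsum (\<lambda>i. f i u) UNIV) \<in> borel_measurable borel"
      by (subst (asm) measurable_cong_sets[OF sets_gegen_measure refl])
  qed
  also have "\<dots> = infsum (\<lambda>i. \<integral>u. f i u \<partial>gegen_measure d) UNIV"
    using has_sum_integral_double_sum[OF G meas bd] by (rule infsumI[symmetric])
  also have "\<dots> = qcoef d k"
    unfolding qcoef_def by (intro infsum_cong) (auto simp: intf)
  finally show ?thesis .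
qed

text \<open>At \<open>\<beta> = M\<close> the factor \<open>pc (1 - M) p\<close> vanishes from
  \<open>p = M\<close> on, and the moment vanishes for \<open>p < k\<close>. Nothing is left for
  \<open>k \<ge> M\<close>, and for \<open>k = M - 1\<close> only \<open>p = q = M - 1\<close>, with
  denominator 1.\<close>

lemma
  assumes M: "M \<ge> 1" "\<beta> = real M"
  shows qcoef_eq_0: "k \<ge> M \<Longrightarrow> qcoef d k = 0"
    and qcoef_nonzero: "d \<ge> 2 \<Longrightarrow> qcoef d (M - 1) \<noteq> 0"
proof -
  let ?m = "gegen_moment ((real d + 1) / 2)"
  have pc0: "pc (1 - \<beta>) p = 0 \<longleftrightarrow> p \<ge> M" for p
  proof -
    have e: "1 - \<beta> = - real (M - 1)" using M by simp
    show ?thesis using M(1) unfolding e by (auto simp: pc_def pochhammer_of_nat_eq_0_iff simp del: of_nat_diff)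
  qed
  have w0: "weight p q * (?m p k * ?m q k) = 0" if "k \<ge> M \<or> p \<noteq> k \<or> q \<noteq> k" "k \<ge> M - 1" for p q k
  proof -
    have "p < k \<or> q < k \<or> p \<ge> M \<or> q \<ge> M" using that by linarith
    thus ?thesis by (auto simp: weight_def pc0 gegen_moment_eq_0)
  qed
  show "qcoef d k = 0" if "k \<ge> M"
    unfolding qcoef_def by (rule infsum_0) (use that w0 in \<open>auto simp del: mult_eq_0_iff\<close>)
  assume d: "d \<ge> 2"
  let ?k = "M - 1"
  have "qcoef d ?k = infsum (\<lambda>(p, q). weight p q * (?m p ?k * ?m q ?k)) {(?k, ?k)}"
    unfolding qcoef_def
  proof (rule infsum_cong_neutral)
    fix i assume "i \<in> UNIV - {(?k, ?k)}"
    thus "(case i of (p, q) \<Rightarrow> weight p q * (?m p ?k * ?m q ?k)) = 0"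
      using w0[of ?k "fst i" "snd i"] by (cases i) auto
  qed auto
  also have "\<dots> = weight ?k ?k * (?m ?k ?k * ?m ?k ?k)" by simp
  also have "\<dots> \<noteq> 0"
  proof -
    have "pochhammer ((real d + 1) / 2) ((?k + ?k) div 2) > 0" by (intro pochhammer_pos) (simp add: add_nonneg_pos)
    hence "?m ?k ?k \<noteq> 0" by (simp add: gegen_moment_def)
    moreover have "2 * \<beta> - 1 - real (?k + ?k) = 1" using M by (simp add: of_nat_diff)
    moreover have "pc (1 - \<beta>) ?k \<noteq> 0" unfolding pc0 using M(1) by simp
    ultimately show ?thesis by (simp add: weight_def)
  qed
  finally show "qcoef d (M - 1) \<noteq> 0" .
qed

text \<open>Only the summand \<open>k = M - 1\<close> reaches degree \<open>M - 1\<close>; its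
  coefficient and the leading coefficient of its Gegenbauer polynomial are nonzero, so nothing
  cancels.\<close>

lemma qcoef_polynomial:
  assumes d: "d \<ge> 2" and M: "M \<ge> 1" "\<beta> = real M"
  defines "P \<equiv> \<Sum>k<M. smult (qcoef d k * harmonic_dim d k) (gegenbauer_poly d k)"
  shows "P \<noteq> 0" "degree P = M - 1"
    and "(\<Sum>k<M. qcoef d k * harmonic_dim d k * gegenbauer_P d k u) = poly P u"
proof -
  show "(\<Sum>k<M. qcoef d k * harmonic_dim d k * gegenbauer_P d k u) = poly P u"
    by (simp add: P_def poly_sum poly_gegenbauer_poly)
  have deg: "degree P \<le> M - 1"
    unfolding P_def
  proof (rule degree_sum_le)
    fix k assume "k \<in> {..<M}"
    thus "degree (smult (qcoef d k * harmonic_dim d k) (gegenbauer_poly d k)) \<le> M - 1"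
      using degree_smult_le[of _ "gegenbauer_poly d k"] degree_gegenbauer_poly_le[of d k]
      by (auto intro: order.trans)
  qed simp
  have "coeff P (M - 1) = (\<Sum>k<M. if k = M - 1 then qcoef d (M - 1) * harmonic_dim d (M - 1) * coeff (gegenbauer_poly d (M - 1)) (M - 1) else 0)"
    unfolding P_def coeff_sum
  proof (intro sum.cong refl)
    fix k assume k: "k \<in> {..<M}"
    show "coeff (smult (qcoef d k * harmonic_dim d k) (gegenbauer_poly d k)) (M - 1) =
      (if k = M - 1 then qcoef d (M - 1) * harmonic_dim d (M - 1) * coeff (gegenbauer_poly d (M - 1)) (M - 1) else 0)"
    proof (cases "k = M - 1")
      case False
      hence "degree (gegenbauer_poly d k) < M - 1" using k degree_gegenbauer_poly_le[of d k] by auto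
      thus ?thesis using False by (simp add: coeff_eq_0)
    qed simp
  qed
  also have "\<dots> = qcoef d (M - 1) * harmonic_dim d (M - 1) * coeff (gegenbauer_poly d (M - 1)) (M - 1)"
    using M by simp
  also have "\<dots> \<noteq> 0"
    using qcoef_nonzero[OF M d] harmonic_dim_pos[OF d, of "M - 1"] lead_gegenbauer_poly[OF d, of "M - 1"] by simp
  finally have c: "coeff P (M - 1) \<noteq> 0" .
  thus "P \<noteq> 0" by auto
  show "degree P = M - 1" using deg le_degree[OF c] by simp
qed

end

section \<open>The kernel of truncated powers\<close>

lemma borel_measurable_trunc_pow [measurable]: "(\<lambda>u. trunc_pow u \<alpha>) \<in> borel_measurable borel"
  unfolding trunc_pow_def by measurable

lemma trunc_pow_nonneg [simp]: "trunc_pow u \<alpha> \<ge> 0"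
  by (simp add: trunc_pow_def)

context half_integer_free
begin

lemma qfun_abs: "qfun W \<bar>h\<bar> = qfun W h"
  by (simp add: qfun_def power_mult power_divide)

text \<open>Absolute summability of \<open>hcoef\<close> gives uniform convergence up to and
  including \<open>v = h\<close>, which is the lower limit of the integral over \<open>v\<close>.
  The case \<open>h = 0\<close> is separate because \<open>v\<close> may then be 0.\<close>

lemma qfun_continuous:
  assumes "h \<ge> 0"
  shows "continuous_on {h..} (\<lambda>v. qfun v h)"
proof (cases "h = 0")
  case True
  have "qfun v h = v powr (2 * \<beta> - 1) * hcoef \<beta> 0" for v
  proof -
    have "(\<lambda>n. hcoef \<beta> n * (h / v) ^ (2 * n)) sums (\<Sum>n\<in>{0}. hcoef \<beta> n * (h / v) ^ (2 * n))"
      by (rule sums_finite) (auto simp: True)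
    thus ?thesis by (simp add: qfun_def sums_iff)
  qed
  moreover have "continuous_on {h..} (\<lambda>v. v powr (2 * \<beta> - 1) * hcoef \<beta> 0)"
    using beta_gt True by (intro continuous_intros continuous_on_powr') auto
  ultimately show ?thesis by simp
next
  case False
  have "uniform_limit {h..} (\<lambda>n v. \<Sum>i<n. hcoef \<beta> i * (h / v) ^ (2 * i))
     (\<lambda>v. \<Sum>i. hcoef \<beta> i * (h / v) ^ (2 * i)) sequentially"
  proof (rule Weierstrass_m_test[OF _ hcoef_summable])
    fix n v assume "v \<in> {h..}"
    hence "(h / v) ^ (2 * n) \<le> 1" "(h / v) ^ (2 * n) \<ge> 0" using assms False by (auto intro!: power_le_one)
    thus "norm (hcoef \<beta> n * (h / v) ^ (2 * n)) \<le> \<bar>hcoef \<beta> n\<bar>"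
      by (simp add: abs_mult mult_left_le)
  qed
  hence "continuous_on {h..} (\<lambda>v. \<Sum>i. hcoef \<beta> i * (h / v) ^ (2 * i))"
    by (rule uniform_limit_theorem[rotated])
       (use assms False in \<open>auto intro!: always_eventually continuous_intros\<close>)
  thus ?thesis unfolding qfun_def
    using assms False by (intro continuous_intros continuous_on_powr') auto
qed

text \<open>The series \<open>G\<close> satisfies \<open>(2 * \<beta> - 1) * G w - 2 * w * G' w = (1
  - w) powr (\<beta> - 1)\<close>, because this operator multiplies the \<open>n\<close>-th
  coefficient by exactly its denominator \<open>2 * \<beta> - 1 - 2 * n\<close>. At
  \<open>w = (h / v)\<^sup>2\<close> this is the claim, up to a power of \<open>v\<close>.\<close>

lemma qfun_has_derivative:
  assumes h: "h \<ge> 0" and v: "v > h"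
  shows "((\<lambda>v. qfun v h) has_real_derivative (v\<^sup>2 - h\<^sup>2) powr (\<beta> - 1)) (at v)"
proof -
  define G where "G w = (\<Sum>n. hcoef \<beta> n * w ^ n)" for w
  define w where "w = (h / v)\<^sup>2"
  have v0: "v > 0" using assms by linarith
  have w: "0 \<le> w" "w < 1"
    using assms v0 unfolding w_def by (auto simp: power_less_one_iff abs_square_less_1)
  have dG: "(G has_real_derivative (\<Sum>n. diffs (hcoef \<beta>) n * w ^ n)) (at w)"
    unfolding G_def by (rule termdiffs_strong[where K = 1]) (use hcoef_power_summable[of 1] w in auto)
  have sG': "summable (\<lambda>n. diffs (hcoef \<beta>) n * w ^ n)"
    by (rule termdiff_converges[where K = 1]) (use w hcoef_power_summable in auto)
  have "(\<lambda>n. real n * hcoef \<beta> n * w ^ (n - Suc 0)) sums (\<Sum>n. diffs (hcoef \<beta>) n * w ^ n)"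
    using diffs_equiv[OF sG'] by (simp add: mult_ac)
  hence "(\<lambda>n. w * (real n * hcoef \<beta> n * w ^ (n - Suc 0))) sums (w * (\<Sum>n. diffs (hcoef \<beta>) n * w ^ n))"
    by (rule sums_mult)
  also have "(\<lambda>n. w * (real n * hcoef \<beta> n * w ^ (n - Suc 0))) = (\<lambda>n. real n * hcoef \<beta> n * w ^ n)"
  proof
    fix n show "w * (real n * hcoef \<beta> n * w ^ (n - Suc 0)) = real n * hcoef \<beta> n * w ^ n" by (cases n) auto
  qed
  finally have 1: "(\<lambda>n. real n * hcoef \<beta> n * w ^ n) sums (w * (\<Sum>n. diffs (hcoef \<beta>) n * w ^ n))" .
  have 2: "(\<lambda>n. hcoef \<beta> n * w ^ n) sums G w"
    unfolding G_def using hcoef_power_summable[of w] w by (intro summable_sums) auto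
  have "(\<lambda>n. (2 * \<beta> - 1) * (hcoef \<beta> n * w ^ n) - 2 * (real n * hcoef \<beta> n * w ^ n)) sums
      ((2 * \<beta> - 1) * G w - 2 * (w * (\<Sum>n. diffs (hcoef \<beta>) n * w ^ n)))"
    by (intro sums_diff sums_mult 1 2)
  also have "(\<lambda>n. (2 * \<beta> - 1) * (hcoef \<beta> n * w ^ n) - 2 * (real n * hcoef \<beta> n * w ^ n)) = (\<lambda>n. pc (1 - \<beta>) n * w ^ n)"
  proof
    fix n
    have "(2 * \<beta> - 1 - 2 * real n) * hcoef \<beta> n = pc (1 - \<beta>) n" using nonhalf[of n] by (simp add: hcoef_def)
    moreover have "(2 * \<beta> - 1) * (hcoef \<beta> n * w ^ n) - 2 * (real n * hcoef \<beta> n * w ^ n) =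
       ((2 * \<beta> - 1 - 2 * real n) * hcoef \<beta> n) * w ^ n" by (simp add: algebra_simps)
    ultimately show "(2 * \<beta> - 1) * (hcoef \<beta> n * w ^ n) - 2 * (real n * hcoef \<beta> n * w ^ n) = pc (1 - \<beta>) n * w ^ n"
      by simp
  qed
  finally have key: "(2 * \<beta> - 1) * G w - 2 * (w * (\<Sum>n. diffs (hcoef \<beta>) n * w ^ n)) = (1 - w) powr (\<beta> - 1)"
    using pc_sums[of w "1 - \<beta>"] w by (auto dest: sums_unique2)
  have "((\<lambda>v. v powr (2 * \<beta> - 1) * G ((h / v)\<^sup>2)) has_real_derivative
     ((2 * \<beta> - 1) * v powr (2 * \<beta> - 1 - 1)) * G ((h / v)\<^sup>2) +
     (\<Sum>n. diffs (hcoef \<beta>) n * w ^ n) * (- 2 * h\<^sup>2 / v ^ 3) * v powr (2 * \<beta> - 1)) (at v)"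
  proof (rule DERIV_mult)
    show "((\<lambda>v. v powr (2 * \<beta> - 1)) has_real_derivative (2 * \<beta> - 1) * v powr (2 * \<beta> - 1 - 1)) (at v)"
      by (rule has_real_derivative_powr[OF v0])
    have "((\<lambda>v. (h / v)\<^sup>2) has_real_derivative (- 2 * h\<^sup>2 / v ^ 3)) (at v)"
      using v0 by (auto intro!: derivative_eq_intros simp: field_simps power2_eq_square power3_eq_cube)
    thus "((\<lambda>v. G ((h / v)\<^sup>2)) has_real_derivative (\<Sum>n. diffs (hcoef \<beta>) n * w ^ n) * (- 2 * h\<^sup>2 / v ^ 3)) (at v)"
      by (rule DERIV_chain2[where f = G and g = "\<lambda>v. (h / v)\<^sup>2", OF dG[unfolded w_def], folded w_def])
  qed
  also have "(\<lambda>v. v powr (2 * \<beta> - 1) * G ((h / v)\<^sup>2)) = (\<lambda>v. qfun v h)"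
    by (simp add: qfun_def G_def power_mult)
  also have "((2 * \<beta> - 1) * v powr (2 * \<beta> - 1 - 1)) * G ((h / v)\<^sup>2) +
     (\<Sum>n. diffs (hcoef \<beta>) n * w ^ n) * (- 2 * h\<^sup>2 / v ^ 3) * v powr (2 * \<beta> - 1) = (v\<^sup>2 - h\<^sup>2) powr (\<beta> - 1)"
  proof -
    have p: "v powr (2 * \<beta> - 1) = v * v powr (2 * \<beta> - 2)"
      using v0 by (simp add: powr_mult_base)
    have "(v\<^sup>2 - h\<^sup>2) powr (\<beta> - 1) = (v\<^sup>2 * (1 - w)) powr (\<beta> - 1)"
      using v0 by (simp add: w_def power_divide right_diff_distrib)
    also have "\<dots> = (v\<^sup>2) powr (\<beta> - 1) * (1 - w) powr (\<beta> - 1)"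
      by (rule powr_mult)
    also have "(v\<^sup>2) powr (\<beta> - 1) = v powr (2 * \<beta> - 2)"
      using v0 by (simp add: powr_powr flip: powr_numeral)
    also have "v powr (2 * \<beta> - 2) * (1 - w) powr (\<beta> - 1) =
      v powr (2 * \<beta> - 2) * ((2 * \<beta> - 1) * G w - 2 * (w * (\<Sum>n. diffs (hcoef \<beta>) n * w ^ n)))"
      by (simp add: key)
    finally show ?thesis unfolding p
      using v0 by (simp add: w_def power_divide field_simps power2_eq_square power3_eq_cube)
  qed
  finally show ?thesis .
qed

text \<open>In the variable \<open>v = m - t\<close> the product is
  \<open>(v\<^sup>2 - h\<^sup>2) powr (\<beta> - 1)\<close>, and the factor with the smaller base
  cuts it off at \<open>v = h\<close>. For \<beta> < 1 it is singular there, so the fundamental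
  theorem is used with derivatives in the interior only; Lebesgue integrability follows from
  nonnegativity. At \<open>v = h\<close> the argument of the series is 1, which produces the sum of
  all \<open>hcoef\<close>.\<close>

lemma integral_trunc_pow_product_ordered:
  assumes b: "-1 \<le> m - h" and h: "0 \<le> h" and a: "m + h \<le> 1"
  defines "f \<equiv> \<lambda>t. trunc_pow (m + h - t) (\<beta> - 1) * trunc_pow (m - h - t) (\<beta> - 1)"
  shows "set_integrable lborel {-1..1} f"
    and "(LINT t:{-1..1}|lborel. f t) = qfun (1 + m) h - (\<Sum>n. hcoef \<beta> n) * h powr (2 * \<beta> - 1)"
proof -
  define F where "F t = - qfun (m - t) h" for t
  have "(f has_integral (F (m - h) - F (-1))) {-1..m - h}"
  proof (rule fundamental_theorem_of_calculus_interior)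
    show "-1 \<le> m - h" by fact
    have "continuous_on {-1..m - h} ((\<lambda>v. qfun v h) \<circ> (\<lambda>t. m - t))"
      by (rule continuous_on_compose[OF _ continuous_on_subset[OF qfun_continuous[OF h]]])
         (auto intro!: continuous_intros)
    thus "continuous_on {-1..m - h} F"
      unfolding F_def comp_def by (intro continuous_intros)
    fix t assume t: "t \<in> {-1<..<m - h}"
    have "((\<lambda>t. - qfun (m - t) h) has_real_derivative - (((m - t)\<^sup>2 - h\<^sup>2) powr (\<beta> - 1) * (-1))) (at t)"
      by (intro DERIV_minus DERIV_chain2[OF qfun_has_derivative[OF h]])
         (use t in \<open>auto intro!: derivative_eq_intros\<close>)
    also have "- (((m - t)\<^sup>2 - h\<^sup>2) powr (\<beta> - 1) * (-1)) = f t"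
    proof -
      have "(m - t)\<^sup>2 - h\<^sup>2 = (m + h - t) * (m - h - t)" by (simp add: power2_eq_square algebra_simps)
      moreover have "0 < m + h - t" "0 < m - h - t" using t h by auto
      ultimately show ?thesis by (simp add: f_def trunc_pow_def powr_mult)
    qed
    finally show "(F has_vector_derivative f t) (at t)"
      by (simp add: F_def[abs_def] has_real_derivative_iff_has_vector_derivative)
  qed
  hence "(f has_integral (F (m - h) - F (-1))) {-1..1}"
  proof (rule has_integral_spike_set_eq[THEN iffD1, rotated -1])
    have "{x \<in> {-1..m - h} - {-1..1}. f x \<noteq> 0} = {}" using h a by auto
    thus "negligible {x \<in> {-1..m - h} - {-1..1}. f x \<noteq> 0}" by (simp only: negligible_empty)
    have "{x \<in> {-1..1} - {-1..m - h}. f x \<noteq> 0} = {}" by (auto simp: f_def trunc_pow_def)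
    thus "negligible {x \<in> {-1..1} - {-1..m - h}. f x \<noteq> 0}" by (simp only: negligible_empty)
  qed
  moreover have "F (m - h) - F (-1) = qfun (1 + m) h - (\<Sum>n. hcoef \<beta> n) * h powr (2 * \<beta> - 1)"
  proof (cases "h = 0")
    case True thus ?thesis by (simp add: F_def qfun_def add.commute)
  next
    case False thus ?thesis by (simp add: F_def qfun_def add.commute)
  qed
  ultimately have I: "(f has_integral (qfun (1 + m) h - (\<Sum>n. hcoef \<beta> n) * h powr (2 * \<beta> - 1))) {-1..1}"
    by simp
  have meas: "f \<in> borel_measurable borel" unfolding f_def by measurable
  show "set_integrable lborel {-1..1} f"
    and "(LINT t:{-1..1}|lborel. f t) = qfun (1 + m) h - (\<Sum>n. hcoef \<beta> n) * h powr (2 * \<beta> - 1)"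
    by (rule has_integral_nonneg_lborel[OF meas _ _ I]; simp add: f_def)+
qed

lemma integral_trunc_pow_product:
  assumes a: "\<bar>a\<bar> \<le> 1" and b: "\<bar>b\<bar> \<le> 1"
  shows "set_integrable lborel {-1..1} (\<lambda>t. trunc_pow (a - t) (\<beta> - 1) * trunc_pow (b - t) (\<beta> - 1))"
    and "(LINT t:{-1..1}|lborel. trunc_pow (a - t) (\<beta> - 1) * trunc_pow (b - t) (\<beta> - 1)) =
      qfun (1 + (a + b) / 2) ((a - b) / 2) - (\<Sum>n. hcoef \<beta> n) * \<bar>(a - b) / 2\<bar> powr (2 * \<beta> - 1)"
proof -
  define m h where "m = (a + b) / 2" and "h = \<bar>(a - b) / 2\<bar>"
  have mh: "-1 \<le> m - h" "0 \<le> h" "m + h \<le> 1" unfolding m_def h_def using a b by (auto simp: abs_if field_simps split: if_splits)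
  have "(m + h = a \<and> m - h = b) \<or> (m + h = b \<and> m - h = a)"
    unfolding m_def h_def by (cases "a \<ge> b") (simp_all add: field_simps)
  hence "(\<lambda>t. trunc_pow (a - t) (\<beta> - 1) * trunc_pow (b - t) (\<beta> - 1)) =
     (\<lambda>t. trunc_pow (m + h - t) (\<beta> - 1) * trunc_pow (m - h - t) (\<beta> - 1))"
    by (auto simp: mult.commute)
  moreover have "qfun (1 + m) ((a - b) / 2) = qfun (1 + m) h" unfolding h_def by (rule qfun_abs[symmetric])
  ultimately show "set_integrable lborel {-1..1} (\<lambda>t. trunc_pow (a - t) (\<beta> - 1) * trunc_pow (b - t) (\<beta> - 1))"
    and "(LINT t:{-1..1}|lborel. trunc_pow (a - t) (\<beta> - 1) * trunc_pow (b - t) (\<beta> - 1)) =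
      qfun (1 + (a + b) / 2) ((a - b) / 2) - (\<Sum>n. hcoef \<beta> n) * \<bar>(a - b) / 2\<bar> powr (2 * \<beta> - 1)"
    using integral_trunc_pow_product_ordered[OF mh]
    by (simp_all only: m_def[symmetric] h_def[symmetric])
qed

text \<open>The integrand is nonnegative, so joint integrability follows from the integrals over
  \<open>t\<close>, which are explicit for every \<open>z\<close>. They involve \<open>1 + m\<close>
  in place of \<open>1 - m\<close>, that is, the integrand of \<open>Q\<close> at
  \<open>- z\<close>; the reflection of the sphere removes the sign.\<close>

lemma
  fixes x y :: "real ^ 'n::{finite, wellorder}"
  assumes xy: "norm x = 1" "norm y = 1"
  shows K_kernel_integrable: "integrable (restrict_space lborel {-1..1} \<Otimes>\<^sub>M sphere_measure)
          (\<lambda>(t, z). trunc_pow (x \<bullet> z - t) (\<beta> - 1) * trunc_pow (y \<bullet> z - t) (\<beta> - 1))"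
    and K_kernel_eq_series: "K_kernel \<beta> x y = Q_kernel \<beta> x y -
       (\<Sum>n. hcoef \<beta> n) * norm (hdiff x y) powr (2 * \<beta> - 1) * sphere_abs_moment CARD('n) (2 * \<beta> - 1)"
proof -
  let ?S = "sphere_measure :: (real ^ 'n::_) measure" and ?L = "restrict_space lborel {-1..1::real}"
  let ?f = "\<lambda>(t, z). trunc_pow (x \<bullet> z - t) (\<beta> - 1) * trunc_pow (y \<bullet> z - t) (\<beta> - 1)"
  let ?g = "\<Sum>n. hcoef \<beta> n"
  interpret S: prob_space ?S by (rule prob_space_sphere_measure)
  interpret L: sigma_finite_measure ?L
    by (rule sigma_finite_measure_restrict_space) (auto intro: sigma_finite_lborel)
  interpret P: pair_sigma_finite ?L ?S ..
  interpret P': pair_sigma_finite ?S ?L ..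
  have [measurable]: "(\<lambda>z. v \<bullet> z) \<in> borel_measurable ?S" for v by simp
  have [measurable]: "(\<lambda>t. t) \<in> borel_measurable ?L" by (rule measurable_restrict_space1) simp
  have meas: "(\<lambda>(z, t). ?f (t, z)) \<in> borel_measurable (?S \<Otimes>\<^sub>M ?L)" by simp
  have inner: "integrable ?L (\<lambda>t. ?f (t, z))"
    "(\<integral>t. ?f (t, z) \<partial>?L) = Q_integrand \<beta> x y (- z) - ?g * \<bar>hdiff x y \<bullet> z\<bar> powr (2 * \<beta> - 1)"
    if z: "norm z = 1" for z
  proof -
    have ab: "\<bar>x \<bullet> z\<bar> \<le> 1" "\<bar>y \<bullet> z\<bar> \<le> 1"
      using Cauchy_Schwarz_ineq2[of x z] Cauchy_Schwarz_ineq2[of y z] xy z by auto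
    show "integrable ?L (\<lambda>t. ?f (t, z))"
      using integral_trunc_pow_product(1)[OF ab] by (simp add: set_integrable_def integrable_restrict_space)
    have "Q_integrand \<beta> x y (- z) = qfun (1 - mid x y \<bullet> (- z)) (hdiff x y \<bullet> (- z))"
      by (rule Q_integrand_qfun) (use xy z in auto)
    also have "\<dots> = qfun (1 + mid x y \<bullet> z) (hdiff x y \<bullet> z)"
      using qfun_abs[of "1 + mid x y \<bullet> z" "- (hdiff x y \<bullet> z)"] qfun_abs[of "1 + mid x y \<bullet> z" "hdiff x y \<bullet> z"]
      by simp
    finally have "qfun (1 + mid x y \<bullet> z) (hdiff x y \<bullet> z) = Q_integrand \<beta> x y (- z)" ..
    moreover have "mid x y \<bullet> z = (x \<bullet> z + y \<bullet> z) / 2" "hdiff x y \<bullet> z = (x \<bullet> z - y \<bullet> z) / 2"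
      by (simp_all add: mid_def hdiff_def inner_add_left inner_diff_left)
    ultimately show "(\<integral>t. ?f (t, z) \<partial>?L) = Q_integrand \<beta> x y (- z) - ?g * \<bar>hdiff x y \<bullet> z\<bar> powr (2 * \<beta> - 1)"
      using integral_trunc_pow_product(2)[OF ab] by (simp only: set_lebesgue_integral_def integral_restrict_space split_conv) (simp add: integral_restrict_space)
  qed
  have mQ: "Q_integrand \<beta> x y \<in> borel_measurable borel"
    unfolding Q_integrand_def hyp2F1_def hyp2F1_term_def Q_argument_def by measurable
  have iQ: "integrable ?S (\<lambda>z. Q_integrand \<beta> x y (- z))"
    using integrable_Q_integrand[OF xy]
    by (subst integrable_sphere_rotate[where T = uminus, OF _ mQ])
       (auto simp: orthogonal_transformation_def linear_iff)
  have ih: "integrable ?S (\<lambda>z. ?g * \<bar>hdiff x y \<bullet> z\<bar> powr (2 * \<beta> - 1))"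
  proof (intro integrable_mult_right integrable_sphere_continuous[where B = 1])
    fix z :: "real ^ 'n::_" assume "norm z = 1"
    hence "\<bar>hdiff x y \<bullet> z\<bar> \<le> 1" using mid_hdiff_bound[OF xy, of z] by linarith
    thus "\<bar>\<bar>hdiff x y \<bullet> z\<bar> powr (2 * \<beta> - 1)\<bar> \<le> 1"
      using beta_gt powr_mono2[of "2 * \<beta> - 1" "\<bar>hdiff x y \<bullet> z\<bar>" 1] by simp
  qed measurable
  have int': "integrable (?S \<Otimes>\<^sub>M ?L) (\<lambda>(z, t). ?f (t, z))"
  proof (rule P'.Fubini_integrable[OF meas])
    have "integrable ?S (\<lambda>z. Q_integrand \<beta> x y (- z) - ?g * \<bar>hdiff x y \<bullet> z\<bar> powr (2 * \<beta> - 1))"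
      by (intro Bochner_Integration.integrable_diff iQ ih)
    also have "?this \<longleftrightarrow> integrable ?S (\<lambda>z. \<integral>t. norm (case (z, t) of (z, t) \<Rightarrow> ?f (t, z)) \<partial>?L)"
      by (rule Bochner_Integration.integrable_cong) (auto simp: inner(2)[symmetric])
    finally show "integrable ?S (\<lambda>z. \<integral>t. norm (case (z, t) of (z, t) \<Rightarrow> ?f (t, z)) \<partial>?L)" .
    show "AE z in ?S. integrable ?L (\<lambda>t. case (z, t) of (z, t) \<Rightarrow> ?f (t, z))"
      using inner(1) by (intro AE_I2) simp
  qed
  thus int: "integrable (?L \<Otimes>\<^sub>M ?S) ?f"
    by (subst P.integrable_product_swap_iff[symmetric]) (simp add: case_prod_unfold)
  have "K_kernel \<beta> x y = (\<integral>t. (\<integral>z. ?f (t, z) \<partial>?S) \<partial>?L)"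
    by (simp add: K_kernel_def set_lebesgue_integral_def integral_restrict_space)
  also have "\<dots> = (\<integral>z. (\<integral>t. ?f (t, z) \<partial>?L) \<partial>?S)"
    using P.Fubini_integral[of "\<lambda>t z. ?f (t, z)"] int by (simp add: case_prod_unfold)
  also have "\<dots> = (\<integral>z. Q_integrand \<beta> x y (- z) - ?g * \<bar>hdiff x y \<bullet> z\<bar> powr (2 * \<beta> - 1) \<partial>?S)"
    by (intro Bochner_Integration.integral_cong refl) (use inner(2) in auto)
  also have "\<dots> = (\<integral>z. Q_integrand \<beta> x y (- z) \<partial>?S) - (\<integral>z. ?g * \<bar>hdiff x y \<bullet> z\<bar> powr (2 * \<beta> - 1) \<partial>?S)"
    by (intro Bochner_Integration.integral_diff iQ ih)
  also have "(\<integral>z. Q_integrand \<beta> x y (- z) \<partial>?S) = Q_kernel \<beta> x y"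
    unfolding Q_kernel_def by (rule integral_sphere_uminus[OF mQ])
  also have "(\<integral>z. ?g * \<bar>hdiff x y \<bullet> z\<bar> powr (2 * \<beta> - 1) \<partial>?S) =
     ?g * norm (hdiff x y) powr (2 * \<beta> - 1) * sphere_abs_moment CARD('n) (2 * \<beta> - 1)"
    using beta_gt by (simp add: integral_sphere_abs_powr)
  finally show "K_kernel \<beta> x y = Q_kernel \<beta> x y -
       ?g * norm (hdiff x y) powr (2 * \<beta> - 1) * sphere_abs_moment CARD('n) (2 * \<beta> - 1)" .
qed

text \<open>The hypergeometric series at argument 1, evaluated by the Beta series at the negative
  value \<open>a = 1/2 - \<beta>\<close>.\<close>

lemma hcoef_sums: "hcoef \<beta> sums (Gamma (3 / 2 - \<beta>) * Gamma \<beta> / ((2 * \<beta> - 1) * sqrt pi))"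
proof -
  have "1 / 2 - \<beta> + real n \<noteq> 0" for n using nonhalf[of n] by (auto simp: algebra_simps)
  hence "(\<lambda>n. pc (1 - \<beta>) n / (1 / 2 - \<beta> + real n)) sums Beta (1 / 2 - \<beta>) \<beta>"
    using beta_gt by (intro pc_series_beta) auto
  hence "(\<lambda>n. (- 1 / 2) * (pc (1 - \<beta>) n / (1 / 2 - \<beta> + real n))) sums ((- 1 / 2) * Beta (1 / 2 - \<beta>) \<beta>)"
    by (rule sums_mult)
  also have "(\<lambda>n. (- 1 / 2) * (pc (1 - \<beta>) n / (1 / 2 - \<beta> + real n))) = hcoef \<beta>"
  proof
    fix n
    have "2 * \<beta> - 1 - 2 * real n = (1 / 2 - \<beta> + real n) * (- 2)" by (simp add: algebra_simps)
    thus "(- 1 / 2) * (pc (1 - \<beta>) n / (1 / 2 - \<beta> + real n)) = hcoef \<beta> n"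
      unfolding hcoef_def by (simp only: divide_divide_eq_left[symmetric]) simp
  qed
  also have "(- 1 / 2) * Beta (1 / 2 - \<beta>) \<beta> = Gamma (3 / 2 - \<beta>) * Gamma \<beta> / ((2 * \<beta> - 1) * sqrt pi)"
  proof -
    have "1 / 2 - \<beta> \<notin> \<int>\<^sub>\<le>\<^sub>0"
    proof
      assume "1 / 2 - \<beta> \<in> \<int>\<^sub>\<le>\<^sub>0"
      then obtain n where "1 / 2 - \<beta> = - real n" by (auto elim!: nonpos_Ints_cases')
      thus False using nonhalf[of n] by (simp add: algebra_simps)
    qed
    hence G: "Gamma (3 / 2 - \<beta>) = (2 * \<beta> - 1) * ((- 1 / 2) * Gamma (1 / 2 - \<beta>))"
      using Gamma_plus1[of "1 / 2 - \<beta>"] by (simp add: field_simps)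
    have "2 * \<beta> - 1 \<noteq> 0" using beta_gt by simp
    hence "Gamma (3 / 2 - \<beta>) * Gamma \<beta> / ((2 * \<beta> - 1) * sqrt pi) = (- 1 / 2) * Gamma (1 / 2 - \<beta>) * Gamma \<beta> / sqrt pi"
      unfolding G by (simp add: mult.assoc)
    also have "\<dots> = (- 1 / 2) * Beta (1 / 2 - \<beta>) \<beta>"
      by (simp add: Beta_def Gamma_one_half_real)
    finally show ?thesis ..
  qed
  finally show ?thesis .
qed

text \<open>The sum of \<open>hcoef\<close> contains \<open>Gamma (3 / 2 - \<beta>)\<close>, which
  the reflection formula expresses through \<open>Gamma (\<beta> - 1 / 2)\<close> and a sine; L
  enters by \<open>sin (pi * (L + \<epsilon>)) = (-1) ^ L * sin (pi * \<epsilon>)\<close>. The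
  variable \<open>r\<close> stands for \<open>norm (x - y)\<close>, halved because the linear form
  is \<open>hdiff x y\<close>.\<close>

lemma hcoef_moment_c_const:
  assumes "\<beta> - 1 / 2 = real L + \<epsilon>" "0 < \<epsilon>" "\<epsilon> < 1"
  shows "(\<Sum>n. hcoef \<beta> n) * (r / 2) powr (2 * \<beta> - 1) * sphere_abs_moment (d + 1) (2 * \<beta> - 1) =
      (-1) ^ L * c_const d L \<beta> * r powr (2 * \<beta> - 1)"
    and "c_const d L \<beta> > 0"
proof -
  have eps: "\<beta> - 1 / 2 - real L = \<epsilon>" using assms by linarith
  have sin: "sin (pi * \<epsilon>) > 0" using assms by (intro sin_gt_zero) auto
  have Gpos: "Gamma (\<beta> - 1 / 2) > 0" "Gamma (\<beta> + real d / 2) > 0" "Gamma ((real d + 1) / 2) > 0"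
    "Gamma \<beta> > 0" "Gamma (\<beta> + 1 / 2) > 0"
    using beta_gt by (intro Gamma_real_pos; simp add: add_pos_nonneg add_nonneg_pos)+
  show "c_const d L \<beta> > 0"
    unfolding c_const_def eps by (intro mult_pos_pos divide_pos_pos Gpos sin) auto
  have sinL: "sin (pi * (\<beta> - 1 / 2)) = (-1) ^ L * sin (pi * \<epsilon>)"
    unfolding assms(1) distrib_left sin_add by simp
  have "complex_of_real (Gamma (\<beta> - 1 / 2) * Gamma (1 - (\<beta> - 1 / 2))) =
      Gamma (of_real (\<beta> - 1 / 2)) * Gamma (of_real (1 - (\<beta> - 1 / 2)))"
    by (simp only: Gamma_complex_of_real of_real_mult)
  also have "complex_of_real (1 - (\<beta> - 1 / 2)) = 1 - of_real (\<beta> - 1 / 2)" by (simp only: of_real_diff of_real_1)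
  also have "Gamma (complex_of_real (\<beta> - 1 / 2)) * Gamma (1 - of_real (\<beta> - 1 / 2)) =
      of_real pi / sin (of_real pi * of_real (\<beta> - 1 / 2))"
    by (rule Gamma_reflection_complex)
  also have "\<dots> = of_real (pi / sin (pi * (\<beta> - 1 / 2)))"
    by (simp only: of_real_mult[symmetric] sin_of_real of_real_divide)
  finally have "complex_of_real (Gamma (\<beta> - 1 / 2) * Gamma (1 - (\<beta> - 1 / 2))) = of_real (pi / sin (pi * (\<beta> - 1 / 2)))" .
  hence refl: "Gamma (\<beta> - 1 / 2) * Gamma (3 / 2 - \<beta>) = pi / ((-1) ^ L * sin (pi * \<epsilon>))"
    unfolding of_real_eq_iff sinL by simp
  have "Gamma (\<beta> - 1 / 2 + 1) = (\<beta> - 1 / 2) * Gamma (\<beta> - 1 / 2)"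
    using beta_gt by (intro Gamma_plus1 pos_not_nonpos_Ints) simp
  hence shift: "Gamma (\<beta> + 1 / 2) = (\<beta> - 1 / 2) * Gamma (\<beta> - 1 / 2)" by (simp add: add.commute)
  have pw: "(r / 2) powr (2 * \<beta> - 1) = 2 * 2 powr (- 2 * \<beta>) * r powr (2 * \<beta> - 1)"
    by (simp add: powr_divide powr_diff powr_minus field_simps)
  have mom: "sphere_abs_moment (d + 1) (2 * \<beta> - 1) =
      Gamma \<beta> * Gamma ((real d + 1) / 2) / (sqrt pi * Gamma (\<beta> + real d / 2))"
    by (simp add: sphere_abs_moment_def add_divide_distrib add.commute)
  \<comment> \<open>The identity with the Gamma values as free variables: \<open>e\<close> is
    \<open>(-1) ^ L\<close>, \<open>S\<close> the sine, \<open>G1\<close> and \<open>G3\<close> the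
    pair linked by reflection, \<open>Gs\<close> is \<open>Gamma (\<beta> + 1 / 2)\<close> and
    \<open>q\<close> is \<open>sqrt pi\<close>.\<close>
  have alg: "G3 * Gb / (b2 * q) * (2 * P * R) * (Gb * Gd / (q * Gbd)) = e * (P / S * (Gd * Gb * Gb / (Gbd * Gs))) * R"
    if "b2 > 0" "q * q = p" "p > 0" "G1 * G3 = p / (e * S)" "G1 > 0" "Gs = b2 / 2 * G1" "S > 0" "e * e = 1" "Gbd > 0"
    for G3 Gb b2 q P R Gd Gbd e S Gs G1 p :: real
  proof -
    have e: "e \<noteq> 0" using that(8) by auto
    have "1 / e = e" using that(8) e by (simp add: field_simps)
    have "G3 = (G1 * G3) / G1" using that(5) by simp
    hence "G3 = p * (1 / e) / (S * G1)" unfolding that(4) by (simp add: mult_ac)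
    hence G3: "G3 = p * e / (S * G1)" unfolding \<open>1 / e = e\<close> .
    have q: "q \<noteq> 0" using that(2,3) by auto
    have "G3 * Gb / (b2 * q) * (2 * P * R) * (Gb * Gd / (q * Gbd)) = 2 * G3 * Gb * P * R * Gb * Gd / (b2 * (q * q) * Gbd)"
      by (simp add: field_simps q)
    also have "\<dots> = e * (P / S * (Gd * Gb * Gb / (Gbd * Gs))) * R"
      unfolding that(2) G3 that(6) using that by (simp add: field_simps)
    finally show ?thesis .
  qed
  show "(\<Sum>n. hcoef \<beta> n) * (r / 2) powr (2 * \<beta> - 1) * sphere_abs_moment (d + 1) (2 * \<beta> - 1) =
      (-1) ^ L * c_const d L \<beta> * r powr (2 * \<beta> - 1)"
    unfolding sums_unique[OF hcoef_sums, symmetric] pw mom c_const_def eps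
    by (rule alg[where p = pi and ?G1.0 = "Gamma (\<beta> - 1 / 2)"])
       (use beta_gt sin Gpos refl shift in \<open>simp_all add: diff_divide_distrib flip: power_mult_distrib\<close>)
qed

end

text \<open>At \<open>\<beta> = 1\<close> only \<open>hcoef 1 0 = 1\<close> survives, so the
  integrand is \<open>1 - mid x y \<bullet> z\<close>, whose linear part averages to 0.\<close>

lemma Q_kernel_one:
  fixes x y :: "real ^ 'n::{finite, wellorder}"
  assumes xy: "norm x = 1" "norm y = 1"
  shows "Q_kernel 1 x y = 1"
proof -
  interpret half_integer_free 1
  proof
    show "2 * 1 - 1 \<noteq> 2 * real n" for n
    proof
      assume "2 * 1 - 1 = 2 * real n"
      hence "real 1 = real (2 * n)" by simp
      thus False by (simp only: of_nat_eq_iff) presburger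
    qed
  qed simp
  have h: "hcoef 1 n = (if n = 0 then 1 else 0)" for n by (simp add: hcoef_def pc_0_left)
  have q: "qfun W v = W" if "W \<ge> 0" for W v
  proof -
    have "(\<lambda>n. hcoef 1 n * (v / W) ^ (2 * n)) sums (\<Sum>n\<in>{0}. hcoef 1 n * (v / W) ^ (2 * n))"
      by (rule sums_finite) (auto simp: h)
    thus ?thesis using that by (simp add: qfun_def sums_iff h)
  qed
  have m: "integrable sphere_measure (\<lambda>z. mid x y \<bullet> z)"
  proof (rule integrable_sphere_continuous[where B = 1])
    show "\<bar>mid x y \<bullet> z\<bar> \<le> 1" if "norm z = 1" for z
      using mid_hdiff_bound[OF xy that] by linarith
  qed simp
  interpret prob_space "sphere_measure :: (real ^ 'n::_) measure" by (rule prob_space_sphere_measure)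
  have "Q_kernel 1 x y = (LINT z|sphere_measure. 1 - mid x y \<bullet> z)"
    unfolding Q_kernel_def
  proof (intro Bochner_Integration.integral_cong refl)
    fix z :: "real ^ 'n::_" assume "z \<in> space sphere_measure"
    hence z: "norm z = 1" by simp
    have "\<bar>mid x y \<bullet> z\<bar> \<le> 1" using mid_hdiff_bound[OF xy z] by linarith
    thus "Q_integrand 1 x y z = 1 - mid x y \<bullet> z" by (simp add: Q_integrand_qfun[OF xy z] q)
  qed
  also have "\<dots> = 1 - (LINT z|sphere_measure. mid x y \<bullet> z)"
    using m prob_space by simp
  also have "(LINT z|sphere_measure. mid x y \<bullet> z) = 0"
    using integral_sphere_uminus[of "\<lambda>z. mid x y \<bullet> z"] by simp
  finally show ?thesis by simp
qed

lemma c_const_one: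
  assumes "d > 0"
  shows "c_const d 0 1 = 1 / real d * (Gamma ((real d + 1) / 2) / (sqrt pi * Gamma (real d / 2)))"
proof -
  have "Gamma (real d / 2 + 1) = real d / 2 * Gamma (real d / 2)"
    using assms by (intro Gamma_plus1 pos_not_nonpos_Ints) simp
  hence 1: "Gamma (1 + real d / 2) = real d / 2 * Gamma (real d / 2)" by (simp add: add.commute)
  have "Gamma (1 / 2 + 1 :: real) = 1 / 2 * Gamma (1 / 2)"
    by (intro Gamma_plus1 pos_not_nonpos_Ints) simp
  hence 2: "Gamma (1 + 1 / 2 :: real) = sqrt pi / 2" by (simp add: Gamma_one_half_real)
  have 3: "(2::real) powr (- 2 * 1) = 1 / 4" by (simp add: powr_minus)
  have 4: "sin (pi * (1 - 1 / 2 - real 0)) = 1" by (simp add: sin_pi_half)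
  show ?thesis unfolding c_const_def 1 2 3 4 using assms by simp
qed

section \<open>Asymptotics of the coefficients\<close>

text \<open>A coefficient of order \<open>k\<close> in dimension \<open>d\<close> is a plain moment
  in dimension \<open>d + 2 * k\<close>; for integrals this is Rodrigues' formula. It moves the
  whole dependence on the Gegenbauer polynomial into the weight.\<close>

lemma gegen_moment_shift:
  assumes "\<nu> > 0"
  shows "gegen_moment \<nu> (k + r) k = fact (k + r) / (fact r * 2 ^ k * pochhammer \<nu> k) * gegen_moment (\<nu> + real k) r 0"
proof (cases "even r")
  case True
  then obtain j where r: "r = 2 * j" by blast
  have "gegen_moment (\<nu> + real k) r 0 = fact (2 * j) / (2 ^ (2 * j) * fact j * pochhammer (\<nu> + real k) j)"
    using gegen_moment_add[of "\<nu> + real k" 0 j] by (simp add: r)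
  thus ?thesis
    by (simp add: r gegen_moment_add pochhammer_product' power_add)
qed (simp add: gegen_moment_def)

lemma fact_le_pochhammer: "\<nu> \<ge> 1 \<Longrightarrow> fact n \<le> pochhammer (\<nu> :: real) n"
proof (induction n)
  case (Suc n)
  have "fact n * (1 + real n) \<le> pochhammer \<nu> n * (\<nu> + real n)"
    using Suc by (intro mult_mono) (auto intro: order.trans[OF fact_ge_zero])
  thus ?case by (simp add: pochhammer_Suc algebra_simps)
qed simp

text \<open>For \<open>\<nu> \<ge> 1\<close> the Pochhammer symbol is at least a factorial, and what
  remains is a binomial coefficient over \<open>2 ^ n\<close>.\<close>

lemma gegen_moment_le_1:
  assumes "\<nu> \<ge> 1"
  shows "gegen_moment \<nu> n k \<le> 1"
proof (cases "k \<le> n \<and> even (n - k)")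
  case True
  then obtain j where n: "n = k + 2 * j" by (metis evenE le_add_diff_inverse)
  have pos: "(fact (k + j) :: real) > 0" by simp
  have "gegen_moment \<nu> n k \<le> fact n / (2 ^ n * fact j * fact (k + j))"
    unfolding n gegen_moment_add
    using fact_le_pochhammer[OF assms, of "k + j"] pos
    by (intro divide_left_mono mult_left_mono mult_pos_pos) (auto intro: less_le_trans[OF pos])
  also have "\<dots> = real (n choose j) / 2 ^ n"
    by (subst binomial_fact) (auto simp: n add.commute)
  also have "\<dots> \<le> 1"
  proof -
    have "n choose j \<le> 2 ^ n" by (rule binomial_le_pow2)
    hence "real (n choose j) \<le> real (2 ^ n)" by (simp only: of_nat_le_iff)
    thus ?thesis by simp
  qed
  finally show ?thesis .
qed (auto simp: gegen_moment_def)

lemma nn_integral_powr_tail: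
  assumes "p > 1"
  shows "(\<integral>\<^sup>+T. ennreal (T powr (- p)) * indicator {1<..} T \<partial>lborel) = ennreal (1 / (p - 1))"
proof -
  have "(\<integral>\<^sup>+T. ennreal (T powr (- p)) * indicator {1<..} T \<partial>lborel) =
    (\<integral>\<^sup>+T. ennreal (T powr (- p)) * indicator {1..} T \<partial>lborel)"
    using AE_lborel_singleton[of 1] by (intro nn_integral_cong_AE) (auto simp: indicator_def elim!: eventually_mono)
  also have "\<dots> = ennreal (0 - (- (1 powr (1 - p) / (p - 1))))"
  proof (rule nn_integral_FTC_atLeast[where F = "\<lambda>T. - (T powr (1 - p) / (p - 1))"])
    fix T :: real assume "1 \<le> T"
    hence "((\<lambda>T. (- 1 / (p - 1)) * T powr (1 - p)) has_real_derivative (- 1 / (p - 1)) * ((1 - p) * T powr (1 - p - 1))) (at T)"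
      by (intro DERIV_cmult has_real_derivative_powr) simp
    moreover have h: "(- 1 / (p - 1)) * (1 - p) = 1" using assms by (simp add: field_simps)
    have "(- 1 / (p - 1)) * ((1 - p) * T powr (1 - p - 1)) = T powr (- p)"
      unfolding mult.assoc[symmetric] h by simp
    ultimately show "((\<lambda>T. - (T powr (1 - p) / (p - 1))) has_real_derivative T powr (- p)) (at T)"
      by simp
  next
    have "((\<lambda>T. T powr (1 - p)) \<longlongrightarrow> 0) at_top"
      using assms by (intro tendsto_neg_powr filterlim_ident) auto
    hence "((\<lambda>T. - (T powr (1 - p) / (p - 1))) \<longlongrightarrow> - (0 / (p - 1))) at_top"
      using assms by (intro tendsto_intros) auto
    thus "((\<lambda>T. - (T powr (1 - p) / (p - 1))) \<longlongrightarrow> 0) at_top" by simp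
  qed auto
  finally show ?thesis by simp
qed

lemma ennreal_infsum_double:
  fixes f :: "nat \<times> nat \<Rightarrow> real"
  assumes f: "f summable_on UNIV" and nonneg: "\<And>i. f i \<ge> 0"
  shows "ennreal (infsum f UNIV) = (\<Sum>r. \<Sum>r'. ennreal (f (r, r')))"
proof -
  have hs: "((\<lambda>(r, r'). f (r, r')) has_sum infsum f UNIV) (UNIV \<times> UNIV)" using f by simp
  have inner: "((\<lambda>r'. f (r, r')) has_sum (\<Sum>r'. f (r, r'))) UNIV" for r
    using summable_on_SigmaD1[OF has_sum_imp_summable[OF hs], of r]
    by (metis UNIV_I has_sum_imp_sums has_sum_infsum sums_unique)
  have outer: "((\<lambda>r. \<Sum>r'. f (r, r')) has_sum infsum f UNIV) UNIV"
    by (rule has_sum_SigmaD[OF hs]) (simp add: inner)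
  have "ennreal (infsum f UNIV) = ennreal (\<Sum>r. \<Sum>r'. f (r, r'))"
    using has_sum_imp_sums[OF outer] by (simp add: sums_iff)
  also have "\<dots> = (\<Sum>r. ennreal (\<Sum>r'. f (r, r')))"
    using has_sum_imp_sums[OF outer] has_sum_imp_sums[OF inner] nonneg
    by (intro suminf_ennreal2[symmetric]) (auto simp: sums_iff intro!: suminf_nonneg)
  also have "(\<lambda>r. ennreal (\<Sum>r'. f (r, r'))) = (\<lambda>r. \<Sum>r'. ennreal (f (r, r')))"
    using has_sum_imp_sums[OF inner] nonneg
    by (intro ext suminf_ennreal2[symmetric]) (auto simp: sums_iff)
  finally show ?thesis .
qed

text \<open>Expansion of \<open>(1 - u / T) powr (- a)\<close> in powers of \<open>u\<close>;
  \<open>T > 1\<close> gives a convergent majorant on all of \<open>[-1, 1]\<close>.\<close>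

lemma nn_integral_gegen_kernel:
  assumes d: "d \<ge> 2" and a: "a > 0" and T: "T > 1"
  shows "(\<integral>\<^sup>+u. ennreal ((T - u) powr (- a)) \<partial>gegen_measure d) =
    (\<Sum>r. ennreal (pc a r * gegen_moment ((real d + 1) / 2) r 0 * T powr (- (real r + a))))"
proof -
  let ?m = "\<lambda>r. gegen_moment ((real d + 1) / 2) r 0"
  interpret prob_space "gegen_measure d" by (rule prob_space_gegen_measure[OF d])
  define f where "f r u = indicator {-1..1} u * (pc a r * (u / T) ^ r)" for r and u :: real
  have pw: "(\<lambda>r. pc a r * x ^ r) sums (1 - x) powr (- a)" if "\<bar>x\<bar> < 1" for x
    using pc_sums[OF that] .
  have sT: "summable (\<lambda>r. pc a r * (1 / T) ^ r)" using pw[of "1 / T"] T by (auto simp: sums_iff)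
  have bd: "norm (f r u) \<le> pc a r * (1 / T) ^ r" for r u
  proof (cases "u \<in> {-1..1}")
    case True
    hence "\<bar>u\<bar> ^ r \<le> 1" by (intro power_le_one) auto
    thus ?thesis using True T pc_nonneg[of a r] a
      by (auto simp: f_def abs_mult power_abs power_divide intro!: mult_left_le divide_right_mono)
  qed (use pc_nonneg[of a r] a T in \<open>simp add: f_def\<close>)
  have int: "integrable (gegen_measure d) (f r)" for r
    by (rule integrable_const_bound[where B = "pc a r * (1 / T) ^ r"])
       (use bd in \<open>auto simp: f_def[abs_def]\<close>)
  have intf: "(\<integral>u. f r u \<partial>gegen_measure d) = pc a r * ?m r * (1 / T) ^ r" for r
  proof -
    have "(\<integral>u. f r u \<partial>gegen_measure d) = (\<integral>u. (pc a r * (1 / T) ^ r) * u ^ r \<partial>gegen_measure d)"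
    proof (rule integral_cong_AE)
      show "AE u in gegen_measure d. f r u = (pc a r * (1 / T) ^ r) * u ^ r"
        using AE_gegen_measure[of d] by eventually_elim (simp add: f_def power_divide)
    qed (simp_all add: f_def[abs_def])
    thus ?thesis by (simp add: integral_gegen_power[OF d])
  qed
  have sumn: "summable (\<lambda>r. \<integral>u. norm (f r u) \<partial>gegen_measure d)"
  proof (rule summable_comparison_test[OF _ sT], intro exI allI impI)
    fix r
    have "(\<integral>u. norm (f r u) \<partial>gegen_measure d) \<le> pc a r * (1 / T) ^ r"
      using bd[of r] int[of r] by (intro integral_le_const) (auto simp: integrable_norm)
    thus "norm (\<integral>u. norm (f r u) \<partial>gegen_measure d) \<le> pc a r * (1 / T) ^ r"
      by (simp add: integral_nonneg_AE)
  qed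
  have sumx: "summable (\<lambda>r. norm (f r u))" for u
    by (rule summable_comparison_test[OF _ sT]) (use bd in auto)
  have sums: "(\<lambda>r. pc a r * ?m r * (1 / T) ^ r) sums (\<integral>u. (\<Sum>r. f r u) \<partial>gegen_measure d)"
    using sums_integral[OF int _ sumn] sumx by (simp add: intf)
  have eq: "T powr (- a) * (\<Sum>r. f r u) = (T - u) powr (- a)" if u: "u \<in> {-1..1}" for u
  proof -
    have "\<bar>u / T\<bar> < 1" using u T by (auto simp: abs_less_iff field_simps)
    from sums_unique[OF pw[OF this]] have "(\<Sum>r. f r u) = (1 - u / T) powr (- a)"
      using u by (simp add: f_def)
    moreover have "T powr (- a) * (1 - u / T) powr (- a) = (T * (1 - u / T)) powr (- a)"
      by (rule powr_mult[symmetric])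
    moreover have "T * (1 - u / T) = T - u" using T by (simp add: field_simps)
    ultimately show ?thesis by simp
  qed
  have "(\<integral>\<^sup>+u. ennreal ((T - u) powr (- a)) \<partial>gegen_measure d) =
    (\<integral>\<^sup>+u. ennreal (T powr (- a) * (\<Sum>r. f r u)) \<partial>gegen_measure d)"
    by (rule nn_integral_cong_AE, use AE_gegen_measure[of d] in eventually_elim) (simp only: eq)
  also have "\<dots> = ennreal (\<integral>u. T powr (- a) * (\<Sum>r. f r u) \<partial>gegen_measure d)"
  proof (rule nn_integral_eq_integral)
    show "integrable (gegen_measure d) (\<lambda>u. T powr (- a) * (\<Sum>r. f r u))"
      using integrable_suminf[OF int _ sumn] sumx by simp
    show "AE u in gegen_measure d. 0 \<le> T powr (- a) * (\<Sum>r. f r u)"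
      using AE_gegen_measure[of d] by eventually_elim (simp only: eq powr_ge_zero)
  qed
  also have "(\<integral>u. T powr (- a) * (\<Sum>r. f r u) \<partial>gegen_measure d) =
    T powr (- a) * (\<Sum>r. pc a r * ?m r * (1 / T) ^ r)"
    using sums by (simp add: sums_iff)
  also have "\<dots> = (\<Sum>r. T powr (- a) * (pc a r * ?m r * (1 / T) ^ r))"
    using sums by (intro suminf_mult[symmetric]) (auto simp: sums_iff)
  also have "(\<lambda>r. T powr (- a) * (pc a r * ?m r * (1 / T) ^ r)) =
    (\<lambda>r. pc a r * ?m r * T powr (- (real r + a)))"
  proof
    fix r
    have "T powr (- (real r + a)) = T powr (- a) * (1 / T) ^ r"
      using T by (simp add: powr_diff powr_realpow power_divide field_simps powr_minus)
    thus "T powr (- a) * (pc a r * ?m r * (1 / T) ^ r) = pc a r * ?m r * T powr (- (real r + a))" by simp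
  qed
  also have "ennreal (\<Sum>r. pc a r * ?m r * T powr (- (real r + a))) =
     (\<Sum>r. ennreal (pc a r * ?m r * T powr (- (real r + a))))"
  proof (rule suminf_ennreal2[symmetric])
    show "0 \<le> pc a r * ?m r * T powr (- (real r + a))" for r
      using a by (intro mult_nonneg_nonneg pc_nonneg gegen_moment_nonneg) (auto simp: add_nonneg_pos)
    have "summable (\<lambda>r. T powr (- a) * (pc a r * ?m r * (1 / T) ^ r))"
      using sums by (intro summable_mult) (auto simp: sums_iff)
    also have "(\<lambda>r. T powr (- a) * (pc a r * ?m r * (1 / T) ^ r)) =
      (\<lambda>r. pc a r * ?m r * T powr (- (real r + a)))"
      using T by (intro ext) (simp add: powr_diff powr_realpow power_divide field_simps powr_minus)
    finally show "summable (\<lambda>r. pc a r * ?m r * T powr (- (real r + a)))" .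
  qed
  finally show ?thesis .
qed

context half_integer_free
begin

text \<open>With \<open>p = k + r\<close>, \<open>q = k + r'\<close> and
  \<open>A = 1 - \<beta> + k\<close>, each numerator splits off \<kappa>, and the reciprocal of the
  denominator is minus the integral of \<open>T powr (- (r + r' + 2 * A))\<close> over
  \<open>T > 1\<close>. Under that integral the double sum is a square. As
  \<open>k > \<beta>\<close> makes the coefficients \<open>a r\<close> nonnegative, sums and
  integrals exchange freely, and the minus sign explains \<open>- qcoef d k\<close>.\<close>

lemma nn_integral_qcoef:
  assumes d: "d \<ge> 2" and k: "real k > \<beta>"
  defines "\<kappa> \<equiv> pochhammer (1 - \<beta>) k / (2 ^ k * pochhammer ((real d + 1) / 2) k)"
  shows "ennreal (- qcoef d k) = ennreal (\<kappa>\<^sup>2) *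
    (\<integral>\<^sup>+T. (\<integral>\<^sup>+u. ennreal ((T - u) powr (- (1 - \<beta> + real k))) \<partial>gegen_measure (d + 2 * k))\<^sup>2 * indicator {1<..} T \<partial>lborel)"
proof -
  let ?\<nu> = "(real d + 1) / 2"
  let ?m = "gegen_moment ?\<nu>"
  define A where "A = 1 - \<beta> + real k"
  have A: "A > 1" using k by (simp add: A_def)
  have \<nu>: "?\<nu> \<ge> 1" using d by simp
  define a where "a r = pc A r * gegen_moment (?\<nu> + real k) r 0" for r
  have "?\<nu> + real k > 0" using \<nu> by linarith
  hence a0: "a r \<ge> 0" for r
    unfolding a_def using A by (intro mult_nonneg_nonneg pc_nonneg gegen_moment_nonneg) auto
  have fac: "pc (1 - \<beta>) (k + r) * ?m (k + r) k = \<kappa> * a r" for r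
  proof -
    have "pc (1 - \<beta>) (k + r) = pochhammer (1 - \<beta>) k * pochhammer A r / fact (k + r)"
      by (simp add: pc_def pochhammer_product' A_def)
    thus ?thesis using \<nu> by (simp add: gegen_moment_shift a_def \<kappa>_def pc_def)
  qed
  define F where "F = (\<lambda>(p, q). weight p q * (?m p k * ?m q k))"
  define G where "G = (\<lambda>(r, r'). \<kappa>\<^sup>2 * (a r * a r' / (real r + real r' + 2 * A - 1)))"
  have FG: "F (k + r, k + r') = - G (r, r')" for r r'
  proof -
    have den: "2 * \<beta> - 1 - real (k + r + (k + r')) = - (real r + real r' + 2 * A - 1)"
      by (simp add: A_def)
    have "F (k + r, k + r') = (pc (1 - \<beta>) (k + r) * ?m (k + r) k) * (pc (1 - \<beta>) (k + r') * ?m (k + r') k) /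
       (2 * \<beta> - 1 - real (k + r + (k + r')))"
      by (simp add: F_def weight_def)
    also have "\<dots> = - G (r, r')" unfolding fac den
      by (simp only: G_def split divide_minus_right power2_eq_square) (simp add: mult_ac)
    finally show ?thesis .
  qed
  have Fsum: "F summable_on UNIV"
  proof -
    have "(\<lambda>i. norm (F i)) summable_on UNIV"
    proof (rule summable_on_comparison_test[OF weight_abs_summable])
      fix i :: "nat \<times> nat"
      obtain p q where i: "i = (p, q)" by (cases i)
      have m: "0 \<le> ?m n k" "?m n k \<le> 1" for n
        using gegen_moment_nonneg[of ?\<nu> n k] gegen_moment_le_1[OF \<nu>, of n k] \<nu> by auto
      have "\<bar>?m p k * ?m q k\<bar> \<le> 1" using m[of p] m[of q] by (simp add: abs_mult mult_le_one)
      thus "norm (F i) \<le> (case i of (p, q) \<Rightarrow> \<bar>weight p q\<bar>)"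
        by (simp add: i F_def abs_mult[of "weight p q"] mult_left_le)
    qed auto
    thus ?thesis by (subst summable_on_iff_abs_summable_on_real) simp
  qed
  let ?h = "\<lambda>(r, r'). (k + r, k + r')"
  have inj: "inj ?h" by (auto simp: inj_def)
  have "qcoef d k = infsum F (range ?h)"
    unfolding qcoef_def F_def[symmetric]
  proof (rule infsum_cong_neutral)
    fix i assume "i \<in> UNIV - range ?h"
    moreover obtain p q where i: "i = (p, q)" by (cases i)
    ultimately have "p < k \<or> q < k"
      by (metis (mono_tags, lifting) DiffE case_prod_conv le_add_diff_inverse not_less rangeI)
    thus "F i = 0" by (auto simp: i F_def gegen_moment_eq_0)
  qed auto
  also have "\<dots> = infsum (F \<circ> ?h) UNIV" using inj by (rule infsum_reindex)
  also have "F \<circ> ?h = (\<lambda>i. - G i)" using FG by (auto simp: fun_eq_iff)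
  also have "infsum (\<lambda>i. - G i) UNIV = - infsum G UNIV" by (rule infsum_uminus)
  finally have q: "- qcoef d k = infsum G UNIV" by simp
  have "(F \<circ> ?h) summable_on UNIV"
    using summable_on_subset_banach[OF Fsum, of "range ?h"] inj by (simp add: summable_on_reindex)
  hence "(\<lambda>i. - G i) summable_on UNIV" using FG by (simp add: comp_def case_prod_unfold)
  hence Gsum: "G summable_on UNIV" by (simp add: summable_on_uminus)
  have G0: "G i \<ge> 0" for i
    using A a0 by (cases i) (auto simp: G_def intro!: mult_nonneg_nonneg divide_nonneg_nonneg)
  have W: "(\<integral>\<^sup>+u. ennreal ((T - u) powr (- A)) \<partial>gegen_measure (d + 2 * k)) = (\<Sum>r. ennreal (a r * T powr (- (real r + A))))"
    if "T > 1" for T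
  proof -
    have e: "(real (d + 2 * k) + 1) / 2 = ?\<nu> + real k" by simp
    show ?thesis unfolding a_def e[symmetric]
      by (rule nn_integral_gegen_kernel) (use A d that in auto)
  qed
  have "(\<integral>\<^sup>+T. (\<integral>\<^sup>+u. ennreal ((T - u) powr (- A)) \<partial>gegen_measure (d + 2 * k))\<^sup>2 * indicator {1<..} T \<partial>lborel) =
    (\<integral>\<^sup>+T. (\<Sum>r. \<Sum>r'. ennreal (a r * a r') * (ennreal (T powr (- (real r + real r' + 2 * A))) * indicator {1<..} T)) \<partial>lborel)"
  proof (intro nn_integral_cong)
    fix T :: real
    show "(\<integral>\<^sup>+u. ennreal ((T - u) powr (- A)) \<partial>gegen_measure (d + 2 * k))\<^sup>2 * indicator {1<..} T =
      (\<Sum>r. \<Sum>r'. ennreal (a r * a r') * (ennreal (T powr (- (real r + real r' + 2 * A))) * indicator {1<..} T))"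
    proof (cases "T > 1")
      case True
      have "ennreal (a r' * T powr (- (real r' + A))) * ennreal (a r * T powr (- (real r + A))) =
         ennreal (a r * a r') * ennreal (T powr (- (real r + real r' + 2 * A)))" for r r'
      proof -
        have "T powr (- (real r' + A)) * T powr (- (real r + A)) = T powr (- (real r + real r' + 2 * A))"
          by (simp only: powr_add[symmetric]) (rule arg_cong[where f = "\<lambda>x. T powr x"], simp)
        hence "(a r' * T powr (- (real r' + A))) * (a r * T powr (- (real r + A))) =
          (a r * a r') * T powr (- (real r + real r' + 2 * A))" by (simp add: mult_ac)
        thus ?thesis using a0 by (simp flip: ennreal_mult)
      qed
      thus ?thesis using True
        by (simp add: W power2_eq_square ennreal_suminf_multc[symmetric] ennreal_suminf_cmult[symmetric]
             del: ennreal_suminf_multc ennreal_suminf_cmult)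
    qed simp
  qed
  also have "\<dots> = (\<Sum>r. \<Sum>r'. ennreal (a r * a r') * (\<integral>\<^sup>+T. ennreal (T powr (- (real r + real r' + 2 * A))) * indicator {1<..} T \<partial>lborel))"
    by (simp add: nn_integral_suminf nn_integral_cmult)
  also have "\<dots> = (\<Sum>r. \<Sum>r'. ennreal (a r * a r' / (real r + real r' + 2 * A - 1)))"
  proof (intro suminf_cong)
    fix r r'
    have "(\<integral>\<^sup>+T. ennreal (T powr (- (real r + real r' + 2 * A))) * indicator {1<..} T \<partial>lborel) =
       ennreal (1 / (real r + real r' + 2 * A - 1))"
      using A by (intro nn_integral_powr_tail) linarith
    thus "ennreal (a r * a r') * (\<integral>\<^sup>+T. ennreal (T powr (- (real r + real r' + 2 * A))) * indicator {1<..} T \<partial>lborel) =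
      ennreal (a r * a r' / (real r + real r' + 2 * A - 1))"
      using a0 A by (simp flip: ennreal_mult)
  qed
  finally have I: "ennreal (\<kappa>\<^sup>2) * (\<integral>\<^sup>+T. (\<integral>\<^sup>+u. ennreal ((T - u) powr (- A)) \<partial>gegen_measure (d + 2 * k))\<^sup>2 * indicator {1<..} T \<partial>lborel) =
     (\<Sum>r. \<Sum>r'. ennreal (\<kappa>\<^sup>2) * ennreal (a r * a r' / (real r + real r' + 2 * A - 1)))"
    by simp
  also have "\<dots> = (\<Sum>r. \<Sum>r'. ennreal (G (r, r')))"
    using a0 A by (simp add: G_def flip: ennreal_mult)
  also have "\<dots> = ennreal (- qcoef d k)"
    unfolding q by (rule ennreal_infsum_double[OF Gsum G0, symmetric])
  finally show ?thesis by (simp add: A_def)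
qed

end

section \<open>The limiting integral\<close>

lemma nn_integral_exp_tail:
  assumes c: "c > 0"
  shows "(\<integral>\<^sup>+x. ennreal (exp (- (c * x))) * indicator {a<..} x \<partial>lborel) = ennreal (exp (- (c * a)) / c)"
proof -
  have "(\<integral>\<^sup>+x. ennreal (exp (- (c * x))) * indicator {a<..} x \<partial>lborel) =
    (\<integral>\<^sup>+x. ennreal (exp (- (c * x))) * indicator {a..} x \<partial>lborel)"
    using AE_lborel_singleton[of a] by (intro nn_integral_cong_AE) (auto simp: indicator_def elim!: eventually_mono)
  also have "\<dots> = ennreal (0 - (- (exp (- (c * a)) / c)))"
  proof (rule nn_integral_FTC_atLeast[where F = "\<lambda>x. - (exp (- (c * x)) / c)"])
    show "((\<lambda>x. - (exp (- (c * x)) / c)) has_real_derivative exp (- (c * x))) (at x)" for x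
      using c by (auto intro!: derivative_eq_intros)
    show "((\<lambda>x. - (exp (- (c * x)) / c)) \<longlongrightarrow> 0) at_top"
      using c by real_asymp
  qed auto
  finally show ?thesis by simp
qed

lemma nn_integral_gamma_scaled:
  assumes p: "p > 0" and c: "c > 0"
  shows "(\<integral>\<^sup>+x. ennreal (indicator {0<..} x * (x powr (p - 1) * exp (- (c * x)))) \<partial>lborel) =
    ennreal (Gamma p * c powr (- p))"
proof -
  let ?f = "\<lambda>x. ennreal (indicator {0<..} x * (x powr (p - 1) * exp (- (c * x))))"
  have "ennreal (Gamma p) = (\<integral>\<^sup>+t. ennreal (indicator {0..} t * t powr (p - 1) / exp t) \<partial>lborel)"
    by (rule Gamma_conv_nn_integral_real[OF p])
  also have "\<dots> = ennreal c * (\<integral>\<^sup>+x. ennreal (indicator {0..} (0 + c * x) * (0 + c * x) powr (p - 1) / exp (0 + c * x)) \<partial>lborel)"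
    using c by (subst nn_integral_real_affine[where c = c and t = 0]) auto
  also have "\<dots> = (\<integral>\<^sup>+x. ennreal (c powr p) * ?f x \<partial>lborel)"
  proof (subst nn_integral_cmult[symmetric])
    show "(\<integral>\<^sup>+x. ennreal c * ennreal (indicator {0..} (0 + c * x) * (0 + c * x) powr (p - 1) / exp (0 + c * x)) \<partial>lborel) =
       (\<integral>\<^sup>+x. ennreal (c powr p) * ?f x \<partial>lborel)"
    proof (intro nn_integral_cong)
      fix x :: real
      have "c * (indicator {0..} (c * x) * (c * x) powr (p - 1) / exp (c * x)) =
         c powr p * (indicator {0<..} x * (x powr (p - 1) * exp (- (c * x))))"
      proof (cases "x > 0")
        case True
        have "c powr p = c * c powr (p - 1)" using c by (simp add: powr_mult_base)
        thus ?thesis using True c by (simp add: powr_mult exp_minus field_simps)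
      qed (use c in \<open>auto simp: indicator_def zero_le_mult_iff\<close>)
      thus "ennreal c * ennreal (indicator {0..} (0 + c * x) * (0 + c * x) powr (p - 1) / exp (0 + c * x)) =
        ennreal (c powr p) * ?f x"
        using c by (simp flip: ennreal_mult)
    qed
  qed simp
  also have "\<dots> = ennreal (c powr p) * (\<integral>\<^sup>+x. ?f x \<partial>lborel)"
    by (rule nn_integral_cmult) simp
  finally have *: "ennreal (Gamma p) = ennreal (c powr p) * (\<integral>\<^sup>+x. ?f x \<partial>lborel)" .
  have "(\<integral>\<^sup>+x. ?f x \<partial>lborel) = ennreal (c powr (- p)) * (ennreal (c powr p) * (\<integral>\<^sup>+x. ?f x \<partial>lborel))"
    using c by (simp add: mult.assoc[symmetric] flip: ennreal_mult powr_add)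
  also have "\<dots> = ennreal (Gamma p * c powr (- p))"
    unfolding *[symmetric] using Gamma_real_pos[OF p] by (simp add: mult.commute less_imp_le flip: ennreal_mult)
  finally show ?thesis .
qed

lemma nn_integral_square_swap:
  fixes f :: "real \<Rightarrow> real \<Rightarrow> ennreal"
  assumes [measurable]: "(\<lambda>(y, t). f y t) \<in> borel_measurable (borel \<Otimes>\<^sub>M borel)"
  shows "(\<integral>\<^sup>+y. (\<integral>\<^sup>+t. f y t \<partial>lborel)\<^sup>2 \<partial>lborel) = (\<integral>\<^sup>+t. \<integral>\<^sup>+s. \<integral>\<^sup>+y. f y t * f y s \<partial>lborel \<partial>lborel \<partial>lborel)"
proof -
  have "(\<integral>\<^sup>+y. (\<integral>\<^sup>+t. f y t \<partial>lborel)\<^sup>2 \<partial>lborel) = (\<integral>\<^sup>+y. \<integral>\<^sup>+t. f y t * (\<integral>\<^sup>+s. f y s \<partial>lborel) \<partial>lborel \<partial>lborel)"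
    by (simp add: power2_eq_square nn_integral_multc)
  also have "\<dots> = (\<integral>\<^sup>+t. \<integral>\<^sup>+y. f y t * (\<integral>\<^sup>+s. f y s \<partial>lborel) \<partial>lborel \<partial>lborel)"
    by (rule lborel_pair.Fubini') simp
  also have "\<dots> = (\<integral>\<^sup>+t. \<integral>\<^sup>+y. \<integral>\<^sup>+s. f y t * f y s \<partial>lborel \<partial>lborel \<partial>lborel)"
    by (simp add: nn_integral_cmult)
  also have "\<dots> = (\<integral>\<^sup>+t. \<integral>\<^sup>+s. \<integral>\<^sup>+y. f y t * f y s \<partial>lborel \<partial>lborel \<partial>lborel)"
    by (intro nn_integral_cong lborel_pair.Fubini') simp
  finally show ?thesis .
qed

text \<open>For \<open>y > 0\<close> its integral over \<tau> is
  \<open>2 * y powr (\<delta> / 2)\<close> times the modified Bessel function K of order \<delta> at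
  \<open>2 * sqrt y\<close>.\<close>

definition bessel_kernel :: "real \<Rightarrow> real \<Rightarrow> real \<Rightarrow> real" where
  "bessel_kernel \<delta> y \<tau> = indicator {0<..} \<tau> * (\<tau> powr (\<delta> - 1) * exp (- \<tau> - y / \<tau>))"

text \<open>Write the square as a double integral over \<open>t\<close> and \<open>s\<close> and
  integrate over \<open>y\<close> first, which gives \<open>t * s / (t + s)\<close>. Then
  \<open>exp (- (t + s)) / (t + s)\<close> is the integral of \<open>exp (- l * (t + s))\<close>
  over \<open>l > 1\<close>, so the variables separate again: for each \<open>l\<close> the square
  of \<open>Gamma (\<delta> + 1) * l powr (- (\<delta> + 1))\<close> remains.\<close>

lemma nn_integral_bessel_square:
  assumes \<delta>: "\<delta> > 0"
  shows "(\<integral>\<^sup>+y. (\<integral>\<^sup>+\<tau>. ennreal (bessel_kernel \<delta> y \<tau>) \<partial>lborel)\<^sup>2 * indicator {0<..} y \<partial>lborel) =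
    ennreal ((Gamma (\<delta> + 1))\<^sup>2 / (2 * \<delta> + 1))"
proof -
  let ?f = "\<lambda>y \<tau>. ennreal (bessel_kernel \<delta> y \<tau>) * indicator {0<..} y"
  let ?h = "\<lambda>l \<tau>. ennreal (indicator {0<..} \<tau> * (\<tau> powr \<delta> * exp (- (l * \<tau>)))) * indicator {1<..} l"
  have [measurable]: "(\<lambda>(y, t). ?f y t) \<in> borel_measurable (borel \<Otimes>\<^sub>M borel)"
    unfolding bessel_kernel_def by measurable
  have ind2: "(indicator A y :: ennreal)\<^sup>2 = indicator A y" for A and y :: real by (simp split: split_indicator)
  have eq: "(\<integral>\<^sup>+y. ?f y t * ?f y s \<partial>lborel) = (\<integral>\<^sup>+l. ?h l t * ?h l s \<partial>lborel)" for t s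
  proof (cases "t > 0 \<and> s > 0")
    case True
    hence ts: "t > 0" "s > 0" by auto
    define c where "c = 1 / t + 1 / s"
    have c: "c > 0" "t + s > 0" using ts by (auto simp: c_def add_pos_pos)
    have "?f y t * ?f y s = ennreal (t powr (\<delta> - 1) * s powr (\<delta> - 1) * exp (- (t + s))) * (ennreal (exp (- (c * y))) * indicator {0<..} y)" for y
    proof -
      have "exp (- t - y / t) * exp (- s - y / s) = exp (- (t + s)) * exp (- (c * y))"
        by (simp add: c_def algebra_simps flip: exp_add)
      hence "bessel_kernel \<delta> y t * bessel_kernel \<delta> y s = t powr (\<delta> - 1) * s powr (\<delta> - 1) * exp (- (t + s)) * exp (- (c * y))"
        using ts by (simp add: bessel_kernel_def mult_ac)
      moreover have "bessel_kernel \<delta> y t \<ge> 0" "bessel_kernel \<delta> y s \<ge> 0" by (simp_all add: bessel_kernel_def)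
      ultimately show ?thesis
        by (cases "y > 0") (simp_all flip: ennreal_mult)
    qed
    hence "(\<integral>\<^sup>+y. ?f y t * ?f y s \<partial>lborel) =
      ennreal (t powr (\<delta> - 1) * s powr (\<delta> - 1) * exp (- (t + s))) * ennreal (exp (- (c * 0)) / c)"
      using nn_integral_exp_tail[OF c(1), of 0] by (simp add: nn_integral_cmult)
    also have "\<dots> = ennreal (t powr (\<delta> - 1) * s powr (\<delta> - 1) * exp (- (t + s)) * (1 / c))"
      using c by (simp flip: ennreal_mult)
    also have "t powr (\<delta> - 1) * s powr (\<delta> - 1) * exp (- (t + s)) * (1 / c) =
       (t powr \<delta> * s powr \<delta>) * (exp (- ((t + s) * 1)) / (t + s))"
    proof -
      have "1 / c = t * s / (t + s)" using ts by (simp add: c_def field_simps)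
      moreover have "t powr \<delta> = t * t powr (\<delta> - 1)" "s powr \<delta> = s * s powr (\<delta> - 1)"
        using ts by (simp_all add: powr_mult_base)
      ultimately show ?thesis by simp
    qed
    also have "ennreal \<dots> = ennreal (t powr \<delta> * s powr \<delta>) * (\<integral>\<^sup>+l. ennreal (exp (- ((t + s) * l))) * indicator {1<..} l \<partial>lborel)"
      unfolding nn_integral_exp_tail[OF c(2)] using c by (simp flip: ennreal_mult)
    also have "\<dots> = (\<integral>\<^sup>+l. ennreal (t powr \<delta> * s powr \<delta>) * (ennreal (exp (- ((t + s) * l))) * indicator {1<..} l) \<partial>lborel)"
      by (rule nn_integral_cmult[symmetric]) simp
    also have "\<dots> = (\<integral>\<^sup>+l. ?h l t * ?h l s \<partial>lborel)"
    proof (intro nn_integral_cong)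
      fix l :: real
      have "exp (- ((t + s) * l)) = exp (- (l * t)) * exp (- (l * s))"
        by (simp add: algebra_simps flip: exp_add)
      thus "ennreal (t powr \<delta> * s powr \<delta>) * (ennreal (exp (- ((t + s) * l))) * indicator {1<..} l) = ?h l t * ?h l s"
        using ts by (cases "l > 1") (simp_all add: mult_ac flip: ennreal_mult)
    qed
    finally show ?thesis .
  qed (auto simp: bessel_kernel_def)
  have "(\<integral>\<^sup>+y. (\<integral>\<^sup>+\<tau>. ennreal (bessel_kernel \<delta> y \<tau>) \<partial>lborel)\<^sup>2 * indicator {0<..} y \<partial>lborel) =
    (\<integral>\<^sup>+y. (\<integral>\<^sup>+\<tau>. ?f y \<tau> \<partial>lborel)\<^sup>2 \<partial>lborel)"
    by (simp add: nn_integral_multc bessel_kernel_def power_mult_distrib ind2)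
  also have "\<dots> = (\<integral>\<^sup>+t. \<integral>\<^sup>+s. \<integral>\<^sup>+l. ?h l t * ?h l s \<partial>lborel \<partial>lborel \<partial>lborel)"
    by (subst nn_integral_square_swap) (simp_all only: eq, measurable)
  also have "\<dots> = (\<integral>\<^sup>+l. (\<integral>\<^sup>+\<tau>. ?h l \<tau> \<partial>lborel)\<^sup>2 \<partial>lborel)"
    by (rule nn_integral_square_swap[symmetric]) measurable
  also have "\<dots> = (\<integral>\<^sup>+l. ennreal ((Gamma (\<delta> + 1))\<^sup>2) * (ennreal (l powr (- (2 * \<delta> + 2))) * indicator {1<..} l) \<partial>lborel)"
  proof (intro nn_integral_cong)
    fix l :: real
    show "(\<integral>\<^sup>+\<tau>. ?h l \<tau> \<partial>lborel)\<^sup>2 = ennreal ((Gamma (\<delta> + 1))\<^sup>2) * (ennreal (l powr (- (2 * \<delta> + 2))) * indicator {1<..} l)"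
    proof (cases "l > 1")
      case True
      have G: "Gamma (\<delta> + 1) \<ge> 0" using Gamma_real_pos[of "\<delta> + 1"] \<delta> by simp
      have "(\<integral>\<^sup>+\<tau>. ?h l \<tau> \<partial>lborel) = ennreal (Gamma (\<delta> + 1) * l powr (- (\<delta> + 1)))"
        using nn_integral_gamma_scaled[of "\<delta> + 1" l] \<delta> True by simp
      moreover have "(Gamma (\<delta> + 1) * l powr (- (\<delta> + 1)))\<^sup>2 = (Gamma (\<delta> + 1))\<^sup>2 * l powr (- (2 * \<delta> + 2))"
        by (simp add: power_mult_distrib power2_eq_square[of "_ powr _"] flip: powr_add)
      ultimately show ?thesis using True G by (simp add: ennreal_power flip: ennreal_mult)
    qed simp
  qed
  also have "\<dots> = ennreal ((Gamma (\<delta> + 1))\<^sup>2) * ennreal (1 / (2 * \<delta> + 2 - 1))"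
    using nn_integral_powr_tail[of "2 * \<delta> + 2"] \<delta> by (simp add: nn_integral_cmult)
  also have "\<dots> = ennreal ((Gamma (\<delta> + 1))\<^sup>2 / (2 * \<delta> + 1))"
    using \<delta> by (simp flip: ennreal_mult)
  finally show ?thesis .
qed

text \<open>What is left of the weight and of \<open>(T - u) powr (- (1 - \<beta> + k))\<close> in
  the scaled variables once the powers of 2 and \<open>k\<close> are taken out; \<open>u\<close> in
  \<open>(-1, 1)\<close> corresponds to \<tau> in \<open>(0, k)\<close>. The exponent of \<tau>
  joins \<open>k + d / 2 - 1\<close> from the weight with
  \<open>- (1 - \<beta> + k)\<close>.\<close>

definition scaled_kernel :: "nat \<Rightarrow> real \<Rightarrow> nat \<Rightarrow> real \<Rightarrow> real \<Rightarrow> real" where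
  "scaled_kernel d \<beta> k y \<tau> = indicator {0<..<real k} \<tau> *
     (\<tau> powr (real d / 2 + \<beta> - 2) * (1 - \<tau> / real k) powr (real k + real d / 2 - 1) *
      (1 + y / \<tau> / real k) powr (- (1 - \<beta> + real k)))"

lemma scaled_kernel_nonneg: "scaled_kernel d \<beta> k y \<tau> \<ge> 0"
  by (simp add: scaled_kernel_def)

lemma borel_measurable_scaled_kernel [measurable]:
  "(\<lambda>(y, \<tau>). scaled_kernel d \<beta> k y \<tau>) \<in> borel_measurable (borel \<Otimes>\<^sub>M borel)"
  unfolding scaled_kernel_def by measurable

text \<open>Two majorants, for two ranges of \<open>y\<close>. The first bounds the last factor by
  1. The second gains \<open>1 / y\<close> at the price of a factor \<tau>, from Bernoulli's
  inequality \<open>(1 + z) ^ n \<ge> 1 + n * z\<close>.\<close>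

lemma scaled_kernel_bounds:
  assumes d: "d \<ge> 2" and k: "k \<ge> 1" "real k \<ge> 2 * \<beta>" and y: "y > 0" and \<delta>: "\<delta> = real d / 2 + \<beta> - 1"
  shows "scaled_kernel d \<beta> k y \<tau> \<le> indicator {0<..} \<tau> * (\<tau> powr (\<delta> - 1) * exp (- (1 * \<tau>)))"
    and "scaled_kernel d \<beta> k y \<tau> \<le> 2 / y * (indicator {0<..} \<tau> * (\<tau> powr (\<delta> + 1 - 1) * exp (- (1 * \<tau>))))"
proof -
  have "scaled_kernel d \<beta> k y \<tau> \<le> indicator {0<..} \<tau> * (\<tau> powr (\<delta> - 1) * exp (- (1 * \<tau>))) \<and>
    scaled_kernel d \<beta> k y \<tau> \<le> 2 / y * (indicator {0<..} \<tau> * (\<tau> powr (\<delta> + 1 - 1) * exp (- (1 * \<tau>))))"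
  proof (cases "0 < \<tau> \<and> \<tau> < real k")
    case True
    hence \<tau>: "\<tau> > 0" "\<tau> < real k" by auto
    have k0: "real k > 0" using k by simp
    define z where "z = y / \<tau> / real k"
    have z: "z > 0" using y \<tau> k0 by (simp add: z_def)
    have "(1 - \<tau> / real k) powr (real k + real d / 2 - 1) \<le> (1 - \<tau> / real k) powr real k"
      using d \<tau> by (intro powr_mono') (auto simp: field_simps)
    also have "\<dots> = (1 - \<tau> / real k) ^ k" using \<tau> k0 by (intro powr_realpow) simp
    also have "\<dots> \<le> exp (- \<tau>)" using \<tau> k by (intro exp_ge_one_minus_x_over_n_power_n) auto
    finally have e: "(1 - \<tau> / real k) powr (real k + real d / 2 - 1) \<le> exp (- (1 * \<tau>))" by simp
    \<comment> \<open>Bernoulli's inequality is applied with an integer exponent;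
      \<open>k \<ge> 2 * \<beta>\<close> ensures that rounding down still leaves at least
      \<open>k / 2\<close>.\<close>
    define n where "n = nat \<lfloor>1 - \<beta> + real k\<rfloor>"
    have n: "real n \<le> 1 - \<beta> + real k" "real n \<ge> real k / 2"
      unfolding n_def using k k0 by linarith+
    have "(1 + z) powr (1 - \<beta> + real k) \<ge> (1 + z) powr real n" using z n by (intro powr_mono) auto
    moreover have "(1 + z) powr real n = (1 + z) ^ n" using z by (intro powr_realpow) simp
    moreover have "1 + real n * z \<le> (1 + z) ^ n" using z by (intro Bernoulli_inequality) simp
    moreover have "real k / 2 * z \<le> real n * z" using z n by (intro mult_right_mono) auto
    moreover have "real k / 2 * z = y / (2 * \<tau>)" using k0 by (simp add: z_def)
    ultimately have p: "y / (2 * \<tau>) \<le> (1 + z) powr (1 - \<beta> + real k)" "1 \<le> (1 + z) powr (1 - \<beta> + real k)"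
      using z n by (smt (verit) mult_nonneg_nonneg of_nat_0_le_iff)+
    have b1: "(1 + z) powr (- (1 - \<beta> + real k)) \<le> 1"
      using p(2) by (subst powr_minus) (intro inverse_le_1_iff[THEN iffD2] disjI2)
    have "inverse ((1 + z) powr (1 - \<beta> + real k)) \<le> inverse (y / (2 * \<tau>))"
      using p(1) y \<tau> by (intro le_imp_inverse_le) auto
    hence b2: "(1 + z) powr (- (1 - \<beta> + real k)) \<le> 2 / y * \<tau>"
      by (subst powr_minus) (simp add: mult.commute)
    have s: "scaled_kernel d \<beta> k y \<tau> = \<tau> powr (\<delta> - 1) * (1 - \<tau> / real k) powr (real k + real d / 2 - 1) *
        (1 + z) powr (- (1 - \<beta> + real k))"
      using \<tau> by (simp add: scaled_kernel_def z_def \<delta>)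
    have "scaled_kernel d \<beta> k y \<tau> \<le> \<tau> powr (\<delta> - 1) * exp (- (1 * \<tau>)) * 1"
      unfolding s by (intro mult_mono mult_left_mono e b1 mult_nonneg_nonneg) auto
    moreover have "scaled_kernel d \<beta> k y \<tau> \<le> \<tau> powr (\<delta> - 1) * exp (- (1 * \<tau>)) * (2 / y * \<tau>)"
      unfolding s by (intro mult_mono mult_left_mono e b2 mult_nonneg_nonneg) auto
    moreover have "\<tau> powr (\<delta> + 1 - 1) = \<tau> * \<tau> powr (\<delta> - 1)" using \<tau> by (simp add: powr_mult_base)
    ultimately show ?thesis using \<tau> by (simp add: mult_ac)
  next
    case False
    hence "scaled_kernel d \<beta> k y \<tau> = 0" by (auto simp: scaled_kernel_def)
    thus ?thesis using y by simp
  qed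
  thus "scaled_kernel d \<beta> k y \<tau> \<le> indicator {0<..} \<tau> * (\<tau> powr (\<delta> - 1) * exp (- (1 * \<tau>)))"
    and "scaled_kernel d \<beta> k y \<tau> \<le> 2 / y * (indicator {0<..} \<tau> * (\<tau> powr (\<delta> + 1 - 1) * exp (- (1 * \<tau>))))"
    by blast+
qed

lemma scaled_kernel_tendsto:
  assumes "y > 0"
  shows "(\<lambda>k. scaled_kernel d \<beta> k y \<tau>) \<longlonglongrightarrow> bessel_kernel (real d / 2 + \<beta> - 1) y \<tau>"
proof (cases "\<tau> > 0")
  case True
  have 1: "(\<lambda>k. (1 - \<tau> / real k) powr (real k + real d / 2 - 1)) \<longlonglongrightarrow> exp (- \<tau>)"
    using True by real_asymp
  have 2: "(\<lambda>k. (1 + z / real k) powr (- (1 - \<beta> + real k))) \<longlonglongrightarrow> exp (- z)" if "z > 0" for z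
    using that by real_asymp
  have "(\<lambda>k. \<tau> powr (real d / 2 + \<beta> - 2) * (1 - \<tau> / real k) powr (real k + real d / 2 - 1) *
      (1 + y / \<tau> / real k) powr (- (1 - \<beta> + real k))) \<longlonglongrightarrow> \<tau> powr (real d / 2 + \<beta> - 2) * exp (- \<tau>) * exp (- (y / \<tau>))"
    using True assms by (intro tendsto_mult tendsto_const 1 2) auto
  also have "\<tau> powr (real d / 2 + \<beta> - 2) * exp (- \<tau>) * exp (- (y / \<tau>)) = bessel_kernel (real d / 2 + \<beta> - 1) y \<tau>"
    using True by (simp add: bessel_kernel_def mult.assoc flip: exp_add)
  finally show ?thesis
  proof (rule Lim_transform_eventually)
    have "eventually (\<lambda>k. real k > \<tau>) sequentially" by real_asymp
    thus "\<forall>\<^sub>F k in sequentially. \<tau> powr (real d / 2 + \<beta> - 2) * (1 - \<tau> / real k) powr (real k + real d / 2 - 1) *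
      (1 + y / \<tau> / real k) powr (- (1 - \<beta> + real k)) = scaled_kernel d \<beta> k y \<tau>"
      by eventually_elim (simp add: scaled_kernel_def True)
  qed
qed (simp add: scaled_kernel_def bessel_kernel_def)

text \<open>Dominated convergence twice. For fixed \<open>y\<close> the first majorant suffices. For
  the integral over \<open>y\<close> neither alone does: the constant \<open>Gamma \<delta>\<close>
  fails at infinity, and the square of \<open>2 / y * Gamma (\<delta> + 1)\<close> fails at 0.
  Together they give a multiple of \<open>1 / (1 + y\<^sup>2)\<close>.\<close>

lemma nn_integral_scaled_kernel_square_tendsto:
  assumes d: "d \<ge> 2" and \<beta>: "\<beta> > 1 / 2"
  defines "\<delta> \<equiv> real d / 2 + \<beta> - 1"
  shows "(\<lambda>k. \<integral>\<^sup>+y. (\<integral>\<^sup>+\<tau>. ennreal (scaled_kernel d \<beta> k y \<tau>) \<partial>lborel)\<^sup>2 * indicator {0<..} y \<partial>lborel)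
     \<longlonglongrightarrow> ennreal ((Gamma (\<delta> + 1))\<^sup>2 / (2 * \<delta> + 1))"
proof -
  have \<delta>: "\<delta> > 0" using d \<beta> by (simp add: \<delta>_def)
  \<comment> \<open>The majorants hold from \<open>N\<close> on, so the limits are taken along
    \<open>k + N\<close> and the offset is removed at the end.\<close>
  obtain N :: nat where N: "N \<ge> 1" "real N \<ge> 2 * \<beta>"
    by (meson le_trans max.cobounded1 max.cobounded2 of_nat_mono order.trans real_arch_simple)
  have kN: "k + N \<ge> 1" "real (k + N) \<ge> 2 * \<beta>" for k using N by auto
  note bounds = scaled_kernel_bounds[OF d kN _ \<delta>_def[THEN meta_eq_to_obj_eq]]
  define M where "M k y = (\<integral>\<^sup>+\<tau>. ennreal (scaled_kernel d \<beta> k y \<tau>) \<partial>lborel)" for k y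
  have G: "Gamma \<delta> \<ge> 0" "Gamma (\<delta> + 1) \<ge> 0"
    using Gamma_real_pos[of "\<delta>"] Gamma_real_pos[of "\<delta> + 1"] \<delta> by simp_all
  have M1: "M (k + N) y \<le> ennreal (Gamma \<delta>)" and M2: "M (k + N) y \<le> ennreal (2 / y * Gamma (\<delta> + 1))"
    if y: "y > 0" for k y
  proof -
    have "M (k + N) y \<le> (\<integral>\<^sup>+\<tau>. ennreal (indicator {0<..} \<tau> * (\<tau> powr (\<delta> - 1) * exp (- (1 * \<tau>)))) \<partial>lborel)"
      unfolding M_def by (intro nn_integral_mono ennreal_leI bounds y)
    thus "M (k + N) y \<le> ennreal (Gamma \<delta>)"
      using nn_integral_gamma_scaled[OF \<delta>, of 1] by simp
    have "M (k + N) y \<le> (\<integral>\<^sup>+\<tau>. ennreal (2 / y) * ennreal (indicator {0<..} \<tau> * (\<tau> powr (\<delta> + 1 - 1) * exp (- (1 * \<tau>)))) \<partial>lborel)"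
      unfolding M_def
    proof (intro nn_integral_mono)
      fix \<tau> :: real
      have "ennreal (scaled_kernel d \<beta> (k + N) y \<tau>) \<le> ennreal (2 / y * (indicator {0<..} \<tau> * (\<tau> powr (\<delta> + 1 - 1) * exp (- (1 * \<tau>)))))"
        by (intro ennreal_leI bounds y)
      also have "\<dots> = ennreal (2 / y) * ennreal (indicator {0<..} \<tau> * (\<tau> powr (\<delta> + 1 - 1) * exp (- (1 * \<tau>))))"
        using y by (intro ennreal_mult) auto
      finally show "ennreal (scaled_kernel d \<beta> (k + N) y \<tau>) \<le> ennreal (2 / y) * ennreal (indicator {0<..} \<tau> * (\<tau> powr (\<delta> + 1 - 1) * exp (- (1 * \<tau>))))" .
    qed
    also have "\<dots> = ennreal (2 / y) * (\<integral>\<^sup>+\<tau>. ennreal (indicator {0<..} \<tau> * (\<tau> powr (\<delta> + 1 - 1) * exp (- (1 * \<tau>)))) \<partial>lborel)"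
      by (rule nn_integral_cmult) simp
    also have "\<dots> = ennreal (2 / y) * ennreal (Gamma (\<delta> + 1))"
      using nn_integral_gamma_scaled[of "\<delta> + 1" 1] \<delta> by simp
    also have "\<dots> = ennreal (2 / y * Gamma (\<delta> + 1))" using y G by (simp flip: ennreal_mult)
    finally show "M (k + N) y \<le> ennreal (2 / y * Gamma (\<delta> + 1))" .
  qed
  have Mlim: "(\<lambda>k. M (k + N) y) \<longlonglongrightarrow> (\<integral>\<^sup>+\<tau>. ennreal (bessel_kernel \<delta> y \<tau>) \<partial>lborel)" if y: "y > 0" for y
    unfolding M_def
  proof (rule nn_integral_dominated_convergence)
    show "AE \<tau> in lborel. ennreal (scaled_kernel d \<beta> (k + N) y \<tau>) \<le> ennreal (indicator {0<..} \<tau> * (\<tau> powr (\<delta> - 1) * exp (- (1 * \<tau>))))" for k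
      by (intro AE_I2 ennreal_leI bounds y)
    show "(\<integral>\<^sup>+\<tau>. ennreal (indicator {0<..} \<tau> * (\<tau> powr (\<delta> - 1) * exp (- (1 * \<tau>)))) \<partial>lborel) < \<infinity>"
      using nn_integral_gamma_scaled[OF \<delta>, of 1] by simp
    show "AE \<tau> in lborel. (\<lambda>k. ennreal (scaled_kernel d \<beta> (k + N) y \<tau>)) \<longlonglongrightarrow> ennreal (bessel_kernel \<delta> y \<tau>)"
      unfolding \<delta>_def by (intro AE_I2 tendsto_ennrealI LIMSEQ_ignore_initial_segment scaled_kernel_tendsto y)
  qed (simp_all add: bessel_kernel_def)
  define B where "B = (Gamma \<delta>)\<^sup>2 + (2 * Gamma (\<delta> + 1))\<^sup>2"
  have "(\<lambda>k. \<integral>\<^sup>+y. (M (k + N) y)\<^sup>2 * indicator {0<..} y \<partial>lborel) \<longlonglongrightarrow>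
      (\<integral>\<^sup>+y. (\<integral>\<^sup>+\<tau>. ennreal (bessel_kernel \<delta> y \<tau>) \<partial>lborel)\<^sup>2 * indicator {0<..} y \<partial>lborel)"
  proof (rule nn_integral_dominated_convergence)
    show "AE y in lborel. (M (k + N) y)\<^sup>2 * indicator {0<..} y \<le> ennreal (B * inverse (1 + y\<^sup>2))" for k
    proof (intro AE_I2)
      fix y :: real
      show "(M (k + N) y)\<^sup>2 * indicator {0<..} y \<le> ennreal (B * inverse (1 + y\<^sup>2))"
      proof (cases "y > 0")
        case True
        obtain r where r: "M (k + N) y = ennreal r" "r \<ge> 0"
          using M1[OF True, of k] by (metis ennreal_cases ennreal_less_top leD top.not_eq_extremum)
        have "r \<le> Gamma \<delta>" using M1[OF True, of k] r G by (simp add: ennreal_le_iff)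
        hence 1: "r\<^sup>2 \<le> (Gamma \<delta>)\<^sup>2" using r(2) by (rule power_mono)
        have "r \<le> 2 / y * Gamma (\<delta> + 1)" using M2[OF True, of k] r G True by (simp add: ennreal_le_iff)
        hence "r * y \<le> 2 * Gamma (\<delta> + 1)" using True by (simp add: field_simps)
        hence 2: "(r * y)\<^sup>2 \<le> (2 * Gamma (\<delta> + 1))\<^sup>2" using r True by (intro power_mono) auto
        have "r\<^sup>2 * (1 + y\<^sup>2) \<le> B" using 1 2 by (simp add: B_def algebra_simps power_mult_distrib)
        moreover have "1 + y\<^sup>2 > 0" by (simp add: add_pos_nonneg)
        ultimately have "r\<^sup>2 \<le> B * inverse (1 + y\<^sup>2)" by (simp add: field_simps)
        hence "ennreal (r\<^sup>2) \<le> ennreal (B * inverse (1 + y\<^sup>2))" by (rule ennreal_leI)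
        thus ?thesis using True r by (simp add: ennreal_power)
      qed simp
    qed
    have "integrable lborel (\<lambda>y::real. inverse (1 + y\<^sup>2))"
      using integrable_inverse_1_plus_square by (simp add: set_integrable_def einterval_eq_UNIV)
    hence "integrable lborel (\<lambda>y::real. B * inverse (1 + y\<^sup>2))" by simp
    thus "(\<integral>\<^sup>+y. ennreal (B * inverse (1 + y\<^sup>2)) \<partial>lborel) < \<infinity>"
      by (subst nn_integral_eq_integral) (auto simp: B_def)
    show "AE y in lborel. (\<lambda>k. (M (k + N) y)\<^sup>2 * indicator {0<..} y) \<longlonglongrightarrow>
       (\<integral>\<^sup>+\<tau>. ennreal (bessel_kernel \<delta> y \<tau>) \<partial>lborel)\<^sup>2 * indicator {0<..} y"
    proof (intro AE_I2)
      fix y :: real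
      show "(\<lambda>k. (M (k + N) y)\<^sup>2 * indicator {0<..} y) \<longlonglongrightarrow>
       (\<integral>\<^sup>+\<tau>. ennreal (bessel_kernel \<delta> y \<tau>) \<partial>lborel)\<^sup>2 * indicator {0<..} y"
      proof (cases "y > 0")
        case True
        have "(\<integral>\<^sup>+\<tau>. ennreal (bessel_kernel \<delta> y \<tau>) \<partial>lborel) \<le> ennreal (Gamma \<delta>)"
          using Mlim[OF True] M1[OF True] by (intro LIMSEQ_le_const2) auto
        hence "(\<integral>\<^sup>+\<tau>. ennreal (bessel_kernel \<delta> y \<tau>) \<partial>lborel) \<noteq> top"
          using ennreal_less_top le_less_trans by (metis less_irrefl)
        thus ?thesis using Mlim[OF True] True
          unfolding power2_eq_square by (intro tendsto_mult_ennreal) auto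
      qed simp
    qed
    show "(\<lambda>y. (M (k + N) y)\<^sup>2 * indicator {0<..} y) \<in> borel_measurable lborel" for k
      unfolding M_def by measurable
    show "(\<lambda>y. (\<integral>\<^sup>+\<tau>. ennreal (bessel_kernel \<delta> y \<tau>) \<partial>lborel)\<^sup>2 * indicator {0<..} y) \<in> borel_measurable lborel"
      unfolding bessel_kernel_def by measurable
  qed simp
  from LIMSEQ_offset[OF this] show ?thesis
    unfolding M_def nn_integral_bessel_square[OF \<delta>] .
qed

text \<open>With \<open>T = 1 + 2 * y / k\<^sup>2\<close> and \<open>u = 1 - 2 * \<tau> / k\<close>,
  both \<open>1 - u\<^sup>2 = (2 / k) * 2 * \<tau> * (1 - \<tau> / k)\<close> and
  \<open>T - u = (2 / k) * \<tau> * (1 + y / (\<tau> * k))\<close> carry a factor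
  \<open>2 / k\<close>. Together with the one from \<open>du\<close> these collect to the exponent
  \<open>d / 2 + \<beta> - 1\<close>.\<close>

lemma nn_integral_gegen_kernel_scaled:
  assumes d: "d \<ge> 2" and k: "k \<ge> 1" and y: "y > 0"
  shows "(\<integral>\<^sup>+u. ennreal ((1 + 2 / (real k)\<^sup>2 * y - u) powr (- (1 - \<beta> + real k))) \<partial>gegen_measure (d + 2 * k)) =
    ennreal (1 / Beta (1 / 2) (real d / 2 + real k) * ((2 / real k) powr (real d / 2 + \<beta> - 1) * 2 powr (real k + real d / 2 - 1))) *
    (\<integral>\<^sup>+\<tau>. ennreal (scaled_kernel d \<beta> k y \<tau>) \<partial>lborel)"
proof -
  define c where "c = 1 / Beta (1 / 2) (real d / 2 + real k)"
  define a where "a = 1 - \<beta> + real k"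
  define e where "e = real k + real d / 2 - 1"
  define T where "T = 1 + 2 / (real k)\<^sup>2 * y"
  have k0: "real k > 0" using k by simp
  have c0: "c \<ge> 0" unfolding c_def Beta_def using d
    by (intro divide_nonneg_nonneg mult_nonneg_nonneg less_imp_le[OF Gamma_real_pos]) (auto simp: add_pos_nonneg)
  have area: "sphere_area (d + 2 * k - 1) / sphere_area (d + 2 * k) = c"
    using sphere_area_ratio[of "d + 2 * k"] d by (simp add: c_def add_divide_distrib)
  let ?w = "\<lambda>u. indicator {-1..1} u * (c * (1 - u\<^sup>2) powr e)"
  have e': "real (d + 2 * k) / 2 - 1 = e" by (simp add: e_def add_divide_distrib)
  have "(\<integral>\<^sup>+u. ennreal ((T - u) powr (- a)) \<partial>gegen_measure (d + 2 * k)) =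
    (\<integral>\<^sup>+u. ennreal (?w u) * ennreal ((T - u) powr (- a)) \<partial>lborel)"
    unfolding gegen_measure_def area e' by (subst nn_integral_density) auto
  also have "\<dots> = (\<integral>\<^sup>+u. ennreal (?w u * (T - u) powr (- a)) \<partial>lborel)"
    using c0 by (intro nn_integral_cong) (simp add: ennreal_mult)
  also have "\<dots> = ennreal \<bar>- 2 / real k\<bar> * (\<integral>\<^sup>+\<tau>. ennreal (?w (1 + (- 2 / real k) * \<tau>) * (T - (1 + (- 2 / real k) * \<tau>)) powr (- a)) \<partial>lborel)"
    using k0 by (intro nn_integral_real_affine) auto
  also have "\<dots> = (\<integral>\<^sup>+\<tau>. ennreal (2 / real k) * ennreal (?w (1 + (- 2 / real k) * \<tau>) * (T - (1 + (- 2 / real k) * \<tau>)) powr (- a)) \<partial>lborel)"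
    by (subst nn_integral_cmult) auto
  also have "\<dots> = (\<integral>\<^sup>+\<tau>. ennreal (c * ((2 / real k) powr (real d / 2 + \<beta> - 1) * 2 powr e)) * ennreal (scaled_kernel d \<beta> k y \<tau>) \<partial>lborel)"
  proof (intro nn_integral_cong)
    fix \<tau> :: real
    define u where "u = 1 + (- 2 / real k) * \<tau>"
    have "(2 / real k) * (?w u * (T - u) powr (- a)) =
      c * ((2 / real k) powr (real d / 2 + \<beta> - 1) * 2 powr e) * scaled_kernel d \<beta> k y \<tau>"
    proof (cases "0 < \<tau> \<and> \<tau> < real k")
      case True
      hence \<tau>: "\<tau> > 0" "\<tau> < real k" by auto
      have u: "u \<in> {-1..1}" using \<tau> k0 by (auto simp: u_def field_simps)
      have 1: "1 - u\<^sup>2 = (2 / real k) * (2 * (\<tau> * (1 - \<tau> / real k)))"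
        using k0 by (simp add: u_def power2_eq_square field_simps)
      have 2: "T - u = (2 / real k) * (\<tau> * (1 + y / \<tau> / real k))"
        using k0 \<tau> by (simp add: u_def T_def power2_eq_square field_simps)
      have p1: "(2 / real k) * ((2 / real k) powr e * (2 / real k) powr (- a)) = (2 / real k) powr (real d / 2 + \<beta> - 1)"
      proof -
        have "(2 / real k) powr (real d / 2 + \<beta> - 1) = (2 / real k) powr (1 + (e + - a))" by (simp add: e_def a_def)
        also have "\<dots> = (2 / real k) * ((2 / real k) powr e * (2 / real k) powr (- a))"
          unfolding powr_add using k0 by simp
        finally show ?thesis ..
      qed
      have p2: "\<tau> powr e * \<tau> powr (- a) = \<tau> powr (real d / 2 + \<beta> - 2)"
        by (simp add: e_def a_def flip: powr_add)
      have "(2 / real k) * (?w u * (T - u) powr (- a)) =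
        c * (((2 / real k) * ((2 / real k) powr e * (2 / real k) powr (- a))) * 2 powr e) *
        ((\<tau> powr e * \<tau> powr (- a)) * (1 - \<tau> / real k) powr e * (1 + y / \<tau> / real k) powr (- a))"
        unfolding 1 2 powr_mult using u by (simp add: mult_ac)
      thus ?thesis unfolding p1 p2 using \<tau> by (simp add: scaled_kernel_def a_def e_def)
    next
      case False
      hence "?w u = 0"
      \<comment> \<open>At the endpoints the weight is \<open>0 powr e = 0\<close>; beyond them the
        indicator vanishes.\<close>
      proof (cases "\<tau> = 0 \<or> \<tau> = real k")
        case True
        hence "1 - u\<^sup>2 = 0" using k0 by (auto simp: u_def)
        thus ?thesis by simp
      next
        case False
        with \<open>\<not> (0 < \<tau> \<and> \<tau> < real k)\<close> have "u \<notin> {-1..1}" using k0 by (auto simp: u_def field_simps)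
        thus ?thesis by simp
      qed
      thus ?thesis using False by (auto simp: scaled_kernel_def)
    qed
    moreover have "?w u * (T - u) powr (- a) \<ge> 0" using c0 by simp
    ultimately show "ennreal (2 / real k) * ennreal (?w (1 + (- 2 / real k) * \<tau>) * (T - (1 + (- 2 / real k) * \<tau>)) powr (- a)) =
      ennreal (c * ((2 / real k) powr (real d / 2 + \<beta> - 1) * 2 powr e)) * ennreal (scaled_kernel d \<beta> k y \<tau>)"
      unfolding u_def[symmetric] using k0 c0 scaled_kernel_nonneg
      by (simp add: ennreal_mult[symmetric] del: indicator_simps)
  qed
  also have "\<dots> = ennreal (c * ((2 / real k) powr (real d / 2 + \<beta> - 1) * 2 powr e)) * (\<integral>\<^sup>+\<tau>. ennreal (scaled_kernel d \<beta> k y \<tau>) \<partial>lborel)"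
    by (rule nn_integral_cmult) measurable
  finally show ?thesis by (simp only: a_def T_def c_def e_def)
qed

section \<open>The leading term of the coefficients\<close>

lemma borel_measurable_gegen_kernel [measurable]:
  "(\<lambda>T. \<integral>\<^sup>+u. ennreal ((T - u) powr a) \<partial>gegen_measure d) \<in> borel_measurable borel"
proof -
  have "(\<lambda>T. \<integral>\<^sup>+u. ennreal (indicator {-1..1} u * (sphere_area (d - 1) / sphere_area d * (1 - u\<^sup>2) powr (real d / 2 - 1))) *
     ennreal ((T - u) powr a) \<partial>lborel) \<in> borel_measurable borel"
    by measurable
  thus ?thesis unfolding gegen_measure_def by (subst nn_integral_density) auto
qed

lemma Gamma_legendre_duplication_real:
  fixes z :: real
  assumes "z > 0"
  shows "Gamma z * Gamma (z + 1 / 2) = 2 powr (1 - 2 * z) * sqrt pi * Gamma (2 * z)"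
proof -
  have nz: "complex_of_real x \<notin> \<int>\<^sub>\<le>\<^sub>0" if "x > 0" for x
    using that by (auto elim!: nonpos_Ints_cases simp: complex_eq_iff)
  have "complex_of_real (Gamma z * Gamma (z + 1 / 2)) = Gamma (of_real z) * Gamma (of_real (z + 1 / 2))"
    by (simp only: Gamma_complex_of_real of_real_mult)
  also have "complex_of_real (z + 1 / 2) = of_real z + 1 / 2" by simp
  also have "Gamma (complex_of_real z) * Gamma (of_real z + 1 / 2) =
     exp ((1 - 2 * of_real z) * of_real (ln 2)) * of_real (sqrt pi) * Gamma (2 * of_real z)"
    using nz[of z] nz[of "z + 1 / 2"] assms by (intro Gamma_legendre_duplication) auto
  also have "2 * complex_of_real z = of_real (2 * z)" by simp
  also have "exp ((1 - of_real (2 * z)) * complex_of_real (ln 2)) = of_real (2 powr (1 - 2 * z))"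
    by (simp add: powr_def flip: exp_of_real)
  finally show ?thesis
    by (simp only: Gamma_complex_of_real of_real_mult[symmetric] of_real_eq_iff)
qed

lemma Beta_half_shift:
  assumes "a > 0"
  shows "1 / Beta (1 / 2) (a + real k) = Gamma (a + 1 / 2) / (sqrt pi * Gamma a) * (pochhammer (a + 1 / 2) k / pochhammer a k)"
proof -
  have "pochhammer (a + 1 / 2) k = Gamma (a + 1 / 2 + real k) / Gamma (a + 1 / 2)" "pochhammer a k = Gamma (a + real k) / Gamma a"
    using assms by (auto intro!: pochhammer_Gamma pos_not_nonpos_Ints)
  moreover have "Gamma (a + 1 / 2) > 0" "Gamma a > 0" "Gamma (a + real k) > 0"
    using assms by (auto intro!: Gamma_real_pos simp: add_pos_nonneg)
  ultimately show ?thesis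
    by (simp add: Beta_def Gamma_one_half_real field_simps)
qed

context half_integer_free
begin

text \<open>The factor \<open>pochhammer ((d + 1) / 2) k\<close> of \<kappa> cancels against the
  normalization of the weight in dimension \<open>d + 2 * k\<close>, and \<open>2 ^ k\<close>
  against a power of 2 from the scaling; only the ratio of \<open>pc\<close> terms and powers of
  \<open>k\<close> depend on \<open>k\<close>. The outer 2 and one \<open>1 / k\<close> inside the
  square come from the substitution factor \<open>2 / k\<^sup>2\<close> for
  \<open>T\<close>.\<close>

lemma qcoef_scaled:
  assumes d: "d \<ge> 2" and k: "real k > \<beta>"
  shows "ennreal (- qcoef d k) =
    ennreal (2 * (Gamma ((real d + 1) / 2) / (sqrt pi * Gamma (real d / 2)) * (pc (1 - \<beta>) k / pc (real d / 2) k) *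
       (2 powr (real d + \<beta> - 2)) * real k powr (- (real d / 2 + \<beta>)))\<^sup>2) *
    (\<integral>\<^sup>+y. (\<integral>\<^sup>+\<tau>. ennreal (scaled_kernel d \<beta> k y \<tau>) \<partial>lborel)\<^sup>2 * indicator {0<..} y \<partial>lborel)"
proof -
  have k0: "real k > 0" "k \<ge> 1" using k beta_gt by auto
  let ?W = "\<lambda>T. \<integral>\<^sup>+u. ennreal ((T - u) powr (- (1 - \<beta> + real k))) \<partial>gegen_measure (d + 2 * k)"
  let ?M = "\<lambda>y. \<integral>\<^sup>+\<tau>. ennreal (scaled_kernel d \<beta> k y \<tau>) \<partial>lborel"
  define \<kappa> where "\<kappa> = pochhammer (1 - \<beta>) k / (2 ^ k * pochhammer ((real d + 1) / 2) k)"
  define c where "c = 1 / Beta (1 / 2) (real d / 2 + real k) * ((2 / real k) powr (real d / 2 + \<beta> - 1) * 2 powr (real k + real d / 2 - 1))"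
  define C where "C = Gamma ((real d + 1) / 2) / (sqrt pi * Gamma (real d / 2)) * (pc (1 - \<beta>) k / pc (real d / 2) k) *
       (2 powr (real d + \<beta> - 2)) * real k powr (- (real d / 2 + \<beta>))"
  have c0: "c \<ge> 0" unfolding c_def Beta_def using d
    by (intro divide_nonneg_nonneg mult_nonneg_nonneg less_imp_le[OF Gamma_real_pos]) (auto simp: add_pos_nonneg)
  have "(\<integral>\<^sup>+T. (?W T)\<^sup>2 * indicator {1<..} T \<partial>lborel) =
    ennreal \<bar>2 / (real k)\<^sup>2\<bar> * (\<integral>\<^sup>+y. (?W (1 + 2 / (real k)\<^sup>2 * y))\<^sup>2 * indicator {1<..} (1 + 2 / (real k)\<^sup>2 * y) \<partial>lborel)"
    using k0 by (intro nn_integral_real_affine) auto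
  also have "\<dots> = ennreal (2 / (real k)\<^sup>2) * (\<integral>\<^sup>+y. ennreal (c\<^sup>2) * ((?M y)\<^sup>2 * indicator {0<..} y) \<partial>lborel)"
  proof (rule arg_cong2[where f = "(*)", OF _ nn_integral_cong])
    fix y :: real
    show "(?W (1 + 2 / (real k)\<^sup>2 * y))\<^sup>2 * indicator {1<..} (1 + 2 / (real k)\<^sup>2 * y) = ennreal (c\<^sup>2) * ((?M y)\<^sup>2 * indicator {0<..} y)"
    proof (cases "y > 0")
      case True
      have "?W (1 + 2 / (real k)\<^sup>2 * y) = ennreal c * ?M y"
        unfolding c_def by (rule nn_integral_gegen_kernel_scaled[OF d k0(2) True])
      thus ?thesis using True k0 c0 by (simp add: power_mult_distrib ennreal_power)
    next
      case False
      hence "2 / (real k)\<^sup>2 * y \<le> 0" by (simp add: divide_nonpos_nonneg)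
      thus ?thesis using False by simp
    qed
  qed simp
  also have "\<dots> = ennreal (2 / (real k)\<^sup>2) * (ennreal (c\<^sup>2) * (\<integral>\<^sup>+y. (?M y)\<^sup>2 * indicator {0<..} y \<partial>lborel))"
    by (subst nn_integral_cmult) (auto, measurable)
  finally have "ennreal (- qcoef d k) = ennreal (\<kappa>\<^sup>2) * (ennreal (2 / (real k)\<^sup>2) * (ennreal (c\<^sup>2) * (\<integral>\<^sup>+y. (?M y)\<^sup>2 * indicator {0<..} y \<partial>lborel)))"
    unfolding \<kappa>_def using nn_integral_qcoef[OF d k] by simp
  also have "\<dots> = ennreal (\<kappa>\<^sup>2 * (2 / (real k)\<^sup>2) * c\<^sup>2) * (\<integral>\<^sup>+y. (?M y)\<^sup>2 * indicator {0<..} y \<partial>lborel)"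
  proof -
    have "ennreal u * (ennreal v * (ennreal w * X)) = ennreal (u * v * w) * X" if "u \<ge> 0" "v \<ge> 0" "w \<ge> 0" for u v w X
      using that by (simp add: ennreal_mult mult.assoc)
    thus ?thesis by simp
  qed
  also have "\<kappa>\<^sup>2 * (2 / (real k)\<^sup>2) * c\<^sup>2 = 2 * (\<kappa> * c / real k)\<^sup>2"
    by (simp add: power_mult_distrib power_divide)
  also have "\<kappa> * c / real k = C"
  proof -
    have p: "pochhammer ((real d + 1) / 2) k > 0" "pochhammer (real d / 2) k > 0"
      using d by (auto intro!: pochhammer_pos)
    have B: "1 / Beta (1 / 2) (real d / 2 + real k) = Gamma ((real d + 1) / 2) / (sqrt pi * Gamma (real d / 2)) *
      (pochhammer ((real d + 1) / 2) k / pochhammer (real d / 2) k)"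
      using Beta_half_shift[of "real d / 2" k] d by (simp add: add_divide_distrib)
    have r: "pc (1 - \<beta>) k / pc (real d / 2) k = pochhammer (1 - \<beta>) k / pochhammer (real d / 2) k"
      by (simp add: pc_def)
    have pw: "(2 / real k) powr A * 2 powr B / (2 ^ k * real k) = 2 powr (A + B - real k) * real k powr (- A - 1)" for A B
    proof -
      have "2 powr (A + B - real k) = 2 powr A * 2 powr B / 2 ^ k" by (simp add: powr_add powr_diff powr_realpow)
      moreover have "real k powr (- A - 1) = 1 / (real k powr A * real k)"
        using k0 by (simp add: powr_diff powr_minus field_simps)
      moreover have "(2 / real k) powr A = 2 powr A / real k powr A" by (rule powr_divide) 
      ultimately show ?thesis by simp
    qed
    have "(2 / real k) powr (real d / 2 + \<beta> - 1) * 2 powr (real k + real d / 2 - 1) / (2 ^ k * real k) =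
      2 powr (real d / 2 + \<beta> - 1 + (real k + real d / 2 - 1) - real k) * real k powr (- (real d / 2 + \<beta> - 1) - 1)"
      by (rule pw)
    also have "\<dots> = 2 powr (real d + \<beta> - 2) * real k powr (- (real d / 2 + \<beta>))"
      by (intro arg_cong2[where f = "(*)"] arg_cong2[where f = "(powr)"]) (auto simp: field_simps)
    finally have q: "(2 / real k) powr (real d / 2 + \<beta> - 1) * 2 powr (real k + real d / 2 - 1) / (2 ^ k * real k) =
      2 powr (real d + \<beta> - 2) * real k powr (- (real d / 2 + \<beta>))" .
    have alg: "P / (t * n) * (g * (n / m) * X) / K = g * (P / m) * (X / (t * K))"
      if "n > 0" for P t n g m X K :: real using that by (simp add: mult_ac)
    show ?thesis unfolding \<kappa>_def c_def C_def B r
      by (subst alg[OF p(1)], subst q) (simp add: mult.assoc)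
  qed
  finally show ?thesis unfolding C_def .
qed

text \<open>With \<open>\<delta> = s - 1 / 2\<close> the ratio of \<open>pc\<close> terms has order
  \<open>k powr (- \<delta>)\<close>, and the explicit power of \<open>k\<close> is
  \<open>k powr (- (\<delta> + 1))\<close>; squaring the product gives
  \<open>k powr (- 4 * s)\<close>. The limit constant contains \<open>rGamma (1 - \<beta>)\<close>,
  which is nonzero because \<beta> is not a positive integer.\<close>

lemma qcoef_asymp:
  assumes d: "d \<ge> 2" and nonint: "\<nexists>M::nat. M \<ge> 1 \<and> \<beta> = real M" and s: "2 * \<beta> - 1 = 2 * s - real d"
  shows "(\<lambda>k. qcoef d k) \<sim>[at_top] (\<lambda>k. - A2_leading_const d s * real k powr (- 4 * s))"
proof -
  define \<delta> where "\<delta> = real d / 2 + \<beta> - 1"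
  have \<delta>: "\<delta> > 0" using d beta_gt by (simp add: \<delta>_def)
  have s\<delta>: "s = \<delta> + 1 / 2" using s by (simp add: \<delta>_def field_simps)
  define C where "C = Gamma ((real d + 1) / 2) / (sqrt pi * Gamma (real d / 2))"
  define \<rho> where "\<rho> k = pc (1 - \<beta>) k / pc (real d / 2) k" for k
  define c where "c k = C * \<rho> k * (2 powr (real d + \<beta> - 2)) * real k powr (- (real d / 2 + \<beta>))" for k
  define J where "J k = (\<integral>\<^sup>+y. (\<integral>\<^sup>+\<tau>. ennreal (scaled_kernel d \<beta> k y \<tau>) \<partial>lborel)\<^sup>2 * indicator {0<..} y \<partial>lborel)" for k
  define I where "I = (Gamma (\<delta> + 1))\<^sup>2 / (2 * \<delta> + 1)"
  have d2: "real d / 2 > 0" using d by simp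
  have Gpos: "Gamma (real d / 2) > 0" "Gamma ((real d + 1) / 2) > 0"
    using d by (auto intro!: Gamma_real_pos)
  have bnon: "1 - \<beta> \<notin> \<int>\<^sub>\<le>\<^sub>0"
  proof
    assume "1 - \<beta> \<in> \<int>\<^sub>\<le>\<^sub>0"
    then obtain n where "1 - \<beta> = - real n" by (auto elim!: nonpos_Ints_cases')
    hence "n + 1 \<ge> 1 \<and> \<beta> = real (n + 1)" by simp
    thus False using nonint by blast
  qed
  have rG: "rGamma (1 - \<beta>) \<noteq> 0" using bnon by (simp add: rGamma_eq_zero_iff)
  define R where "R = rGamma (1 - \<beta>) * Gamma (real d / 2)"
  have "(\<lambda>k. (pc (1 - \<beta>) k * real (k + 1) powr (1 - (1 - \<beta>))) / (pc (real d / 2) k * real (k + 1) powr (1 - real d / 2)))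
      \<longlonglongrightarrow> rGamma (1 - \<beta>) / rGamma (real d / 2)"
    using Gpos by (intro tendsto_divide pc_asymp) (auto simp: rGamma_inverse_Gamma)
  also have "rGamma (1 - \<beta>) / rGamma (real d / 2) = R" by (simp add: R_def rGamma_inverse_Gamma field_simps)
  also have "(\<lambda>k. (pc (1 - \<beta>) k * real (k + 1) powr (1 - (1 - \<beta>))) / (pc (real d / 2) k * real (k + 1) powr (1 - real d / 2))) =
     (\<lambda>k. \<rho> k * real (k + 1) powr \<delta>)"
  proof
    fix k
    have "real (k + 1) powr \<delta> = real (k + 1) powr (1 - (1 - \<beta>)) / real (k + 1) powr (1 - real d / 2)"
      unfolding powr_diff[symmetric] by (rule arg_cong2[where f = "(powr)"]) (auto simp: \<delta>_def)
    thus "(pc (1 - \<beta>) k * real (k + 1) powr (1 - (1 - \<beta>))) / (pc (real d / 2) k * real (k + 1) powr (1 - real d / 2)) =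
      \<rho> k * real (k + 1) powr \<delta>" by (simp add: \<rho>_def)
  qed
  finally have 1: "(\<lambda>k. \<rho> k * real (k + 1) powr \<delta>) \<longlonglongrightarrow> R" .
  have 2: "(\<lambda>k. (real k / real (k + 1)) powr \<delta>) \<longlonglongrightarrow> 1" by real_asymp
  have \<rho>lim: "(\<lambda>k. \<rho> k * real k powr \<delta>) \<longlonglongrightarrow> R"
    using tendsto_mult[OF 1 2] by (simp add: powr_divide)
  define K where "K = 2 * (C * R * 2 powr (real d + \<beta> - 2))\<^sup>2"
  have clim: "(\<lambda>k. 2 * (c k)\<^sup>2 * real k powr (4 * s)) \<longlonglongrightarrow> K"
  proof (rule Lim_transform_eventually)
    show "(\<lambda>k. 2 * (C * (\<rho> k * real k powr \<delta>) * 2 powr (real d + \<beta> - 2))\<^sup>2) \<longlonglongrightarrow> K"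
      unfolding K_def by (intro tendsto_intros \<rho>lim)
    show "\<forall>\<^sub>F k in sequentially. 2 * (C * (\<rho> k * real k powr \<delta>) * 2 powr (real d + \<beta> - 2))\<^sup>2 = 2 * (c k)\<^sup>2 * real k powr (4 * s)"
      using eventually_gt_at_top[of 0]
    proof eventually_elim
      case (elim k)
      have "(real k powr (- (real d / 2 + \<beta>)))\<^sup>2 * real k powr (4 * s) = (real k powr \<delta>)\<^sup>2"
        unfolding power2_eq_square powr_add[symmetric] s\<delta> by (simp add: \<delta>_def algebra_simps)
      thus ?case by (simp add: c_def power_mult_distrib mult_ac)
    qed
  qed
  have Jlim: "J \<longlonglongrightarrow> ennreal I"
    unfolding J_def I_def \<delta>_def by (rule nn_integral_scaled_kernel_square_tendsto[OF d beta_gt])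
  have J0: "I \<ge> 0" using \<delta> by (simp add: I_def)
  have lim: "(\<lambda>k. ennreal (2 * (c k)\<^sup>2 * real k powr (4 * s)) * J k) \<longlonglongrightarrow> ennreal K * ennreal I"
    by (intro tendsto_mult_ennreal tendsto_ennrealI clim Jlim) auto
  have ev: "\<forall>\<^sub>F k in sequentially. real k > \<beta>" by real_asymp
  have eq: "\<forall>\<^sub>F k in sequentially. ennreal (2 * (c k)\<^sup>2 * real k powr (4 * s)) * J k = ennreal (- qcoef d k * real k powr (4 * s))"
    using ev
  proof eventually_elim
    case (elim k)
    have "ennreal (2 * (c k)\<^sup>2 * real k powr (4 * s)) * J k = ennreal (2 * (c k)\<^sup>2) * J k * ennreal (real k powr (4 * s))"
      by (simp add: ennreal_mult mult_ac)
    also have "ennreal (2 * (c k)\<^sup>2) * J k = ennreal (- qcoef d k)"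
      unfolding c_def C_def \<rho>_def J_def by (rule qcoef_scaled[OF d elim, symmetric])
    also have "ennreal (- qcoef d k) * ennreal (real k powr (4 * s)) = ennreal (- qcoef d k * real k powr (4 * s))"
      by (rule ennreal_mult''[symmetric]) simp
    finally show ?case .
  qed
  have "(\<lambda>k. ennreal (- qcoef d k * real k powr (4 * s))) \<longlonglongrightarrow> ennreal (K * I)"
    using Lim_transform_eventually[OF lim eq] J0 by (simp add: K_def ennreal_mult)
  moreover have KJ: "K * I > 0"
  proof -
    have "Gamma (\<delta> + 1) > 0" using \<delta> by (intro Gamma_real_pos) simp
    hence "I > 0" unfolding I_def using \<delta> by (intro divide_pos_pos zero_less_power) auto
    moreover have "Gamma (real d / 2) \<noteq> 0" "Gamma ((real d + 1) / 2) \<noteq> 0" using Gpos by (metis less_irrefl)+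
    hence "K > 0" using rG by (simp add: K_def C_def R_def)
    ultimately show ?thesis by simp
  qed
  \<comment> \<open>\<open>ennreal\<close> maps negative numbers to 0, so its limit alone does not
    control them. As the limit is positive, the real sequence is eventually nonnegative, and the
    convergence carries over.\<close>
  ultimately have lim': "(\<lambda>k. - qcoef d k * real k powr (4 * s)) \<longlonglongrightarrow> K * I"
  proof -
    assume L: "(\<lambda>k. ennreal (- qcoef d k * real k powr (4 * s))) \<longlonglongrightarrow> ennreal (K * I)"
    have "\<forall>\<^sub>F k in sequentially. ennreal (- qcoef d k * real k powr (4 * s)) > 0"
      using order_tendstoD(1)[OF L, of 0] KJ by simp
    hence "\<forall>\<^sub>F k in sequentially. - qcoef d k * real k powr (4 * s) \<ge> 0"
      by eventually_elim (simp add: less_imp_le)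
    thus ?thesis using L KJ by (subst (asm) tendsto_ennreal_iff) (auto simp: less_imp_le)
  qed
  \<comment> \<open>\<open>A2_leading_const\<close> takes the form of \<open>K * I\<close> by the
    duplication formula for \<open>Gamma (2 * s)\<close>, by
    \<open>Gamma (s + 1) = s * Gamma s\<close> and by
    \<open>(d + 1) / 2 - s = 1 - \<beta>\<close>.\<close>
  have const: "K * I = A2_leading_const d s"
  proof -
    have b: "(real d + 1) / 2 - s = 1 - \<beta>" using s by (simp add: field_simps)
    have sp: "s > 0" using s\<delta> \<delta> by simp
    have G1: "Gamma (s + 1) = s * Gamma s" using sp by (intro Gamma_plus1 pos_not_nonpos_Ints)
    have Gs: "Gamma s > 0" "Gamma (s + 1 / 2) > 0" using sp by (auto intro!: Gamma_real_pos)
    have dup: "Gamma (2 * s) = Gamma s * Gamma (s + 1 / 2) * 2 powr (2 * s - 1) / sqrt pi"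
    proof -
      have "2 powr (1 - 2 * s) * 2 powr (2 * s - 1) = (1 :: real)" by (simp flip: powr_add)
      hence "Gamma s * Gamma (s + 1 / 2) * 2 powr (2 * s - 1) = sqrt pi * Gamma (2 * s)"
        unfolding Gamma_legendre_duplication_real[OF sp] by (simp add: mult_ac)
      thus ?thesis by simp
    qed
    have CR: "C * R = Gamma ((real d + 1) / 2) / Gamma (1 - \<beta>) / sqrt pi"
      using Gpos by (simp add: C_def R_def rGamma_inverse_Gamma field_simps)
    have pw: "(2 powr (real d + \<beta> - 2))\<^sup>2 = 2 powr (real d - 2) * 2 powr (2 * s - 1)"
      unfolding power2_eq_square powr_add[symmetric] by (rule arg_cong2[where f = "(powr)"]) (use s in auto)
    have I: "I = (Gamma (s + 1 / 2))\<^sup>2 / (2 * s)" by (simp add: I_def s\<delta> add.commute)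
    have "K * I = 2 * ((C * R)\<^sup>2 * (2 powr (real d + \<beta> - 2))\<^sup>2) * I"
      by (simp add: K_def power_mult_distrib)
    also have "\<dots> = (Gamma ((real d + 1) / 2) / Gamma (1 - \<beta>))\<^sup>2 / pi * (2 powr (real d - 2) * 2 powr (2 * s - 1)) * (Gamma (s + 1 / 2))\<^sup>2 / s"
      unfolding CR pw I by (simp add: power_divide power_mult_distrib mult_ac)
    also have "\<dots> = A2_leading_const d s"
      unfolding A2_leading_const_def b dup G1 using less_imp_neq[OF Gs(1)] sp by (simp add: power2_eq_square field_simps)
    finally show ?thesis .
  qed
  have A0: "A2_leading_const d s > 0" using KJ const by simp
  show ?thesis
  proof (rule asymp_equivI')
    have "(\<lambda>k. - qcoef d k * real k powr (4 * s) / A2_leading_const d s) \<longlonglongrightarrow> A2_leading_const d s / A2_leading_const d s"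
      using lim' A0 unfolding const by (intro tendsto_divide tendsto_const) auto
    hence "(\<lambda>k. - qcoef d k * real k powr (4 * s) / A2_leading_const d s) \<longlonglongrightarrow> 1" using A0 by simp
    moreover have "- qcoef d k * real k powr (4 * s) / A2_leading_const d s = qcoef d k / (- A2_leading_const d s * real k powr (- 4 * s))" for k
      using powr_minus[of "real k" "4 * s"] by (simp add: field_simps)
    ultimately show "(\<lambda>k. qcoef d k / (- A2_leading_const d s * real k powr (- 4 * s))) \<longlonglongrightarrow> 1" by simp
  qed
qed

end

theorem theorem8:
  fixes d L :: nat and \<beta> \<epsilon> s :: real
  assumes d: "d \<ge> 2" and dim: "CARD('n::{finite, wellorder}) = d + 1"
    and beta: "\<beta> > 1 / 2" "\<beta> - 1 / 2 = real L + \<epsilon>" "0 < \<epsilon>" "\<epsilon> < 1"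
    and s: "2 * \<beta> - 1 = 2 * s - real d"
  shows
    "(\<forall>x\<in>sphere (0 :: real ^ 'n::_) 1. \<forall>y\<in>sphere (0 :: real ^ 'n::_) 1.
        integrable (restrict_space lborel {-1..1} \<Otimes>\<^sub>M sphere_measure)
          (\<lambda>(t, z). trunc_pow (x \<bullet> z - t) (\<beta> - 1) * trunc_pow (y \<bullet> z - t) (\<beta> - 1)) \<and>
        (\<forall>z\<in>sphere 0 1.
           summable (hyp2F1_term (1 / 2 - \<beta>) (1 - \<beta>) (3 / 2 - \<beta>) (Q_argument x y z))) \<and>
        integrable sphere_measure (Q_integrand \<beta> x y) \<and>
        K_kernel \<beta> x y =
          Q_kernel \<beta> x y + (-1) ^ (L + 1) * c_const d L \<beta> * norm (x - y) powr (2 * \<beta> - 1) \<and>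
        kampe_de_feriet_converges [1 / 2 - \<beta>, 1 - \<beta>] [(real d + 1) / 2] [] [] [1 / 2] [3 / 2 - \<beta>]
          ((1 + x \<bullet> y) / 2) ((1 - x \<bullet> y) / 2) \<and>
        Q_kernel \<beta> x y =
          1 / (2 * \<beta> - 1) *
          kampe_de_feriet [1 / 2 - \<beta>, 1 - \<beta>] [(real d + 1) / 2] [] [] [1 / 2] [3 / 2 - \<beta>]
            ((1 + x \<bullet> y) / 2) ((1 - x \<bullet> y) / 2)) \<and>
     c_const d L \<beta> > 0 \<and>
     (\<beta> = 1 \<longrightarrow>
        (\<forall>x\<in>sphere (0 :: real ^ 'n::_) 1. \<forall>y\<in>sphere (0 :: real ^ 'n::_) 1.
           K_kernel 1 x y =
             1 - 1 / real d * (Gamma ((real d + 1) / 2) / (sqrt pi * Gamma (real d / 2))) *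
                 norm (x - y))) \<and>
     (\<forall>x\<in>sphere (0 :: real ^ 'n::_) 1. \<forall>y\<in>sphere (0 :: real ^ 'n::_) 1.
        (\<lambda>k. A2_coeff TYPE('n) s d k * harmonic_dim d k * gegenbauer_P d k (x \<bullet> y))
          sums Q_kernel \<beta> x y) \<and>
     (\<forall>M::nat. M \<ge> 1 \<longrightarrow> \<beta> = real M \<longrightarrow>
        (\<forall>k\<ge>M. A2_coeff TYPE('n) s d k = 0) \<and>
        (\<exists>p :: real poly. p \<noteq> 0 \<and> degree p = M - 1 \<and>
           (\<forall>u. (\<Sum>k<M. A2_coeff TYPE('n) s d k * harmonic_dim d k * gegenbauer_P d k u) = poly p u) \<and>
           (\<forall>x\<in>sphere (0 :: real ^ 'n::_) 1. \<forall>y\<in>sphere (0 :: real ^ 'n::_) 1.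
              Q_kernel \<beta> x y = poly p (x \<bullet> y)))) \<and>
     ((\<nexists>M::nat. M \<ge> 1 \<and> \<beta> = real M) \<longrightarrow>
        (\<lambda>k. A2_coeff TYPE('n) s d k) \<sim>[at_top]
          (\<lambda>k. - A2_leading_const d s * real k powr (- 4 * s)))"
proof -
  interpret half_integer_free \<beta>
  proof
    show "2 * \<beta> - 1 \<noteq> 2 * real n" for n
    proof
      assume "2 * \<beta> - 1 = 2 * real n"
      hence "\<epsilon> = of_int (int n - int L)" using beta(2) by simp
      hence "0 < int n - int L" "int n - int L < 1" using beta(3,4) by auto
      thus False by linarith
    qed
  qed (rule beta(1))
  have s': "s - real d / 2 + 1 / 2 = \<beta>" using s by (simp add: field_simps)
  have A2: "A2_coeff TYPE('n) s d k = qcoef d k" for k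
    unfolding A2_coeff_def s' by (rule ultraspherical_coeff_Q_kernel[OF d dim])
  have Ksum: "K_kernel \<beta> x y = Q_kernel \<beta> x y + (-1) ^ (L + 1) * c_const d L \<beta> * norm (x - y) powr (2 * \<beta> - 1)"
    if "norm x = 1" "norm y = 1" for x y :: "real ^ 'n::_"
  proof -
    have h: "norm (hdiff x y) = norm (x - y) / 2" by (simp add: hdiff_def)
    show ?thesis
      using K_kernel_eq_series[OF that] unfolding h dim hcoef_moment_c_const(1)[OF beta(2-4)] by simp
  qed
  have 1: "\<forall>x\<in>sphere (0 :: real ^ 'n::_) 1. \<forall>y\<in>sphere (0 :: real ^ 'n::_) 1.
        integrable (restrict_space lborel {-1..1} \<Otimes>\<^sub>M sphere_measure)
          (\<lambda>(t, z). trunc_pow (x \<bullet> z - t) (\<beta> - 1) * trunc_pow (y \<bullet> z - t) (\<beta> - 1)) \<and>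
        (\<forall>z\<in>sphere 0 1.
           summable (hyp2F1_term (1 / 2 - \<beta>) (1 - \<beta>) (3 / 2 - \<beta>) (Q_argument x y z))) \<and>
        integrable sphere_measure (Q_integrand \<beta> x y) \<and>
        K_kernel \<beta> x y =
          Q_kernel \<beta> x y + (-1) ^ (L + 1) * c_const d L \<beta> * norm (x - y) powr (2 * \<beta> - 1) \<and>
        kampe_de_feriet_converges [1 / 2 - \<beta>, 1 - \<beta>] [(real d + 1) / 2] [] [] [1 / 2] [3 / 2 - \<beta>]
          ((1 + x \<bullet> y) / 2) ((1 - x \<bullet> y) / 2) \<and>
        Q_kernel \<beta> x y =
          1 / (2 * \<beta> - 1) *
          kampe_de_feriet [1 / 2 - \<beta>, 1 - \<beta>] [(real d + 1) / 2] [] [] [1 / 2] [3 / 2 - \<beta>]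
            ((1 + x \<bullet> y) / 2) ((1 - x \<bullet> y) / 2)"
  proof (intro ballI conjI)
    fix x y z :: "real ^ 'n::_"
    assume "x \<in> sphere 0 1" "y \<in> sphere 0 1"
    hence xy: "norm x = 1" "norm y = 1" by simp_all
    note [intro] = K_kernel_integrable[OF xy] integrable_Q_integrand[OF xy] Ksum[OF xy]
      kampe_de_feriet_converges_Q[OF dim xy] Q_kernel_kampe_de_feriet[OF dim xy]
    show "integrable (restrict_space lborel {-1..1} \<Otimes>\<^sub>M sphere_measure)
        (\<lambda>(t, z). trunc_pow (x \<bullet> z - t) (\<beta> - 1) * trunc_pow (y \<bullet> z - t) (\<beta> - 1))" ..
    show "integrable sphere_measure (Q_integrand \<beta> x y)" ..
    show "K_kernel \<beta> x y =
        Q_kernel \<beta> x y + (-1) ^ (L + 1) * c_const d L \<beta> * norm (x - y) powr (2 * \<beta> - 1)" ..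
    show "kampe_de_feriet_converges [1 / 2 - \<beta>, 1 - \<beta>] [(real d + 1) / 2] [] [] [1 / 2] [3 / 2 - \<beta>]
        ((1 + x \<bullet> y) / 2) ((1 - x \<bullet> y) / 2)" ..
    show "Q_kernel \<beta> x y = 1 / (2 * \<beta> - 1) *
        kampe_de_feriet [1 / 2 - \<beta>, 1 - \<beta>] [(real d + 1) / 2] [] [] [1 / 2] [3 / 2 - \<beta>]
          ((1 + x \<bullet> y) / 2) ((1 - x \<bullet> y) / 2)" ..
    assume "z \<in> sphere 0 1"
    hence "norm z = 1" by simp
    thus "summable (hyp2F1_term (1 / 2 - \<beta>) (1 - \<beta>) (3 / 2 - \<beta>) (Q_argument x y z))"
      by (rule Q_hyp_summable[OF xy])
  qed
  have 2: "\<beta> = 1 \<longrightarrow>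
        (\<forall>x\<in>sphere (0 :: real ^ 'n::_) 1. \<forall>y\<in>sphere (0 :: real ^ 'n::_) 1.
           K_kernel 1 x y =
             1 - 1 / real d * (Gamma ((real d + 1) / 2) / (sqrt pi * Gamma (real d / 2))) *
                 norm (x - y))"
  proof (intro impI ballI)
    fix x y :: "real ^ 'n::_"
    assume b: "\<beta> = 1" and "x \<in> sphere 0 1" "y \<in> sphere 0 1"
    hence xy: "norm x = 1" "norm y = 1" by simp_all
    have L: "L = 0" using beta b by linarith
    show "K_kernel 1 x y = 1 - 1 / real d * (Gamma ((real d + 1) / 2) / (sqrt pi * Gamma (real d / 2))) * norm (x - y)"
      using Ksum[OF xy] c_const_one[of d] d unfolding b L Q_kernel_one[OF xy] by simp
  qed
  have 3: "\<forall>x\<in>sphere (0 :: real ^ 'n::_) 1. \<forall>y\<in>sphere (0 :: real ^ 'n::_) 1.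
        (\<lambda>k. A2_coeff TYPE('n) s d k * harmonic_dim d k * gegenbauer_P d k (x \<bullet> y)) sums Q_kernel \<beta> x y"
    unfolding A2 using Q_kernel_gegenbauer_sums[OF d dim] by simp
  have 4: "\<forall>M::nat. M \<ge> 1 \<longrightarrow> \<beta> = real M \<longrightarrow>
        (\<forall>k\<ge>M. A2_coeff TYPE('n) s d k = 0) \<and>
        (\<exists>p :: real poly. p \<noteq> 0 \<and> degree p = M - 1 \<and>
           (\<forall>u. (\<Sum>k<M. A2_coeff TYPE('n) s d k * harmonic_dim d k * gegenbauer_P d k u) = poly p u) \<and>
           (\<forall>x\<in>sphere (0 :: real ^ 'n::_) 1. \<forall>y\<in>sphere (0 :: real ^ 'n::_) 1.
              Q_kernel \<beta> x y = poly p (x \<bullet> y)))"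
  proof (intro allI impI)
    fix M :: nat assume M: "M \<ge> 1" "\<beta> = real M"
    define p where "p = (\<Sum>k<M. smult (qcoef d k * harmonic_dim d k) (gegenbauer_poly d k))"
    note P = qcoef_polynomial[OF d M, folded p_def]
    have "Q_kernel \<beta> x y = poly p (x \<bullet> y)" if "norm x = 1" "norm y = 1" for x y :: "real ^ 'n::_"
    proof -
      have "(\<lambda>k. qcoef d k * harmonic_dim d k * gegenbauer_P d k (x \<bullet> y)) sums
        (\<Sum>k<M. qcoef d k * harmonic_dim d k * gegenbauer_P d k (x \<bullet> y))"
        by (rule sums_finite) (auto simp: qcoef_eq_0[OF M])
      with Q_kernel_gegenbauer_sums[OF d dim that] show ?thesis
        unfolding P(3) by (rule sums_unique2)
    qed
    thus "(\<forall>k\<ge>M. A2_coeff TYPE('n) s d k = 0) \<and>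
        (\<exists>p :: real poly. p \<noteq> 0 \<and> degree p = M - 1 \<and>
           (\<forall>u. (\<Sum>k<M. A2_coeff TYPE('n) s d k * harmonic_dim d k * gegenbauer_P d k u) = poly p u) \<and>
           (\<forall>x\<in>sphere (0 :: real ^ 'n::_) 1. \<forall>y\<in>sphere (0 :: real ^ 'n::_) 1.
              Q_kernel \<beta> x y = poly p (x \<bullet> y)))"
      unfolding A2 using P qcoef_eq_0[OF M] by (intro conjI exI[of _ p]) auto
  qed
  have 5: "(\<nexists>M::nat. M \<ge> 1 \<and> \<beta> = real M) \<longrightarrow>
        (\<lambda>k. A2_coeff TYPE('n) s d k) \<sim>[at_top] (\<lambda>k. - A2_leading_const d s * real k powr (- 4 * s))"
    unfolding A2 using qcoef_asymp[OF d _ s] by blast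
  show ?thesis
    by (intro conjI 1 hcoef_moment_c_const(2)[OF beta(2-4)] 2 3 4 5)
qed

end
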